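(* Let $n\in\mathbb{N}$. Then: (i) $N(1,1,6,6;n)=2\sigma(n)-2\sigma(n/2)-6\sigma(n/3)-4\sigma(n/4)+6\sigma(n/6)+16\sigma(n/8)+12\sigma(n/12)-48\sigma(n/24)+2a(n)$. (ii) $N(2,2,3,3;n)=2\sigma(n)-2\sigma(n/2)-6\sigma(n/3)-4\sigma(n/4)+6\sigma(n/6)+16\sigma(n/8)+12\sigma(n/12)-48\sigma(n/24)-2a(n)$. (iii) $N(1,2,6,6;n)=\frac45\sigma_{(\chi_1,\chi_8)}(n)+\frac{24}{5}\sigma_{(\chi_1,\chi_8)}(n/3)+\frac25\sigma_{(\chi_8,\chi_1)}(n)-\frac{12}{5}\sigma_{(\chi_8,\chi_1)}(n/3)+\frac85b_1(n)-\frac45b_2(n)$. (iv) $N(2,2,3,6;n)=\frac85\sigma_{(\chi_1,\chi_8)}(n)-\frac{12}{5}\sigma_{(\chi_1,\chi_8)}(n/3)-\frac45\sigma_{(\chi_8,\chi_1)}(n)-\frac65\sigma_{(\chi_8,\chi_1)}(n/3)-\frac45b_2(n)$. (v) $N(1,3,3,3;n)=2\sigma_{(\chi_1,\chi_{12})}(n)-\sigma_{(\chi_{12},\chi_1)}(n)+2\sigma_{(\chi_{-3},\chi_{-4})}(n)-\sigma_{(\chi_{-4},\chi_{-3})}(n)$. (vi) $N(1,3,6,6;n)=\sigma_{(\chi_1,\chi_{12})}(n)-\sigma_{(\chi_{12},\chi_1)}(n/2)+\sigma_{(\chi_{-3},\chi_{-4})}(n)+\sigma_{(\chi_{-4},\chi_{-3})}(n/2)$.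 (vii) $N(2,3,3,6;n)=\sigma_{(\chi_1,\chi_{12})}(n)-\sigma_{(\chi_{12},\chi_1)}(n/2)-\sigma_{(\chi_{-3},\chi_{-4})}(n)-\sigma_{(\chi_{-4},\chi_{-3})}(n/2)$. (viii) $N(1,3,3,6;n)=\frac43\sigma_{(\chi_1,\chi_{24})}(n)-\frac13\sigma_{(\chi_{24},\chi_1)}(n)+\frac43\sigma_{(\chi_{-3},\chi_{-8})}(n)-\frac13\sigma_{(\chi_{-8},\chi_{-3})}(n)$. (ix) $N(1,6,6,6;n)=\frac23\sigma_{(\chi_1,\chi_{24})}(n)-\frac13\sigma_{(\chi_{24},\chi_1)}(n)+\frac23\sigma_{(\chi_{-3},\chi_{-8})}(n)-\frac13\sigma_{(\chi_{-8},\chi_{-3})}(n)+\frac83c_1(n)+\frac43c_2(n)$. (x) $N(2,2,2,3;n)=2\sigma_{(\chi_1,\chi_{24})}(n)-\frac13\sigma_{(\chi_{24},\chi_1)}(n)+\frac23\sigma_{(\chi_{-3},\chi_{-8})}(n)-\sigma_{(\chi_{-8},\chi_{-3})}(n)-\frac43c_2(n)$. (xi) $N(2,3,3,3;n)=\frac43\sigma_{(\chi_1,\chi_{24})}(n)-\frac13\sigma_{(\chi_{24},\chi_1)}(n)-\frac43\sigma_{(\chi_{-3},\chi_{-8})}(n)+\frac13\sigma_{(\chi_{-8},\chi_{-3})}(n)-\frac83c_1(n)$. (xii) $N(2,3,6,6;n)=\frac13\big(2\sigma_{(\chi_1,\chi_{24})}(n)-\sigma_{(\chi_{24},\chi_1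)}(n)-2\sigma_{(\chi_{-3},\chi_{-8})}(n)+\sigma_{(\chi_{-8},\chi_{-3})}(n)\big)$.
   Context: For $a_1,a_2,a_3,a_4\in\mathbb{N}$ and $n\in\mathbb{N}_0$, $N(a_1,a_2,a_3,a_4;n)$ is the number of $(x_1,x_2,x_3,x_4)\in\mathbb{Z}^4$ with $n=a_1x_1^2+a_2x_2^2+a_3x_3^2+a_4x_4^2$. For $t\in\{-8,-4,-3,1,8,12,24\}$, $\chi_t(m)=\left(\frac{t}{m}\right)$ (Kronecker symbol); $\chi_1$ is trivial. For Dirichlet characters $\chi,\psi$ and $n\in\mathbb{N}$, $\sigma_{(\chi,\psi)}(n)=\sum_{1\le m\mid n}\chi(m)\psi(n/m)\,m$, and $\sigma(n)=\sum_{1\le m\mid n}m$. If $n\notin\mathbb{N}$, then $\sigma_{(\chi,\psi)}(n)=0$ and $\sigma(n)=0$. Let $q=e^{2\pi i z}$ with $\operatorname{Im}z>0$ and $\eta(z)=e^{\pi i z/12}\prod_{n=1}^\infty(1-e^{2\pi i n z})$. The numbers $a(n),b_1(n),b_2(n),c_1(n),c_2(n)$ are the coefficients of $q^n$ in the $q$-expansions $A(q)=\sum_{n\ge1}a(n)q^n$, $B_j(q)=\sum_{n\ge1}b_j(n)q^n$, $C_j(q)=\sum_{n\ge1}c_j(n)q^n$ $(j=1,2)$ of $$A(q)=\eta(2z)\eta(4z)\eta(6z)\eta(12z),$$ $$B_1(q)=\frac{\eta(z)\eta^4(6z)\eta^2(8z)}{\eta(2z)\eta(3z)\eta(12z)},\qquad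 B_2(q)=\frac{\eta^2(z)\eta(8z)\eta^4(12z)}{\eta(4z)\eta(6z)\eta(24z)},$$ $$C_1(q)=\frac{\eta(z)\eta(4z)\eta^4(6z)\eta^2(24z)}{\eta(2z)\eta(3z)\eta^2(12z)},\qquad C_2(q)=\frac{\eta^2(z)\eta^4(4z)\eta(6z)\eta(24z)}{\eta^2(2z)\eta(8z)\eta(12z)}.$$ *)

theory Defs
  imports
    "HOL-Analysis.Analysis"
    "HOL-Number_Theory.Number_Theory"
begin

definition repr_count :: "nat \<Rightarrow> nat \<Rightarrow> nat \<Rightarrow> nat \<Rightarrow> nat \<Rightarrow> nat" where
  "repr_count a1 a2 a3 a4 n =
     card {(x1 :: int, x2 :: int, x3 :: int, x4 :: int).
       int n = int a1 * x1\<^sup>2 + int a2 * x2\<^sup>2 + int a3 * x3\<^sup>2 + int a4 * x4\<^sup>2}"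

text \<open>The Kronecker symbol at a prime: at an odd prime it is the Legendre symbol, at 2 it is
  given by the residue of the top entry modulo 8.\<close>

definition kronecker_prime :: "int \<Rightarrow> int \<Rightarrow> int" where
  "kronecker_prime t p =
     (if p = 2 then (if even t then 0 else if t mod 8 \<in> {1, 7} then 1 else - 1)
      else Legendre t p)"

definition kronecker :: "int \<Rightarrow> int \<Rightarrow> int" where
  "kronecker t m =
     (if m = 0 then (if \<bar>t\<bar> = 1 then 1 else 0)
      else (if m < 0 \<and> t < 0 then - 1 else 1) *
        (\<Prod>p\<in>prime_factors m. kronecker_prime t p ^ multiplicity p m))"

definition chi :: "int \<Rightarrow> nat \<Rightarrow> complex" where
  "chi t m = of_int (kronecker t (int m))"

text \<open>The divisor sums take a real argument, so that \<open>\<sigma>(n/k)\<close> can be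
  written directly; they vanish off the positive integers.\<close>

definition sigma_char :: "(nat \<Rightarrow> complex) \<Rightarrow> (nat \<Rightarrow> complex) \<Rightarrow> real \<Rightarrow> complex" where
  "sigma_char f g x =
     (if x \<in> \<nat> \<and> x > 0
      then (\<Sum>m | m dvd nat \<lfloor>x\<rfloor>. f m * g (nat \<lfloor>x\<rfloor> div m) * of_nat m)
      else 0)"

definition divisor_sigma :: "real \<Rightarrow> complex" where
  "divisor_sigma x = (if x \<in> \<nat> \<and> x > 0 then (\<Sum>m | m dvd nat \<lfloor>x\<rfloor>. of_nat m) else 0)"

text \<open>The infinite product starts at exponent 1, whence the shift by \<open>Suc\<close>.\<close>

definition dedekind_eta :: "complex \<Rightarrow> complex" where
  "dedekind_eta z =
     exp (of_real pi * \<i> * z / 12) *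
     (\<Prod>n. 1 - exp (2 * of_real pi * \<i> * of_nat (Suc n) * z))"

definition has_q_expansion :: "(complex \<Rightarrow> complex) \<Rightarrow> (nat \<Rightarrow> complex) \<Rightarrow> bool" where
  "has_q_expansion F c \<longleftrightarrow>
     (\<forall>z. Im z > 0 \<longrightarrow> (\<lambda>n. c n * exp (2 * of_real pi * \<i> * z) ^ n) sums F z)"

text \<open>The coefficient of \<open>q\<^sup>n\<close> in the \<open>q\<close>-expansion of a function on the upper
  half-plane. The expansion is unique when it exists. Including the constant term makes the whole
  sequence determined; for the five functions below that term is 0.\<close>

definition q_coeff :: "(complex \<Rightarrow> complex) \<Rightarrow> nat \<Rightarrow> complex" where
  "q_coeff F = (THE c. has_q_expansion F c)"

lemma q_coeff_eq:
  assumes "has_q_expansion F c"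
  shows "q_coeff F = c"
proof -
  have "d = c" if d: "has_q_expansion F d" for d
  proof -
    define a where "a n = d n - c n" for n
    have a: "(\<lambda>n. a n * w ^ n) sums 0" if w: "w \<noteq> 0" "norm w < 1" for w :: complex
    proof -
      define z where "z = - \<i> * Ln w / (2 * of_real pi)"
      have "Im z = - ln (norm w) / (2 * pi)"
        using w by (simp add: z_def Im_divide_of_real flip: of_real_mult)
      also have "\<dots> > 0" using w by (simp add: divide_less_0_iff)
      finally have z: "Im z > 0" .
      have "2 * of_real pi * \<i> * z = Ln w" by (simp add: z_def)
      hence e: "exp (2 * of_real pi * \<i> * z) = w" using w by simp
      have "(\<lambda>n. d n * w ^ n) sums F z" "(\<lambda>n. c n * w ^ n) sums F z"
        using assms d z unfolding has_q_expansion_def e[symmetric] by blast+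
      from sums_diff[OF this] show ?thesis by (simp add: a_def algebra_simps)
    qed
    have "a n = 0" for n
    proof (induction n rule: less_induct)
      case (less n)
      have "(\<lambda>k. a (k + n) * w ^ k) sums 0" if w: "w \<noteq> 0" "norm w < 1" for w :: complex
      proof -
        have "(\<lambda>k. a (k + n) * w ^ (k + n)) sums 0"
          using a[OF w] less.IH by (subst sums_iff_shift) simp
        from sums_mult[OF this, of "inverse (w ^ n)"] show ?thesis
          using w by (simp add: power_add field_simps)
      qed
      hence "((\<lambda>_. 0) \<longlongrightarrow> a (0 + n)) (at (0::complex))"
        using powser_limit_0_strong[of 1 "\<lambda>k. a (k + n)" "\<lambda>_. 0"] by simp
      thus "a n = 0" by (simp add: tendsto_const_iff)
    qed
    thus ?thesis by (auto simp: a_def fun_eq_iff)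
  qed
  with assms show ?thesis unfolding q_coeff_def by (intro the_equality)
qed

definition A_fun :: "complex \<Rightarrow> complex" where
  "A_fun z = dedekind_eta (2 * z) * dedekind_eta (4 * z) *
     dedekind_eta (6 * z) * dedekind_eta (12 * z)"

definition B1_fun :: "complex \<Rightarrow> complex" where
  "B1_fun z =
     (dedekind_eta z * dedekind_eta (6 * z) ^ 4 * dedekind_eta (8 * z) ^ 2) /
     (dedekind_eta (2 * z) * dedekind_eta (3 * z) * dedekind_eta (12 * z))"

definition B2_fun :: "complex \<Rightarrow> complex" where
  "B2_fun z =
     (dedekind_eta z ^ 2 * dedekind_eta (8 * z) * dedekind_eta (12 * z) ^ 4) /
     (dedekind_eta (4 * z) * dedekind_eta (6 * z) * dedekind_eta (24 * z))"

definition C1_fun :: "complex \<Rightarrow> complex" where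
  "C1_fun z =
     (dedekind_eta z * dedekind_eta (4 * z) * dedekind_eta (6 * z) ^ 4 * dedekind_eta (24 * z) ^ 2) /
     (dedekind_eta (2 * z) * dedekind_eta (3 * z) * dedekind_eta (12 * z) ^ 2)"

definition C2_fun :: "complex \<Rightarrow> complex" where
  "C2_fun z =
     (dedekind_eta z ^ 2 * dedekind_eta (4 * z) ^ 4 * dedekind_eta (6 * z) * dedekind_eta (24 * z)) /
     (dedekind_eta (2 * z) ^ 2 * dedekind_eta (8 * z) * dedekind_eta (12 * z))"

definition a_coeff :: "nat \<Rightarrow> complex" where "a_coeff = q_coeff A_fun"
definition b1_coeff :: "nat \<Rightarrow> complex" where "b1_coeff = q_coeff B1_fun"
definition b2_coeff :: "nat \<Rightarrow> complex" where "b2_coeff = q_coeff B2_fun"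
definition c1_coeff :: "nat \<Rightarrow> complex" where "c1_coeff = q_coeff C1_fun"
definition c2_coeff :: "nat \<Rightarrow> complex" where "c2_coeff = q_coeff C2_fun"

end

theory Submission
  imports Defs "HOL-Complex_Analysis.Complex_Analysis"
begin

text \<open>Let \<open>\<phi>(q)\<close> be the theta series of \<open>x\<^sup>2\<close>. The number of representations by a diagonal form is a
coefficient of a product of four of \<open>a = \<phi>(q)\<close>, \<open>b = \<phi>(q\<^sup>2)\<close>, \<open>c = \<phi>(q\<^sup>3)\<close>, \<open>d = \<phi>(q\<^sup>6)\<close>
(\<open>repr_count_sums\<close>), so each of the twelve formulas says that a monomial of degree four in
\<open>a, b, c, d\<close> equals a combination of Lambert series and eta quotients. These are identities between
modular forms of weight two and level 24. The proof given here is elementary: it replaces the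
dimension of a space of modular forms by addition formulas for theta functions.

Lambert series. Writing the first character as a combination of powers of roots of unity and
splitting the other variable into residue classes turns the generating function of a twisted divisor
sum into a combination of values of \<open>\<Sum> x q\<^sup>k / (1 - x q\<^sup>k)\<^sup>2\<close> (\<open>divsum_sums\<close>). Up to an additive
constant, the sum of this series at \<open>x\<close> and at \<open>q / x\<close> is the Weierstrass function of the Tate curve
\<open>\<complex>\<^sup>* / q\<^sup>\<int>\<close>, and the classical formula
\<open>\<wp>(x) - \<wp>(y) = - \<sigma>(x + y) \<sigma>(x - y) / (\<sigma>(x)\<^sup>2 \<sigma>(y)\<^sup>2)\<close> becomes a product formula (\<open>weier_diff\<close>). It is
obtained from the Jacobi triple product by comparing moments of theta series. At torsion points the
factors are eta quotients. This evaluates the Lambert series for conductors up to 12, and suitable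
combinations of those of \<open>\<sigma>\<close>, as eta quotients up to a constant. The pairs built from the discriminants
\<open>24, 1\<close> and \<open>-8, -3\<close> also need the theta function at points of order eight, whose squares are linear in \<open>\<phi>\<close> (\<open>theta_eighth_squares\<close>, \<open>theta_eighth_root_square\<close>).

Relations. Differences of Weierstrass values at three points add up to zero; at points of order
twelve this yields four three-term relations between eta quotients (\<open>eta_three_term_a\<close> to
\<open>eta_three_term_d\<close>). They show that the squares of all theta values are rational in two quantities
\<open>p\<close> and \<open>v\<close>: in units of \<open>c\<^sup>2\<close>,
\<open>a\<^sup>2 = 1 + 2p\<close>, \<open>\<phi>(-q)\<^sup>2 = v(1 - p)\<close>, \<open>\<phi>(-q\<^sup>3)\<^sup>2 = v(1 + p)\<close>, where \<open>(1 + 2p)v\<^sup>2 = 1 - p\<^sup>2\<close>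
(\<open>a_square\<close>, \<open>a1_square\<close>, \<open>c1_square\<close>, \<open>v_square\<close>). After multiplication by a suitable monomial
the same is true of every product in the twelve formulas. Each formula then reduces to a polynomial
identity modulo the relation between \<open>p\<close> and \<open>v\<close>. Some products are only known through their squares;
for \<open>0 < q < 1\<close> all quantities are positive, which fixes the signs. An identity for all such \<open>q\<close> is an identity of
coefficients (\<open>power_sums_eq\<close>).\<close>

section \<open>Infinite products and the Jacobi triple product\<close>

definition qpoch :: "complex \<Rightarrow> complex \<Rightarrow> complex" where
  "qpoch x q = (\<Prod>n. 1 - x * q ^ n)"

lemma qpoch_convergent: "norm (q :: complex) < 1 \<Longrightarrow> convergent_prod (\<lambda>n. 1 - x * q ^ n)"
  by (intro abs_convergent_prod_imp_convergent_prod summable_imp_abs_convergent_prod)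
     (simp add: norm_mult norm_power summable_mult summable_geometric)

lemma qpoch_LIMSEQ:
  assumes "norm q < 1"
  shows "(\<lambda>N. \<Prod>n<N. 1 - x * q ^ n) \<longlonglongrightarrow> qpoch x q"
proof -
  have "(\<lambda>N. \<Prod>n<Suc N. 1 - x * q ^ n) \<longlonglongrightarrow> qpoch x q"
    using convergent_prod_LIMSEQ[OF qpoch_convergent[OF assms]]
    by (simp only: lessThan_Suc_atMost qpoch_def)
  thus ?thesis by (rule LIMSEQ_imp_Suc)
qed

lemma qpoch_nonzero:
  assumes "norm q < 1" "\<And>n. x * q ^ n \<noteq> 1"
  shows "qpoch x q \<noteq> 0"
  unfolding qpoch_def using assms by (intro prodinf_nonzero qpoch_convergent) (auto dest: sym)

lemma qpoch_rec:
  assumes "norm q < 1"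
  shows "qpoch x q = (1 - x) * qpoch (x * q) q"
proof (rule LIMSEQ_unique)
  show "(\<lambda>N. \<Prod>n<Suc N. 1 - x * q ^ n) \<longlonglongrightarrow> qpoch x q"
    using qpoch_LIMSEQ[OF assms] by (rule LIMSEQ_Suc)
  have "(\<lambda>N. (1 - x) * (\<Prod>n<N. 1 - x * q * q ^ n)) \<longlonglongrightarrow> (1 - x) * qpoch (x * q) q"
    by (intro tendsto_mult tendsto_const qpoch_LIMSEQ assms)
  thus "(\<lambda>N. \<Prod>n<Suc N. 1 - x * q ^ n) \<longlonglongrightarrow> (1 - x) * qpoch (x * q) q"
    by (simp add: prod.lessThan_Suc_shift mult_ac del: prod.lessThan_Suc)
qed

lemma qpoch_dissect:
  assumes "norm q < 1" "k > 0"
  shows "qpoch x q = (\<Prod>j<k. qpoch (x * q ^ j) (q ^ k))"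
proof (rule LIMSEQ_unique)
  have k: "norm (q ^ k) < 1" using assms by (simp add: norm_power power_less_one_iff)
  show "(\<lambda>N. \<Prod>n<N * k. 1 - x * q ^ n) \<longlonglongrightarrow> qpoch x q"
    using LIMSEQ_subseq_LIMSEQ[OF qpoch_LIMSEQ[OF assms(1)], of "\<lambda>N. N * k" x] assms(2)
    by (simp add: o_def strict_mono_def)
  have "(\<Prod>n<N * k. 1 - x * q ^ n) = (\<Prod>j<k. \<Prod>n<N. 1 - x * q ^ j * (q ^ k) ^ n)" for N
  proof -
    have "(\<Prod>n<N * k. 1 - x * q ^ n) = (\<Prod>n<N. \<Prod>j\<in>{n*k..<n*k+k}. 1 - x * q ^ j)"
      by (rule prod.nat_group[symmetric])
    also have "\<dots> = (\<Prod>n<N. \<Prod>j<k. 1 - x * q ^ j * (q ^ k) ^ n)"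
    proof (rule prod.cong[OF refl])
      fix n
      show "(\<Prod>j\<in>{n*k..<n*k+k}. 1 - x * q ^ j) = (\<Prod>j<k. 1 - x * q ^ j * (q ^ k) ^ n)"
        by (rule prod.reindex_bij_witness[of _ "\<lambda>j. j + n * k" "\<lambda>j. j - n * k"])
           (auto simp: mult.assoc mult.commute[of n k] simp flip: power_add power_mult)
    qed
    finally show ?thesis by (rule trans) (rule prod.swap)
  qed
  thus "(\<lambda>N. \<Prod>n<N * k. 1 - x * q ^ n) \<longlonglongrightarrow> (\<Prod>j<k. qpoch (x * q ^ j) (q ^ k))"
    by (simp add: tendsto_prod qpoch_LIMSEQ k)
qed

lemma qpoch_mult_roots:
  assumes "norm q < 1" "finite A" "k > 0" "\<And>x :: complex. (\<Prod>z\<in>A. 1 - z * x) = 1 - x ^ k"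
  shows "(\<Prod>z\<in>A. qpoch (z * x) q) = qpoch (x ^ k) (q ^ k)"
proof (rule LIMSEQ_unique)
  have k: "norm (q ^ k) < 1" using assms by (simp add: norm_power power_less_one_iff)
  show "(\<lambda>N. \<Prod>n<N. 1 - x ^ k * (q ^ k) ^ n) \<longlonglongrightarrow> qpoch (x ^ k) (q ^ k)"
    by (rule qpoch_LIMSEQ[OF k])
  have "(\<Prod>z\<in>A. \<Prod>n<N. 1 - z * x * q ^ n) = (\<Prod>n<N. 1 - x ^ k * (q ^ k) ^ n)" for N
  proof -
    have "(\<Prod>z\<in>A. 1 - z * x * q ^ n) = 1 - x ^ k * (q ^ k) ^ n" for n
      using assms(4)[of "x * q ^ n"]
      by (simp add: mult.assoc power_mult_distrib mult.commute[of n k] flip: power_mult)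
    thus ?thesis by (subst prod.swap) (intro prod.cong refl)
  qed
  moreover have "(\<lambda>N. \<Prod>z\<in>A. \<Prod>n<N. 1 - z * x * q ^ n) \<longlonglongrightarrow> (\<Prod>z\<in>A. qpoch (z * x) q)"
    by (intro tendsto_prod qpoch_LIMSEQ assms)
  ultimately show "(\<lambda>N. \<Prod>n<N. 1 - x ^ k * (q ^ k) ^ n) \<longlonglongrightarrow> (\<Prod>z\<in>A. qpoch (z * x) q)"
    by simp
qed

text \<open>Tannery's theorem over the integers, from its version for series by means of an enumeration.\<close>

lemma has_sum_dominated:
  fixes f :: "nat \<Rightarrow> int \<Rightarrow> complex"
  assumes sum: "\<And>n. (f n has_sum S n) UNIV"
    and lim: "\<And>j. (\<lambda>n. f n j) \<longlonglongrightarrow> g j"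
    and bound: "\<And>n j. norm (f n j) \<le> M j"
    and M: "M summable_on UNIV"
  shows "S \<longlonglongrightarrow> infsum g UNIV" "g summable_on UNIV"
proof -
  have bij: "bij_betw int_decode UNIV UNIV" by (rule bij_int_decode)
  have M': "summable (\<lambda>k. M (int_decode k))"
    using M summable_on_reindex_bij_betw[OF bij, of M] summable_on_imp_summable by auto
  have g: "norm (g j) \<le> M j" for j
    by (rule tendsto_upperbound[OF tendsto_norm[OF lim]]) (auto intro!: always_eventually bound)
  have T: "(\<lambda>n. suminf (\<lambda>k. f n (int_decode k))) \<longlonglongrightarrow> suminf (\<lambda>k. g (int_decode k))"
    using tannerys_theorem[of "\<lambda>k n. f n (int_decode k)" "\<lambda>k. g (int_decode k)" sequentially
       "\<lambda>k. M (int_decode k)"] lim bound M' by (auto intro!: always_eventually)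
  have S: "suminf (\<lambda>k. f n (int_decode k)) = S n" for n
    using sum[of n] has_sum_reindex_bij_betw[OF bij, of "f n"] by (metis has_sum_imp_sums sums_unique)
  have "summable (\<lambda>k. norm (g (int_decode k)))"
    by (rule summable_comparison_test'[OF M']) (simp add: g)
  hence "(\<lambda>k. g (int_decode k)) summable_on UNIV"
    by (rule norm_summable_imp_summable_on)
  thus gs: "g summable_on UNIV" using summable_on_reindex_bij_betw[OF bij, of g] by simp
  have "suminf (\<lambda>k. g (int_decode k)) = infsum g UNIV"
    using has_sum_infsum[OF gs] has_sum_reindex_bij_betw[OF bij, of g] by (metis has_sum_imp_sums sums_unique)
  with T S show "S \<longlonglongrightarrow> infsum g UNIV" by simp
qed

definition qfac :: "complex \<Rightarrow> nat \<Rightarrow> complex" where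
  "qfac q n = (\<Prod>k<n. 1 - q ^ Suc k)"

text \<open>Extending \<open>1 / (q; q)\<^sub>j\<close> by zero to negative \<open>j\<close> keeps the recurrence valid and cuts the finite triple
product off at the right places.\<close>

definition inv_qfac :: "complex \<Rightarrow> int \<Rightarrow> complex" where
  "inv_qfac q j = (if j < 0 then 0 else 1 / qfac q (nat j))"

text \<open>The coefficient of \<open>x\<^sup>j\<close> in the theta series; the exponent \<open>j (j - 1) / 2\<close> makes the triple product
start with the factor \<open>1 - x\<close>.\<close>

definition theta_coeff :: "complex \<Rightarrow> int \<Rightarrow> complex" where
  "theta_coeff q j = (- 1) powi j * q powi (j * (j - 1) div 2)"

text \<open>The coefficients of the finite triple product: up to sign and a power of \<open>q\<close>, a Gaussian binomial
coefficient \<open>2n\<close> over \<open>n + j\<close>.\<close>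

definition jtp_coeff :: "complex \<Rightarrow> nat \<Rightarrow> int \<Rightarrow> complex" where
  "jtp_coeff q n j = theta_coeff q j * qfac q (2 * n) * inv_qfac q (int n + j) * inv_qfac q (int n - j)"

lemma power_neq_1_of_norm_less:
  fixes q :: complex
  assumes "norm q < 1" "n > 0"
  shows "q ^ n \<noteq> 1"
  using power_less_one_iff[of "norm q" n] assms by (metis norm_ge_zero norm_one norm_power less_irrefl)

lemma qfac_nonzero: "norm q < 1 \<Longrightarrow> qfac q n \<noteq> 0"
  using power_neq_1_of_norm_less[of q "Suc _"] by (auto simp: qfac_def simp del: power_Suc)

lemma inv_qfac_pred:
  assumes "norm q < 1" "q \<noteq> 0"
  shows "inv_qfac q (j - 1) = (1 - q powi j) * inv_qfac q j"
proof (cases "j > 0")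
  case True
  then obtain n where n: "j = int (Suc n)" by (metis zero_less_imp_eq_int Suc_pred)
  have "1 - q ^ Suc n \<noteq> 0" using power_neq_1_of_norm_less[OF assms(1), of "Suc n"] by simp
  moreover have "q powi j = q ^ Suc n" unfolding n by (rule power_int_of_nat)
  moreover have "nat j = Suc n" "nat (j - 1) = n" using n by auto
  ultimately show ?thesis using True qfac_nonzero[OF assms(1), of n]
    by (simp add: inv_qfac_def qfac_def del: power_Suc)
next
  case False
  thus ?thesis by (cases "j = 0") (auto simp: inv_qfac_def)
qed

lemma theta_coeff_Suc:
  assumes "q \<noteq> 0"
  shows "theta_coeff q (j + 1) = - (q powi j) * theta_coeff q j"
proof -
  have "(j + 1) * (j + 1 - 1) div 2 = j * (j - 1) div 2 + j"
  proof -
    have "(j + 1) * (j + 1 - 1) = j * (j - 1) + j * 2" by (simp add: algebra_simps)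
    thus ?thesis by simp
  qed
  thus ?thesis using assms by (simp add: theta_coeff_def power_int_add)
qed

text \<open>Pascal's rule for Gaussian binomial coefficients, used once for each of the two new factors.\<close>

lemma jtp_coeff_Suc:
  assumes q: "norm q < 1" "q \<noteq> 0"
  shows "jtp_coeff q (Suc n) j = (1 + q ^ (2 * n + 1)) * jtp_coeff q n j
           - q ^ n * jtp_coeff q n (j - 1) - q ^ (n + 1) * jtp_coeff q n (j + 1)"
proof -
  define u where "u = inv_qfac q (int n + 1 + j)"
  define v where "v = inv_qfac q (int n + 1 - j)"
  define X where "X = q powi (int n + 1 + j)"
  define Y where "Y = q powi (int n + 1 - j)"
  define Z where "Z = q powi j"
  have Z: "Z \<noteq> 0" using q by (simp add: Z_def)
  have qn: "q ^ n \<noteq> 0" using q by simp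
  have X: "X = q ^ n * q * Z" using q by (simp add: X_def Z_def power_int_add)
  have Y: "Y = q ^ n * q / Z" using q by (simp add: Y_def Z_def power_int_diff power_int_add)
  have 1: "inv_qfac q (int n + j) = (1 - X) * u"
    using inv_qfac_pred[OF q, of "int n + 1 + j"] by (simp add: u_def X_def)
  have 2: "inv_qfac q (int n - j) = (1 - Y) * v"
    using inv_qfac_pred[OF q, of "int n + 1 - j"] by (simp add: v_def Y_def)
  have 3: "inv_qfac q (int n + (j - 1)) = (1 - X / q) * ((1 - X) * u)"
  proof -
    have "inv_qfac q (int n + (j - 1)) = inv_qfac q ((int n + j) - 1)" by (simp add: algebra_simps)
    also have "\<dots> = (1 - q powi (int n + j)) * inv_qfac q (int n + j)" by (rule inv_qfac_pred[OF q])
    also have "q powi (int n + j) = X / q" using q by (simp add: X Z_def power_int_add)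
    finally show ?thesis using 1 by simp
  qed
  have 4: "inv_qfac q (int n - (j + 1)) = (1 - Y / q) * ((1 - Y) * v)"
  proof -
    have "inv_qfac q (int n - (j + 1)) = inv_qfac q ((int n - j) - 1)" by (simp add: algebra_simps)
    also have "\<dots> = (1 - q powi (int n - j)) * inv_qfac q (int n - j)" by (rule inv_qfac_pred[OF q])
    also have "q powi (int n - j) = Y / q" using q by (simp add: Y Z_def power_int_diff)
    finally show ?thesis using 2 by simp
  qed
  have 5: "inv_qfac q (int n - (j - 1)) = v" "inv_qfac q (int n + (j + 1)) = u"
    by (simp_all add: u_def v_def algebra_simps)
  have 6: "inv_qfac q (int (Suc n) + j) = u" "inv_qfac q (int (Suc n) - j) = v"
    by (simp_all add: u_def v_def algebra_simps)
  have 7: "theta_coeff q (j + 1) = - Z * theta_coeff q j"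
    unfolding Z_def by (rule theta_coeff_Suc) fact
  have 8: "theta_coeff q (j - 1) = - (q / Z) * theta_coeff q j"
  proof -
    have "theta_coeff q j = - (q powi (j - 1)) * theta_coeff q (j - 1)"
      using theta_coeff_Suc[OF q(2), of "j - 1"] by simp
    also have "q powi (j - 1) = Z / q" using q by (simp add: Z_def power_int_diff)
    finally show ?thesis using q Z by (simp add: field_simps)
  qed
  have e: "q ^ (2 * n) = q ^ n * q ^ n" by (simp add: power_add mult_2)
  define X' Y' c where "X' = X / q" and "Y' = Y / q" and "c = q / Z"
  have 9: "qfac q (2 * Suc n) = qfac q (2 * n) * (1 - q ^ n * q ^ n * q) * (1 - q ^ n * q ^ n * q * q)"
  proof -
    have "2 * Suc n = Suc (Suc (2 * n))" by simp
    thus ?thesis unfolding qfac_def by (simp only: prod.lessThan_Suc power_Suc e) (simp add: mult_ac)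
  qed
  define F where "F = theta_coeff q j * qfac q (2 * n) * u * v"
  have L: "jtp_coeff q (Suc n) j = F * ((1 - q ^ n * q ^ n * q) * (1 - q ^ n * q ^ n * q * q))"
    unfolding jtp_coeff_def 6 9 F_def by (simp only: mult_ac)
  have R: "(1 + q ^ (2 * n + 1)) * jtp_coeff q n j
           - q ^ n * jtp_coeff q n (j - 1) - q ^ (n + 1) * jtp_coeff q n (j + 1)
     = F * ((1 + q ^ n * q ^ n * q) * (1 - X) * (1 - Y) + q ^ n * c * (1 - X') * (1 - X)
        + q ^ n * q * Z * (1 - Y') * (1 - Y))"
    unfolding jtp_coeff_def 1 2 3 4 5 7 8 F_def X'_def[symmetric] Y'_def[symmetric] c_def[symmetric]
      power_add e by (simp add: algebra_simps)
  have "(1 - q ^ n * q ^ n * q) * (1 - q ^ n * q ^ n * q * q) =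
     (1 + q ^ n * q ^ n * q) * (1 - X) * (1 - Y) + q ^ n * c * (1 - X') * (1 - X)
        + q ^ n * q * Z * (1 - Y') * (1 - Y)"
    unfolding X'_def Y'_def c_def X Y using q Z by (simp add: field_simps)
  thus ?thesis unfolding L R by simp
qed

text \<open>The finite product \<open>\<Prod>k<n. (1 - x q\<^sup>k) (1 - q\<^sup>k\<^sup>+\<^sup>1 / x)\<close> and its first two derivatives with
respect to \<open>x d/dx\<close>, by the product rule. Carrying the derivatives through the induction on \<open>n\<close>
avoids differentiating the limit.\<close>

fun jtp_moment0 jtp_moment1 jtp_moment2 :: "complex \<Rightarrow> complex \<Rightarrow> nat \<Rightarrow> complex" where
  "jtp_moment0 x q 0 = 1"
| "jtp_moment0 x q (Suc n) = (1 - x * q ^ n) * (1 - q ^ Suc n / x) * jtp_moment0 x q n"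
| "jtp_moment1 x q 0 = 0"
| "jtp_moment1 x q (Suc n) = (1 - x * q ^ n) * (1 - q ^ Suc n / x) * jtp_moment1 x q n
      + (q ^ Suc n / x - x * q ^ n) * jtp_moment0 x q n"
| "jtp_moment2 x q 0 = 0"
| "jtp_moment2 x q (Suc n) = (1 - x * q ^ n) * (1 - q ^ Suc n / x) * jtp_moment2 x q n
      + 2 * (q ^ Suc n / x - x * q ^ n) * jtp_moment1 x q n
      - (q ^ Suc n / x + x * q ^ n) * jtp_moment0 x q n"

lemma has_sum_shift_int:
  fixes f :: "int \<Rightarrow> complex"
  assumes "(f has_sum S) UNIV"
  shows "((\<lambda>j. f (j + k)) has_sum S) UNIV"
  using assms by (subst has_sum_reindex_bij_witness[of UNIV "\<lambda>j. j - k" "\<lambda>j. j + k" UNIV f]) auto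

text \<open>The three statements have to be proved together, because weighting the recurrence for the coefficients by
\<open>j\<close> or \<open>j\<^sup>2\<close> brings in the moments of lower order.\<close>

lemma finite_jtp:
  assumes q: "norm q < 1" "q \<noteq> 0" and x: "x \<noteq> 0"
  shows "((\<lambda>j. jtp_coeff q n j * x powi j) has_sum jtp_moment0 x q n) UNIV \<and>
         ((\<lambda>j. of_int j * (jtp_coeff q n j * x powi j)) has_sum jtp_moment1 x q n) UNIV \<and>
         ((\<lambda>j. of_int j ^ 2 * (jtp_coeff q n j * x powi j)) has_sum jtp_moment2 x q n) UNIV"
proof (induction n)
  case 0
  have d: "jtp_coeff q 0 j = (if j = 0 then 1 else 0)" for j
    by (auto simp: jtp_coeff_def inv_qfac_def qfac_def theta_coeff_def)
  have "((\<lambda>j. jtp_coeff q 0 j * x powi j) has_sum 1) UNIV"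
    by (rule has_sum_finite_neutralI[of "{0}"]) (auto simp: d)
  moreover have "((\<lambda>j. of_int j * (jtp_coeff q 0 j * x powi j)) has_sum 0) UNIV"
    by (rule has_sum_0) (auto simp: d)
  moreover have "((\<lambda>j. of_int j ^ 2 * (jtp_coeff q 0 j * x powi j)) has_sum 0) UNIV"
    by (rule has_sum_0) (auto simp: d)
  ultimately show ?case by simp
next
  case (Suc n)
  define f where "f j = jtp_coeff q n j * x powi j" for j
  have 0: "(f has_sum jtp_moment0 x q n) UNIV"
    and 1: "((\<lambda>j. of_int j * f j) has_sum jtp_moment1 x q n) UNIV"
    and 2: "((\<lambda>j. of_int j ^ 2 * f j) has_sum jtp_moment2 x q n) UNIV"
    using Suc.IH unfolding f_def by blast+
  note sh = has_sum_shift_int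
  define \<alpha> \<beta> \<gamma> where "\<alpha> = 1 + q ^ (2 * n + 1)" and "\<beta> = q ^ n * x" and "\<gamma> = q ^ (n + 1) / x"
  have g: "(1 - \<beta>) * (1 - \<gamma>) = \<alpha> - \<beta> - \<gamma>"
    using x by (simp add: \<alpha>_def \<beta>_def \<gamma>_def field_simps power_add mult_2 power2_eq_square power_mult)
  have g': "q ^ Suc n / x = \<gamma>" "x * q ^ n = \<beta>" by (simp_all add: \<beta>_def \<gamma>_def)
  have rec: "jtp_coeff q (Suc n) j * x powi j = \<alpha> * f j - \<beta> * f (j + (- 1)) - \<gamma> * f (j + 1)" for j
    using x unfolding jtp_coeff_Suc[OF q] f_def \<alpha>_def \<beta>_def \<gamma>_def
    by (simp add: power_int_diff power_int_add field_simps)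
  have "((\<lambda>j. jtp_coeff q (Suc n) j * x powi j) has_sum
          (\<alpha> * jtp_moment0 x q n - \<beta> * jtp_moment0 x q n - \<gamma> * jtp_moment0 x q n)) UNIV"
    unfolding rec diff_conv_add_uminus
    by (intro has_sum_add has_sum_uminusI has_sum_cmult_right sh[OF 0] 0)
  moreover have "((\<lambda>j. of_int j * (jtp_coeff q (Suc n) j * x powi j)) has_sum
          (\<alpha> * jtp_moment1 x q n - \<beta> * (jtp_moment1 x q n + jtp_moment0 x q n)
           - \<gamma> * (jtp_moment1 x q n - jtp_moment0 x q n))) UNIV"
  proof -
    have r: "of_int j * (jtp_coeff q (Suc n) j * x powi j) = \<alpha> * (of_int j * f j)
       - \<beta> * (of_int (j + (-1)) * f (j + (-1)) + f (j + (-1)))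
       - \<gamma> * (of_int (j + 1) * f (j + 1) - f (j + 1))" for j
      unfolding rec by (simp add: algebra_simps)
    show ?thesis unfolding r diff_conv_add_uminus
      by (intro has_sum_add has_sum_uminusI has_sum_cmult_right sh[OF 0] sh[OF 1] 1)
  qed
  moreover have "((\<lambda>j. of_int j ^ 2 * (jtp_coeff q (Suc n) j * x powi j)) has_sum
          (\<alpha> * jtp_moment2 x q n
           - \<beta> * (jtp_moment2 x q n + (2 * jtp_moment1 x q n + jtp_moment0 x q n))
           - \<gamma> * (jtp_moment2 x q n - (2 * jtp_moment1 x q n - jtp_moment0 x q n)))) UNIV"
  proof -
    have r: "of_int j ^ 2 * (jtp_coeff q (Suc n) j * x powi j) = \<alpha> * (of_int j ^ 2 * f j)
       - \<beta> * (of_int (j + (-1)) ^ 2 * f (j + (-1)) + (2 * (of_int (j + (-1)) * f (j + (-1))) + f (j + (-1))))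
       - \<gamma> * (of_int (j + 1) ^ 2 * f (j + 1) - (2 * (of_int (j + 1) * f (j + 1)) - f (j + 1)))" for j
      unfolding rec by (simp add: algebra_simps power2_eq_square)
    show ?thesis unfolding r diff_conv_add_uminus
      by (intro has_sum_add has_sum_uminusI has_sum_cmult_right sh[OF 0] sh[OF 1] sh[OF 2] 2)
  qed
  ultimately show ?case unfolding jtp_moment0.simps jtp_moment1.simps jtp_moment2.simps g'
    unfolding g by (simp add: algebra_simps)
qed

lemma summable_gauss_nat:
  fixes r y :: real
  assumes "0 < r" "r < 1" "0 < y"
  shows "summable (\<lambda>n. (1 + real n) ^ 2 * r ^ (n * (n - 1) div 2) * y ^ n)"
proof -
  have "(\<lambda>n. 4 * r ^ n * y) \<longlonglongrightarrow> 4 * 0 * y"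
    by (intro tendsto_mult tendsto_const LIMSEQ_power_zero) (use assms in auto)
  hence "eventually (\<lambda>n. 4 * r ^ n * y < 1 / 2) sequentially"
    by (intro order_tendstoD) auto
  then obtain N where N: "\<And>n. n \<ge> N \<Longrightarrow> 4 * r ^ n * y < 1 / 2" by (auto simp: eventually_sequentially)
  show ?thesis
  proof (rule summable_ratio_test[of "1/2" N])
    fix n assume n: "n \<ge> N"
    have e: "Suc n * (Suc n - 1) div 2 = n * (n - 1) div 2 + n"
    proof -
      have "Suc n * (Suc n - 1) = n * (n - 1) + n * 2" by (cases n) (auto simp: algebra_simps)
      thus ?thesis by simp
    qed
    have "(1 + real (Suc n)) ^ 2 \<le> (2 * (1 + real n)) ^ 2" by (intro power_mono) auto
    hence "(1 + real (Suc n)) ^ 2 * (r ^ n * y) \<le> (4 * (1 + real n) ^ 2) * (r ^ n * y)"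
      using assms by (intro mult_right_mono mult_nonneg_nonneg) (auto simp: power_mult_distrib[symmetric] power2_eq_square algebra_simps)
    also have "\<dots> = (1 + real n) ^ 2 * (4 * r ^ n * y)" by simp
    also have "\<dots> \<le> (1 + real n) ^ 2 * (1 / 2)" using N[OF n] by (intro mult_left_mono) auto
    finally have "(1 + real (Suc n)) ^ 2 * (r ^ n * y) * (r ^ (n * (n - 1) div 2) * y ^ n)
        \<le> (1 + real n) ^ 2 * (1 / 2) * (r ^ (n * (n - 1) div 2) * y ^ n)"
      using assms by (intro mult_right_mono) auto
    thus "norm ((1 + real (Suc n)) ^ 2 * r ^ (Suc n * (Suc n - 1) div 2) * y ^ Suc n)
        \<le> 1 / 2 * norm ((1 + real n) ^ 2 * r ^ (n * (n - 1) div 2) * y ^ n)"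
      unfolding e using assms by (simp add: power_add mult_ac)
  qed auto
qed

lemma int_triangle: "int n * (int n - 1) div 2 = int (n * (n - 1) div 2)"
proof -
  have "int n * (int n - 1) = int (n * (n - 1))" by (cases n) (auto simp: algebra_simps)
  thus ?thesis by (simp only: zdiv_int of_nat_numeral)
qed

lemma summable_gauss_int:
  fixes r y :: real
  assumes "0 < r" "r < 1" "0 < y"
  shows "(\<lambda>j::int. (1 + \<bar>of_int j\<bar>) ^ 2 * r powi (j * (j - 1) div 2) * y powi j) summable_on UNIV"
    (is "?f summable_on UNIV")
proof -
  have 1: "?f summable_on int ` UNIV"
  proof (subst summable_on_reindex)
    have "?f (int n) = (1 + real n) ^ 2 * r ^ (n * (n - 1) div 2) * y ^ n" for n
      unfolding int_triangle power_int_of_nat by simp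
    thus "(?f \<circ> int) summable_on UNIV"
      using summable_gauss_nat[OF assms] assms
      by (simp add: o_def summable_on_UNIV_nonneg_real_iff)
  qed auto
  have 2: "?f summable_on (\<lambda>n. - int n) ` UNIV"
  proof (subst summable_on_reindex)
    have "?f (- int n) = (1 + real n) ^ 2 * r ^ (n * (n - 1) div 2) * (r / y) ^ n" for n
    proof -
      have "(- int n) * (- int n - 1) = int n * (int n - 1) + int n * 2" by (simp add: algebra_simps)
      hence "(- int n) * (- int n - 1) div 2 = int n * (int n - 1) div 2 + int n" by simp
      also have "int n * (int n - 1) div 2 = int (n * (n - 1) div 2)"
        by (rule int_triangle)
      finally have "(- int n) * (- int n - 1) div 2 = int (n * (n - 1) div 2 + n)" by simp
      hence "r powi ((- int n) * (- int n - 1) div 2) = r ^ (n * (n - 1) div 2 + n)"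
        by (simp only: power_int_of_nat)
      moreover have "y powi (- int n) = 1 / y ^ n"
        by (simp add: power_int_minus field_simps)
      ultimately show ?thesis by (simp add: power_add power_divide)
    qed
    hence "?f \<circ> (\<lambda>n. - int n) = (\<lambda>n. (1 + real n) ^ 2 * r ^ (n * (n - 1) div 2) * (r / y) ^ n)"
      unfolding o_def by (intro ext)
    thus "(?f \<circ> (\<lambda>n. - int n)) summable_on UNIV"
      using summable_gauss_nat[of r "r / y"] assms
      by (simp add: summable_on_UNIV_nonneg_real_iff)
  qed (auto simp: inj_on_def)
  have "UNIV = int ` UNIV \<union> (\<lambda>n. - int n) ` UNIV"
    by (auto simp: image_iff) (metis int_cases2)
  thus ?thesis using summable_on_union[OF 1 2] by simp
qed

definition theta :: "complex \<Rightarrow> complex \<Rightarrow> complex" where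
  "theta x q = (\<Sum>\<^sub>\<infinity>j. theta_coeff q j * x powi j)"

definition theta' :: "complex \<Rightarrow> complex \<Rightarrow> complex" where
  "theta' x q = (\<Sum>\<^sub>\<infinity>j. of_int j * (theta_coeff q j * x powi j))"

definition theta'' :: "complex \<Rightarrow> complex \<Rightarrow> complex" where
  "theta'' x q = (\<Sum>\<^sub>\<infinity>j. of_int j ^ 2 * (theta_coeff q j * x powi j))"

definition euler :: "complex \<Rightarrow> complex" where "euler q = qpoch q q"

lemma qfac_LIMSEQ: "norm q < 1 \<Longrightarrow> qfac q \<longlonglongrightarrow> euler q"
  using qpoch_LIMSEQ[of q q] by (simp add: qfac_def[abs_def] euler_def)

lemma euler_nonzero: "norm q < 1 \<Longrightarrow> euler q \<noteq> 0"
  unfolding euler_def using power_neq_1_of_norm_less[of q "Suc _"]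
  by (intro qpoch_nonzero) (auto simp: power_Suc[symmetric] simp del: power_Suc)

lemma norm_theta_coeff: "norm (theta_coeff q j) = norm q powi (j * (j - 1) div 2)"
  by (simp add: theta_coeff_def norm_mult norm_power_int)

lemma inv_qfac_LIMSEQ:
  assumes "norm q < 1"
  shows "(\<lambda>n. inv_qfac q (int n + j)) \<longlonglongrightarrow> 1 / euler q"
proof (rule Lim_transform_eventually)
  have "filterlim (\<lambda>n. nat (int n + j)) at_top sequentially"
    unfolding filterlim_at_top eventually_sequentially
  proof
    fix Z :: nat
    show "\<exists>N. \<forall>n\<ge>N. Z \<le> nat (int n + j)"
      by (intro exI[of _ "Z + nat (- j)"]) auto
  qed
  hence "(\<lambda>n. qfac q (nat (int n + j))) \<longlonglongrightarrow> euler q"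
    by (rule filterlim_compose[OF qfac_LIMSEQ[OF assms]])
  thus "(\<lambda>n. 1 / qfac q (nat (int n + j))) \<longlonglongrightarrow> 1 / euler q"
    by (intro tendsto_divide tendsto_const euler_nonzero assms)
  show "eventually (\<lambda>n. 1 / qfac q (nat (int n + j)) = inv_qfac q (int n + j)) sequentially"
    unfolding eventually_sequentially by (intro exI[of _ "nat (- j)"]) (auto simp: inv_qfac_def)
qed

lemma jtp_coeff_LIMSEQ:
  assumes "norm q < 1"
  shows "(\<lambda>n. jtp_coeff q n j) \<longlonglongrightarrow> theta_coeff q j / euler q"
proof -
  have "(\<lambda>n. qfac q (2 * n)) \<longlonglongrightarrow> euler q"
    using LIMSEQ_subseq_LIMSEQ[OF qfac_LIMSEQ[OF assms], of "\<lambda>n. 2 * n"] by (simp add: o_def strict_mono_def)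
  hence "(\<lambda>n. jtp_coeff q n j) \<longlonglongrightarrow> theta_coeff q j * euler q * (1 / euler q) * (1 / euler q)"
    unfolding jtp_coeff_def diff_conv_add_uminus
    by (intro tendsto_mult tendsto_const inv_qfac_LIMSEQ assms)
  thus ?thesis using euler_nonzero[OF assms] by simp
qed

text \<open>The \<open>q\<close>-factorials converge to a nonzero limit, hence they and their inverses are bounded. What is left
decays like a Gaussian in \<open>j\<close>, uniformly in \<open>n\<close>, as dominated convergence requires.\<close>

lemma jtp_coeff_bound:
  assumes "norm q < 1"
  obtains K where "\<And>n j. norm (jtp_coeff q n j) \<le> K * norm q powi (j * (j - 1) div 2)" "K \<ge> 0"
proof -
  obtain K1 where K1: "\<And>n. norm (qfac q n) \<le> K1" "K1 > 0"
    using convergent_imp_Bseq[OF convergentI[OF qfac_LIMSEQ[OF assms]]] by (auto simp: Bseq_def)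
  have "(\<lambda>n. 1 / qfac q n) \<longlonglongrightarrow> 1 / euler q"
    by (intro tendsto_divide tendsto_const euler_nonzero qfac_LIMSEQ assms)
  from convergent_imp_Bseq[OF convergentI[OF this]]
  obtain K2 where K2: "\<And>n. norm (1 / qfac q n) \<le> K2" "K2 > 0"
    by (auto simp: Bseq_def)
  have K2': "norm (inv_qfac q j) \<le> K2" for j
    using K2 by (auto simp: inv_qfac_def less_imp_le)
  have "norm (jtp_coeff q n j) \<le> norm q powi (j * (j - 1) div 2) * K1 * K2 * K2" for n j
    unfolding jtp_coeff_def norm_mult norm_theta_coeff
    by (intro mult_mono K1 K2' order_refl) (use K1 K2 in \<open>auto intro!: mult_nonneg_nonneg zero_le_power_int simp: less_imp_le\<close>)
  thus ?thesis using K1 K2 by (intro that[of "K1 * K2 * K2"]) (auto simp: mult_ac)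
qed

lemma
  assumes q: "norm q < 1" "q \<noteq> 0" and x: "x \<noteq> 0"
  shows theta_has_sum: "((\<lambda>j. theta_coeff q j * x powi j) has_sum theta x q) UNIV"
    and jtp_moment0_LIMSEQ: "jtp_moment0 x q \<longlonglongrightarrow> theta x q / euler q"
    and theta'_has_sum: "((\<lambda>j. of_int j * (theta_coeff q j * x powi j)) has_sum theta' x q) UNIV"
    and jtp_moment1_LIMSEQ: "jtp_moment1 x q \<longlonglongrightarrow> theta' x q / euler q"
    and theta''_has_sum: "((\<lambda>j. of_int j ^ 2 * (theta_coeff q j * x powi j)) has_sum theta'' x q) UNIV"
    and jtp_moment2_LIMSEQ: "jtp_moment2 x q \<longlonglongrightarrow> theta'' x q / euler q"
proof -
  obtain K where K: "\<And>n j. norm (jtp_coeff q n j) \<le> K * norm q powi (j * (j - 1) div 2)" "K \<ge> 0"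
    using jtp_coeff_bound[OF q(1)] by blast
  define M where "M j = K * ((1 + \<bar>real_of_int j\<bar>) ^ 2 * norm q powi (j * (j - 1) div 2) * norm x powi j)" for j
  have M: "M summable_on UNIV"
    unfolding M_def using summable_gauss_int[of "norm q" "norm x"] q x
    by (intro summable_on_cmult_right) auto
  have E: "euler q \<noteq> 0" by (rule euler_nonzero) fact
  have gen: "(\<lambda>j. w j * (theta_coeff q j * x powi j)) summable_on UNIV \<and>
      (S \<longlonglongrightarrow> (\<Sum>\<^sub>\<infinity>j. w j * (theta_coeff q j * x powi j)) / euler q)"
    if S: "\<And>n. ((\<lambda>j. w j * (jtp_coeff q n j * x powi j)) has_sum S n) UNIV"
    and w: "\<And>j. norm (w j) \<le> (1 + \<bar>real_of_int j\<bar>) ^ 2" for w S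
  proof -
    have b: "norm (w j * (jtp_coeff q n j * x powi j)) \<le> M j" for n j
    proof -
      have "norm (w j * (jtp_coeff q n j * x powi j)) =
          norm (w j) * (norm (jtp_coeff q n j) * norm x powi j)"
        by (simp add: norm_mult norm_power_int)
      also have "\<dots> \<le> (1 + \<bar>real_of_int j\<bar>) ^ 2 * (K * norm q powi (j * (j - 1) div 2) * norm x powi j)"
        by (intro mult_mono w K mult_right_mono) (auto intro!: mult_nonneg_nonneg)
      finally show ?thesis by (simp add: M_def mult_ac)
    qed
    have l: "(\<lambda>n. w j * (jtp_coeff q n j * x powi j)) \<longlonglongrightarrow> w j * (theta_coeff q j / euler q * x powi j)" for j
      by (intro tendsto_mult tendsto_const jtp_coeff_LIMSEQ q)
    note D = has_sum_dominated[OF S l b M]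
    have r: "(\<lambda>j. w j * (theta_coeff q j / euler q * x powi j)) =
       (\<lambda>j. (w j * (theta_coeff q j * x powi j)) * (1 / euler q))" by (simp add: fun_eq_iff)
    have "(\<lambda>j. w j * (theta_coeff q j * x powi j)) summable_on UNIV"
      using D(2) E unfolding r by (subst (asm) summable_on_cmult_left') auto
    moreover have "S \<longlonglongrightarrow> (\<Sum>\<^sub>\<infinity>j. w j * (theta_coeff q j * x powi j)) * (1 / euler q)"
      using D(1) unfolding r by (subst (asm) infsum_cmult_left')
    ultimately show ?thesis by simp
  qed
  note F = finite_jtp[OF q x]
  have b0: "norm (1 :: complex) \<le> (1 + \<bar>real_of_int j\<bar>) ^ 2" for j by (simp add: one_le_power)
  have b2: "norm (complex_of_int j ^ 2) \<le> (1 + \<bar>real_of_int j\<bar>) ^ 2" for j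
    unfolding norm_power by (intro power_mono) auto
  have b1: "norm (complex_of_int j) \<le> (1 + \<bar>real_of_int j\<bar>) ^ 2" for j
  proof -
    have "norm (complex_of_int j) \<le> (1 + \<bar>real_of_int j\<bar>) ^ 1" by simp
    also have "\<dots> \<le> (1 + \<bar>real_of_int j\<bar>) ^ 2" by (intro power_increasing) auto
    finally show ?thesis .
  qed
  have 0: "((\<lambda>j. 1 * (jtp_coeff q n j * x powi j)) has_sum jtp_moment0 x q n) UNIV" for n using F[of n] by simp
  have 1: "((\<lambda>j. of_int j * (jtp_coeff q n j * x powi j)) has_sum jtp_moment1 x q n) UNIV" for n using F[of n] by simp
  have 2: "((\<lambda>j. of_int j ^ 2 * (jtp_coeff q n j * x powi j)) has_sum jtp_moment2 x q n) UNIV" for n using F[of n] by simp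
  from gen[OF 0 b0] gen[OF 1 b1] gen[OF 2 b2]
  show "((\<lambda>j. theta_coeff q j * x powi j) has_sum theta x q) UNIV"
    "jtp_moment0 x q \<longlonglongrightarrow> theta x q / euler q"
    "((\<lambda>j. of_int j * (theta_coeff q j * x powi j)) has_sum theta' x q) UNIV"
    "jtp_moment1 x q \<longlonglongrightarrow> theta' x q / euler q"
    "((\<lambda>j. of_int j ^ 2 * (theta_coeff q j * x powi j)) has_sum theta'' x q) UNIV"
    "jtp_moment2 x q \<longlonglongrightarrow> theta'' x q / euler q"
    by (auto simp: theta_def theta'_def theta''_def)
qed

definition theta_prod :: "complex \<Rightarrow> complex \<Rightarrow> complex" where
  "theta_prod x q = qpoch x q * qpoch (q / x) q"

text \<open>The limit of the finite version: the coefficients tend to \<open>theta_coeff q j / euler q\<close>.\<close>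

theorem jacobi_triple_product:
  assumes q: "norm q < 1" "q \<noteq> 0" and x: "x \<noteq> 0"
  shows "theta x q = euler q * theta_prod x q"
proof -
  have "jtp_moment0 x q n = (\<Prod>k<n. 1 - x * q ^ k) * (\<Prod>k<n. 1 - q / x * q ^ k)" for n
    by (induction n) auto
  hence "jtp_moment0 x q = (\<lambda>n. (\<Prod>k<n. 1 - x * q ^ k) * (\<Prod>k<n. 1 - q / x * q ^ k))" by (rule ext)
  hence "jtp_moment0 x q \<longlonglongrightarrow> theta_prod x q"
    unfolding theta_prod_def using tendsto_mult[OF qpoch_LIMSEQ[OF q(1), of x] qpoch_LIMSEQ[OF q(1), of "q / x"]]
    by simp
  with jtp_moment0_LIMSEQ[OF assms] have "theta x q / euler q = theta_prod x q"
    by (rule LIMSEQ_unique)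
  thus ?thesis using euler_nonzero[OF q(1)] by (simp add: field_simps)
qed

section \<open>Products of two theta series\<close>

lemma has_sum_times_complex:
  fixes f :: "'a \<Rightarrow> complex" and g :: "'b \<Rightarrow> complex"
  assumes f: "(f has_sum a) A" and g: "(g has_sum b) B"
  shows "((\<lambda>(x, y). f x * g y) has_sum a * b) (A \<times> B)"
proof -
  have f': "(\<lambda>x. norm (f x)) summable_on A" and g': "(\<lambda>x. norm (g x)) summable_on B"
    using has_sum_imp_summable[OF f] has_sum_imp_summable[OF g] summable_on_iff_abs_summable_on_complex by blast+
  define b' where "b' = infsum (\<lambda>y. norm (g y)) B"
  have "(\<lambda>p. norm (f (fst p)) * norm (g (snd p))) summable_on Sigma A (\<lambda>_. B)"
  proof (rule summable_on_SigmaI)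
    show "((\<lambda>y. norm (f (fst (x, y))) * norm (g (snd (x, y)))) has_sum norm (f x) * b') B" for x
      unfolding fst_conv snd_conv b'_def by (intro has_sum_cmult_right has_sum_infsum g')
    show "(\<lambda>x. norm (f x) * b') summable_on A" by (rule summable_on_cmult_left[OF f'])
  qed auto
  hence "(\<lambda>p. norm (case p of (x, y) \<Rightarrow> f x * g y)) summable_on A \<times> B"
    by (simp add: case_prod_unfold norm_mult)
  hence s: "(\<lambda>(x, y). f x * g y) summable_on A \<times> B" by (rule Infinite_Sum.abs_summable_summable)
  show ?thesis
  proof (rule has_sum_SigmaI[OF _ _ s])
    show "((\<lambda>y. case (x, y) of (x, y) \<Rightarrow> f x * g y) has_sum f x * b) B" for x
      using has_sum_cmult_right[OF g] by simp
    show "((\<lambda>x. f x * b) has_sum a * b) A" by (rule has_sum_cmult_left[OF f])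
  qed
qed

lemma has_sum_parity_split:
  fixes h :: "int \<times> int \<Rightarrow> complex"
  assumes "((\<lambda>(n, m). h (n + m, n - m)) has_sum a) UNIV"
    and "((\<lambda>(n, m). h (n + m + 1, n - m)) has_sum b) UNIV"
  shows "(h has_sum (a + b)) UNIV"
proof -
  define E Od where "E = {p :: int \<times> int. even (fst p - snd p)}" and "Od = {p :: int \<times> int. odd (fst p - snd p)}"
  have "(h has_sum a) E"
    using assms(1) by (subst has_sum_reindex_bij_witness[of UNIV "\<lambda>(i, j). ((i + j) div 2, (i - j) div 2)"
       "\<lambda>(n, m). (n + m, n - m)" E h "\<lambda>(n, m). h (n + m, n - m)", symmetric])
      (auto simp: E_def elim!: evenE, (presburger+)?)
  moreover have "(h has_sum b) Od"
    using assms(2) by (subst has_sum_reindex_bij_witness[of UNIV "\<lambda>(i, j). ((i + j - 1) div 2, (i - j - 1) div 2)"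
       "\<lambda>(n, m). (n + m + 1, n - m)" Od h "\<lambda>(n, m). h (n + m + 1, n - m)", symmetric])
      (auto simp: Od_def elim!: evenE oddE, (presburger+)?)
  ultimately have "(h has_sum (a + b)) (E \<union> Od)" by (rule has_sum_Un_disjoint) (auto simp: E_def Od_def)
  also have "E \<union> Od = UNIV" by (auto simp: E_def Od_def)
  finally show ?thesis .
qed

text \<open>The substitution \<open>i = n + m\<close>, \<open>j = n - m\<close> (or \<open>n + m + 1\<close>, \<open>n - m\<close> when the parities differ) turns a
product of two theta series into theta series with the base squared. An arbitrary weight depending on
\<open>i - j\<close> only is kept, for the sake of the second moments below.\<close>

lemma theta_pair_has_sum:
  assumes q: "norm q < 1" "q \<noteq> 0" and xy: "x \<noteq> 0" "y \<noteq> 0"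
    and U0: "((\<lambda>m. c (2 * m) * (theta_coeff (q ^ 2) m * (- (q * y ^ 2)) powi m)) has_sum U0) UNIV"
    and U1: "((\<lambda>m. c (2 * m + 1) * (theta_coeff (q ^ 2) m * (- (q ^ 2 * y ^ 2)) powi m)) has_sum U1) UNIV"
  shows "((\<lambda>(i, j). c (i - j) * ((theta_coeff q i * (x * y) powi i) * (theta_coeff q j * (x / y) powi j)))
           has_sum theta (- (x ^ 2)) (q ^ 2) * U0 - x * y * theta (- (q * x ^ 2)) (q ^ 2) * U1) UNIV"
proof -
  have q2: "norm (q ^ 2) < 1" "q ^ 2 \<noteq> 0" using q by (auto simp: norm_power power_less_one_iff)
  have F: "((\<lambda>n. theta_coeff (q ^ 2) n * (- (x ^ 2)) powi n) has_sum theta (- (x ^ 2)) (q ^ 2)) UNIV"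
    and G: "((\<lambda>n. theta_coeff (q ^ 2) n * (- (q * x ^ 2)) powi n) has_sum theta (- (q * x ^ 2)) (q ^ 2)) UNIV"
    using q2 q xy by (auto intro!: theta_has_sum)
  have sgn: "(-1) powi n * (-1) powi n = (1 :: complex)" for n :: int
    by (simp flip: power_int_mult_distrib)
  have q2n: "(q ^ 2) powi (n * (n - 1) div 2) = q powi (n ^ 2 - n)" for n :: int
  proof -
    have "(q ^ 2) powi (n * (n - 1) div 2) = q powi (2 * (n * (n - 1) div 2))"
      by (simp only: power_int_mult power_int_numeral)
    also have "2 * (n * (n - 1) div 2) = n ^ 2 - n" by (simp add: power2_eq_square algebra_simps)
    finally show ?thesis .
  qed
  have tc: "theta_coeff (q ^ 2) n * (- z) powi n = q powi (n ^ 2 - n) * z powi n" for n z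
  proof -
    have "(- z) powi n = (-1) powi n * z powi n" by (simp flip: power_int_mult_distrib)
    thus ?thesis using sgn[of n] by (simp add: theta_coeff_def q2n)
  qed
  define h where "h i j = c (i - j) * ((theta_coeff q i * (x * y) powi i) * (theta_coeff q j * (x / y) powi j))" for i j
  have t: "theta_coeff q i * theta_coeff q j = (-1) powi (i + j) * q powi k"
    if "2 * k = i * (i - 1) + j * (j - 1)" for i j k
  proof -
    have "i * (i - 1) div 2 + j * (j - 1) div 2 = k"
      using that by (metis div_add dvd_triv_left even_mult_iff even_diff nonzero_mult_div_cancel_left odd_one zero_neq_numeral even_plus_one_iff)
    thus ?thesis using q by (auto simp: theta_coeff_def power_int_add)
  qed
  have "((\<lambda>(n, m). h (n + m) (n - m)) has_sum theta (- (x ^ 2)) (q ^ 2) * U0) UNIV"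
  proof -
    have "((\<lambda>(n, m). (theta_coeff (q ^ 2) n * (- (x ^ 2)) powi n) *
         (c (2 * m) * (theta_coeff (q ^ 2) m * (- (q * y ^ 2)) powi m))) has_sum theta (- (x ^ 2)) (q ^ 2) * U0) (UNIV \<times> UNIV)"
      by (rule has_sum_times_complex[OF F U0])
    also have "(\<lambda>(n, m). (theta_coeff (q ^ 2) n * (- (x ^ 2)) powi n) *
         (c (2 * m) * (theta_coeff (q ^ 2) m * (- (q * y ^ 2)) powi m))) = (\<lambda>(n, m). h (n + m) (n - m))"
    proof (rule arg_cong[of _ _ case_prod], intro ext)
      fix n m :: int
      have e: "2 * (n ^ 2 + m ^ 2 - n) = (n + m) * (n + m - 1) + (n - m) * (n - m - 1)"
        by (simp add: algebra_simps power2_eq_square)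
      have "h (n + m) (n - m) = c (2 * m) * ((theta_coeff q (n + m) * theta_coeff q (n - m)) *
          ((x * y) powi (n + m) * (x / y) powi (n - m)))" by (simp add: h_def)
      also have "theta_coeff q (n + m) * theta_coeff q (n - m) = q powi (n ^ 2 + m ^ 2 - n)"
        unfolding t[OF e] by (simp add: mult_2[symmetric] power_int_mult)
      also have "(x * y) powi (n + m) * (x / y) powi (n - m) = (x ^ 2) powi n * (y ^ 2) powi m"
        using xy by (simp add: power_int_add power_int_diff power_int_mult_distrib power_int_divide_distrib
           power2_eq_square field_simps)
      also have "q powi (n ^ 2 + m ^ 2 - n) = q powi (n ^ 2 - n) * (q powi (m ^ 2 - m) * q powi m)"
        using q by (simp add: power_int_add power_int_diff)
      finally show "(theta_coeff (q ^ 2) n * (- (x ^ 2)) powi n) *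
         (c (2 * m) * (theta_coeff (q ^ 2) m * (- (q * y ^ 2)) powi m)) = h (n + m) (n - m)"
        unfolding tc by (simp add: power_int_mult_distrib)
    qed
    finally show ?thesis by simp
  qed
  moreover have "((\<lambda>(n, m). h (n + m + 1) (n - m)) has_sum - (x * y * theta (- (q * x ^ 2)) (q ^ 2) * U1)) UNIV"
  proof -
    have "((\<lambda>p. (- (x * y)) * (case p of (n, m) \<Rightarrow> (theta_coeff (q ^ 2) n * (- (q * x ^ 2)) powi n) *
         (c (2 * m + 1) * (theta_coeff (q ^ 2) m * (- (q ^ 2 * y ^ 2)) powi m)))) has_sum
         (- (x * y)) * (theta (- (q * x ^ 2)) (q ^ 2) * U1)) (UNIV \<times> UNIV)"
      by (intro has_sum_cmult_right has_sum_times_complex[OF G U1])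
    also have "(\<lambda>p. (- (x * y)) * (case p of (n, m) \<Rightarrow> (theta_coeff (q ^ 2) n * (- (q * x ^ 2)) powi n) *
         (c (2 * m + 1) * (theta_coeff (q ^ 2) m * (- (q ^ 2 * y ^ 2)) powi m)))) = (\<lambda>(n, m). h (n + m + 1) (n - m))"
    proof (rule ext, clarify)
      fix n m :: int
      have e: "2 * (n ^ 2 + m ^ 2 + m) = (n + m + 1) * (n + m + 1 - 1) + (n - m) * (n - m - 1)"
        by (simp add: algebra_simps power2_eq_square)
      have "h (n + m + 1) (n - m) = c (2 * m + 1) * ((theta_coeff q (n + m + 1) * theta_coeff q (n - m)) *
          ((x * y) powi (n + m + 1) * (x / y) powi (n - m)))" by (simp add: h_def algebra_simps)
      also have "theta_coeff q (n + m + 1) * theta_coeff q (n - m) = - (q powi (n ^ 2 + m ^ 2 + m))"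
      proof -
        have "n + m + 1 + (n - m) = 2 * n + 1" by simp
        thus ?thesis unfolding t[OF e] by (simp add: power_int_add power_int_mult)
      qed
      also have "(x * y) powi (n + m + 1) * (x / y) powi (n - m) = x * y * (x ^ 2) powi n * (y ^ 2) powi m"
        using xy by (simp add: power_int_add power_int_diff power_int_mult_distrib power_int_divide_distrib
           power2_eq_square field_simps)
      also have "q powi (n ^ 2 + m ^ 2 + m) = (q powi (n ^ 2 - n) * q powi n) * (q powi (m ^ 2 - m) * (q ^ 2) powi m)"
        using q by (simp add: power_int_add power_int_diff power2_eq_square power_int_mult_distrib)
      finally show "(- (x * y)) * ((theta_coeff (q ^ 2) n * (- (q * x ^ 2)) powi n) *
         (c (2 * m + 1) * (theta_coeff (q ^ 2) m * (- (q ^ 2 * y ^ 2)) powi m))) = h (n + m + 1) (n - m)"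
        unfolding tc by (simp add: power_int_mult_distrib mult_ac)
    qed
    finally show ?thesis by (simp add: mult_ac)
  qed
  ultimately have "(case_prod h has_sum (theta (- (x ^ 2)) (q ^ 2) * U0 + - (x * y * theta (- (q * x ^ 2)) (q ^ 2) * U1))) UNIV"
    by (intro has_sum_parity_split) (simp_all add: case_prod_unfold)
  thus ?thesis by (simp add: h_def[abs_def])
qed

lemma theta_mult_theta:
  assumes q: "norm q < 1" "q \<noteq> 0" and xy: "x \<noteq> 0" "y \<noteq> 0"
  shows "theta (x * y) q * theta (x / y) q =
     theta (- (x ^ 2)) (q ^ 2) * theta (- (q * y ^ 2)) (q ^ 2)
     - x * y * theta (- (q * x ^ 2)) (q ^ 2) * theta (- (q ^ 2 * y ^ 2)) (q ^ 2)"
proof (rule has_sum_unique)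
  have q2: "norm (q ^ 2) < 1" "q ^ 2 \<noteq> 0" using q by (auto simp: norm_power power_less_one_iff)
  show "((\<lambda>(i, j). (theta_coeff q i * (x * y) powi i) * (theta_coeff q j * (x / y) powi j))
      has_sum theta (x * y) q * theta (x / y) q) (UNIV \<times> UNIV)"
    by (intro has_sum_times_complex theta_has_sum) (use q xy in auto)
  show "((\<lambda>(i, j). (theta_coeff q i * (x * y) powi i) * (theta_coeff q j * (x / y) powi j))
      has_sum theta (- (x ^ 2)) (q ^ 2) * theta (- (q * y ^ 2)) (q ^ 2)
       - x * y * theta (- (q * x ^ 2)) (q ^ 2) * theta (- (q ^ 2 * y ^ 2)) (q ^ 2)) (UNIV \<times> UNIV)"
    using theta_pair_has_sum[OF q xy, of "\<lambda>_. 1"] q2 q xy by (simp add: theta_has_sum)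
qed

section \<open>Differences of values of the Weierstrass function\<close>

text \<open>The Koebe function, the sum of \<open>m z\<^sup>m\<close>.\<close>

definition koebe :: "complex \<Rightarrow> complex" where "koebe z = z / (1 - z) ^ 2"

definition koebe_sum :: "complex \<Rightarrow> complex \<Rightarrow> complex" where
  "koebe_sum x q = (\<Sum>k. koebe (x * q ^ k))"

text \<open>Up to an additive constant independent of \<open>x\<close> and a factor, the Weierstrass function of the lattice with
\<open>q = e\<^sup>2\<^sup>\<pi>\<^sup>i\<^sup>\<tau>\<close>, written multiplicatively in \<open>x\<close>.\<close>

definition weier :: "complex \<Rightarrow> complex \<Rightarrow> complex" where
  "weier x q = koebe_sum x q + koebe_sum (q / x) q"

lemma koebe_summable:
  assumes "norm q < 1"
  shows "summable (\<lambda>k. norm (koebe (x * q ^ k)))"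
proof -
  have "(\<lambda>k. norm x * norm q ^ k) \<longlonglongrightarrow> norm x * 0"
    by (intro tendsto_mult tendsto_const LIMSEQ_power_zero) (use assms in auto)
  hence "eventually (\<lambda>k. norm x * norm q ^ k < 1 / 2) sequentially"
    by (intro order_tendstoD) auto
  hence "eventually (\<lambda>k. norm (norm (koebe (x * q ^ k))) \<le> 4 * (norm x * norm q ^ k)) sequentially"
  proof eventually_elim
    case (elim k)
    define z where "z = x * q ^ k"
    have z2: "norm x * norm q ^ k = norm z" by (simp add: z_def norm_mult norm_power)
    have z: "norm z < 1 / 2" using elim z2 by simp
    have "1 / 2 \<le> norm (1 - z)" using norm_triangle_ineq2[of 1 z] z by simp
    hence "(1 / 2) ^ 2 \<le> norm (1 - z) ^ 2" by (intro power_mono) auto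
    hence n: "1 / 4 \<le> norm (1 - z) ^ 2" by (simp add: power2_eq_square)
    have "norm (koebe z) = norm z / norm (1 - z) ^ 2"
      by (simp add: koebe_def norm_divide norm_power)
    also have "\<dots> \<le> norm z / (1 / 4)"
      using n by (intro divide_left_mono mult_pos_pos) auto
    finally show ?case unfolding z2 z_def[symmetric] by simp
  qed
  thus ?thesis
    by (rule summable_comparison_test_ev) (intro summable_mult summable_geometric, use assms in simp)
qed

lemma koebe_sums:
  assumes "norm q < 1"
  shows "(\<lambda>k. koebe (x * q ^ k)) sums koebe_sum x q"
  unfolding koebe_sum_def by (rule summable_sums[OF summable_norm_cancel[OF koebe_summable[OF assms]]])

lemma koebe_sum_rec:
  assumes "norm q < 1"
  shows "koebe_sum x q = koebe x + koebe_sum (x * q) q"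
  using suminf_split_head[OF sums_summable[OF koebe_sums[OF assms, of x]]]
  by (simp add: koebe_sum_def mult_ac)

lemma qpoch_eq_0:
  assumes "norm q < 1" "x * q ^ k = 1"
  shows "qpoch x q = 0"
proof (rule LIMSEQ_unique[OF qpoch_LIMSEQ[OF assms(1)]])
  have "eventually (\<lambda>N. (\<Prod>n<N. 1 - x * q ^ n) = 0) sequentially"
    using eventually_gt_at_top[of k] by eventually_elim (use assms(2) in auto)
  thus "(\<lambda>N. \<Prod>n<N. 1 - x * q ^ n) \<longlonglongrightarrow> 0" by (rule tendsto_eventually)
qed

text \<open>Minus the second logarithmic derivative of a product is the sum over its factors, and for the factor
\<open>1 - u\<close> it is the Koebe function of \<open>u\<close>.\<close>

lemma jtp_moments_log_derivative:
  assumes "\<And>k. x * q ^ k \<noteq> 1" "\<And>k. q ^ Suc k \<noteq> x" "x \<noteq> 0"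
  shows "jtp_moment1 x q n ^ 2 - jtp_moment0 x q n * jtp_moment2 x q n =
           jtp_moment0 x q n ^ 2 * (\<Sum>k<n. koebe (x * q ^ k) + koebe (q / x * q ^ k))"
proof (induction n)
  case (Suc n)
  define u v A B C where "u = x * q ^ n" and "v = q ^ Suc n / x"
    and "A = jtp_moment0 x q n" and "B = jtp_moment1 x q n" and "C = jtp_moment2 x q n"
  have uv: "1 - u \<noteq> 0" "1 - v \<noteq> 0" using assms(1)[of n] assms(2)[of n] assms(3)
    by (auto simp: u_def v_def field_simps)
  have v': "q / x * q ^ n = v" by (simp add: v_def)
  define g where "g = (1 - u) * (1 - v)"
  have e: "(v - u) ^ 2 + g * (v + u) = g ^ 2 * (koebe u + koebe v)"
    unfolding koebe_def g_def using uv by (simp add: field_simps) (simp add: power2_eq_square algebra_simps)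
  have "jtp_moment1 x q (Suc n) ^ 2 - jtp_moment0 x q (Suc n) * jtp_moment2 x q (Suc n)
     = (g * B + (v - u) * A) ^ 2 - g * A * (g * C + 2 * (v - u) * B - (v + u) * A)"
    by (simp add: A_def B_def C_def g_def u_def v_def)
  also have "\<dots> = g ^ 2 * (B ^ 2 - A * C) + A ^ 2 * ((v - u) ^ 2 + g * (v + u))"
    by (simp add: power2_eq_square algebra_simps)
  also have "\<dots> = (g * A) ^ 2 * (\<Sum>k<Suc n. koebe (x * q ^ k) + koebe (q / x * q ^ k))"
    using Suc.IH unfolding e A_def[symmetric] B_def[symmetric] C_def[symmetric] sum.lessThan_Suc u_def[symmetric] v'
    by (simp add: power_mult_distrib algebra_simps)
  finally show ?case by (simp add: g_def u_def v_def A_def)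
qed auto

lemma theta_log_derivative:
  assumes q: "norm q < 1" "q \<noteq> 0" and x: "x \<noteq> 0" and nz: "theta_prod x q \<noteq> 0"
  shows "theta' x q ^ 2 - theta x q * theta'' x q = theta x q ^ 2 * weier x q"
proof -
  have 1: "x * q ^ k \<noteq> 1" for k
    using qpoch_eq_0[OF q(1), of x k] nz by (auto simp: theta_prod_def)
  have 2: "q ^ Suc k \<noteq> x" for k
    using qpoch_eq_0[OF q(1), of "q / x" k] nz x by (auto simp: theta_prod_def)
  have "(\<lambda>n. jtp_moment1 x q n ^ 2 - jtp_moment0 x q n * jtp_moment2 x q n)
     \<longlonglongrightarrow> (theta' x q / euler q) ^ 2 - theta x q / euler q * (theta'' x q / euler q)"
    by (intro tendsto_intros jtp_moment0_LIMSEQ jtp_moment1_LIMSEQ jtp_moment2_LIMSEQ q x)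
  moreover have "(\<lambda>n. jtp_moment0 x q n ^ 2 * (\<Sum>k<n. koebe (x * q ^ k) + koebe (q / x * q ^ k)))
     \<longlonglongrightarrow> (theta x q / euler q) ^ 2 * weier x q"
  proof (intro tendsto_mult tendsto_power jtp_moment0_LIMSEQ q x)
    show "(\<lambda>n. \<Sum>k<n. koebe (x * q ^ k) + koebe (q / x * q ^ k)) \<longlonglongrightarrow> weier x q"
      using sums_add[OF koebe_sums[OF q(1), of x] koebe_sums[OF q(1), of "q / x"]]
      by (simp add: sums_def weier_def)
  qed
  ultimately have "(theta' x q / euler q) ^ 2 - theta x q / euler q * (theta'' x q / euler q)
       = (theta x q / euler q) ^ 2 * weier x q"
    unfolding jtp_moments_log_derivative[OF 1 2 x] by (rule LIMSEQ_unique)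
  thus ?thesis using euler_nonzero[OF q(1)] by (simp add: field_simps power2_eq_square)
qed

lemma theta_prod_one: "norm q < 1 \<Longrightarrow> theta_prod 1 q = 0"
  using qpoch_eq_0[of q 1 0] by (simp add: theta_prod_def)

lemma theta_prod_inverse:
  assumes "norm q < 1" "x \<noteq> 0"
  shows "theta_prod (1 / x) q = - theta_prod x q / x"
proof -
  have "theta_prod (1 / x) q = (1 - 1 / x) * qpoch (q / x) q * qpoch (q * x) q"
    unfolding theta_prod_def by (subst qpoch_rec[OF assms(1), of "1 / x"]) simp
  moreover have "theta_prod x q = (1 - x) * qpoch (q * x) q * qpoch (q / x) q"
    unfolding theta_prod_def by (subst qpoch_rec[OF assms(1), of x]) (simp add: mult_ac)
  ultimately show ?thesis using assms(2) by (simp only:) (simp add: field_simps)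
qed

lemma theta_prod_shift:
  assumes "norm q < 1" "q \<noteq> 0" "x \<noteq> 0"
  shows "theta_prod (x * q) q = - theta_prod x q / x"
proof -
  have "theta_prod (x * q) q = theta_prod (1 / x) q"
    using assms by (simp add: theta_prod_def mult.commute)
  thus ?thesis using theta_prod_inverse[OF assms(1,3)] by simp
qed

text \<open>At \<open>x = 1\<close> the first factor of the finite product vanishes, so the derivative is minus the product of
the others, which tends to \<open>euler q ^ 2\<close>; the normalisation of the moments contributes one more
factor.\<close>

lemma theta'_one:
  assumes q: "norm q < 1" "q \<noteq> 0"
  shows "theta' 1 q = - (euler q ^ 3)"
proof -
  have m0: "jtp_moment0 1 q (Suc n) = 0" for n by (induction n) auto
  have "jtp_moment1 1 q (Suc n) = - (qfac q n * qfac q (Suc n))" for n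
  proof (induction n)
    case (Suc n)
    have "jtp_moment1 1 q (Suc (Suc n)) = (1 - q ^ Suc n) * (1 - q ^ Suc (Suc n)) * jtp_moment1 1 q (Suc n)"
      using m0[of n] by (simp del: jtp_moment0.simps power_Suc add: jtp_moment1.simps(2)[of _ _ "Suc n"])
    thus ?case unfolding Suc.IH by (simp add: qfac_def del: power_Suc jtp_moment1.simps)
  qed (simp add: qfac_def)
  hence "(\<lambda>n. jtp_moment1 1 q (Suc n)) \<longlonglongrightarrow> - (euler q * euler q)"
    by (simp only:) (intro tendsto_minus tendsto_mult qfac_LIMSEQ LIMSEQ_Suc q)
  moreover have "(\<lambda>n. jtp_moment1 1 q (Suc n)) \<longlonglongrightarrow> theta' 1 q / euler q"
    by (intro LIMSEQ_Suc jtp_moment1_LIMSEQ q) auto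
  ultimately have "theta' 1 q / euler q = - (euler q * euler q)" by (metis LIMSEQ_unique)
  thus ?thesis using euler_nonzero[OF q(1)] by (simp add: field_simps power3_eq_cube)
qed

text \<open>The multiplicative form of \<open>\<wp>(x) - \<wp>(y) = - \<sigma>(x + y) \<sigma>(x - y) / (\<sigma>(x)\<^sup>2 \<sigma>(y)\<^sup>2)\<close>. By
\<open>theta_log_derivative\<close> the left side is a quotient with numerator
\<open>K(x) \<theta>(y)\<^sup>2 - K(y) \<theta>(x)\<^sup>2\<close>, where \<open>K = \<theta>'\<^sup>2 - \<theta> \<theta>''\<close>. By parity splitting,
\<open>\<theta>(x)\<^sup>2\<close>, \<open>K(x)\<close> and \<open>\<theta>(xy) \<theta>(x/y)\<close> are all built from the same pair of theta functions with squared base, so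
numerator and right side are proportional, and \<open>x = 1\<close> determines the factor.\<close>

theorem weier_diff:
  assumes q: "norm q < 1" "q \<noteq> 0" and xy: "x \<noteq> 0" "y \<noteq> 0"
    and nz: "theta_prod x q \<noteq> 0" "theta_prod y q \<noteq> 0"
  shows "weier x q - weier y q = - y * euler q ^ 4 * theta_prod (x * y) q * theta_prod (x / y) q
           / (theta_prod x q ^ 2 * theta_prod y q ^ 2)"
proof -
  have q2: "norm (q ^ 2) < 1" "q ^ 2 \<noteq> 0" using q by (auto simp: norm_power power_less_one_iff)
  define K where "K x = theta' x q ^ 2 - theta x q * theta'' x q" for x
  define F where "F x = theta (- (x ^ 2)) (q ^ 2)" for x
  define G where "G x = theta (- (q * x ^ 2)) (q ^ 2)" for x
  define m0 m1 where "m0 = theta (- q) (q ^ 2)" and "m1 = theta (- (q ^ 2)) (q ^ 2)"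
  define \<mu>0 where "\<mu>0 = 4 * theta'' (- q) (q ^ 2)"
  define \<mu>1 where "\<mu>1 = 4 * theta'' (- (q ^ 2)) (q ^ 2) + 4 * theta' (- (q ^ 2)) (q ^ 2) + m1"
  \<comment> \<open>The three quantities are linear in \<open>F x\<close> and \<open>x * G x\<close>; eliminating gives the determinant of these pairs at \<open>x\<close> and \<open>y\<close>.\<close>
  have sq: "theta x q ^ 2 = F x * m0 - x * G x * m1" if "x \<noteq> 0" for x
    using theta_mult_theta[OF q that, of 1]
    by (simp add: F_def G_def m0_def m1_def power2_eq_square)
  have K: "2 * K x = - (F x * \<mu>0 - x * G x * \<mu>1)" if x: "x \<noteq> 0" for x
  proof -
    define f where "f j = theta_coeff q j * x powi j" for j
    have f0: "(f has_sum theta x q) UNIV" and f1: "((\<lambda>j. of_int j * f j) has_sum theta' x q) UNIV"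
      and f2: "((\<lambda>j. of_int j ^ 2 * f j) has_sum theta'' x q) UNIV"
      unfolding f_def by (intro theta_has_sum theta'_has_sum theta''_has_sum q x)+
    \<comment> \<open>As a double series \<open>- 2 K(x)\<close> has the weight \<open>(i - j)\<^sup>2\<close>, so that parity splitting applies to it.\<close>
    have "((\<lambda>p. (case p of (i, j) \<Rightarrow> (of_int i ^ 2 * f i) * f j) + (case p of (i, j) \<Rightarrow> f i * (of_int j ^ 2 * f j))
        + (-2) * (case p of (i, j) \<Rightarrow> (of_int i * f i) * (of_int j * f j)))
        has_sum (theta'' x q * theta x q + theta x q * theta'' x q + (-2) * (theta' x q * theta' x q))) (UNIV \<times> UNIV)"
      by (intro has_sum_add has_sum_cmult_right has_sum_times_complex f0 f1 f2)
    also have "(\<lambda>p. (case p of (i, j) \<Rightarrow> (of_int i ^ 2 * f i) * f j) + (case p of (i, j) \<Rightarrow> f i * (of_int j ^ 2 * f j))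
        + (-2) * (case p of (i, j) \<Rightarrow> (of_int i * f i) * (of_int j * f j)))
        = (\<lambda>(i, j). of_int (i - j) ^ 2 * (f i * f j))"
      by (auto simp: fun_eq_iff power2_eq_square algebra_simps)
    finally have 1: "((\<lambda>(i, j). of_int (i - j) ^ 2 * (f i * f j)) has_sum (- 2 * K x)) UNIV"
      by (simp add: K_def power2_eq_square algebra_simps)
    have g0: "((\<lambda>m. theta_coeff (q ^ 2) m * (- (q ^ 2)) powi m) has_sum m1) UNIV"
      and g1: "((\<lambda>m. of_int m * (theta_coeff (q ^ 2) m * (- (q ^ 2)) powi m)) has_sum theta' (- (q ^ 2)) (q ^ 2)) UNIV"
      and g2: "((\<lambda>m. of_int m ^ 2 * (theta_coeff (q ^ 2) m * (- (q ^ 2)) powi m)) has_sum theta'' (- (q ^ 2)) (q ^ 2)) UNIV"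
      unfolding m1_def by (intro theta_has_sum theta'_has_sum theta''_has_sum q2; use q in simp)+
    have U0: "((\<lambda>m. of_int (2 * m) ^ 2 * (theta_coeff (q ^ 2) m * (- (q * 1 ^ 2)) powi m)) has_sum \<mu>0) UNIV"
      using has_sum_cmult_right[OF theta''_has_sum[OF q2, of "- q"], of 4] q
      by (simp add: \<mu>0_def power_mult_distrib mult_ac)
    have U1: "((\<lambda>m. of_int (2 * m + 1) ^ 2 * (theta_coeff (q ^ 2) m * (- (q ^ 2 * 1 ^ 2)) powi m)) has_sum \<mu>1) UNIV"
      using has_sum_add[OF has_sum_add[OF has_sum_cmult_right[OF g2, of 4] has_sum_cmult_right[OF g1, of 4]] g0]
      by (simp add: \<mu>1_def power2_eq_square algebra_simps)
    have "((\<lambda>(i, j). of_int (i - j) ^ 2 * (f i * f j)) has_sum (F x * \<mu>0 - x * G x * \<mu>1)) UNIV"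
      using theta_pair_has_sum[OF q x, of 1 "\<lambda>k. of_int k ^ 2", OF _ U0 U1] by (simp add: F_def G_def f_def)
    from has_sum_unique[OF 1 this] show ?thesis by (metis minus_mult_left minus_minus mult_minus_left)
  qed
  have D: "theta (x * y) q * theta (x / y) q = F x * G y - x / y * G x * F y" if "x \<noteq> 0" "y \<noteq> 0" for x y
  proof -
    have "theta (- (y ^ 2) * q ^ 2) (q ^ 2) = theta (- (y ^ 2)) (q ^ 2) / y ^ 2"
      using theta_prod_shift[OF q2, of "- (y ^ 2)"] that q
      by (simp add: jacobi_triple_product[OF q2])
    thus ?thesis using theta_mult_theta[OF q that] that
      by (simp add: F_def G_def mult_ac power2_eq_square)
  qed
  define \<kappa> where "\<kappa> = (\<mu>1 * m0 - \<mu>0 * m1) / 2"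
  have main: "K x * theta y q ^ 2 - K y * theta x q ^ 2 = - y * \<kappa> * (theta (x * y) q * theta (x / y) q)"
    if "x \<noteq> 0" "y \<noteq> 0" for x y
  proof -
    have "2 * (K x * theta y q ^ 2 - K y * theta x q ^ 2) = (2 * K x) * theta y q ^ 2 - (2 * K y) * theta x q ^ 2"
      by (simp add: algebra_simps)
    also have "\<dots> = 2 * (- y * \<kappa> * (theta (x * y) q * theta (x / y) q))"
      unfolding K[OF that(1)] K[OF that(2)] sq[OF that(1)] sq[OF that(2)] D[OF that] \<kappa>_def using that
      by (simp add: field_simps)
    finally show ?thesis by (metis mult_left_cancel zero_neq_numeral)
  qed
  \<comment> \<open>The factor \<open>\<kappa>\<close> is found at \<open>x = 1\<close>, where \<open>\<theta>\<close> vanishes and \<open>K\<close> is the square of \<open>\<theta>'\<close>.\<close>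
  have th1: "theta 1 q = 0" using jacobi_triple_product[OF q, of 1] theta_prod_one[OF q(1)] by simp
  have nz': "theta y q \<noteq> 0" "theta x q \<noteq> 0"
    using nz euler_nonzero[OF q(1)] xy by (simp_all add: jacobi_triple_product[OF q])
  have "theta (1 / y) q = - theta y q / y"
    using xy theta_prod_inverse[OF q(1), of y] by (simp add: jacobi_triple_product[OF q])
  hence "theta' 1 q ^ 2 * theta y q ^ 2 = \<kappa> * theta y q ^ 2"
    using main[of 1 y] xy th1 by (simp add: K_def power2_eq_square)
  hence \<kappa>: "\<kappa> = euler q ^ 6"
    using nz' theta'_one[OF q] by (simp flip: power_mult)
  have "theta x q ^ 2 * theta y q ^ 2 * (weier x q - weier y q) = K x * theta y q ^ 2 - K y * theta x q ^ 2"
    unfolding K_def theta_log_derivative[OF q xy(1) nz(1)] theta_log_derivative[OF q xy(2) nz(2)]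
    by (simp add: algebra_simps)
  also note main[OF xy]
  finally have "euler q ^ 4 * (theta_prod x q ^ 2 * theta_prod y q ^ 2 * (weier x q - weier y q))
     = euler q ^ 4 * (- y * euler q ^ 4 * theta_prod (x * y) q * theta_prod (x / y) q)"
    using xy unfolding \<kappa> by (simp add: jacobi_triple_product[OF q] power_mult_distrib eval_nat_numeral mult_ac)
  hence "theta_prod x q ^ 2 * theta_prod y q ^ 2 * (weier x q - weier y q)
     = - y * euler q ^ 4 * theta_prod (x * y) q * theta_prod (x / y) q"
    using euler_nonzero[OF q(1)] by (metis mult_left_cancel power_not_zero)
  thus ?thesis using nz by (simp add: field_simps)
qed

section \<open>Theta products at torsion points\<close>

text \<open>Writing powers out as products lets ring normalisation compare the exponents that come from
clearing denominators of eta quotients.\<close>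

lemma pow_expand:
  fixes x :: "'a :: monoid_mult"
  shows "x ^ 2 = x * x" "x ^ 3 = x * x * x" "x ^ 4 = x * x * x * x" "x ^ 5 = x * x * x * x * x" "x ^ 6 = x * x * x * x * x * x" "x ^ 7 = x * x * x * x * x * x * x" "x ^ 8 = x * x * x * x * x * x * x * x" "x ^ 9 = x * x * x * x * x * x * x * x * x" "x ^ 10 = x * x * x * x * x * x * x * x * x * x" "x ^ 11 = x * x * x * x * x * x * x * x * x * x * x" "x ^ 12 = x * x * x * x * x * x * x * x * x * x * x * x" "x ^ 13 = x * x * x * x * x * x * x * x * x * x * x * x * x" "x ^ 20 = x * x * x * x * x * x * x * x * x * x * x * x * x * x * x * x * x * x * x * x"
  by (simp_all add: eval_nat_numeral mult.assoc)

lemma theta_prod_recip: "x \<noteq> 0 \<Longrightarrow> q \<noteq> 0 \<Longrightarrow> theta_prod (q / x) q = theta_prod x q"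
  by (simp add: theta_prod_def mult.commute)

lemma theta_prod_nonzero:
  assumes "norm q < 1" "\<And>n. x * q ^ n \<noteq> 1" "\<And>n. q ^ Suc n \<noteq> x" "x \<noteq> 0"
  shows "theta_prod x q \<noteq> 0"
  unfolding theta_prod_def using assms(2,3,4)
  by (intro no_zero_divisors qpoch_nonzero assms(1)) (auto simp: field_simps)

text \<open>The points \<open>x\<close> and \<open>- x\<close> are the preimages of \<open>x\<^sup>2\<close> under the isogeny that squares both \<open>x\<close> and \<open>q\<close>.\<close>

lemma theta_prod_mult_minus:
  assumes "norm q < 1"
  shows "theta_prod x q * theta_prod (- x) q = theta_prod (x ^ 2) (q ^ 2)"
proof -
  have 1: "qpoch y q * qpoch (- y) q = qpoch (y ^ 2) (q ^ 2)" for y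
    using qpoch_mult_roots[OF assms, of "{1, -1}" 2 y]
    by (simp add: power2_eq_square algebra_simps)
  have "theta_prod x q * theta_prod (- x) q = (qpoch x q * qpoch (- x) q) * (qpoch (q / x) q * qpoch (- (q / x)) q)"
    by (simp add: theta_prod_def)
  thus ?thesis unfolding 1 by (simp add: theta_prod_def power_divide)
qed

lemma cube_root_of_unity:
  fixes w :: complex
  assumes w: "w ^ 2 + w + 1 = 0"
  shows "w ^ 3 = 1" "w \<noteq> 0" "w \<noteq> 1" "w ^ 2 \<noteq> 1" "w ^ 2 \<noteq> w" "inverse w = w ^ 2" "inverse (w ^ 2) = w"
    "(1 - z) * ((1 - w * z) * (1 - w ^ 2 * z)) = 1 - z ^ 3"
proof -
  have "w ^ 3 - 1 = (w - 1) * (w ^ 2 + w + 1)" by (simp add: algebra_simps power2_eq_square power3_eq_cube)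
  thus w3: "w ^ 3 = 1" using w by simp
  show "w \<noteq> 0" "w \<noteq> 1" "w ^ 2 \<noteq> 1" "w ^ 2 \<noteq> w"
    using w w3 by (auto simp: power2_eq_square power3_eq_cube)
  have "w * w ^ 2 = 1" "w ^ 2 * w = 1" using w3 by (simp_all add: power2_eq_square power3_eq_cube mult_ac)
  thus "inverse w = w ^ 2" "inverse (w ^ 2) = w" by (metis inverse_unique)+
  have "(1 - z) * ((1 - w * z) * (1 - w ^ 2 * z)) =
      1 - z * (w ^ 2 + w + 1) + z ^ 2 * w * (w ^ 2 + w + 1) - w ^ 3 * z ^ 3"
    by (simp add: algebra_simps power2_eq_square power3_eq_cube)
  thus "(1 - z) * ((1 - w * z) * (1 - w ^ 2 * z)) = 1 - z ^ 3" using w w3 by simp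
qed

lemma qpoch_mult_cube_roots:
  assumes "norm q < 1" and w: "w ^ 2 + w + 1 = 0"
  shows "qpoch y q * (qpoch (w * y) q * qpoch (w ^ 2 * y) q) = qpoch (y ^ 3) (q ^ 3)"
proof -
  note c = cube_root_of_unity[OF w]
  have "1 \<notin> {w, w ^ 2}" "w \<notin> {w ^ 2}" using c(3,4,5) by auto
  thus ?thesis using qpoch_mult_roots[OF assms(1), of "{1, w, w ^ 2}" 3 y] c(8) by simp
qed

lemma theta_prod_mult_cube_roots:
  assumes "norm q < 1" and w: "w ^ 2 + w + 1 = 0"
  shows "theta_prod x q * theta_prod (w * x) q * theta_prod (w ^ 2 * x) q = theta_prod (x ^ 3) (q ^ 3)"
proof -
  have 2: "q / (w * x) = w ^ 2 * (q / x)" "q / (w ^ 2 * x) = w * (q / x)"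
    by (simp_all add: divide_inverse mult_ac cube_root_of_unity[OF w] del: power_inverse)
  have "theta_prod x q * theta_prod (w * x) q * theta_prod (w ^ 2 * x) q =
     (qpoch x q * (qpoch (w * x) q * qpoch (w ^ 2 * x) q)) *
     (qpoch (q / x) q * (qpoch (w * (q / x)) q * qpoch (w ^ 2 * (q / x)) q))"
    unfolding theta_prod_def 2 by (simp add: mult_ac)
  thus ?thesis unfolding qpoch_mult_cube_roots[OF assms] by (simp add: theta_prod_def power_divide)
qed

text \<open>The isogeny in the other direction: the base is raised to a power and the product runs over the kernel.\<close>

lemma theta_prod_dissect:
  assumes "norm q < 1" "q \<noteq> 0" "k > 0"
  shows "theta_prod x q = (\<Prod>j<k. theta_prod (x * q ^ j) (q ^ k))"
proof -
  have "qpoch (q / x) q = (\<Prod>j<k. qpoch (q / x * q ^ j) (q ^ k))"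
    by (rule qpoch_dissect[OF assms(1,3)])
  also have "\<dots> = (\<Prod>j<k. qpoch (q ^ k / (x * q ^ j)) (q ^ k))"
    by (rule prod.reindex_bij_witness[of _ "\<lambda>j. k - Suc j" "\<lambda>j. k - Suc j"])
       (use assms in \<open>auto simp: power_diff field_simps\<close>)
  finally show ?thesis
    unfolding theta_prod_def by (subst qpoch_dissect[OF assms(1,3), of x]) (simp add: prod.distrib)
qed

lemma qpoch_odd:
  assumes "norm q < 1"
  shows "qpoch q (q ^ 2) = euler q / euler (q ^ 2)"
proof -
  have "norm (q ^ 2) < 1" using assms by (simp add: norm_power power_less_one_iff)
  thus ?thesis using qpoch_dissect[OF assms, of 2 q] euler_nonzero[of "q ^ 2"]
    by (simp add: euler_def eval_nat_numeral)
qed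

lemma qpoch_minus_self:
  assumes "norm q < 1"
  shows "qpoch (- q) q = euler (q ^ 2) / euler q"
  using qpoch_mult_roots[OF assms, of "{1, -1}" 2 q] euler_nonzero[OF assms]
  by (simp add: euler_def field_simps power2_eq_square algebra_simps)

text \<open>All functions of \<open>q\<close> below are expressed through \<open>E k = \<Prod> (1 - q\<^sup>k\<^sup>n)\<close>; an eta quotient
\<open>\<Prod> \<eta>(kz)\<^sup>r\<close> is the corresponding product of the \<open>E k\<close> times a power of \<open>q\<close>.\<close>

locale nome =
  fixes q :: complex
  assumes norm_q: "norm q < 1" and q_nz: "q \<noteq> 0"
begin

definition E :: "nat \<Rightarrow> complex" where "E k = euler (q ^ k)"

lemma norm_qk: "k > 0 \<Longrightarrow> norm (q ^ k) < 1"
  using norm_q by (simp add: norm_power power_less_one_iff)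

lemma qk_nz: "q ^ k \<noteq> 0" using q_nz by simp

lemma E_nz: "k > 0 \<Longrightarrow> E k \<noteq> 0"
  unfolding E_def by (rule euler_nonzero[OF norm_qk])

lemma E_pow: "euler ((q ^ k) ^ m) = E (k * m)" by (simp add: E_def power_mult)

text \<open>The theta product is now evaluated at points of small order: roots of unity of order 2, 3, 4, fractions of the period, and
(up to a product of two conjugate values) roots of unity of order 8.\<close>

lemma theta_prod_minus_one: "k > 0 \<Longrightarrow> theta_prod (- 1) (q ^ k) = 2 * (E (2 * k) / E k) ^ 2"
proof -
  assume k: "k > 0"
  show ?thesis
    using qpoch_rec[OF norm_qk[OF k], of "-1"] qpoch_minus_self[OF norm_qk[OF k], unfolded E_pow]
    by (simp add: theta_prod_def E_def[of k, symmetric] power2_eq_square mult.commute[of 2])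
qed

lemma theta_prod_cube_root:
  assumes k: "k > 0" and w: "w ^ 2 + w + 1 = 0"
  shows "theta_prod w (q ^ k) = (1 - w) * E (3 * k) / E k"
proof -
  have "qpoch (q ^ k) (q ^ k) * (qpoch (w * q ^ k) (q ^ k) * qpoch (w ^ 2 * q ^ k) (q ^ k)) = E (3 * k)"
    using qpoch_mult_cube_roots[OF norm_qk[OF k] w, of "q ^ k"]
    by (simp add: mult.commute[of 3] E_pow[symmetric] euler_def)
  moreover have "q ^ k / w = w ^ 2 * q ^ k"
    by (simp add: divide_inverse cube_root_of_unity[OF w])
  moreover have "qpoch w (q ^ k) = (1 - w) * qpoch (w * q ^ k) (q ^ k)" by (rule qpoch_rec[OF norm_qk[OF k]])
  ultimately show ?thesis using E_nz[OF k]
    by (simp only: theta_prod_def E_def[of k] euler_def) (simp add: field_simps)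
qed

lemma theta_prod_imaginary:
  assumes k: "k > 0" and i: "i ^ 2 = - 1"
  shows "theta_prod i (q ^ k) = (1 - i) * E (4 * k) / E (2 * k)"
proof -
  have ii: "i * i = - 1" "i \<noteq> 0" using i by (auto simp: power2_eq_square)
  have "qpoch (i * q ^ k) (q ^ k) * qpoch (- (i * q ^ k)) (q ^ k) = qpoch ((i * q ^ k) ^ 2) ((q ^ k) ^ 2)"
    using qpoch_mult_roots[OF norm_qk[OF k], of "{1, -1}" 2 "i * q ^ k"]
    by (simp add: power2_eq_square algebra_simps)
  also have "(i * q ^ k) ^ 2 = - ((q ^ k) ^ 2)" using i by (simp add: power_mult_distrib)
  also have "qpoch (- ((q ^ k) ^ 2)) ((q ^ k) ^ 2) = E (4 * k) / E (2 * k)"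
    using qpoch_minus_self[of "(q ^ k) ^ 2"] norm_qk[of "k * 2"] k
    by (simp add: E_def mult_ac flip: power_mult)
  moreover have "inverse i = - i" using ii by (intro inverse_unique) simp
  hence "q ^ k / i = - (i * q ^ k)" by (simp add: divide_inverse mult_ac)
  moreover have "qpoch i (q ^ k) = (1 - i) * qpoch (i * q ^ k) (q ^ k)" by (rule qpoch_rec[OF norm_qk[OF k]])
  ultimately show ?thesis by (simp add: theta_prod_def mult.assoc)
qed

lemma theta_prod_half: "k > 0 \<Longrightarrow> theta_prod (q ^ k) (q ^ (2 * k)) = (E k / E (2 * k)) ^ 2"
  using qpoch_odd[OF norm_qk[of k]] q_nz
  by (simp add: theta_prod_def E_def power2_eq_square mult_2 power_add)

lemma theta_prod_minus_half:
  assumes k: "k > 0"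
  shows "theta_prod (- (q ^ k)) (q ^ (2 * k)) = (E (2 * k) ^ 2 / (E k * E (4 * k))) ^ 2"
proof -
  have "theta_prod (q ^ k) (q ^ (2 * k)) * theta_prod (- (q ^ k)) (q ^ (2 * k)) = theta_prod (q ^ (2 * k)) (q ^ (4 * k))"
    using theta_prod_mult_minus[OF norm_qk[of "2 * k"], of "q ^ k"] k by (simp add: mult_ac flip: power_mult)
  thus ?thesis using theta_prod_half[OF k] theta_prod_half[of "2 * k"] k E_nz[of k] E_nz[of "2 * k"] E_nz[of "4 * k"]
    by (simp add: field_simps) (simp add: eval_nat_numeral mult_ac)?
qed

lemma theta_prod_third: "k > 0 \<Longrightarrow> theta_prod (q ^ k) (q ^ (3 * k)) = E k / E (3 * k)"
  using qpoch_dissect[OF norm_qk[of k], of 3 "q ^ k"] E_nz[of "3 * k"] q_nz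
  by (simp add: theta_prod_def E_def euler_def eval_nat_numeral power_mult[symmetric] field_simps mult_ac power_add)

lemma theta_prod_quarter: "k > 0 \<Longrightarrow> theta_prod (q ^ k) (q ^ (4 * k)) = E k / E (2 * k)"
  using qpoch_dissect[OF norm_qk[of "2 * k"], of 2 "q ^ k"] qpoch_odd[OF norm_qk[of k]] q_nz
  by (simp add: theta_prod_def E_def eval_nat_numeral power_add field_simps mult_ac flip: power_mult)

lemma theta_prod_sixth:
  assumes k: "k > 0"
  shows "theta_prod (q ^ k) (q ^ (6 * k)) = E k * E (6 * k) / (E (2 * k) * E (3 * k))"
proof -
  define Q where "Q = q ^ k"
  have Q: "norm Q < 1" "norm (Q ^ 2) < 1" "norm (Q ^ 3) < 1" "Q \<noteq> 0"
    using norm_qk[OF k] q_nz by (auto simp: Q_def norm_power power_less_one_iff)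
  have "qpoch Q (Q ^ 2) = qpoch Q (Q ^ 6) * (qpoch (Q ^ 3) (Q ^ 6) * qpoch (Q ^ 5) (Q ^ 6))"
    using qpoch_dissect[OF Q(2), of 3 Q] by (simp add: eval_nat_numeral mult_ac)
  moreover have "theta_prod Q (Q ^ 6) = qpoch Q (Q ^ 6) * qpoch (Q ^ 5) (Q ^ 6)"
    using Q(4) by (simp add: theta_prod_def eval_nat_numeral)
  moreover have "qpoch Q (Q ^ 2) = E k / E (2 * k)"
    using qpoch_odd[OF Q(1)] by (simp add: Q_def E_def mult.commute flip: power_mult)
  moreover have "qpoch (Q ^ 3) (Q ^ 6) = E (3 * k) / E (6 * k)"
    using qpoch_odd[OF Q(3)] by (simp add: Q_def E_def mult.commute flip: power_mult)
  moreover have "q ^ (6 * k) = Q ^ 6" by (simp add: Q_def mult.commute flip: power_mult)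
  ultimately have "E k / E (2 * k) = theta_prod (q ^ k) (q ^ (6 * k)) * (E (3 * k) / E (6 * k))"
    by (simp add: Q_def[symmetric] mult_ac)
  thus ?thesis using E_nz[of "6 * k"] E_nz[of "3 * k"] E_nz[of "2 * k"] k by (simp add: divide_eq_eq eq_divide_eq mult_ac)
qed

text \<open>The point \<open>q\<^sup>a\<close> on the curve with base \<open>q\<^sup>N\<close>, that is, the \<open>N\<close>-torsion point \<open>a / N\<close> of the period.\<close>

definition T :: "nat \<Rightarrow> nat \<Rightarrow> complex" where "T N a = theta_prod (q ^ a) (q ^ N)"

lemma T_nz: "0 < a \<Longrightarrow> a < N \<Longrightarrow> T N a \<noteq> 0"
  unfolding T_def
proof (rule theta_prod_nonzero)
  assume a: "0 < a" "a < N"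
  show "norm (q ^ N) < 1" using a by (intro norm_qk) auto
  show "q ^ a * (q ^ N) ^ n \<noteq> 1" for n
    using power_neq_1_of_norm_less[OF norm_q, of "a + N * n"] a by (simp add: power_add power_mult)
  show "(q ^ N) ^ Suc n \<noteq> q ^ a" for n
  proof
    assume "(q ^ N) ^ Suc n = q ^ a"
    moreover have "N * Suc n - a + a = N * Suc n" using a by (simp add: trans_le_add1)
    ultimately have "q ^ (N * Suc n - a + a) = 1 * q ^ a" by (simp only: power_mult mult_1)
    hence "q ^ (N * Suc n - a) = 1" using q_nz by (simp only: power_add mult_right_cancel[OF qk_nz])
    thus False using power_neq_1_of_norm_less[OF norm_q, of "N * Suc n - a"] a by simp
  qed
qed (use q_nz in auto)

lemma T_reflect: "a < N \<Longrightarrow> T N (N - a) = T N a"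
  using theta_prod_recip[of "q ^ a" "q ^ N"] q_nz by (simp add: T_def power_diff)

lemma T_shift: "N > 0 \<Longrightarrow> T N (a + N) = - T N a / q ^ a"
  using theta_prod_shift[OF norm_qk qk_nz qk_nz, of N a] by (simp add: T_def power_add)

lemma weier_diff_powers:
  assumes "0 < i" "i < j" "j < N"
  shows "weier (q ^ i) (q ^ N) - weier (q ^ j) (q ^ N)
     = q ^ i * E N ^ 4 * T N (i + j) * T N (j - i) / (T N i ^ 2 * T N j ^ 2)"
proof -
  have N: "N > 0" using assms by simp
  have "theta_prod (q ^ i / q ^ j) (q ^ N) = - T N (j - i) / q ^ (j - i)"
    using theta_prod_inverse[OF norm_qk[OF N], of "q ^ (j - i)"] q_nz assms by (simp add: T_def power_diff)
  hence 1: "q ^ j * theta_prod (q ^ i / q ^ j) (q ^ N) = - (q ^ i * T N (j - i))"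
    using assms q_nz by (simp add: power_diff)
  have "weier (q ^ i) (q ^ N) - weier (q ^ j) (q ^ N) = - (q ^ j * theta_prod (q ^ i / q ^ j) (q ^ N)) *
     (E N ^ 4 * theta_prod (q ^ i * q ^ j) (q ^ N)) / (theta_prod (q ^ i) (q ^ N) ^ 2 * theta_prod (q ^ j) (q ^ N) ^ 2)"
    using weier_diff[OF norm_qk[OF N] qk_nz qk_nz qk_nz, of i j] assms T_nz[of i N] T_nz[of j N]
    by (simp add: E_def T_def mult_ac)
  thus ?thesis unfolding 1 by (simp add: T_def power_add mult_ac)
qed

lemma E_nz_simps [simp]:
  "E (Suc 0) \<noteq> 0" "E (numeral n) \<noteq> 0"
  by (auto intro!: E_nz)

text \<open>Points of order twelve. Only the product of the two values at primitive points \<open>1\<close> and \<open>5\<close> is an eta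
quotient, and only this product occurs.\<close>

lemma T12:
  "T 12 6 = (E 6 / E 12) ^ 2" "T 12 4 = E 4 / E 12" "T 12 3 = E 3 / E 6" "T 12 2 = E 2 * E 12 / (E 4 * E 6)"
  "T 12 5 * T 12 (Suc 0) = E (Suc 0) * E 6 / (E 2 * E 3)"
  "T 12 7 = T 12 5" "T 12 8 = T 12 4" "T 12 9 = T 12 3" "T 12 10 = T 12 2"
proof -
  show "T 12 6 = (E 6 / E 12) ^ 2" using theta_prod_half[of 6] by (simp add: T_def)
  show "T 12 4 = E 4 / E 12" using theta_prod_third[of 4] by (simp add: T_def)
  show 3: "T 12 3 = E 3 / E 6" using theta_prod_quarter[of 3] by (simp add: T_def)
  show "T 12 2 = E 2 * E 12 / (E 4 * E 6)" using theta_prod_sixth[of 2] by (simp add: T_def)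
  show "T 12 7 = T 12 5" "T 12 8 = T 12 4" "T 12 9 = T 12 3" "T 12 10 = T 12 2"
    using T_reflect[of 5 12] T_reflect[of 4 12] T_reflect[of 3 12] T_reflect[of 2 12] by auto
  have "norm (q ^ 2) < 1" using norm_qk[of 2] by simp
  hence "qpoch q (q ^ 2) = qpoch q (q ^ 12) * qpoch (q ^ 3) (q ^ 12) * qpoch (q ^ 5) (q ^ 12)
      * qpoch (q ^ 7) (q ^ 12) * qpoch (q ^ 9) (q ^ 12) * qpoch (q ^ 11) (q ^ 12)"
    by (subst qpoch_dissect[of "q ^ 2" 6]) (simp_all add: eval_nat_numeral mult_ac)
  also have "\<dots> = (T 12 5 * T 12 (Suc 0)) * T 12 3"
    using q_nz by (simp add: T_def theta_prod_def eval_nat_numeral mult_ac)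
  finally show "T 12 5 * T 12 (Suc 0) = E (Suc 0) * E 6 / (E 2 * E 3)"
    unfolding 3 qpoch_odd[OF norm_q] using E_nz[of 2]
    by (simp add: E_def[of "Suc 0"] E_def[of 2] divide_eq_eq eq_divide_eq mult_ac)
qed

text \<open>Points of order eight, where again only a product of primitive values is an eta quotient.\<close>

lemma T8:
  "T 8 4 = (E 4 / E 8) ^ 2" "T 8 2 = E 2 / E 4" "T 8 3 * T 8 (Suc 0) = E (Suc 0) / E 2" "T 8 6 = T 8 2" "T 8 5 = T 8 3"
proof -
  show "T 8 4 = (E 4 / E 8) ^ 2" using theta_prod_half[of 4] by (simp add: T_def)
  show "T 8 2 = E 2 / E 4" using theta_prod_quarter[of 2] by (simp add: T_def)
  show "T 8 6 = T 8 2" "T 8 5 = T 8 3" using T_reflect[of 2 8] T_reflect[of 3 8] by auto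
  have "norm (q ^ 2) < 1" using norm_qk[of 2] by simp
  hence "qpoch q (q ^ 2) = qpoch q (q ^ 8) * qpoch (q ^ 3) (q ^ 8) * qpoch (q ^ 5) (q ^ 8) * qpoch (q ^ 7) (q ^ 8)"
    by (subst qpoch_dissect[of "q ^ 2" 4]) (simp_all add: eval_nat_numeral mult_ac)
  also have "\<dots> = T 8 3 * T 8 (Suc 0)"
    using q_nz by (simp add: T_def theta_prod_def eval_nat_numeral mult_ac)
  finally show "T 8 3 * T 8 (Suc 0) = E (Suc 0) / E 2"
    unfolding qpoch_odd[OF norm_q] by (simp add: E_def)
qed

text \<open>The generating function of \<open>\<sigma>\<close> twisted by the character modulo 8 on the complementary divisor:
the character takes equal values at \<open>r\<close> and \<open>8 - r\<close>, so its residue classes pair up to Weierstrass values.\<close>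

lemma weier_chi8_q: "weier q (q ^ 8) - weier (q ^ 3) (q ^ 8) = q * E 2 ^ 3 * E 4 * E 8 ^ 2 / E (Suc 0) ^ 2"
proof -
  have "weier q (q ^ 8) - weier (q ^ 3) (q ^ 8) = q * E 8 ^ 4 * T 8 4 * T 8 2 / (T 8 3 * T 8 (Suc 0)) ^ 2"
    using weier_diff_powers[of "Suc 0" 3 8] by (simp add: power_mult_distrib mult_ac)
  thus ?thesis unfolding T8 by (simp add: field_simps pow_expand)
qed

lemma weier_diff_eval:
  assumes "norm r < 1" "r \<noteq> 0" "x \<noteq> 0" "y \<noteq> 0"
    and "theta_prod x r = X" "theta_prod y r = Y" "X \<noteq> 0" "Y \<noteq> 0"
    and "theta_prod (x * y) r = Z" "theta_prod (x / y) r = V"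
  shows "weier x r - weier y r = - y * euler r ^ 4 * Z * V / (X ^ 2 * Y ^ 2)"
  using weier_diff[of r x y] assms by simp

text \<open>With \<open>s_jacobi\<close> this gives Jacobi's theorem on four squares, the eta quotient being
\<open>\<phi>(q)\<^sup>4 / 4\<close>.\<close>

lemma weier_jacobi: "weier q (q ^ 2) - weier (- 1) (q ^ 2) = E 2 ^ 20 / (4 * E (Suc 0) ^ 8 * E 4 ^ 8)"
proof -
  have a: "theta_prod q (q ^ 2) = (E (Suc 0) / E 2) ^ 2" "theta_prod (- q) (q ^ 2) = (E 2 ^ 2 / (E (Suc 0) * E 4)) ^ 2"
     "theta_prod (- 1) (q ^ 2) = 2 * (E 4 / E 2) ^ 2"
    using theta_prod_half[of "Suc 0"] theta_prod_minus_half[of "Suc 0"] theta_prod_minus_one[of 2] by auto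
  have "weier q (q ^ 2) - weier (- 1) (q ^ 2) = - (- 1) * euler (q ^ 2) ^ 4 * (E 2 ^ 2 / (E (Suc 0) * E 4)) ^ 2
     * (E 2 ^ 2 / (E (Suc 0) * E 4)) ^ 2 / (((E (Suc 0) / E 2) ^ 2) ^ 2 * (2 * (E 4 / E 2) ^ 2) ^ 2)"
    by (rule weier_diff_eval) (use norm_qk[of 2] q_nz a in auto)
  thus ?thesis unfolding E_def[of 2, symmetric] by (simp add: field_simps pow_expand)
qed

lemma weier_odd: "weier q (q ^ 2) - weier (- q) (q ^ 2) = 4 * q * E 4 ^ 8 / E 2 ^ 4"
proof -
  have a: "theta_prod q (q ^ 2) = (E (Suc 0) / E 2) ^ 2" "theta_prod (- q) (q ^ 2) = (E 2 ^ 2 / (E (Suc 0) * E 4)) ^ 2"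
     "theta_prod (- 1) (q ^ 2) = 2 * (E 4 / E 2) ^ 2"
    using theta_prod_half[of "Suc 0"] theta_prod_minus_half[of "Suc 0"] theta_prod_minus_one[of 2] by auto
  have b: "theta_prod (- (q * q)) (q ^ 2) = theta_prod (- 1) (q ^ 2)"
    using theta_prod_shift[of "q ^ 2" "- 1"] norm_qk[of 2] q_nz by (simp add: power2_eq_square)
  have "weier q (q ^ 2) - weier (- q) (q ^ 2) = - (- q) * euler (q ^ 2) ^ 4 * (2 * (E 4 / E 2) ^ 2)
     * (2 * (E 4 / E 2) ^ 2) / (((E (Suc 0) / E 2) ^ 2) ^ 2 * ((E 2 ^ 2 / (E (Suc 0) * E 4)) ^ 2) ^ 2)"
    by (rule weier_diff_eval) (use norm_qk[of 2] q_nz a b in auto)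
  thus ?thesis unfolding E_def[of 2, symmetric] by (simp add: field_simps pow_expand)
qed

lemma theta_prod_eighth_roots:
  assumes k: "k > 0" and z: "z ^ 4 = - 1"
  shows "theta_prod z (q ^ k) * theta_prod (z ^ 3) (q ^ k) = (1 - z ^ 2) / z * (E (8 * k) / E (4 * k))"
proof -
  have z0: "z \<noteq> 0" using z by auto
  have i: "(z ^ 2) ^ 2 = - 1" using z by (simp flip: power_mult)
  have "1 / z ^ 3 = - z" using z z0 by (simp add: field_simps pow_expand)
  hence "theta_prod (- z) (q ^ k) = - theta_prod (z ^ 3) (q ^ k) / z ^ 3"
    using theta_prod_inverse[OF norm_qk[OF k], of "z ^ 3"] z0 by simp
  also have "\<dots> = z * theta_prod (z ^ 3) (q ^ k)"
  proof -
    have "- 1 / z ^ 3 = z" using z z0 by (simp add: field_simps pow_expand)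
    thus ?thesis by (metis divide_minus_left mult_minus1 times_divide_eq_left)
  qed
  finally have "z * (theta_prod z (q ^ k) * theta_prod (z ^ 3) (q ^ k)) = theta_prod (z ^ 2) (q ^ (2 * k))"
    using theta_prod_mult_minus[OF norm_qk[OF k], of z] by (simp add: mult_ac flip: power_mult)
  also have "\<dots> = (1 - z ^ 2) * E (8 * k) / E (4 * k)"
    using theta_prod_imaginary[of "2 * k", OF _ i] k by simp
  finally show ?thesis using z0 E_nz[of "4 * k"] k by (simp add: eq_divide_eq mult_ac)
qed

lemma theta_prod_eighth_root_nz:
  assumes k: "k > 0" and z: "z ^ 4 = - 1"
  shows "theta_prod z (q ^ k) \<noteq> 0" "theta_prod (z ^ 3) (q ^ k) \<noteq> 0"
proof -
  have "z \<noteq> 0" "1 - z ^ 2 \<noteq> 0" using z by (auto simp: eval_nat_numeral)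
  hence "theta_prod z (q ^ k) * theta_prod (z ^ 3) (q ^ k) \<noteq> 0"
    unfolding theta_prod_eighth_roots[OF assms] using E_nz[of "8 * k"] E_nz[of "4 * k"] k by simp
  thus "theta_prod z (q ^ k) \<noteq> 0" "theta_prod (z ^ 3) (q ^ k) \<noteq> 0" by auto
qed

lemma weier_chi8_root:
  assumes z: "z ^ 4 = - 1"
  shows "weier z q - weier (z ^ 3) q = - (z + 1 / z) * (E (Suc 0) ^ 2 * E 2 * E 4 ^ 3 / E 8 ^ 2)"
proof -
  have z0: "z \<noteq> 0" using z by auto
  have i: "(z ^ 2) ^ 2 = - 1" "(- (z ^ 2)) ^ 2 = - 1" using z by (simp_all flip: power_mult)
  have zz: "z * z ^ 3 = - 1" "z / z ^ 3 = - (z ^ 2)" using z z0 by (simp_all add: field_simps pow_expand)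
  note k = theta_prod_eighth_roots[of "Suc 0", OF _ z] theta_prod_eighth_root_nz[of "Suc 0", OF _ z]
  have "weier z q - weier (z ^ 3) q = - (z ^ 3) * euler q ^ 4 * (2 * (E 2 / E (Suc 0)) ^ 2) * ((1 + z ^ 2) * E 4 / E 2)
      / (theta_prod z q ^ 2 * theta_prod (z ^ 3) q ^ 2)"
  proof (rule weier_diff_eval)
    show "theta_prod (z * z ^ 3) q = 2 * (E 2 / E (Suc 0)) ^ 2"
      unfolding zz using theta_prod_minus_one[of "Suc 0"] by (simp add: eval_nat_numeral)
    show "theta_prod (z / z ^ 3) q = (1 + z ^ 2) * E 4 / E 2"
      unfolding zz using theta_prod_imaginary[of "Suc 0", OF _ i(2)] by simp
  qed (use norm_q q_nz z0 k in auto)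
  also have "theta_prod z q ^ 2 * theta_prod (z ^ 3) q ^ 2 = ((1 - z ^ 2) ^ 2 / z ^ 2) * (E 8 / E 4) ^ 2"
    using k(1) by (simp add: power_divide power_mult_distrib flip: power_mult_distrib)
  also have "(1 - z ^ 2) ^ 2 / z ^ 2 = - 2"
  proof -
    have "(1 - z ^ 2) ^ 2 = 1 + z ^ 4 - 2 * z ^ 2" by (simp add: power2_eq_square eval_nat_numeral algebra_simps)
    thus ?thesis using z z0 by (simp add: field_simps)
  qed
  also have "- (z ^ 3) * euler q ^ 4 * (2 * (E 2 / E (Suc 0)) ^ 2) * ((1 + z ^ 2) * E 4 / E 2) / (- 2 * (E 8 / E 4) ^ 2)
     = (z ^ 3 + z ^ 5) * (E (Suc 0) ^ 2 * E 2 * E 4 ^ 3 / E 8 ^ 2)"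
    by (simp add: E_def[of "Suc 0"] field_simps pow_expand)
  also have "z ^ 3 + z ^ 5 = - (z + 1 / z)" using z z0 by (simp add: field_simps pow_expand)
  finally show ?thesis .
qed

text \<open>The difference of the values at a point of order two and one of order three, the source of a relation that involves
\<open>\<sigma>(n/3)\<close>.\<close>

lemma weier_hexagonal:
  assumes w: "w ^ 2 + w + 1 = 0"
  shows "weier (- 1) q - weier w q = E (Suc 0) ^ 12 * E 6 ^ 2 / (12 * E 2 ^ 6 * E 3 ^ 4)"
proof -
  note c = cube_root_of_unity[OF w]
  have k: "theta_prod (- 1) q = 2 * (E 2 / E (Suc 0)) ^ 2" "theta_prod w q = (1 - w) * E 3 / E (Suc 0)"
    using theta_prod_minus_one[of "Suc 0"] theta_prod_cube_root[OF _ w, of "Suc 0"] by (auto simp: eval_nat_numeral)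
  have w1: "1 - w \<noteq> 0" using c(3) by simp
  have "theta_prod w q * theta_prod (- w) q = theta_prod (w ^ 2) (q ^ 2)"
    by (rule theta_prod_mult_minus[OF norm_q])
  also have "\<dots> = (1 - w ^ 2) * E 6 / E 2"
    using w c(1) by (subst theta_prod_cube_root) (auto simp: power2_eq_square power3_eq_cube algebra_simps)
  also have "1 - w ^ 2 = (1 - w) * (1 + w)" by (simp add: power2_eq_square algebra_simps)
  finally have "(1 - w) * (E 3 / E (Suc 0) * theta_prod (- w) q) = (1 - w) * ((1 + w) * E 6 / E 2)"
    unfolding k by (simp add: mult_ac)
  hence "E 3 / E (Suc 0) * theta_prod (- w) q = (1 + w) * E 6 / E 2"
    using w1 by (metis mult_left_cancel)
  hence m: "theta_prod (- w) q = (1 + w) * E 6 * E (Suc 0) / (E 2 * E 3)"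
    by (simp add: divide_eq_eq eq_divide_eq mult_ac)
  have "- 1 / w = 1 / (- w)" by simp
  hence m': "theta_prod (- 1 / w) q = theta_prod (- w) q / w"
    using theta_prod_inverse[OF norm_q, of "- w"] c(2) by simp
  have "weier (- 1) q - weier w q = - w * euler q ^ 4 * ((1 + w) * E 6 * E (Suc 0) / (E 2 * E 3)) *
      ((1 + w) * E 6 * E (Suc 0) / (E 2 * E 3) / w) / ((2 * (E 2 / E (Suc 0)) ^ 2) ^ 2 * ((1 - w) * E 3 / E (Suc 0)) ^ 2)"
    by (rule weier_diff_eval) (use norm_q q_nz k m m' c(2) w1 in auto)
  also have "\<dots> = - ((1 + w) ^ 2 / (1 - w) ^ 2) * (E (Suc 0) ^ 4 * (E 6 * E (Suc 0) / (E 2 * E 3)) ^ 2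
     / (2 * (E 2 / E (Suc 0)) ^ 2 * E 3 / E (Suc 0)) ^ 2)"
    using c(2) w1 by (simp add: E_def[of "Suc 0"] power_mult_distrib power_divide) (simp add: power2_eq_square mult_ac)
  also have "(1 + w) ^ 2 / (1 - w) ^ 2 = - (1 / 3)"
  proof -
    have "3 * (1 + w) ^ 2 + (1 - w) ^ 2 = 4 * (w ^ 2 + w + 1)" by (simp add: power2_eq_square algebra_simps)
    hence "3 * (1 + w) ^ 2 = - ((1 - w) ^ 2)" using w by (simp add: eq_neg_iff_add_eq_0)
    thus ?thesis using w1 by (simp add: field_simps)
  qed
  finally show ?thesis by (simp add: field_simps pow_expand)
qed

end

section \<open>Three-term relations at the twelve-torsion points\<close>

text \<open>If \<open>\<wp>(P) - \<wp>(Q)\<close>, \<open>\<wp>(Q) - \<wp>(R)\<close> and \<open>\<wp>(P) - \<wp>(R)\<close> are known as quotients whose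
denominators are \<open>ab\<close>, \<open>bc\<close> and \<open>ac\<close>, then the evident additivity gives a three-term relation between
the numerators.\<close>

lemma telescoping:
  fixes a b c p x y z :: complex
  assumes "a \<noteq> 0" "b \<noteq> 0" "c \<noteq> 0" "p \<noteq> 0"
    and "p * x / (a * b) + p * y / (b * c) = p * z / (a * c)"
  shows "x * c + y * a = z * b"
proof -
  have "p * (x * c + y * a) = (p * x / (a * b) + p * y / (b * c)) * (a * b * c)"
    using assms(1-4) by (simp add: field_simps)
  also have "\<dots> = p * (z * b)" unfolding assms(5) using assms(1-4) by simp
  finally show ?thesis using assms(4) by simp
qed

lemma twelfth_root_of_unity: obtains z :: complex where "z ^ 4 = z ^ 2 - 1"
proof
  define z where "z = Complex (sqrt 3 / 2) (1 / 2)"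
  have z2: "z ^ 2 = Complex (1 / 2) (sqrt 3 / 2)" by (simp add: z_def complex_eq_iff power2_eq_square)
  have "(z ^ 2) ^ 2 = Complex (- 1 / 2) (sqrt 3 / 2)" unfolding z2 by (simp add: complex_eq_iff power2_eq_square)
  hence "z ^ 4 = Complex (- 1 / 2) (sqrt 3 / 2)" by (simp flip: power_mult)
  thus "z ^ 4 = z ^ 2 - 1" unfolding z2 by (simp add: complex_eq_iff)
qed

context nome
begin

text \<open>Additivity at the points \<open>q\<^sup>2\<close>, \<open>q\<^sup>3\<close>, \<open>q\<^sup>4\<close> of the curve with base \<open>q\<^sup>1\<^sup>2\<close>. The eta quotient on the
left is called \<open>\<tau>\<close> below.\<close>

lemma eta_three_term_a:
  "1 + q * E 2 ^ 2 * E 12 ^ 4 / (E 4 ^ 4 * E 6 ^ 2) = E 2 ^ 2 * E 3 ^ 3 * E 12 / (E (Suc 0) * E 4 ^ 3 * E 6 ^ 2)"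
proof -
  have nz: "T 12 2 \<noteq> 0" "T 12 3 \<noteq> 0" "T 12 4 \<noteq> 0" using T_nz[of 2 12] T_nz[of 3 12] T_nz[of 4 12] T_nz[of 6 12] by auto
  define A where "A = T 12 5 * T 12 (Suc 0)"
  have d: "weier (q ^ 2) (q ^ 12) - weier (q ^ 3) (q ^ 12) = q ^ 2 * E 12 ^ 4 * A / (T 12 2 ^ 2 * T 12 3 ^ 2)"
    "weier (q ^ 3) (q ^ 12) - weier (q ^ 4) (q ^ 12) = q ^ 3 * E 12 ^ 4 * A / (T 12 3 ^ 2 * T 12 4 ^ 2)"
    "weier (q ^ 2) (q ^ 12) - weier (q ^ 4) (q ^ 12) = q ^ 2 * E 12 ^ 4 * T 12 6 * T 12 2 / (T 12 2 ^ 2 * T 12 4 ^ 2)"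
    using weier_diff_powers[of 2 3 12] weier_diff_powers[of 3 4 12] weier_diff_powers[of 2 4 12]
    by (simp_all add: T12(6) A_def mult_ac)
  have "A * T 12 4 ^ 2 + q * A * T 12 2 ^ 2 = (T 12 6 * T 12 2) * T 12 3 ^ 2"
  proof (rule telescoping[of _ _ _ "q ^ 2 * E 12 ^ 4"])
    have "q ^ 2 * E 12 ^ 4 * A / (T 12 2 ^ 2 * T 12 3 ^ 2) + q ^ 3 * E 12 ^ 4 * A / (T 12 3 ^ 2 * T 12 4 ^ 2)
       = q ^ 2 * E 12 ^ 4 * T 12 6 * T 12 2 / (T 12 2 ^ 2 * T 12 4 ^ 2)"
      unfolding d[symmetric] by simp
    thus "q ^ 2 * E 12 ^ 4 * A / (T 12 2 ^ 2 * T 12 3 ^ 2) + q ^ 2 * E 12 ^ 4 * (q * A) / (T 12 3 ^ 2 * T 12 4 ^ 2)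
       = q ^ 2 * E 12 ^ 4 * (T 12 6 * T 12 2) / (T 12 2 ^ 2 * T 12 4 ^ 2)"
      by (simp add: pow_expand mult_ac)
  qed (use nz q_nz in auto)
  moreover have "A \<noteq> 0" by (simp add: A_def T12)
  ultimately have "1 + q * T 12 2 ^ 2 / T 12 4 ^ 2 = T 12 6 * T 12 2 * T 12 3 ^ 2 / (A * T 12 4 ^ 2)"
    using nz add_divide_distrib[of "A * T 12 4 ^ 2" "q * A * T 12 2 ^ 2" "A * T 12 4 ^ 2"] by (simp add: mult_ac)
  also have "q * T 12 2 ^ 2 / T 12 4 ^ 2 = q * E 2 ^ 2 * E 12 ^ 4 / (E 4 ^ 4 * E 6 ^ 2)"
    unfolding T12 by (simp add: field_simps pow_expand)
  also have "T 12 6 * T 12 2 * T 12 3 ^ 2 / (A * T 12 4 ^ 2) = E 2 ^ 2 * E 3 ^ 3 * E 12 / (E (Suc 0) * E 4 ^ 3 * E 6 ^ 2)"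
    unfolding T12 A_def by (simp add: field_simps pow_expand)
  finally show ?thesis .
qed

text \<open>The same at \<open>q\<^sup>2\<close>, \<open>q\<^sup>3\<close>, \<open>q\<^sup>6\<close>.\<close>

lemma eta_three_term_b:
  "1 - q * E 2 ^ 2 * E 12 ^ 4 / (E 4 ^ 4 * E 6 ^ 2) = E (Suc 0) * E 6 ^ 7 / (E 2 * E 3 ^ 3 * E 4 ^ 2 * E 12 ^ 2)"
proof -
  have nz: "T 12 2 \<noteq> 0" "T 12 3 \<noteq> 0" "T 12 6 \<noteq> 0" "T 12 4 \<noteq> 0" using T_nz[of 2 12] T_nz[of 3 12] T_nz[of 4 12] T_nz[of 6 12] by auto
  define A where "A = T 12 5 * T 12 (Suc 0)"
  have d: "weier (q ^ 2) (q ^ 12) - weier (q ^ 3) (q ^ 12) = q ^ 2 * E 12 ^ 4 * A / (T 12 2 ^ 2 * T 12 3 ^ 2)"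
    "weier (q ^ 3) (q ^ 12) - weier (q ^ 6) (q ^ 12) = q ^ 3 * E 12 ^ 4 * T 12 3 ^ 2 / (T 12 3 ^ 2 * T 12 6 ^ 2)"
    "weier (q ^ 2) (q ^ 12) - weier (q ^ 6) (q ^ 12) = q ^ 2 * E 12 ^ 4 * T 12 4 ^ 2 / (T 12 2 ^ 2 * T 12 6 ^ 2)"
    using weier_diff_powers[of 2 3 12] weier_diff_powers[of 3 6 12] weier_diff_powers[of 2 6 12]
    by (simp_all add: T12(6-9) A_def mult_ac power2_eq_square[of "T 12 3"] power2_eq_square[of "T 12 4"])
  have "A * T 12 6 ^ 2 + (q * T 12 3 ^ 2) * T 12 2 ^ 2 = T 12 4 ^ 2 * T 12 3 ^ 2"
  proof (rule telescoping[of _ _ _ "q ^ 2 * E 12 ^ 4"])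
    have "q ^ 2 * E 12 ^ 4 * A / (T 12 2 ^ 2 * T 12 3 ^ 2) + q ^ 3 * E 12 ^ 4 * T 12 3 ^ 2 / (T 12 3 ^ 2 * T 12 6 ^ 2)
       = q ^ 2 * E 12 ^ 4 * T 12 4 ^ 2 / (T 12 2 ^ 2 * T 12 6 ^ 2)"
      unfolding d[symmetric] by simp
    thus "q ^ 2 * E 12 ^ 4 * A / (T 12 2 ^ 2 * T 12 3 ^ 2) + q ^ 2 * E 12 ^ 4 * (q * T 12 3 ^ 2) / (T 12 3 ^ 2 * T 12 6 ^ 2)
       = q ^ 2 * E 12 ^ 4 * T 12 4 ^ 2 / (T 12 2 ^ 2 * T 12 6 ^ 2)"
      by (simp add: power2_eq_square[of q] power3_eq_cube[of q] mult_ac)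
  qed (use nz q_nz in auto)
  hence "A * T 12 6 ^ 2 / (T 12 3 ^ 2 * T 12 4 ^ 2) =
      (T 12 3 ^ 2 * T 12 4 ^ 2 - q * T 12 3 ^ 2 * T 12 2 ^ 2) / (T 12 3 ^ 2 * T 12 4 ^ 2)"
    by (simp add: eq_diff_eq mult_ac)
  hence "1 - q * T 12 2 ^ 2 / T 12 4 ^ 2 = A * T 12 6 ^ 2 / (T 12 3 ^ 2 * T 12 4 ^ 2)"
    using nz by (simp add: diff_divide_distrib mult_ac)
  also have "q * T 12 2 ^ 2 / T 12 4 ^ 2 = q * E 2 ^ 2 * E 12 ^ 4 / (E 4 ^ 4 * E 6 ^ 2)"
    unfolding T12 by (simp add: field_simps pow_expand)
  also have "A * T 12 6 ^ 2 / (T 12 3 ^ 2 * T 12 4 ^ 2) = E (Suc 0) * E 6 ^ 7 / (E 2 * E 3 ^ 3 * E 4 ^ 2 * E 12 ^ 2)"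
    unfolding T12 A_def by (simp add: field_simps pow_expand)
  finally show ?thesis .
qed

lemma theta_prod_minus_cube_root:
  assumes w: "w ^ 2 + w + 1 = 0"
  shows "theta_prod (- w) q = (1 + w) * E 6 * E (Suc 0) / (E 2 * E 3)"
proof -
  note c = cube_root_of_unity[OF w]
  have k: "theta_prod w q = (1 - w) * E 3 / E (Suc 0)"
    using theta_prod_cube_root[OF _ w, of "Suc 0"] by (auto simp: eval_nat_numeral)
  have w1: "1 - w \<noteq> 0" using c(3) by simp
  have "theta_prod w q * theta_prod (- w) q = theta_prod (w ^ 2) (q ^ 2)"
    by (rule theta_prod_mult_minus[OF norm_q])
  also have "\<dots> = (1 - w ^ 2) * E 6 / E 2"
    using w c(1) by (subst theta_prod_cube_root) (auto simp: power2_eq_square power3_eq_cube algebra_simps)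
  also have "1 - w ^ 2 = (1 - w) * (1 + w)" by (simp add: power2_eq_square algebra_simps)
  finally have "(1 - w) * (E 3 / E (Suc 0) * theta_prod (- w) q) = (1 - w) * ((1 + w) * E 6 / E 2)"
    unfolding k by (simp add: mult_ac)
  hence "E 3 / E (Suc 0) * theta_prod (- w) q = (1 + w) * E 6 / E 2"
    using w1 by (metis mult_left_cancel)
  thus ?thesis by (simp add: divide_eq_eq eq_divide_eq mult_ac)
qed

lemma theta_prod_twelfth_roots:
  assumes w: "w ^ 2 + w + 1 = 0" and i: "i ^ 2 = - 1"
  shows "theta_prod (- i * w) q * theta_prod (- i * w ^ 2) q = - i * (E 12 * E 2 / (E 6 * E 4))"
proof -
  have i': "(- i) ^ 2 = - 1" "(- i) ^ 3 = i" using i by (simp_all add: power2_eq_square power3_eq_cube)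
  have i1: "1 + i \<noteq> 0" using i by (metis add_eq_0_iff one_neq_neg_one power2_minus power_one)
  have "theta_prod (- i) q * theta_prod (w * (- i)) q * theta_prod (w ^ 2 * (- i)) q = theta_prod i (q ^ 3)"
    using theta_prod_mult_cube_roots[OF norm_q w, of "- i"] i'(2) by simp
  also have "theta_prod i (q ^ 3) = (1 - i) * (E 12 / E 6)" using theta_prod_imaginary[of 3, OF _ i] by simp
  also have "theta_prod (- i) q = (1 + i) * (E 4 / E 2)" using theta_prod_imaginary[of "Suc 0", OF _ i'(1)] by simp
  also have "1 - i = (1 + i) * (- i)" using i by (simp add: power2_eq_square algebra_simps)
  finally have "(1 + i) * ((E 4 / E 2) * (theta_prod (- i * w) q * theta_prod (- i * w ^ 2) q)) = (1 + i) * (- i * (E 12 / E 6))"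
    by (simp add: mult_ac)
  hence "(E 4 / E 2) * (theta_prod (- i * w) q * theta_prod (- i * w ^ 2) q) = - i * (E 12 / E 6)"
    using i1 by (metis mult_left_cancel)
  thus ?thesis by (simp add: field_simps)
qed

text \<open>The same relations for roots of unity of order twelve instead of fractions of the period, at the exponents
\<open>2, 3, 4\<close> and \<open>2, 3, 6\<close>. They correspond to the previous two under the Fricke involution. Later they
appear as \<open>(1 - 3\<tau>) \<phi>(-q\<^sup>3)\<^sup>2 = (1 + \<tau>) \<phi>(-q)\<^sup>2\<close> and
\<open>(1 + 3\<tau>) \<phi>(q\<^sup>3)\<^sup>2 = (1 - \<tau>) \<phi>(q)\<^sup>2\<close>.\<close>

lemma
  shows eta_three_term_c: "3 * (E 12 * E 2 / (E 6 * E 4) * (E 3 / E (Suc 0)) ^ 2)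
      + E 12 * E 2 / (E 6 * E 4) * (E 6 * E (Suc 0) / (E 2 * E 3)) ^ 2
      = 4 * ((E 2 / E (Suc 0)) ^ 2 * (E 6 * E (Suc 0) / (E 2 * E 3)) * (E 4 / E 2) ^ 2)"
    and eta_three_term_d: "2 * (E 12 * E 2 / (E 6 * E 4) * (E 2 / E (Suc 0)) ^ 4)
      + (E 4 / E 2) ^ 2 * (E 6 * E (Suc 0) / (E 2 * E 3)) ^ 2
      = 3 * ((E 3 / E (Suc 0)) ^ 2 * (E 4 / E 2) ^ 2)"
proof -
  obtain z :: complex where z: "z ^ 4 = z ^ 2 - 1" by (rule twelfth_root_of_unity)
  have z6: "z ^ 6 = - 1"
  proof -
    have "z ^ 6 = z ^ 4 * z ^ 2" by (simp add: pow_expand)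
    also have "\<dots> = (z ^ 2 - 1) * z ^ 2" unfolding z ..
    also have "\<dots> = z ^ 4 - z ^ 2" by (simp add: pow_expand algebra_simps)
    finally show ?thesis using z by simp
  qed
  have z0: "z \<noteq> 0" using z6 by auto
  have zp: "z ^ 7 = - z" "z ^ 8 = - (z ^ 2)" "z ^ 9 = - (z ^ 3)" "z ^ 10 = - (z ^ 4)" "z ^ 11 = - (z ^ 5)" "z ^ 12 = 1"
    using power_add[of z 6 1] power_add[of z 6 2] power_add[of z 6 3] power_add[of z 6 4] power_add[of z 6 5]
      power_add[of z 6 6] z6 by simp_all
  have i: "(z ^ 3) ^ 2 = - 1" using z6 by (simp flip: power_mult)
  have w: "(z ^ 4) ^ 2 + z ^ 4 + 1 = 0"
  proof -
    have "(z ^ 4) ^ 2 = z ^ 8" by (simp flip: power_mult)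
    thus ?thesis unfolding zp z by simp
  qed
  have w2: "(z ^ 8) ^ 2 + z ^ 8 + 1 = 0"
  proof -
    have "(z ^ 8) ^ 2 = z ^ 4" unfolding zp by (simp flip: power_mult)
    thus ?thesis unfolding zp z by simp
  qed
  define P where "P k = theta_prod (z ^ k) q" for k
  define X Y C U V where "X = E 12 * E 2 / (E 6 * E 4)" and "Y = E 6 * E (Suc 0) / (E 2 * E 3)" and "C = E 4 / E 2"
    and "U = E 3 / E (Suc 0)" and "V = E 2 / E (Suc 0)"
  have nzU: "X \<noteq> 0" "Y \<noteq> 0" "C \<noteq> 0" "U \<noteq> 0" "V \<noteq> 0" by (auto simp: X_def Y_def C_def U_def V_def)
  have PX: "P 1 * P 5 = - (z ^ 3) * X"
  proof -
    have "- (z ^ 3) * z ^ 4 = z ^ 1" "- (z ^ 3) * (z ^ 4) ^ 2 = z ^ 5"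
      using zp by (simp_all flip: power_add power_mult)
    thus ?thesis using theta_prod_twelfth_roots[OF w i] unfolding P_def X_def by simp
  qed
  have P6: "P 6 = 2 * V ^ 2" using theta_prod_minus_one[of "Suc 0"] z6 by (simp add: P_def V_def numeral_2_eq_2)
  have P4: "P 4 = (1 - z ^ 4) * U" using theta_prod_cube_root[OF _ w, of "Suc 0"] by (simp add: P_def U_def)
  have P3: "P 3 = (1 - z ^ 3) * C" using theta_prod_imaginary[OF _ i, of "Suc 0"] by (simp add: P_def C_def)
  have P2: "P 2 = - (z ^ 4) * Y"
  proof -
    have "1 + z ^ 8 = - (z ^ 4)" unfolding zp z by simp
    thus ?thesis using theta_prod_minus_cube_root[OF w2] unfolding P_def Y_def zp(2) by simp
  qed
  have s4: "(1 - z ^ 4) ^ 2 = - 3 * z ^ 4"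
  proof -
    have "(1 - z ^ 4) ^ 2 = 1 - 2 * z ^ 4 + z ^ 8" by (simp add: pow_expand algebra_simps)
    thus ?thesis unfolding zp z by simp
  qed
  have s3: "(1 - z ^ 3) ^ 2 = - 2 * z ^ 3"
  proof -
    have "(1 - z ^ 3) ^ 2 = 1 - 2 * z ^ 3 + z ^ 6" by (simp add: pow_expand algebra_simps)
    thus ?thesis unfolding z6 by simp
  qed
  have nz: "P 2 ^ 2 \<noteq> 0" "P 3 ^ 2 \<noteq> 0" "P 4 ^ 2 \<noteq> 0" "P 6 ^ 2 \<noteq> 0"
    unfolding P2 P3 P4 P6 power_mult_distrib s3 s4 using nzU z0 by auto
  have refl: "P (12 - k) = - P k / z ^ k" if "k < 12" for k
  proof -
    have "z ^ (12 - k) = 1 / z ^ k" using that zp(6) z0 by (simp add: power_diff)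
    thus ?thesis using theta_prod_inverse[OF norm_q, of "z ^ k"] z0 by (simp add: P_def)
  qed
  have W: "weier (z ^ j) q - weier (z ^ k) q = E (Suc 0) ^ 4 * (z ^ j * P (j + k) * P (k - j)) / (P j ^ 2 * P k ^ 2)"
    if "P j ^ 2 \<noteq> 0" "P k ^ 2 \<noteq> 0" "j < k" for j k
  proof -
    have "z ^ j / z ^ k = 1 / z ^ (k - j)" using that z0 by (simp add: power_diff)
    hence "theta_prod (z ^ j / z ^ k) q = - P (k - j) / z ^ (k - j)"
      using theta_prod_inverse[OF norm_q, of "z ^ (k - j)"] z0 by (simp add: P_def)
    hence e: "z ^ k * theta_prod (z ^ j / z ^ k) q = - (z ^ j * P (k - j))"
      using that z0 by (simp add: power_diff)
    have "weier (z ^ j) q - weier (z ^ k) q = - (z ^ k * theta_prod (z ^ j / z ^ k) q) *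
        (E (Suc 0) ^ 4 * P (j + k)) / (P j ^ 2 * P k ^ 2)"
      using weier_diff[OF norm_q q_nz, of "z ^ j" "z ^ k"] that z0
      by (simp add: P_def E_def power_add mult_ac)
    thus ?thesis unfolding e by (simp add: mult_ac)
  qed
  have W23: "z ^ 2 * P (2 + 3) * P (3 - 2) = - (z ^ 5) * X"
  proof -
    have "z ^ 2 * P (2 + 3) * P (3 - 2) = z ^ 2 * (P 1 * P 5)" by (simp add: mult_ac)
    thus ?thesis unfolding PX by (simp add: pow_expand)
  qed
  have W34: "z ^ 3 * P (3 + 4) * P (4 - 3) = z * X"
  proof -
    have "z ^ 3 * P 7 * P 1 = - (z ^ 3) / z ^ 5 * (P 1 * P 5)" using refl[of 5] by simp
    also have "- (z ^ 3) / z ^ 5 = z ^ 4"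
      using z0 zp(3) power_add[of z 4 5] by (subst divide_eq_eq) simp
    also have "z ^ 4 * (P 1 * P 5) = - (z ^ 7) * X" unfolding PX by (simp add: pow_expand)
    finally show ?thesis using zp by simp
  qed
  have W24: "z ^ 2 * P (2 + 4) * P (4 - 2) = 2 * V ^ 2 * Y"
  proof -
    have "z ^ 2 * P 6 * P 2 = - (z ^ 6) * 2 * V ^ 2 * Y" unfolding P6 P2 by (simp add: pow_expand mult_ac)
    thus ?thesis using z6 by simp
  qed
  have W36: "z ^ 3 * P (3 + 6) * P (6 - 3) = 2 * z ^ 3 * C ^ 2"
  proof -
    have "z ^ 3 * P 9 * P 3 = - (P 3 ^ 2)" using refl[of 3] z0 by (simp add: power2_eq_square)
    also have "\<dots> = 2 * z ^ 3 * C ^ 2" unfolding P3 power_mult_distrib s3 by simp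
    finally show ?thesis by simp
  qed
  have W26: "z ^ 2 * P (2 + 6) * P (6 - 2) = - 3 * z ^ 8 * U ^ 2"
  proof -
    have "z ^ 2 * P 8 * P 4 = - (z ^ 2 / z ^ 4) * P 4 ^ 2" using refl[of 4] z0 by (simp add: power2_eq_square)
    also have "z ^ 2 / z ^ 4 = - (z ^ 4)"
      using z0 z6 power_add[of z 4 4] zp(2) by (subst divide_eq_eq) simp
    finally have "z ^ 2 * P 8 * P 4 = z ^ 4 * (- 3 * z ^ 4 * U ^ 2)" unfolding P4 power_mult_distrib s4 by simp
    thus ?thesis by (simp add: pow_expand)
  qed
  have d: "weier (z ^ 2) q - weier (z ^ 3) q = E (Suc 0) ^ 4 * (- (z ^ 5) * X) / (P 2 ^ 2 * P 3 ^ 2)"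
    "weier (z ^ 3) q - weier (z ^ 4) q = E (Suc 0) ^ 4 * (z * X) / (P 3 ^ 2 * P 4 ^ 2)"
    "weier (z ^ 2) q - weier (z ^ 4) q = E (Suc 0) ^ 4 * (2 * V ^ 2 * Y) / (P 2 ^ 2 * P 4 ^ 2)"
    "weier (z ^ 3) q - weier (z ^ 6) q = E (Suc 0) ^ 4 * (2 * z ^ 3 * C ^ 2) / (P 3 ^ 2 * P 6 ^ 2)"
    "weier (z ^ 2) q - weier (z ^ 6) q = E (Suc 0) ^ 4 * (- 3 * z ^ 8 * U ^ 2) / (P 2 ^ 2 * P 6 ^ 2)"
    unfolding W23[symmetric] W34[symmetric] W24[symmetric] W36[symmetric] W26[symmetric]
    by (rule W[OF nz(1) nz(2)] W[OF nz(2) nz(3)] W[OF nz(1) nz(3)] W[OF nz(2) nz(4)] W[OF nz(1) nz(4)], simp)+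
  have "(- (z ^ 5) * X) * P 4 ^ 2 + (z * X) * P 2 ^ 2 = (2 * V ^ 2 * Y) * P 3 ^ 2"
  proof (rule telescoping[of _ _ _ "E (Suc 0) ^ 4"])
    show "E (Suc 0) ^ 4 * (- (z ^ 5) * X) / (P 2 ^ 2 * P 3 ^ 2) + E (Suc 0) ^ 4 * (z * X) / (P 3 ^ 2 * P 4 ^ 2)
       = E (Suc 0) ^ 4 * (2 * V ^ 2 * Y) / (P 2 ^ 2 * P 4 ^ 2)"
      unfolding d[symmetric] by simp
  qed (use nz in auto)
  also have "(- (z ^ 5) * X) * P 4 ^ 2 = z ^ 9 * (3 * (X * U ^ 2))"
    unfolding P4 power_mult_distrib s4 by (simp add: pow_expand mult_ac)
  also have "(z * X) * P 2 ^ 2 = z ^ 9 * (X * Y ^ 2)"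
    unfolding P2 power_mult_distrib by (simp add: pow_expand mult_ac)
  also have "(2 * V ^ 2 * Y) * P 3 ^ 2 = z ^ 9 * (4 * (V ^ 2 * Y * C ^ 2))"
    unfolding P3 power_mult_distrib s3 zp by (simp add: pow_expand mult_ac)
  finally have "z ^ 9 * (3 * (X * U ^ 2) + X * Y ^ 2) = z ^ 9 * (4 * (V ^ 2 * Y * C ^ 2))" by (simp add: algebra_simps)
  hence "3 * (X * U ^ 2) + X * Y ^ 2 = 4 * (V ^ 2 * Y * C ^ 2)" using z0 by (subst (asm) mult_left_cancel) auto
  thus "3 * (E 12 * E 2 / (E 6 * E 4) * (E 3 / E (Suc 0)) ^ 2)
      + E 12 * E 2 / (E 6 * E 4) * (E 6 * E (Suc 0) / (E 2 * E 3)) ^ 2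
      = 4 * ((E 2 / E (Suc 0)) ^ 2 * (E 6 * E (Suc 0) / (E 2 * E 3)) * (E 4 / E 2) ^ 2)"
    unfolding X_def Y_def C_def U_def V_def .
  have "(- (z ^ 5) * X) * P 6 ^ 2 + (2 * z ^ 3 * C ^ 2) * P 2 ^ 2 = (- 3 * z ^ 8 * U ^ 2) * P 3 ^ 2"
  proof (rule telescoping[of _ _ _ "E (Suc 0) ^ 4"])
    show "E (Suc 0) ^ 4 * (- (z ^ 5) * X) / (P 2 ^ 2 * P 3 ^ 2) + E (Suc 0) ^ 4 * (2 * z ^ 3 * C ^ 2) / (P 3 ^ 2 * P 6 ^ 2)
       = E (Suc 0) ^ 4 * (- 3 * z ^ 8 * U ^ 2) / (P 2 ^ 2 * P 6 ^ 2)"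
      unfolding d[symmetric] by simp
  qed (use nz in auto)
  also have "(- (z ^ 5) * X) * P 6 ^ 2 = 2 * z ^ 11 * (2 * (X * V ^ 4))"
    unfolding P6 power_mult_distrib zp by (simp add: pow_expand mult_ac)
  also have "(2 * z ^ 3 * C ^ 2) * P 2 ^ 2 = 2 * z ^ 11 * (C ^ 2 * Y ^ 2)"
    unfolding P2 power_mult_distrib by (simp add: pow_expand mult_ac)
  also have "(- 3 * z ^ 8 * U ^ 2) * P 3 ^ 2 = 2 * z ^ 11 * (3 * (U ^ 2 * C ^ 2))"
    unfolding P3 power_mult_distrib s3 by (simp add: pow_expand mult_ac)
  finally have "2 * z ^ 11 * (2 * (X * V ^ 4) + C ^ 2 * Y ^ 2) = 2 * z ^ 11 * (3 * (U ^ 2 * C ^ 2))" by (simp add: algebra_simps)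
  hence "2 * (X * V ^ 4) + C ^ 2 * Y ^ 2 = 3 * (U ^ 2 * C ^ 2)" using z0 by (subst (asm) mult_left_cancel) auto
  thus "2 * (E 12 * E 2 / (E 6 * E 4) * (E 2 / E (Suc 0)) ^ 4)
      + (E 4 / E 2) ^ 2 * (E 6 * E (Suc 0) / (E 2 * E 3)) ^ 2
      = 3 * ((E 3 / E (Suc 0)) ^ 2 * (E 4 / E 2) ^ 2)"
    unfolding X_def Y_def C_def U_def V_def .
qed

text \<open>Twisting by the character modulo 3 in the variable dual to \<open>x\<close>. In the product formula the two
unknown theta values \<open>wx\<close> and \<open>w\<^sup>2x\<close> enter through their product only, which the cubing isogeny provides.\<close>

lemma weier_cube_root_twist:
  assumes w: "w ^ 2 + w + 1 = 0" and k: "k > 0" and x: "x \<noteq> 0"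
    and nz: "theta_prod (x ^ 3) (q ^ (3 * k)) \<noteq> 0"
  shows "weier (w * x) (q ^ k) - weier (w ^ 2 * x) (q ^ k) = (w - w ^ 2) *
     (x * E k ^ 3 * E (3 * k) * theta_prod (x ^ 2) (q ^ k) * theta_prod x (q ^ k) ^ 2 / theta_prod (x ^ 3) (q ^ (3 * k)) ^ 2)"
proof -
  note c = cube_root_of_unity[OF w]
  have w2: "(w ^ 2) ^ 2 + w ^ 2 + 1 = 0" using w c(1) by (auto simp: power2_eq_square power3_eq_cube algebra_simps)
  have G: "theta_prod x (q ^ k) * theta_prod (w * x) (q ^ k) * theta_prod (w ^ 2 * x) (q ^ k) = theta_prod (x ^ 3) (q ^ (3 * k))"
    using theta_prod_mult_cube_roots[OF norm_qk[OF k] w, of x] by (simp add: mult.commute flip: power_mult)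
  hence nz': "theta_prod x (q ^ k) \<noteq> 0" "theta_prod (w * x) (q ^ k) \<noteq> 0" "theta_prod (w ^ 2 * x) (q ^ k) \<noteq> 0"
    using nz by auto
  have e: "(w * x) * (w ^ 2 * x) = x ^ 2" "(w * x) / (w ^ 2 * x) = w ^ 2"
    using c(1,2) c(6) x by (simp_all add: power2_eq_square power3_eq_cube field_simps)
  have "weier (w * x) (q ^ k) - weier (w ^ 2 * x) (q ^ k) = - (w ^ 2 * x) * euler (q ^ k) ^ 4 * theta_prod (x ^ 2) (q ^ k) *
     ((1 - w ^ 2) * E (3 * k) / E k) / (theta_prod (w * x) (q ^ k) ^ 2 * theta_prod (w ^ 2 * x) (q ^ k) ^ 2)"
    by (rule weier_diff_eval) (use norm_qk[OF k] q_nz x c(2) nz' e theta_prod_cube_root[OF k w2] in auto)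
  also have "theta_prod (w * x) (q ^ k) ^ 2 * theta_prod (w ^ 2 * x) (q ^ k) ^ 2 = theta_prod (x ^ 3) (q ^ (3 * k)) ^ 2 / theta_prod x (q ^ k) ^ 2"
    unfolding G[symmetric] using nz' by (simp add: power_mult_distrib)
  also have "- (w ^ 2 * x) * euler (q ^ k) ^ 4 * theta_prod (x ^ 2) (q ^ k) * ((1 - w ^ 2) * E (3 * k) / E k) /
      (theta_prod (x ^ 3) (q ^ (3 * k)) ^ 2 / theta_prod x (q ^ k) ^ 2)
     = (- (w ^ 2) * (1 - w ^ 2)) * (x * E k ^ 3 * E (3 * k) * theta_prod (x ^ 2) (q ^ k) * theta_prod x (q ^ k) ^ 2 / theta_prod (x ^ 3) (q ^ (3 * k)) ^ 2)"
    using E_nz[OF k] by (simp add: E_def[of k] eval_nat_numeral mult_ac)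
  also have "- (w ^ 2) * (1 - w ^ 2) = w - w ^ 2" using c(1) by (simp add: algebra_simps power2_eq_square power3_eq_cube)
  finally show ?thesis .
qed

text \<open>The same for the dual isogeny: the points \<open>x q\<^sup>k\<close>, \<open>x q\<^sup>2\<^sup>k\<close> with base \<open>q\<^sup>3\<^sup>k\<close> are eliminated by dissection.\<close>

lemma weier_third_period_twist:
  assumes k: "k > 0" and x: "x \<noteq> 0" and nz: "theta_prod x (q ^ k) \<noteq> 0"
  shows "weier (x * q ^ k) (q ^ (3 * k)) - weier (x * q ^ (2 * k)) (q ^ (3 * k)) =
     - (q ^ k / x * E k * E (3 * k) ^ 3 * theta_prod (x ^ 2) (q ^ (3 * k)) * theta_prod x (q ^ (3 * k)) ^ 2 / theta_prod x (q ^ k) ^ 2)"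
proof -
  define P where "P y = theta_prod y (q ^ (3 * k))" for y
  have n3: "norm (q ^ (3 * k)) < 1" using k by (intro norm_qk) auto
  have G: "theta_prod x (q ^ k) = P x * P (x * q ^ k) * P (x * q ^ (2 * k))"
    using theta_prod_dissect[OF norm_qk[OF k] qk_nz, of 3 x]
    by (simp add: P_def eval_nat_numeral power_add mult_2 mult_ac flip: power_mult)
  hence nz': "P x \<noteq> 0" "P (x * q ^ k) \<noteq> 0" "P (x * q ^ (2 * k)) \<noteq> 0" using nz by auto
  have e: "(x * q ^ k) * (x * q ^ (2 * k)) = x ^ 2 * q ^ (3 * k)" "(x * q ^ k) / (x * q ^ (2 * k)) = 1 / q ^ k"
    using x q_nz by (simp_all add: power2_eq_square power3_eq_cube power_mult mult.commute[of _ k] mult_ac)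
  have P1: "P (x ^ 2 * q ^ (3 * k)) = - P (x ^ 2) / x ^ 2"
    unfolding P_def by (rule theta_prod_shift[OF n3]) (use q_nz x in auto)
  have P2: "P (1 / q ^ k) = - (E k / E (3 * k)) / q ^ k"
    unfolding P_def using theta_prod_inverse[OF n3, of "q ^ k"] theta_prod_third[OF k] q_nz by simp
  have "weier (x * q ^ k) (q ^ (3 * k)) - weier (x * q ^ (2 * k)) (q ^ (3 * k)) = - (x * q ^ (2 * k)) * euler (q ^ (3 * k)) ^ 4
     * (- P (x ^ 2) / x ^ 2) * (- (E k / E (3 * k)) / q ^ k) / (P (x * q ^ k) ^ 2 * P (x * q ^ (2 * k)) ^ 2)"
    by (rule weier_diff_eval) (use n3 q_nz x nz' e P1 P2 in \<open>auto simp: P_def\<close>)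
  also have "P (x * q ^ k) ^ 2 * P (x * q ^ (2 * k)) ^ 2 = theta_prod x (q ^ k) ^ 2 / P x ^ 2"
    unfolding G using nz' by (simp add: power_mult_distrib)
  also have "- (x * q ^ (2 * k)) * euler (q ^ (3 * k)) ^ 4 * (- P (x ^ 2) / x ^ 2) * (- (E k / E (3 * k)) / q ^ k) / (theta_prod x (q ^ k) ^ 2 / P x ^ 2)
     = - (q ^ k / x * E k * E (3 * k) ^ 3 * P (x ^ 2) * P x ^ 2 / theta_prod x (q ^ k) ^ 2)"
    using E_nz[of "3 * k"] k x q_nz nz' nz
    by (simp add: E_def[of "3 * k"] mult_2 power_add) (simp add: field_simps pow_expand)
  finally show ?thesis unfolding P_def .
qed

end

section \<open>Character sums of Weierstrass values\<close>

context nome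
begin

text \<open>The theta series \<open>\<phi>(q\<^sup>k)\<close>; the product formula is the definition here and the series is \<open>phi_has_sum\<close>.\<close>

definition phi :: "nat \<Rightarrow> complex" where "phi k = E (2 * k) ^ 5 / (E k ^ 2 * E (4 * k) ^ 2)"
text \<open>This is \<open>\<phi>(- q\<^sup>k)\<close>.\<close>

definition phi_minus :: "nat \<Rightarrow> complex" where "phi_minus k = E k ^ 2 / E (2 * k)"

lemma theta_eq: "k > 0 \<Longrightarrow> x \<noteq> 0 \<Longrightarrow> theta x (q ^ k) = E k * theta_prod x (q ^ k)"
  by (simp add: jacobi_triple_product[OF norm_qk qk_nz] E_def)

lemma theta_minus_half: "k > 0 \<Longrightarrow> theta (- (q ^ k)) (q ^ (2 * k)) = phi k"
  using theta_prod_minus_half[of k] E_nz[of k] E_nz[of "2 * k"] E_nz[of "4 * k"] q_nz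
  by (simp add: theta_eq phi_def) (simp add: field_simps pow_expand)

lemma theta_half: "k > 0 \<Longrightarrow> theta (q ^ k) (q ^ (2 * k)) = phi_minus k"
  using theta_prod_half[of k] E_nz[of k] E_nz[of "2 * k"] q_nz
  by (simp add: theta_eq phi_minus_def) (simp add: field_simps pow_expand)

text \<open>A form of the product formula in which the arguments are free, so that they can be matched after simplification.\<close>

lemma theta_mult_theta_eval:
  assumes "norm p < 1" "p \<noteq> 0" "x \<noteq> 0" "y \<noteq> 0" and "u = x * y" "v = x / y" "P = p ^ 2"
    "s1 = - (x ^ 2)" "s2 = - (p * y ^ 2)" "s3 = - (p * x ^ 2)" "s4 = - (p ^ 2 * y ^ 2)"
  shows "theta u p * theta v p = theta s1 P * theta s2 P - u * theta s3 P * theta s4 P"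
  unfolding assms(5-) by (rule theta_mult_theta[OF assms(1-4)])

lemma theta_minus_full: "k > 0 \<Longrightarrow> theta (- (q ^ k)) (q ^ k) = 2 * E (2 * k) ^ 2 / E k"
proof -
  assume k: "k > 0"
  have "theta_prod (- (q ^ k)) (q ^ k) = theta_prod (- 1) (q ^ k)"
    using theta_prod_shift[OF norm_qk[OF k] qk_nz, of "- 1"] by simp
  thus ?thesis using theta_prod_minus_one[OF k] q_nz E_nz[OF k]
    by (subst jacobi_triple_product[OF norm_qk[OF k]]) (auto simp: E_def[of k, symmetric] power2_eq_square)
qed

text \<open>For \<open>\<phi>(q)\<^sup>2\<close> the substitution by parity is the splitting of \<open>x\<^sup>2 + y\<^sup>2\<close> according to the parity of
\<open>x + y\<close>. The second summand on the right is \<open>q \<psi>(q\<^sup>4)\<^sup>2\<close> in classical notation, up to the factor 4 and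
the scaling by \<open>k\<close>.\<close>

lemma
  assumes k: "k > 0"
  shows phi_square: "phi k ^ 2 = phi (2 * k) ^ 2 + 4 * q ^ k * (E (8 * k) ^ 2 / E (4 * k)) ^ 2"
    and phi_minus_square: "phi_minus k ^ 2 = phi (2 * k) ^ 2 - 4 * q ^ k * (E (8 * k) ^ 2 / E (4 * k)) ^ 2"
proof -
  define Q where "Q = q ^ k"
  have Q: "norm (Q ^ 2) < 1" "Q ^ 2 \<noteq> 0" "Q \<noteq> 0"
    using norm_qk[of "k * 2"] k q_nz by (auto simp: Q_def simp flip: power_mult)
  have q2: "q ^ (2 * k) = Q ^ 2" "q ^ (4 * k) = Q ^ 4" "q ^ (2 * (2 * k)) = Q ^ 4"
    by (simp_all add: Q_def mult.commute flip: power_mult)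
  have a: "theta (- (Q ^ 2)) (Q ^ 4) = phi (2 * k)" using theta_minus_half[of "2 * k"] k by (simp add: q2)
  have b: "theta (- (Q ^ 4)) (Q ^ 4) = 2 * E (8 * k) ^ 2 / E (4 * k)" using theta_minus_full[of "4 * k"] k by (simp add: q2)
  have "phi k ^ 2 = theta (- Q) (Q ^ 2) * theta (- Q) (Q ^ 2)"
    using theta_minus_half[OF k] by (simp add: q2 Q_def[symmetric] power2_eq_square)
  also have "\<dots> = theta (- (Q ^ 2)) (Q ^ 4) * theta (- (Q ^ 2)) (Q ^ 4) - (- Q) * theta (- (Q ^ 4)) (Q ^ 4) * theta (- (Q ^ 4)) (Q ^ 4)"
    by (rule theta_mult_theta_eval[OF Q(1,2), of "- Q" 1]) (use Q(3) in \<open>auto simp flip: power_mult power_add\<close>)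
  finally show "phi k ^ 2 = phi (2 * k) ^ 2 + 4 * q ^ k * (E (8 * k) ^ 2 / E (4 * k)) ^ 2"
    unfolding a b by (simp add: Q_def power2_eq_square)
  have "phi_minus k ^ 2 = theta Q (Q ^ 2) * theta Q (Q ^ 2)"
    using theta_half[OF k] by (simp add: q2 Q_def[symmetric] power2_eq_square)
  also have "\<dots> = theta (- (Q ^ 2)) (Q ^ 4) * theta (- (Q ^ 2)) (Q ^ 4) - Q * theta (- (Q ^ 4)) (Q ^ 4) * theta (- (Q ^ 4)) (Q ^ 4)"
    by (rule theta_mult_theta_eval[OF Q(1,2), of Q 1]) (use Q(3) in \<open>auto simp flip: power_mult power_add\<close>)
  finally show "phi_minus k ^ 2 = phi (2 * k) ^ 2 - 4 * q ^ k * (E (8 * k) ^ 2 / E (4 * k)) ^ 2"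
    unfolding a b by (simp add: Q_def power2_eq_square)
qed

lemma phi_mult_psi: "k > 0 \<Longrightarrow> E (2 * k) ^ 4 / (E k * E (4 * k)) = E k * E (4 * k) / E (2 * k) * phi k"
  using E_nz[of k] E_nz[of "2 * k"] E_nz[of "4 * k"] by (simp add: phi_def field_simps pow_expand)

text \<open>The theta values at the primitive points of order eight are not eta quotients. Their squares
come from products of two theta functions at points of order four, by parity splitting with half
powers of \<open>q\<close>; the sum and the difference correspond to the two choices of sign.\<close>

lemma
  assumes k: "k > 0"
  shows theta_eighth_sum: "theta (q ^ (3 * k)) (q ^ (8 * k)) ^ 2 + q ^ k * theta (q ^ k) (q ^ (8 * k)) ^ 2
          = E k * E (4 * k) / E (2 * k) * phi k"
    and theta_eighth_diff: "theta (q ^ (3 * k)) (q ^ (8 * k)) ^ 2 - q ^ k * theta (q ^ k) (q ^ (8 * k)) ^ 2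
          = E k * E (4 * k) / E (2 * k) * phi (2 * k)"
proof -
  \<comment> \<open>Half powers of \<open>q\<close> are needed to write \<open>q\<^sup>k\<close> and \<open>q\<^sup>2\<^sup>k\<close> as \<open>x y\<close> and \<open>x / y\<close>.\<close>
  define r where "r = csqrt (q ^ k)"
  have r: "r ^ 2 = q ^ k" "r \<noteq> 0" using q_nz by (auto simp: r_def)
  have q4: "norm (q ^ (4 * k)) < 1" "q ^ (4 * k) \<noteq> 0" using norm_qk[of "4 * k"] k q_nz by auto
  have r': "q ^ (4 * k) = r ^ 8" "q ^ (8 * k) = r ^ 16" "q ^ (3 * k) = r ^ 6" "q ^ (2 * k) = r ^ 4" "(q ^ (4 * k)) ^ 2 = r ^ 16"
    using r(1) by (simp_all add: mult.commute[of _ k] power_mult flip: r(1))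
  have t7: "theta (q ^ (7 * k)) (q ^ (8 * k)) = theta (q ^ k) (q ^ (8 * k))"
  proof -
    have "q ^ (7 * k) = q ^ (8 * k) / q ^ k" using q_nz by (simp add: power_diff flip: power_diff)
    thus ?thesis using theta_prod_recip[of "q ^ k" "q ^ (8 * k)"] q_nz k
      by (simp add: jacobi_triple_product[OF norm_qk qk_nz])
  qed
  have 1: "theta (q ^ k) (q ^ (4 * k)) = E k * E (4 * k) / E (2 * k)"
    using theta_prod_quarter[OF k] q_nz k by (subst jacobi_triple_product[OF q4]) (auto simp: E_def[of "4 * k", symmetric])
  have 2: "theta (- (q ^ (2 * k))) (q ^ (4 * k)) = phi (2 * k)" using theta_minus_half[of "2 * k"] k by simp
  have 3: "theta (q ^ (2 * k)) (q ^ (4 * k)) = E (2 * k) ^ 2 / E (4 * k)"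
    using theta_half[of "2 * k"] k by (simp add: phi_minus_def)
  have 4: "theta (- (q ^ k)) (q ^ (4 * k)) = E (2 * k) ^ 2 / E k"
  proof -
    have "theta_prod (q ^ k) (q ^ (4 * k)) * theta_prod (- (q ^ k)) (q ^ (4 * k)) = theta_prod (q ^ (2 * k)) (q ^ (8 * k))"
      using theta_prod_mult_minus[OF q4(1), of "q ^ k"] by (simp add: mult_ac flip: power_mult)
    also have "\<dots> = E (2 * k) / E (4 * k)" using theta_prod_quarter[of "2 * k"] k by simp
    finally have "theta_prod (- (q ^ k)) (q ^ (4 * k)) = E (2 * k) ^ 2 / (E k * E (4 * k))"
      using theta_prod_quarter[OF k] E_nz[of k] E_nz[of "2 * k"] E_nz[of "4 * k"] k
      by (simp add: field_simps power2_eq_square)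
    thus ?thesis using k q_nz E_nz[of "4 * k"] by (subst jacobi_triple_product[OF q4]) (auto simp: E_def[of "4 * k", symmetric])
  qed
  have q7: "q ^ (7 * k) = r ^ 14" using r(1) by (simp add: mult.commute[of _ k] power_mult flip: r(1))
  note ev = r' q7 r(1)[symmetric]
  have "theta (- (q ^ k)) (q ^ (4 * k)) * theta (q ^ (2 * k)) (q ^ (4 * k)) =
    theta (q ^ (3 * k)) (q ^ (8 * k)) * theta (q ^ (3 * k)) (q ^ (8 * k))
     - (- (q ^ k)) * theta (q ^ (7 * k)) (q ^ (8 * k)) * theta (q ^ (7 * k)) (q ^ (8 * k))"
    by (rule theta_mult_theta_eval[OF q4, of "\<i> * r ^ 3" "\<i> / r"])
       (use r(2) in \<open>simp_all add: ev power_mult_distrib power_divide\<close>, (simp_all add: field_simps eval_nat_numeral)?)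
  hence "theta (q ^ (3 * k)) (q ^ (8 * k)) ^ 2 + q ^ k * theta (q ^ k) (q ^ (8 * k)) ^ 2 = E (2 * k) ^ 4 / (E k * E (4 * k))"
    unfolding t7 3 4 by (simp add: power2_eq_square[of "theta _ _"] pow_expand mult_ac)
  thus "theta (q ^ (3 * k)) (q ^ (8 * k)) ^ 2 + q ^ k * theta (q ^ k) (q ^ (8 * k)) ^ 2
          = E k * E (4 * k) / E (2 * k) * phi k" unfolding phi_mult_psi[OF k] .
  have "theta (q ^ k) (q ^ (4 * k)) * theta (- (q ^ (2 * k))) (q ^ (4 * k)) =
    theta (q ^ (3 * k)) (q ^ (8 * k)) * theta (q ^ (3 * k)) (q ^ (8 * k))
     - q ^ k * theta (q ^ (7 * k)) (q ^ (8 * k)) * theta (q ^ (7 * k)) (q ^ (8 * k))"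
    by (rule theta_mult_theta_eval[OF q4, of "\<i> * r ^ 3" "- (\<i> / r)"])
       (use r(2) in \<open>simp_all add: ev power_mult_distrib power_divide\<close>, (simp_all add: field_simps eval_nat_numeral)?)
  thus "theta (q ^ (3 * k)) (q ^ (8 * k)) ^ 2 - q ^ k * theta (q ^ k) (q ^ (8 * k)) ^ 2
          = E k * E (4 * k) / E (2 * k) * phi (2 * k)"
    unfolding t7 1 2 by (simp add: power2_eq_square[of "theta _ _"] mult_ac)
qed

text \<open>The counterpart for primitive roots of unity of order eight. Since \<open>(z + 1/z)\<^sup>2 = 2\<close>, the value lies in a
quadratic extension, and conjugation exchanges \<open>z\<close> and \<open>z\<^sup>3\<close> up to sign.\<close>

lemma theta_eighth_root_square:
  assumes k: "k > 0" and z: "z ^ 4 = - 1"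
  shows "theta z (q ^ k) ^ 2 = z * (E (2 * k) * E (8 * k) / E (4 * k)) * ((z + 1 / z) * phi k - 2 * phi (2 * k))"
proof -
  have z0: "z \<noteq> 0" using z by auto
  have i: "(- (z ^ 2)) ^ 2 = - 1" using z by (simp flip: power_mult)
  have i4: "(z ^ 2) ^ 2 = - 1" using z by (simp flip: power_mult)
  have q2: "norm (q ^ (2 * k)) < 1" "q ^ (2 * k) \<noteq> 0" using norm_qk[of "2 * k"] k q_nz by auto
  have e: "(q ^ k) ^ 2 = q ^ (2 * k)" by (simp add: mult.commute flip: power_mult)
  have 1: "theta (- (z ^ 2)) (q ^ (2 * k)) = (1 + z ^ 2) * (E (2 * k) * E (8 * k) / E (4 * k))"
    using theta_prod_imaginary[of "2 * k", OF _ i] k z0 by (subst jacobi_triple_product[OF q2]) (auto simp: E_def[of "2 * k", symmetric])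
  have 2: "theta (- (q ^ k * z ^ 2)) (q ^ (2 * k)) = E (4 * k) ^ 2 / E (8 * k)"
  proof -
    have "- (q ^ k * z ^ 2) = q ^ (2 * k) / (q ^ k * z ^ 2)"
    proof -
      have "q ^ (2 * k) = q ^ k * q ^ k" by (simp only: mult_2 power_add)
      hence "- (q ^ k * z ^ 2) * (q ^ k * z ^ 2) = - ((z ^ 2) ^ 2) * q ^ (2 * k)"
        by (simp add: power2_eq_square mult_ac)
      thus ?thesis using i4 z0 q_nz by (simp add: eq_divide_eq)
    qed
    hence e2: "q ^ (2 * k) / - (q ^ k * z ^ 2) = q ^ k * z ^ 2" by (metis divide_minus_right minus_minus)
    have "theta_prod (- (q ^ k * z ^ 2)) (q ^ (2 * k)) = qpoch (q ^ k * z ^ 2) (q ^ (2 * k)) * qpoch (- (q ^ k * z ^ 2)) (q ^ (2 * k))"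
      unfolding theta_prod_def e2 by simp
    also have "\<dots> = qpoch ((q ^ k * z ^ 2) ^ 2) ((q ^ (2 * k)) ^ 2)"
      using qpoch_mult_roots[OF q2(1), of "{1, - 1}" 2 "q ^ k * z ^ 2"] by (simp add: power2_eq_square algebra_simps)
    also have "(q ^ k * z ^ 2) ^ 2 = - (q ^ (2 * k))" using i4 by (simp add: power_mult_distrib e)
    also have "qpoch (- (q ^ (2 * k))) ((q ^ (2 * k)) ^ 2) = E (4 * k) ^ 2 / (E (2 * k) * E (8 * k))"
    proof -
      have "norm (q ^ (4 * k)) < 1" using norm_qk[of "4 * k"] k by auto
      moreover have "qpoch (q ^ (2 * k)) ((q ^ (2 * k)) ^ 2) * qpoch (- (q ^ (2 * k))) ((q ^ (2 * k)) ^ 2) = qpoch ((q ^ (2 * k)) ^ 2) (((q ^ (2 * k)) ^ 2) ^ 2)"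
        using qpoch_mult_roots[of "(q ^ (2 * k)) ^ 2" "{1, - 1}" 2 "q ^ (2 * k)"] norm_qk[of "2 * k * 2"] k
        by (simp add: power2_eq_square algebra_simps flip: power_add power_mult)
      moreover have "qpoch (q ^ (2 * k)) ((q ^ (2 * k)) ^ 2) = E (2 * k) / E (4 * k)"
        using qpoch_odd[OF q2(1)] by (simp add: E_def flip: power_mult)
      moreover have "qpoch ((q ^ (2 * k)) ^ 2) (((q ^ (2 * k)) ^ 2) ^ 2) = E (4 * k) / E (8 * k)"
        using qpoch_odd[of "(q ^ (2 * k)) ^ 2"] norm_qk[of "2 * k * 2"] k by (simp add: E_def flip: power_mult)
      ultimately show ?thesis using E_nz[of "2 * k"] E_nz[of "4 * k"] E_nz[of "8 * k"] k
        by (simp add: field_simps power2_eq_square)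
    qed
    finally show ?thesis using E_nz[of "2 * k"] k q_nz z0
      by (subst jacobi_triple_product[OF q2]) (auto simp: E_def[of "2 * k", symmetric])
  qed
  have "theta z (q ^ k) ^ 2 = theta (- (z ^ 2)) (q ^ (2 * k)) * theta (- (q ^ k)) (q ^ (2 * k))
     - z * theta (- (q ^ k * z ^ 2)) (q ^ (2 * k)) * theta (- (q ^ (2 * k))) (q ^ (2 * k))"
    using theta_mult_theta[OF norm_qk[OF k] qk_nz z0, of 1] by (simp add: power2_eq_square[of "theta z (q ^ k)"] e)
  also have "\<dots> = (1 + z ^ 2) * (E (2 * k) * E (8 * k) / E (4 * k)) * phi k - z * (E (4 * k) ^ 2 / E (8 * k)) * (2 * E (4 * k) ^ 2 / E (2 * k))"
    unfolding 1 2 using theta_minus_half[OF k] theta_minus_full[of "2 * k"] k by simp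
  also have "1 + z ^ 2 = z * (z + 1 / z)" using z0 by (simp add: field_simps power2_eq_square)
  finally have f: "theta z (q ^ k) ^ 2 = z * (z + 1 / z) * (E (2 * k) * E (8 * k) / E (4 * k)) * phi k
     - z * ((E (4 * k) ^ 2 / E (8 * k)) * (2 * E (4 * k) ^ 2 / E (2 * k)))" by (simp only: mult.assoc)
  have g: "(E (4 * k) ^ 2 / E (8 * k)) * (2 * E (4 * k) ^ 2 / E (2 * k)) = 2 * (E (2 * k) * E (8 * k) / E (4 * k)) * phi (2 * k)"
    using E_nz[of "2 * k"] E_nz[of "4 * k"] E_nz[of "8 * k"] k by (simp add: phi_def field_simps pow_expand)
  define nu where "nu = z + 1 / z"
  define S where "S = E (2 * k) * E (8 * k) / E (4 * k)"
  show ?thesis using f unfolding g nu_def[symmetric] S_def[symmetric] by (simp add: algebra_simps)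
qed

text \<open>In these names \<open>S\<close> followed by digits stands for a pair of characters, given by the absolute values of
their discriminants: the first is evaluated at the divisor that is summed, the second at the complementary
one. Here it is the pair of discriminants \<open>-3, -4\<close>.\<close>

lemma weier_S34:
  assumes w: "w ^ 2 + w + 1 = 0"
  shows "weier (w * q) (q ^ 4) - weier (w ^ 2 * q) (q ^ 4) =
           (w - w ^ 2) * (q * E (Suc 0) ^ 2 * E 4 * E 6 ^ 2 * E 12 / E 3 ^ 2)"
proof -
  have t: "theta_prod (q ^ 2) (q ^ 4) = (E 2 / E 4) ^ 2" "theta_prod q (q ^ 4) = E (Suc 0) / E 2"
    "theta_prod (q ^ 3) (q ^ 12) = E 3 / E 6"
    using theta_prod_half[of 2] theta_prod_quarter[of "Suc 0"] theta_prod_quarter[of 3] by simp_all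
  have "weier (w * q) (q ^ 4) - weier (w ^ 2 * q) (q ^ 4) = (w - w ^ 2) *
     (q * E 4 ^ 3 * E 12 * theta_prod (q ^ 2) (q ^ 4) * theta_prod q (q ^ 4) ^ 2 / theta_prod (q ^ 3) (q ^ 12) ^ 2)"
    using weier_cube_root_twist[OF w, of 4 q] q_nz t by simp
  also have "q * E 4 ^ 3 * E 12 * theta_prod (q ^ 2) (q ^ 4) * theta_prod q (q ^ 4) ^ 2 / theta_prod (q ^ 3) (q ^ 12) ^ 2
     = q * E (Suc 0) ^ 2 * E 4 * E 6 ^ 2 * E 12 / E 3 ^ 2"
    unfolding t by (simp add: field_simps pow_expand)
  finally show ?thesis .
qed

lemma weier_S121:
  assumes w: "w ^ 2 + w + 1 = 0" and i: "i ^ 2 = - 1"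
  shows "weier (w * i) q - weier (w ^ 2 * i) q =
           (w - w ^ 2) * (- 2 * i * (E (Suc 0) * E 3 * E 4 ^ 2 * E 6 ^ 2 / E 12 ^ 2))"
proof -
  have i3: "i ^ 3 = - i" using i by (simp add: power2_eq_square power3_eq_cube)
  have mi: "(- i) ^ 2 = - 1" using i by simp
  have i0: "i \<noteq> 0" "1 + i \<noteq> 0" using i by (auto simp: power2_eq_square) (metis add_eq_0_iff one_neq_neg_one power2_minus power_one i)
  have t: "theta_prod (i ^ 2) q = 2 * (E 2 / E (Suc 0)) ^ 2" "theta_prod i q = (1 - i) * (E 4 / E 2)"
    "theta_prod (i ^ 3) (q ^ 3) = (1 + i) * (E 12 / E 6)"
    using theta_prod_minus_one[of "Suc 0"] theta_prod_imaginary[of "Suc 0", OF _ i] theta_prod_imaginary[of 3, OF _ mi] i i3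
    by (simp_all add: numeral_2_eq_2)
  have "weier (w * i) q - weier (w ^ 2 * i) q = (w - w ^ 2) *
     (i * E (Suc 0) ^ 3 * E 3 * theta_prod (i ^ 2) q * theta_prod i q ^ 2 / theta_prod (i ^ 3) (q ^ 3) ^ 2)"
    using weier_cube_root_twist[OF w, of "Suc 0" i] i0 t by simp
  also have "i * E (Suc 0) ^ 3 * E 3 * theta_prod (i ^ 2) q * theta_prod i q ^ 2 / theta_prod (i ^ 3) (q ^ 3) ^ 2
     = (i * ((1 - i) ^ 2 / (1 + i) ^ 2)) * (2 * (E (Suc 0) * E 3 * E 4 ^ 2 * E 6 ^ 2 / E 12 ^ 2))"
  proof -
    define a b where "a = (1 - i) ^ 2" and "b = (1 + i) ^ 2"
    have "b \<noteq> 0" using i0 by (simp add: b_def)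
    thus ?thesis unfolding t power_mult_distrib a_def[symmetric] b_def[symmetric] by (simp add: field_simps pow_expand)
  qed
  also have "(1 - i) ^ 2 / (1 + i) ^ 2 = - 1"
  proof -
    have "(1 - i) ^ 2 = - ((1 + i) ^ 2)" using i by (simp add: power2_eq_square algebra_simps)
    thus ?thesis using i0 by simp
  qed
  finally show ?thesis by simp
qed

lemma weier_S112:
  "weier (q ^ 7) (q ^ 12) - weier (q ^ 11) (q ^ 12) = - (q * E 2 ^ 2 * E 3 ^ 2 * E 4 * E 12 / E (Suc 0) ^ 2)"
proof -
  have t: "theta_prod (q ^ 3) (q ^ 4) = E (Suc 0) / E 2" "theta_prod (q ^ 6) (q ^ 12) = (E 6 / E 12) ^ 2"
    "theta_prod (q ^ 3) (q ^ 12) = E 3 / E 6"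
    using theta_prod_half[of 6] theta_prod_quarter[of "Suc 0"] theta_prod_quarter[of 3] T_reflect[of 1 4]
    by (simp_all add: T_def)
  have "weier (q ^ 7) (q ^ 12) - weier (q ^ 11) (q ^ 12) =
     - (q ^ 4 / q ^ 3 * E 4 * E 12 ^ 3 * theta_prod ((q ^ 3) ^ 2) (q ^ 12) * theta_prod (q ^ 3) (q ^ 12) ^ 2 / theta_prod (q ^ 3) (q ^ 4) ^ 2)"
    using weier_third_period_twist[of 4 "q ^ 3"] q_nz t by (simp flip: power_add)
  also have "(q ^ 3) ^ 2 = q ^ 6" by (simp flip: power_mult)
  finally show ?thesis unfolding t using q_nz by (simp add: field_simps pow_expand)
qed

lemma weier_S43:
  assumes i: "i ^ 2 = - 1"
  shows "weier (i * q) (q ^ 3) - weier (i * q ^ 2) (q ^ 3) =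
           2 * i * (q * E (Suc 0) * E 2 ^ 2 * E 3 * E 12 ^ 2 / E 4 ^ 2)"
proof -
  have i0: "i \<noteq> 0" "1 - i \<noteq> 0" using i by auto
  have t: "theta_prod (i ^ 2) (q ^ 3) = 2 * (E 6 / E 3) ^ 2" "theta_prod i q = (1 - i) * (E 4 / E 2)"
    "theta_prod i (q ^ 3) = (1 - i) * (E 12 / E 6)"
    using theta_prod_minus_one[of 3] theta_prod_imaginary[of "Suc 0", OF _ i] theta_prod_imaginary[of 3, OF _ i] i
    by simp_all
  have "weier (i * q) (q ^ 3) - weier (i * q ^ 2) (q ^ 3) =
     - (q / i * E (Suc 0) * E 3 ^ 3 * theta_prod (i ^ 2) (q ^ 3) * theta_prod i (q ^ 3) ^ 2 / theta_prod i q ^ 2)"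
    using weier_third_period_twist[of "Suc 0" i] q_nz t i0 by simp
  also have "q / i = - (q * i)"
  proof -
    have "inverse i = - i" using i by (intro inverse_unique) (simp add: power2_eq_square)
    thus ?thesis by (simp add: divide_inverse)
  qed
  finally show ?thesis
  proof -
    define a where "a = (1 - i) ^ 2"
    have "a \<noteq> 0" using i0 by (simp add: a_def)
    assume "weier (i * q) (q ^ 3) - weier (i * q ^ 2) (q ^ 3) =
     - (- (q * i) * E (Suc 0) * E 3 ^ 3 * theta_prod (i ^ 2) (q ^ 3) * theta_prod i (q ^ 3) ^ 2 / theta_prod i q ^ 2)"
    thus ?thesis using \<open>a \<noteq> 0\<close> unfolding t power_mult_distrib a_def[symmetric]
      by (simp only:) (simp add: field_simps pow_expand)
  qed
qed

text \<open>For the pairs built from the discriminants \<open>24, 1\<close> and \<open>-8, -3\<close> the four Lambert series turn out to be, up to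
constants, \<open>eta_g\<close> or \<open>eta_g'\<close> times a combination of \<open>\<phi>(q) \<phi>(q\<^sup>3)\<close> and \<open>\<phi>(q\<^sup>2) \<phi>(q\<^sup>6)\<close>.\<close>

definition eta_g :: complex where "eta_g = E (Suc 0) * E 6 * E 8 * E 12 / (E 3 * E 24)"
definition eta_g' :: complex where "eta_g' = q * (E 2 * E 3 * E 4 * E 24 / (E (Suc 0) * E 8))"

lemma phi_diff:
  assumes k: "k > 0"
  shows "phi k ^ 2 - phi (2 * k) ^ 2 = 4 * q ^ k * (E (8 * k) ^ 2 / E (4 * k)) ^ 2"
  using phi_square[OF k] by simp

lemma theta_eighth_squares:
  assumes k: "k > 0"
  shows "theta (q ^ (3 * k)) (q ^ (8 * k)) ^ 2 = E k * E (4 * k) / E (2 * k) * (phi k + phi (2 * k)) / 2"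
    and "q ^ k * theta (q ^ k) (q ^ (8 * k)) ^ 2 = E k * E (4 * k) / E (2 * k) * (phi k - phi (2 * k)) / 2"
proof -
  define u v R where "u = theta (q ^ (3 * k)) (q ^ (8 * k)) ^ 2" and "v = q ^ k * theta (q ^ k) (q ^ (8 * k)) ^ 2"
    and "R = E k * E (4 * k) / E (2 * k)"
  have "u + v = R * phi k" "u - v = R * phi (2 * k)"
    using theta_eighth_sum[OF k] theta_eighth_diff[OF k] by (simp_all add: u_def v_def R_def)
  hence "2 * u = R * (phi k + phi (2 * k))" "2 * v = R * (phi k - phi (2 * k))"
    by (simp_all add: algebra_simps flip: \<open>u + v = R * phi k\<close>)
  thus "u = R * (phi k + phi (2 * k)) / 2" "v = R * (phi k - phi (2 * k)) / 2"
    by (simp_all add: eq_divide_eq mult.commute)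
qed

text \<open>The product \<open>\<phi>(q)\<^sup>2 - \<phi>(q\<^sup>2)\<^sup>2\<close> is a nonzero eta quotient.\<close>

lemma phi_sum_diff_nz:
  assumes k: "k > 0"
  shows "phi k + phi (2 * k) \<noteq> 0" "phi k - phi (2 * k) \<noteq> 0"
proof -
  have "phi k ^ 2 - phi (2 * k) ^ 2 \<noteq> 0"
    unfolding phi_diff[OF k] using E_nz[of "8 * k"] E_nz[of "4 * k"] k q_nz by simp
  thus "phi k + phi (2 * k) \<noteq> 0" "phi k - phi (2 * k) \<noteq> 0"
    by (auto simp: power2_eq_square square_diff_square_factored)
qed

text \<open>In the sums below two residue classes contribute conjugate fractions in the values of \<open>\<phi>\<close>; adding them
produces the denominators \<open>\<phi>(q)\<^sup>2 - \<phi>(q\<^sup>2)\<^sup>2\<close>, which are eta quotients.\<close>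

lemma conjugate_fraction_sums:
  fixes a b c d :: complex
  assumes "c + d \<noteq> 0" "c - d \<noteq> 0"
  shows "(a - b) / (c - d) + (a + b) / (c + d) = 2 * (a * c - b * d) / (c ^ 2 - d ^ 2)"
    and "(a + b) / (c - d) + (a - b) / (c + d) = 2 * (a * c + b * d) / (c ^ 2 - d ^ 2)"
proof -
  have "c ^ 2 - d ^ 2 = (c - d) * (c + d)" by (simp add: power2_eq_square algebra_simps)
  thus "(a - b) / (c - d) + (a + b) / (c + d) = 2 * (a * c - b * d) / (c ^ 2 - d ^ 2)"
    "(a + b) / (c - d) + (a - b) / (c + d) = 2 * (a * c + b * d) / (c ^ 2 - d ^ 2)"
    using assms by (simp_all add: add_frac_eq) (simp_all add: algebra_simps)
qed

text \<open>The two summands are the residue classes 1 and 3 modulo 8. Each has a quotient of squares of eighth-period theta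
values, which \<open>theta_eighth_squares\<close> makes linear fractional in \<open>\<phi>\<close>.\<close>

lemma weier_S38:
  assumes w: "w ^ 2 + w + 1 = 0"
  shows "(weier (w * q) (q ^ 8) - weier (w ^ 2 * q) (q ^ 8)) + (weier (w * q ^ 3) (q ^ 8) - weier (w ^ 2 * q ^ 3) (q ^ 8))
     = (w - w ^ 2) * (eta_g * (phi (Suc 0) * phi 3 - phi 2 * phi 6) / 2)"
proof -
  define u v U V where "u = theta (q ^ 3) (q ^ 8)" and "v = theta q (q ^ 8)"
    and "U = theta (q ^ 9) (q ^ 24)" and "V = theta (q ^ 3) (q ^ 24)"
  define a b c d where "a = phi (Suc 0)" and "b = phi 2" and "c = phi 3" and "d = phi 6"
  define R R3 where "R = E (Suc 0) * E 4 / E 2" and "R3 = E 3 * E 12 / E 6"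
  have nz: "a + b \<noteq> 0" "a - b \<noteq> 0" "c + d \<noteq> 0" "c - d \<noteq> 0" "R \<noteq> 0" "R3 \<noteq> 0"
    using phi_sum_diff_nz[of "Suc 0"] phi_sum_diff_nz[of 3] by (simp_all add: a_def b_def c_def d_def R_def R3_def)
  have u: "u ^ 2 = R * (a + b) / 2" "q * v ^ 2 = R * (a - b) / 2"
    and U: "U ^ 2 = R3 * (c + d) / 2" "q ^ 3 * V ^ 2 = R3 * (c - d) / 2"
    using theta_eighth_squares[of "Suc 0"] theta_eighth_squares[of 3]
    by (simp_all add: u_def v_def U_def V_def R_def R3_def a_def b_def c_def d_def)
  have t: "theta_prod q (q ^ 8) = v / E 8" "theta_prod (q ^ 3) (q ^ 8) = u / E 8"
    "theta_prod (q ^ 3) (q ^ 24) = V / E 24" "theta_prod (q ^ 9) (q ^ 24) = U / E 24"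
    using q_nz by (simp_all add: u_def v_def U_def V_def theta_eq)
  have t2: "theta_prod (q ^ 2) (q ^ 8) = E 2 / E 4" "theta_prod (q ^ 6) (q ^ 8) = E 2 / E 4"
    using T8 by (simp_all add: T_def)
  have UV: "U \<noteq> 0" "V \<noteq> 0" using U nz q_nz by auto
  have 1: "weier (w * q) (q ^ 8) - weier (w ^ 2 * q) (q ^ 8) = (w - w ^ 2) *
      (q * E 8 ^ 3 * E 24 * (E 2 / E 4) * (v / E 8) ^ 2 / (V / E 24) ^ 2)"
    using weier_cube_root_twist[OF w, of 8 q] q_nz UV by (simp add: t t2)
  have 2: "weier (w * q ^ 3) (q ^ 8) - weier (w ^ 2 * q ^ 3) (q ^ 8) = (w - w ^ 2) *
      (q ^ 3 * E 8 ^ 3 * E 24 * (E 2 / E 4) * (u / E 8) ^ 2 / (U / E 24) ^ 2)"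
    using weier_cube_root_twist[OF w, of 8 "q ^ 3"] q_nz UV by (simp add: t t2 flip: power_mult)
  define D where "D = q ^ 3 * E 8 * E 24 ^ 3 * (E 2 / E 4)"
  have "q * E 8 ^ 3 * E 24 * (E 2 / E 4) * (v / E 8) ^ 2 / (V / E 24) ^ 2 = D * ((q * v ^ 2) / (q ^ 3 * V ^ 2))"
    using UV q_nz by (simp add: D_def field_simps pow_expand)
  also have "\<dots> = D * (R / R3) * ((a - b) / (c - d))" unfolding u U using nz by simp
  finally have 3: "q * E 8 ^ 3 * E 24 * (E 2 / E 4) * (v / E 8) ^ 2 / (V / E 24) ^ 2 = D * (R / R3) * ((a - b) / (c - d))" .
  have "q ^ 3 * E 8 ^ 3 * E 24 * (E 2 / E 4) * (u / E 8) ^ 2 / (U / E 24) ^ 2 = D * (u ^ 2 / U ^ 2)"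
    using UV q_nz by (simp add: D_def field_simps pow_expand)
  also have "\<dots> = D * (R / R3) * ((a + b) / (c + d))" unfolding u U using nz by simp
  finally have 4: "q ^ 3 * E 8 ^ 3 * E 24 * (E 2 / E 4) * (u / E 8) ^ 2 / (U / E 24) ^ 2 = D * (R / R3) * ((a + b) / (c + d))" .
  have cd: "c ^ 2 - d ^ 2 = 4 * q ^ 3 * (E 24 ^ 2 / E 12) ^ 2"
    using phi_diff[of 3] by (simp add: c_def d_def)
  have "(weier (w * q) (q ^ 8) - weier (w ^ 2 * q) (q ^ 8)) + (weier (w * q ^ 3) (q ^ 8) - weier (w ^ 2 * q ^ 3) (q ^ 8))
    = (w - w ^ 2) * (D * (R / R3) * ((a - b) / (c - d) + (a + b) / (c + d)))"
    unfolding 1 2 3 4 by (simp add: algebra_simps)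
  also have "D * (R / R3) * ((a - b) / (c - d) + (a + b) / (c + d)) = (D * (R / R3) * 4 / (c ^ 2 - d ^ 2)) * (a * c - b * d) / 2"
    unfolding conjugate_fraction_sums(1)[OF nz(3,4)] by simp
  also have "D * (R / R3) * 4 / (c ^ 2 - d ^ 2) = eta_g"
    unfolding cd eta_g_def D_def R_def R3_def using q_nz by (simp add: field_simps pow_expand)
  finally show ?thesis unfolding a_def b_def c_def d_def .
qed

text \<open>The residue class of 25 is that of 1; taking 25 keeps the two pairs \<open>(11, 19)\<close> and \<open>(17, 25)\<close> of the form
\<open>x q\<^sup>8, x q\<^sup>1\<^sup>6\<close>.\<close>

lemma weier_S124:
  "(weier (q ^ 11) (q ^ 24) - weier (q ^ 19) (q ^ 24)) + (weier (q ^ 17) (q ^ 24) - weier (q ^ 25) (q ^ 24))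
     = - (eta_g' * (phi (Suc 0) * phi 3 + phi 2 * phi 6) / 2)"
proof -
  define u v U V where "u = theta (q ^ 3) (q ^ 8)" and "v = theta q (q ^ 8)"
    and "U = theta (q ^ 9) (q ^ 24)" and "V = theta (q ^ 3) (q ^ 24)"
  define a b c d where "a = phi (Suc 0)" and "b = phi 2" and "c = phi 3" and "d = phi 6"
  define R R3 where "R = E (Suc 0) * E 4 / E 2" and "R3 = E 3 * E 12 / E 6"
  have nz: "a + b \<noteq> 0" "a - b \<noteq> 0" "c + d \<noteq> 0" "c - d \<noteq> 0" "R \<noteq> 0" "R3 \<noteq> 0"
    using phi_sum_diff_nz[of "Suc 0"] phi_sum_diff_nz[of 3] by (simp_all add: a_def b_def c_def d_def R_def R3_def)
  have u: "u ^ 2 = R * (a + b) / 2" "q * v ^ 2 = R * (a - b) / 2"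
    and U: "U ^ 2 = R3 * (c + d) / 2" "q ^ 3 * V ^ 2 = R3 * (c - d) / 2"
    using theta_eighth_squares[of "Suc 0"] theta_eighth_squares[of 3]
    by (simp_all add: u_def v_def U_def V_def R_def R3_def a_def b_def c_def d_def)
  have uv: "u \<noteq> 0" "v \<noteq> 0" using u nz q_nz by auto
  have t: "theta_prod q (q ^ 8) = v / E 8" "theta_prod (q ^ 3) (q ^ 8) = u / E 8"
    "theta_prod (q ^ 3) (q ^ 24) = V / E 24" "theta_prod (q ^ 9) (q ^ 24) = U / E 24"
    using q_nz by (simp_all add: u_def v_def U_def V_def theta_eq)
  have t9: "theta_prod (q ^ 9) (q ^ 8) = - (v / E 8) / q"
    using T_shift[of 8 1] t(1) by (simp add: T_def)
  have t2: "theta_prod (q ^ 6) (q ^ 24) = E 6 / E 12" "theta_prod (q ^ 18) (q ^ 24) = E 6 / E 12"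
    using theta_prod_quarter[of 6] T_reflect[of 6 24] by (simp_all add: T_def)
  have 1: "weier (q ^ 11) (q ^ 24) - weier (q ^ 19) (q ^ 24) =
      - (q ^ 8 / q ^ 3 * E 8 * E 24 ^ 3 * (E 6 / E 12) * (V / E 24) ^ 2 / (u / E 8) ^ 2)"
    using weier_third_period_twist[of 8 "q ^ 3"] q_nz uv by (simp add: t t2 flip: power_mult power_add)
  have 2: "weier (q ^ 17) (q ^ 24) - weier (q ^ 25) (q ^ 24) =
      - (q ^ 8 / q ^ 9 * E 8 * E 24 ^ 3 * (E 6 / E 12) * (U / E 24) ^ 2 / (- (v / E 8) / q) ^ 2)"
    using weier_third_period_twist[of 8 "q ^ 9"] q_nz uv by (simp add: t t2 t9 flip: power_mult power_add)
  define D where "D = q ^ 2 * E 8 ^ 3 * E 24 * (E 6 / E 12)"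
  have "q ^ 8 / q ^ 3 * E 8 * E 24 ^ 3 * (E 6 / E 12) * (V / E 24) ^ 2 / (u / E 8) ^ 2 = D * ((q ^ 3 * V ^ 2) / u ^ 2)"
    using uv q_nz by (simp add: D_def field_simps pow_expand)
  also have "\<dots> = D * (R3 / R) * ((c - d) / (a + b))" unfolding u U using nz by simp
  finally have 3: "q ^ 8 / q ^ 3 * E 8 * E 24 ^ 3 * (E 6 / E 12) * (V / E 24) ^ 2 / (u / E 8) ^ 2 = D * (R3 / R) * ((c - d) / (a + b))" .
  have "q ^ 8 / q ^ 9 * E 8 * E 24 ^ 3 * (E 6 / E 12) * (U / E 24) ^ 2 / (- (v / E 8) / q) ^ 2 = D * (U ^ 2 / (q * v ^ 2))"
    using uv q_nz by (simp add: D_def field_simps pow_expand)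
  also have "\<dots> = D * (R3 / R) * ((c + d) / (a - b))" unfolding u U using nz by simp
  finally have 4: "q ^ 8 / q ^ 9 * E 8 * E 24 ^ 3 * (E 6 / E 12) * (U / E 24) ^ 2 / (- (v / E 8) / q) ^ 2 = D * (R3 / R) * ((c + d) / (a - b))" .
  have ab: "a ^ 2 - b ^ 2 = 4 * q * (E 8 ^ 2 / E 4) ^ 2"
    using phi_diff[of "Suc 0"] by (simp add: a_def b_def)
  have "(weier (q ^ 11) (q ^ 24) - weier (q ^ 19) (q ^ 24)) + (weier (q ^ 17) (q ^ 24) - weier (q ^ 25) (q ^ 24))
    = - (D * (R3 / R) * ((c + d) / (a - b) + (c - d) / (a + b)))"
    unfolding 1 2 3 4 by (simp add: algebra_simps)
  also have "D * (R3 / R) * ((c + d) / (a - b) + (c - d) / (a + b)) = (D * (R3 / R) * 4 / (a ^ 2 - b ^ 2)) * (a * c + b * d) / 2"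
    unfolding conjugate_fraction_sums(2)[OF nz(1,2)] by (simp add: mult.commute)
  also have "D * (R3 / R) * 4 / (a ^ 2 - b ^ 2) = eta_g'"
    unfolding ab eta_g'_def D_def R_def R3_def using q_nz by (simp add: field_simps pow_expand)
  finally show ?thesis unfolding a_def b_def c_def d_def .
qed

end

lemma eighth_root_facts:
  fixes z :: complex
  assumes z: "z ^ 4 = - 1"
  shows "z \<noteq> 0" "(z ^ 2) ^ 2 = - 1" "z ^ 6 = - (z ^ 2)" "z ^ 9 = z" "(- (z ^ 2)) ^ 2 = - 1"
    "(z + 1 / z) ^ 2 = 2" "z ^ 3 + 1 / z ^ 3 = - (z + 1 / z)" "(z ^ 3) ^ 4 = - 1"
    "(1 - z ^ 2) / z = - (z + z ^ 3)" "(1 + z ^ 2) * z = z + z ^ 3"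
proof -
  show z0: "z \<noteq> 0" using z by auto
  show "(z ^ 2) ^ 2 = - 1" "(- (z ^ 2)) ^ 2 = - 1" using z by (simp_all flip: power_mult)
  show "z ^ 6 = - (z ^ 2)" using z power_add[of z 4 2] by simp
  show "z ^ 9 = z" using z power_add[of z 4 5] power_add[of z 4 1] by simp
  have e: "z ^ 3 * z = - 1" using z by (simp add: pow_expand)
  have r: "1 / z = - (z ^ 3)" "1 / z ^ 3 = - z" using e z0 by (simp_all add: divide_eq_eq mult.commute[of z])
  show "z ^ 3 + 1 / z ^ 3 = - (z + 1 / z)" unfolding r by simp
  have "(z + 1 / z) ^ 2 = z ^ 2 - 2 * z ^ 4 + z ^ 6" unfolding r by (simp add: pow_expand algebra_simps)
  thus "(z + 1 / z) ^ 2 = 2" using z \<open>z ^ 6 = - (z ^ 2)\<close> by simp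
  have "(z ^ 3) ^ 4 = (z ^ 4) ^ 3" by (simp flip: power_mult)
  thus "(z ^ 3) ^ 4 = - 1" using z by simp
  have "(1 - z ^ 2) / z = 1 / z - z" using z0 by (simp add: field_simps power2_eq_square)
  thus "(1 - z ^ 2) / z = - (z + z ^ 3)" unfolding r by simp
  show "(1 + z ^ 2) * z = z + z ^ 3" by (simp add: pow_expand algebra_simps)
qed

text \<open>The analogue of \<open>conjugate_fraction_sums\<close> over the field generated by \<open>\<surd>2\<close>.\<close>

lemma eighth_root_combination:
  fixes a b c d \<nu> :: complex
  assumes "\<nu> ^ 2 = 2" "\<nu> * c - 2 * d \<noteq> 0" "\<nu> * c + 2 * d \<noteq> 0"
  shows "(\<nu> * a - 2 * b) / (\<nu> * c + 2 * d) + (\<nu> * a + 2 * b) / (\<nu> * c - 2 * d) = 2 * (a * c + 2 * b * d) / (c ^ 2 - 2 * d ^ 2)"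
    and "(\<nu> * a - 2 * b) / (\<nu> * c - 2 * d) + (\<nu> * a + 2 * b) / (\<nu> * c + 2 * d) = 2 * (a * c - 2 * b * d) / (c ^ 2 - 2 * d ^ 2)"
proof -
  have v: "\<nu> * \<nu> = 2" using assms(1) by (simp add: power2_eq_square)
  have D: "(\<nu> * c - 2 * d) * (\<nu> * c + 2 * d) = 2 * (c ^ 2 - 2 * d ^ 2)"
  proof -
    have "(\<nu> * c - 2 * d) * (\<nu> * c + 2 * d) = (\<nu> * \<nu>) * c ^ 2 - 4 * d ^ 2" by (simp add: power2_eq_square algebra_simps)
    thus ?thesis unfolding v by simp
  qed
  have "(\<nu> * a - 2 * b) / (\<nu> * c + 2 * d) + (\<nu> * a + 2 * b) / (\<nu> * c - 2 * d)
     = ((\<nu> * a - 2 * b) * (\<nu> * c - 2 * d) + (\<nu> * a + 2 * b) * (\<nu> * c + 2 * d)) / ((\<nu> * c - 2 * d) * (\<nu> * c + 2 * d))"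
    using assms by (simp add: add_frac_eq mult.commute)
  also have "(\<nu> * a - 2 * b) * (\<nu> * c - 2 * d) + (\<nu> * a + 2 * b) * (\<nu> * c + 2 * d) = 2 * ((\<nu> * \<nu>) * (a * c) + 4 * (b * d))"
    by (simp add: algebra_simps)
  also have "2 * ((\<nu> * \<nu>) * (a * c) + 4 * (b * d)) = 2 * (2 * (a * c + 2 * b * d))" unfolding v by simp
  finally show "(\<nu> * a - 2 * b) / (\<nu> * c + 2 * d) + (\<nu> * a + 2 * b) / (\<nu> * c - 2 * d) = 2 * (a * c + 2 * b * d) / (c ^ 2 - 2 * d ^ 2)"
    unfolding D by (subst (asm) nonzero_mult_divide_mult_cancel_left) simp_all
  have "(\<nu> * a - 2 * b) / (\<nu> * c - 2 * d) + (\<nu> * a + 2 * b) / (\<nu> * c + 2 * d)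
     = ((\<nu> * a - 2 * b) * (\<nu> * c + 2 * d) + (\<nu> * a + 2 * b) * (\<nu> * c - 2 * d)) / ((\<nu> * c - 2 * d) * (\<nu> * c + 2 * d))"
    using assms by (simp add: add_frac_eq mult.commute)
  also have "(\<nu> * a - 2 * b) * (\<nu> * c + 2 * d) + (\<nu> * a + 2 * b) * (\<nu> * c - 2 * d) = 2 * ((\<nu> * \<nu>) * (a * c) - 4 * (b * d))"
    by (simp add: algebra_simps)
  also have "2 * ((\<nu> * \<nu>) * (a * c) - 4 * (b * d)) = 2 * (2 * (a * c - 2 * b * d))" unfolding v by simp
  finally show "(\<nu> * a - 2 * b) / (\<nu> * c - 2 * d) + (\<nu> * a + 2 * b) / (\<nu> * c + 2 * d) = 2 * (a * c - 2 * b * d) / (c ^ 2 - 2 * d ^ 2)"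
    unfolding D by (subst (asm) nonzero_mult_divide_mult_cancel_left) simp_all
qed

context nome
begin

lemma two_phi_square: "k > 0 \<Longrightarrow> phi k ^ 2 - 2 * phi (2 * k) ^ 2 = - (phi_minus k ^ 2)"
  using phi_square[of k] phi_minus_square[of k] by simp

text \<open>As for \<open>weier_S38\<close> and \<open>weier_S124\<close>, with roots of unity of order eight in place of fractions of the
period.\<close>

lemma
  assumes z: "z ^ 4 = - 1" and w: "w ^ 2 + w + 1 = 0"
  shows weier_S241: "(weier (w * z) q - weier (w ^ 2 * z) q) + (weier (w * z ^ 3) q - weier (w ^ 2 * z ^ 3) q)
     = (w - w ^ 2) * (- 2 * (z + z ^ 3) * (eta_g * (phi (Suc 0) * phi 3 + 2 * phi 2 * phi 6)))"
    and weier_S83: "(weier (z * q) (q ^ 3) - weier (z * q ^ 2) (q ^ 3)) + (weier (z ^ 3 * q) (q ^ 3) - weier (z ^ 3 * q ^ 2) (q ^ 3))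
     = 2 * (z + z ^ 3) * (eta_g' * (2 * phi 2 * phi 6 - phi (Suc 0) * phi 3))"
proof -
  note f = eighth_root_facts[OF z]
  define \<nu> where "\<nu> = z + 1 / z"
  define a b c d where "a = phi (Suc 0)" and "b = phi 2" and "c = phi 3" and "d = phi 6"
  define S S3 where "S = E 2 * E 8 / E 4" and "S3 = E 6 * E 24 / E 12"
  define x y X Y where "x = theta_prod z q" and "y = theta_prod (z ^ 3) q"
    and "X = theta_prod z (q ^ 3)" and "Y = theta_prod (z ^ 3) (q ^ 3)"
  have nz0: "x \<noteq> 0" "y \<noteq> 0" "X \<noteq> 0" "Y \<noteq> 0"
    using theta_prod_eighth_root_nz[of "Suc 0", OF _ z] theta_prod_eighth_root_nz[of 3, OF _ z]
    by (simp_all add: x_def y_def X_def Y_def)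
  have SS: "S \<noteq> 0" "S3 \<noteq> 0" by (simp_all add: S_def S3_def)
  have sq: "E (Suc 0) ^ 2 * x ^ 2 = z * S * (\<nu> * a - 2 * b)" "E (Suc 0) ^ 2 * y ^ 2 = - (z ^ 3 * S * (\<nu> * a + 2 * b))"
    "E 3 ^ 2 * X ^ 2 = z * S3 * (\<nu> * c - 2 * d)" "E 3 ^ 2 * Y ^ 2 = - (z ^ 3 * S3 * (\<nu> * c + 2 * d))"
  proof -
    have y3: "\<nu> = - (z ^ 3 + 1 / z ^ 3)" unfolding \<nu>_def f(7) by simp
    show "E (Suc 0) ^ 2 * x ^ 2 = z * S * (\<nu> * a - 2 * b)" "E 3 ^ 2 * X ^ 2 = z * S3 * (\<nu> * c - 2 * d)"
      using theta_eighth_root_square[of "Suc 0", OF _ z] theta_eighth_root_square[of 3, OF _ z] f(1)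
      by (simp_all add: x_def X_def theta_eq \<nu>_def a_def b_def c_def d_def S_def S3_def theta_eq[of "Suc 0", simplified] power_mult_distrib)
    have "theta (z ^ 3) (q ^ 1) ^ 2 = z ^ 3 * S * (- \<nu> * a - 2 * b)" "theta (z ^ 3) (q ^ 3) ^ 2 = z ^ 3 * S3 * (- \<nu> * c - 2 * d)"
      using theta_eighth_root_square[of 1, OF _ f(8)] theta_eighth_root_square[of 3, OF _ f(8)]
      unfolding y3 a_def b_def c_def d_def S_def S3_def by simp_all
    thus "E (Suc 0) ^ 2 * y ^ 2 = - (z ^ 3 * S * (\<nu> * a + 2 * b))" "E 3 ^ 2 * Y ^ 2 = - (z ^ 3 * S3 * (\<nu> * c + 2 * d))"
      using f(1) theta_eq[of 1 "z ^ 3"] theta_eq[of 3 "z ^ 3"]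
      by (simp_all add: y_def Y_def power_mult_distrib algebra_simps)
  qed
  have nz: "\<nu> * a - 2 * b \<noteq> 0" "\<nu> * a + 2 * b \<noteq> 0" "\<nu> * c - 2 * d \<noteq> 0" "\<nu> * c + 2 * d \<noteq> 0"
  proof -
    have "E (Suc 0) ^ 2 * x ^ 2 \<noteq> 0" "E (Suc 0) ^ 2 * y ^ 2 \<noteq> 0" "E 3 ^ 2 * X ^ 2 \<noteq> 0" "E 3 ^ 2 * Y ^ 2 \<noteq> 0"
      using nz0 by auto
    thus "\<nu> * a - 2 * b \<noteq> 0" "\<nu> * a + 2 * b \<noteq> 0" "\<nu> * c - 2 * d \<noteq> 0" "\<nu> * c + 2 * d \<noteq> 0"
      unfolding sq by auto
  qed
  have \<nu>2: "\<nu> ^ 2 = 2" using f(6) by (simp add: \<nu>_def)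
  have i: "theta_prod (z ^ 2) q = (1 - z ^ 2) * (E 4 / E 2)" "theta_prod (z ^ 6) q = (1 + z ^ 2) * (E 4 / E 2)"
    "theta_prod (z ^ 2) (q ^ 3) = (1 - z ^ 2) * (E 12 / E 6)" "theta_prod (z ^ 6) (q ^ 3) = (1 + z ^ 2) * (E 12 / E 6)"
    using theta_prod_imaginary[of "Suc 0", OF _ f(2)] theta_prod_imaginary[of "Suc 0", OF _ f(5)]
      theta_prod_imaginary[of 3, OF _ f(2)] theta_prod_imaginary[of 3, OF _ f(5)] unfolding f(3) by simp_all
  have z36: "(z ^ 3) ^ 2 = z ^ 6" "(z ^ 3) ^ 3 = z" using f(4) by (simp_all flip: power_mult)
  define h where "h = z + z ^ 3"
  have hz: "z * (1 - z ^ 2) / z ^ 2 = - h" "z ^ 3 * (1 + z ^ 2) * z ^ 2 = - h" "(1 - z ^ 2) / z = - h" "(1 + z ^ 2) / z ^ 3 = - h"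
  proof -
    show 1: "(1 - z ^ 2) / z = - h" using f(9) by (simp add: h_def)
    show "z * (1 - z ^ 2) / z ^ 2 = - h" unfolding 1[symmetric] using f(1) by (simp add: field_simps power2_eq_square)
    have "z ^ 3 * (1 + z ^ 2) * z ^ 2 = z ^ 4 * ((1 + z ^ 2) * z)" by (simp add: pow_expand algebra_simps)
    thus "z ^ 3 * (1 + z ^ 2) * z ^ 2 = - h" unfolding f(10) z by (simp add: h_def)
    have "- h * z ^ 3 = - (z ^ 4) * (1 + z ^ 2)" unfolding h_def by (simp add: pow_expand algebra_simps)
    thus "(1 + z ^ 2) / z ^ 3 = - h" using z f(1) by (simp add: divide_eq_eq)
  qed
  \<comment> \<open>The four square quotients are linear fractional in \<open>\<nu>\<close>.\<close>
  have r1: "x ^ 2 / Y ^ 2 = - (1 / z ^ 2) * ((E 3 / E (Suc 0)) ^ 2 * (S / S3)) * ((\<nu> * a - 2 * b) / (\<nu> * c + 2 * d))"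
  proof -
    have "x ^ 2 / Y ^ 2 = (E 3 / E (Suc 0)) ^ 2 * ((E (Suc 0) ^ 2 * x ^ 2) / (E 3 ^ 2 * Y ^ 2))"
      by (simp add: power_divide)
    thus ?thesis unfolding sq using f(1) by (simp add: pow_expand mult_ac)
  qed
  have r2: "y ^ 2 / X ^ 2 = - (z ^ 2) * ((E 3 / E (Suc 0)) ^ 2 * (S / S3)) * ((\<nu> * a + 2 * b) / (\<nu> * c - 2 * d))"
  proof -
    have "y ^ 2 / X ^ 2 = (E 3 / E (Suc 0)) ^ 2 * ((E (Suc 0) ^ 2 * y ^ 2) / (E 3 ^ 2 * X ^ 2))"
      by (simp add: power_divide)
    thus ?thesis unfolding sq using f(1) by (simp add: pow_expand mult_ac)
  qed
  have r3: "X ^ 2 / x ^ 2 = ((E (Suc 0) / E 3) ^ 2 * (S3 / S)) * ((\<nu> * c - 2 * d) / (\<nu> * a - 2 * b))"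
  proof -
    have "X ^ 2 / x ^ 2 = (E (Suc 0) / E 3) ^ 2 * ((E 3 ^ 2 * X ^ 2) / (E (Suc 0) ^ 2 * x ^ 2))"
      by (simp add: power_divide)
    thus ?thesis unfolding sq using f(1) by simp
  qed
  have r4: "Y ^ 2 / y ^ 2 = ((E (Suc 0) / E 3) ^ 2 * (S3 / S)) * ((\<nu> * c + 2 * d) / (\<nu> * a + 2 * b))"
  proof -
    have "Y ^ 2 / y ^ 2 = (E (Suc 0) / E 3) ^ 2 * ((E 3 ^ 2 * Y ^ 2) / (E (Suc 0) ^ 2 * y ^ 2))"
      by (simp add: power_divide)
    thus ?thesis unfolding sq using f(1) by simp
  qed
  define D where "D = E (Suc 0) ^ 3 * E 3 * (E 4 / E 2) * ((E 3 / E (Suc 0)) ^ 2 * (S / S3))"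
  have 1: "weier (w * z) q - weier (w ^ 2 * z) q = (w - w ^ 2) * (h * D * ((\<nu> * a - 2 * b) / (\<nu> * c + 2 * d)))"
  proof -
    have "weier (w * z) q - weier (w ^ 2 * z) q = (w - w ^ 2) *
        (z * E (Suc 0) ^ 3 * E 3 * ((1 - z ^ 2) * (E 4 / E 2)) * (x ^ 2 / Y ^ 2))"
      using weier_cube_root_twist[OF w, of "Suc 0" z] f(1) nz0 by (simp add: i(1) x_def Y_def)
    also have "z * E (Suc 0) ^ 3 * E 3 * ((1 - z ^ 2) * (E 4 / E 2)) * (x ^ 2 / Y ^ 2)
       = - (z * (1 - z ^ 2) / z ^ 2) * D * ((\<nu> * a - 2 * b) / (\<nu> * c + 2 * d))"
      unfolding r1 D_def by (simp add: mult_ac)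
    finally show ?thesis unfolding hz by simp
  qed
  have 2: "weier (w * z ^ 3) q - weier (w ^ 2 * z ^ 3) q = (w - w ^ 2) * (h * D * ((\<nu> * a + 2 * b) / (\<nu> * c - 2 * d)))"
  proof -
    have "weier (w * z ^ 3) q - weier (w ^ 2 * z ^ 3) q = (w - w ^ 2) *
        (z ^ 3 * E (Suc 0) ^ 3 * E 3 * ((1 + z ^ 2) * (E 4 / E 2)) * (y ^ 2 / X ^ 2))"
      using weier_cube_root_twist[OF w, of "Suc 0" "z ^ 3"] f(1) nz0 unfolding z36 by (simp add: i(2) y_def X_def)
    also have "z ^ 3 * E (Suc 0) ^ 3 * E 3 * ((1 + z ^ 2) * (E 4 / E 2)) * (y ^ 2 / X ^ 2)
       = - (z ^ 3 * (1 + z ^ 2) * z ^ 2) * D * ((\<nu> * a + 2 * b) / (\<nu> * c - 2 * d))"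
      unfolding r2 D_def by (simp add: mult_ac)
    finally show ?thesis unfolding hz by simp
  qed
  have cd: "c ^ 2 - 2 * d ^ 2 = - ((E 3 ^ 2 / E 6) ^ 2)" using two_phi_square[of 3] by (simp add: c_def d_def phi_minus_def)
  have ab: "a ^ 2 - 2 * b ^ 2 = - ((E (Suc 0) ^ 2 / E 2) ^ 2)" using two_phi_square[of "Suc 0"] by (simp add: a_def b_def phi_minus_def)
  have "(weier (w * z) q - weier (w ^ 2 * z) q) + (weier (w * z ^ 3) q - weier (w ^ 2 * z ^ 3) q)
     = (w - w ^ 2) * (h * D * ((\<nu> * a - 2 * b) / (\<nu> * c + 2 * d) + (\<nu> * a + 2 * b) / (\<nu> * c - 2 * d)))"
    unfolding 1 2 by (simp add: algebra_simps)
  also have "\<dots> = (w - w ^ 2) * (2 * h * (D / (c ^ 2 - 2 * d ^ 2)) * (a * c + 2 * b * d))"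
    unfolding eighth_root_combination(1)[OF \<nu>2 nz(3,4)] by simp
  also have "D / (c ^ 2 - 2 * d ^ 2) = - eta_g"
    unfolding cd eta_g_def D_def S_def S3_def by (simp add: field_simps pow_expand)
  finally show "(weier (w * z) q - weier (w ^ 2 * z) q) + (weier (w * z ^ 3) q - weier (w ^ 2 * z ^ 3) q)
     = (w - w ^ 2) * (- 2 * (z + z ^ 3) * (eta_g * (phi (Suc 0) * phi 3 + 2 * phi 2 * phi 6)))"
    unfolding a_def b_def c_def d_def h_def by (simp add: algebra_simps)
  define D3 where "D3 = q * E (Suc 0) * E 3 ^ 3 * (E 12 / E 6) * ((E (Suc 0) / E 3) ^ 2 * (S3 / S))"
  have 3: "weier (z * q) (q ^ 3) - weier (z * q ^ 2) (q ^ 3) = h * D3 * ((\<nu> * c - 2 * d) / (\<nu> * a - 2 * b))"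
  proof -
    have "weier (z * q) (q ^ 3) - weier (z * q ^ 2) (q ^ 3) =
        - (q / z * E (Suc 0) * E 3 ^ 3 * ((1 - z ^ 2) * (E 12 / E 6)) * (X ^ 2 / x ^ 2))"
      using weier_third_period_twist[of "Suc 0" z] f(1) nz0 by (simp add: i(3) x_def X_def)
    also have "\<dots> = - ((1 - z ^ 2) / z) * D3 * ((\<nu> * c - 2 * d) / (\<nu> * a - 2 * b))"
      unfolding r3 D3_def by (simp add: mult_ac)
    finally show ?thesis unfolding hz by simp
  qed
  have 4: "weier (z ^ 3 * q) (q ^ 3) - weier (z ^ 3 * q ^ 2) (q ^ 3) = h * D3 * ((\<nu> * c + 2 * d) / (\<nu> * a + 2 * b))"
  proof -
    have "weier (z ^ 3 * q) (q ^ 3) - weier (z ^ 3 * q ^ 2) (q ^ 3) =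
        - (q / z ^ 3 * E (Suc 0) * E 3 ^ 3 * ((1 + z ^ 2) * (E 12 / E 6)) * (Y ^ 2 / y ^ 2))"
      using weier_third_period_twist[of "Suc 0" "z ^ 3"] f(1) nz0 unfolding z36 by (simp add: i(4) y_def Y_def)
    also have "\<dots> = - ((1 + z ^ 2) / z ^ 3) * D3 * ((\<nu> * c + 2 * d) / (\<nu> * a + 2 * b))"
      unfolding r4 D3_def by (simp add: mult_ac)
    finally show ?thesis unfolding hz by simp
  qed
  have "(weier (z * q) (q ^ 3) - weier (z * q ^ 2) (q ^ 3)) + (weier (z ^ 3 * q) (q ^ 3) - weier (z ^ 3 * q ^ 2) (q ^ 3))
     = h * D3 * ((\<nu> * c - 2 * d) / (\<nu> * a - 2 * b) + (\<nu> * c + 2 * d) / (\<nu> * a + 2 * b))"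
    unfolding 3 4 by (simp add: algebra_simps)
  also have "\<dots> = 2 * h * (D3 / (a ^ 2 - 2 * b ^ 2)) * (c * a - 2 * d * b)"
    unfolding eighth_root_combination(2)[OF \<nu>2 nz(1,2)] by simp
  also have "D3 / (a ^ 2 - 2 * b ^ 2) = - eta_g'"
    unfolding ab eta_g'_def D3_def S_def S3_def by (simp add: field_simps pow_expand)
  finally show "(weier (z * q) (q ^ 3) - weier (z * q ^ 2) (q ^ 3)) + (weier (z ^ 3 * q) (q ^ 3) - weier (z ^ 3 * q ^ 2) (q ^ 3))
     = 2 * (z + z ^ 3) * (eta_g' * (2 * phi 2 * phi 6 - phi (Suc 0) * phi 3))"
    unfolding a_def b_def c_def d_def h_def by (simp add: algebra_simps)
qed

end

section \<open>Lambert series of twisted divisor sums\<close>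

definition divsum :: "(nat \<Rightarrow> complex) \<Rightarrow> (nat \<Rightarrow> complex) \<Rightarrow> nat \<Rightarrow> complex" where
  "divsum f g n = (\<Sum>m | m dvd n. f m * g (n div m) * of_nat m)"

lemma koebe_has_sum:
  assumes "norm z < 1"
  shows "((\<lambda>m. of_nat m * z ^ m) has_sum koebe z) {1..}"
proof -
  have "(\<lambda>n. of_nat (Suc n) * z ^ n) sums (1 / (1 - z) ^ 2)" by (rule geometric_deriv_sums[OF assms])
  from sums_mult[OF this, of z] have "(\<lambda>n. of_nat (Suc n) * z ^ Suc n) sums koebe z"
    by (simp add: koebe_def mult_ac)
  moreover have "summable (\<lambda>n. norm (of_nat (Suc n) * z ^ Suc n))"
  proof -
    have "summable (\<lambda>n. of_nat (Suc n) * norm z ^ n)"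
      using geometric_deriv_sums[of "norm z"] assms by (auto simp: sums_iff)
    hence "summable (\<lambda>n. norm z * (of_nat (Suc n) * norm z ^ n))" by (rule summable_mult)
    thus ?thesis by (simp add: norm_mult norm_power mult_ac del: of_nat_Suc)
  qed
  ultimately have "((\<lambda>n. of_nat (Suc n) * z ^ Suc n) has_sum koebe z) UNIV"
    by (intro norm_summable_imp_has_sum)
  thus ?thesis
    by (subst has_sum_reindex_bij_witness[of "{1..}" Suc "\<lambda>n. n - 1" UNIV "\<lambda>n. of_nat (Suc n) * z ^ Suc n"]) auto
qed

lemma lambert_summable:
  fixes r :: real
  assumes "0 \<le> r" "r < 1"
  shows "(\<lambda>(k, m). of_nat m * r ^ (k * m)) summable_on ({1..} \<times> {1..})"
proof (rule summable_on_SigmaI)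
  fix k :: nat assume k: "k \<in> {1..}"
  hence rk: "r ^ k < 1" "r ^ k \<le> r" "0 \<le> r ^ k" using assms power_decreasing[of 1 k r] by auto
  have "((\<lambda>m. of_nat m * complex_of_real (r ^ k) ^ m) has_sum koebe (of_real (r ^ k))) {1..}"
    using rk by (intro koebe_has_sum) (simp add: norm_power)
  also have "koebe (of_real (r ^ k)) = of_real (r ^ k / (1 - r ^ k) ^ 2)" by (simp add: koebe_def)
  also have "(\<lambda>m. of_nat m * complex_of_real (r ^ k) ^ m) = (\<lambda>m. of_real (of_nat m * r ^ (k * m)))"
    by (simp add: power_mult)
  finally show "((\<lambda>m. case (k, m) of (k, m) \<Rightarrow> of_nat m * r ^ (k * m)) has_sum (r ^ k / (1 - r ^ k) ^ 2)) {1..}"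
    by (simp only: has_sum_of_real_iff prod.case)
next
  have "summable (\<lambda>k. r ^ k * (1 / (1 - r) ^ 2))" using assms by (intro summable_mult2 summable_geometric) auto
  hence "(\<lambda>k. r ^ k * (1 / (1 - r) ^ 2)) summable_on UNIV"
    using assms by (subst summable_on_UNIV_nonneg_real_iff) auto
  hence "(\<lambda>k. r ^ k * (1 / (1 - r) ^ 2)) summable_on {1..}" by (rule summable_on_subset) auto
  thus "(\<lambda>k. r ^ k / (1 - r ^ k) ^ 2) summable_on {1..}"
  proof (rule summable_on_comparison_test)
    fix k :: nat assume k: "k \<in> {1..}"
    hence rk: "r ^ k \<le> r" "0 \<le> r ^ k" using assms power_decreasing[of 1 k r] by auto
    hence "(1 - r) ^ 2 \<le> (1 - r ^ k) ^ 2" using assms by (intro power_mono) auto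
    hence "1 / (1 - r ^ k) ^ 2 \<le> 1 / (1 - r) ^ 2" using assms by (intro divide_left_mono mult_pos_pos) (auto intro!: zero_less_power simp: order.strict_trans1[OF rk(1)])
    from mult_left_mono[OF this rk(2)] show "r ^ k / (1 - r ^ k) ^ 2 \<le> r ^ k * (1 / (1 - r) ^ 2)" by simp
  qed (use assms in auto)
qed (use assms in auto)

text \<open>Summation of the double series over \<open>k\<close> and \<open>m\<close> in two ways: by the product \<open>n = k m\<close>, and first over
\<open>m\<close>.\<close>

lemma divsum_has_sum:
  assumes q: "norm q < 1" and f: "\<And>m. norm (f m) \<le> 1" and g: "\<And>k. norm (g k) \<le> 1"
    and F: "\<And>k. k \<ge> 1 \<Longrightarrow> ((\<lambda>m. f m * (of_nat m * (q ^ k) ^ m)) has_sum F k) {1..}"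
  shows "\<exists>S. ((\<lambda>n. divsum f g n * q ^ n) has_sum S) {1..} \<and> ((\<lambda>k. g k * F k) has_sum S) {1..}"
proof -
  define h where "h k m = g k * (f m * (of_nat m * q ^ (k * m)))" for k m
  have "norm (h k m) \<le> of_nat m * norm q ^ (k * m)" for k m
  proof -
    have "norm (h k m) = norm (g k) * (norm (f m) * (of_nat m * norm q ^ (k * m)))"
      by (simp add: h_def norm_mult norm_power)
    also have "\<dots> \<le> 1 * (1 * (of_nat m * norm q ^ (k * m)))"
      by (intro mult_mono f g) auto
    finally show ?thesis by simp
  qed
  hence "(\<lambda>p. norm (case_prod h p)) summable_on ({1..} \<times> {1..})"
    using lambert_summable[of "norm q"] q
    by (intro summable_on_comparison_test[OF lambert_summable[of "norm q"]]) (auto simp: case_prod_unfold)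
  hence "case_prod h summable_on ({1..} \<times> {1..})" by (rule Infinite_Sum.abs_summable_summable)
  then obtain S where S: "(case_prod h has_sum S) ({1..} \<times> {1..})" by (auto simp: summable_on_def)
  have 1: "((\<lambda>k. g k * F k) has_sum S) {1..}"
  proof (rule has_sum_SigmaD[OF S])
    fix k :: nat assume k: "k \<in> {1..}"
    show "((\<lambda>m. case_prod h (k, m)) has_sum (g k * F k)) {1..}"
      using has_sum_cmult_right[OF F, of k "g k"] k by (simp add: h_def power_mult)
  qed
  have "((\<lambda>(n, m). f m * g (n div m) * of_nat m * q ^ n) has_sum S) (SIGMA n:{1..}. {m. m dvd n})"
    using S by (subst has_sum_reindex_bij_witness[of _ "\<lambda>(k, m). (k * m, m)" "\<lambda>(n, m). (n div m, m)" "{1..} \<times> {1..}" "case_prod h"])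
      (auto simp: h_def Suc_le_eq dvd_div_eq_0_iff intro!: Nat.gr0I)
  hence "((\<lambda>n. divsum f g n * q ^ n) has_sum S) {1..}"
  proof (rule has_sum_SigmaD)
    fix n :: nat assume "n \<in> {1..}"
    thus "((\<lambda>m. case (n, m) of (n, m) \<Rightarrow> f m * g (n div m) * of_nat m * q ^ n) has_sum (divsum f g n * q ^ n)) {m. m dvd n}"
      by (intro has_sum_finiteI) (auto simp: divsum_def sum_distrib_right)
  qed
  with 1 show ?thesis by blast
qed

text \<open>A character \<open>f\<close> is a combination of powers \<open>u\<^sup>m\<close> of roots of unity, so that the inner sum over \<open>m\<close> is a
combination of Koebe functions at \<open>u q\<^sup>k\<close>; periodicity of \<open>g\<close> groups the outer sum into residue classes.\<close>

theorem divsum_sums: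
  assumes q: "norm q < 1" and N: "N > 0" and per: "\<And>k. g (k + N) = g k"
    and f: "\<And>m. norm (f m) \<le> 1" and g: "\<And>k. norm (g k) \<le> 1"
    and fu: "\<And>m. f m = (\<Sum>(c, u)\<leftarrow>cs. c * u ^ m)" and u: "\<And>c u. (c, u) \<in> set cs \<Longrightarrow> norm u \<le> 1"
  shows "(\<lambda>n. divsum f g n * q ^ n) sums
     (\<Sum>r=1..N. g r * (\<Sum>(c, u)\<leftarrow>cs. c * koebe_sum (u * q ^ r) (q ^ N)))"
proof -
  define F where "F k = (\<Sum>(c, u)\<leftarrow>cs. c * koebe (u * q ^ k))" for k
  have F: "((\<lambda>m. f m * (of_nat m * (q ^ k) ^ m)) has_sum F k) {1..}" if k: "k \<ge> 1" for k
  proof -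
    have qk: "norm (q ^ k) < 1" using q k by (simp add: norm_power power_less_one_iff)
    have "((\<lambda>m. (\<Sum>(c, u)\<leftarrow>ds. c * (of_nat m * (u * q ^ k) ^ m))) has_sum (\<Sum>(c, u)\<leftarrow>ds. c * koebe (u * q ^ k))) {1..}"
      if "set ds \<subseteq> set cs" for ds using that
    proof (induction ds)
      case (Cons p ds)
      obtain c u' where p: "p = (c, u')" by force
      have "norm u' \<le> 1" using Cons.prems u p by auto
      hence "norm (u' * q ^ k) < 1" using qk mult_right_mono[of "norm u'" 1 "norm (q ^ k)"] by (simp add: norm_mult)
      from has_sum_cmult_right[OF koebe_has_sum[OF this], of c] Cons
      show ?case unfolding p by (auto intro!: has_sum_add)
    qed simp
    from this[of cs] show ?thesis unfolding F_def fu
      by (simp add: power_mult_distrib case_prod_unfold mult_ac flip: sum_list_const_mult)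
  qed
  from divsum_has_sum[of q f g F, OF q f g F] obtain S where
    S: "((\<lambda>n. divsum f g n * q ^ n) has_sum S) {1..}" "((\<lambda>k. g k * F k) has_sum S) {1..}" by blast
  have "((\<lambda>n. divsum f g n * q ^ n) has_sum S) UNIV"
    using S(1) by (rule has_sum_cong_neutral[THEN iffD1, rotated 3]) (auto simp: divsum_def Suc_le_eq intro: Nat.gr0I)
  hence 1: "(\<lambda>n. divsum f g n * q ^ n) sums S" by (rule has_sum_imp_sums)
  have "((\<lambda>k. g (Suc k) * F (Suc k)) has_sum S) UNIV"
    using S(2) by (subst has_sum_reindex_bij_witness[of UNIV "\<lambda>n. n - 1" Suc "{1..}" "\<lambda>k. g k * F k"]) auto
  hence "(\<lambda>k. g (Suc k) * F (Suc k)) sums S" by (rule has_sum_imp_sums)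
  from sums_group[OF this N] have 2: "(\<lambda>j. \<Sum>i = j * N..<j * N + N. g (Suc i) * F (Suc i)) sums S" .
  have pm: "g (r + N * j) = g r" for r j by (induction j) (use per in \<open>auto simp: add.assoc[symmetric] add.commute[of N]\<close>)
  have pm': "g (Suc a) = g (Suc (a - N * j))" if "N * j \<le> a" for a j
    using pm[of "Suc (a - N * j)" j] that by simp
  have "(\<Sum>i = j * N..<j * N + N. g (Suc i) * F (Suc i)) = (\<Sum>r=1..N. g r * F (r + N * j))" for j
    by (rule sum.reindex_bij_witness[of _ "\<lambda>r. r + N * j - 1" "\<lambda>i. Suc i - N * j"])
       (use N in \<open>auto simp: mult.commute[of j] pm pm' Suc_diff_le\<close>)
  with 2 have 3: "(\<lambda>j. \<Sum>r=1..N. g r * F (r + N * j)) sums S" by simp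
  have qN: "norm (q ^ N) < 1" using q N by (simp add: norm_power power_less_one_iff)
  have e: "q ^ (r + N * j) = q ^ r * (q ^ N) ^ j" for r j by (simp add: power_add power_mult)
  have "(\<lambda>j. \<Sum>r=1..N. g r * F (r + N * j)) sums (\<Sum>r=1..N. g r * (\<Sum>(c, u)\<leftarrow>cs. c * koebe_sum (u * q ^ r) (q ^ N)))"
  proof (intro sums_sum sums_mult)
    fix r
    have "(\<lambda>j. \<Sum>(c, u)\<leftarrow>ds. c * koebe (u * q ^ (r + N * j))) sums (\<Sum>(c, u)\<leftarrow>ds. c * koebe_sum (u * q ^ r) (q ^ N))" for ds
    proof (induction ds)
      case (Cons p ds)
      obtain c u' where p: "p = (c, u')" by force
      from sums_mult[OF koebe_sums[OF qN, of "u' * q ^ r"], of c] Cons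
      show ?case unfolding p e by (auto intro!: sums_add simp: mult_ac)
    qed simp
    thus "(\<lambda>j. F (r + N * j)) sums (\<Sum>(c, u)\<leftarrow>cs. c * koebe_sum (u * q ^ r) (q ^ N))" unfolding F_def .
  qed
  from sums_unique2[OF 3 this] 1 show ?thesis by simp
qed

lemma koebe_inverse: "koebe (1 / x) = koebe x"
proof (cases "x = 0 \<or> x = 1")
  case False
  hence "x \<noteq> 0" "1 - x \<noteq> 0" by auto
  moreover have "(1 - 1 / x) ^ 2 = (1 - x) ^ 2 / x ^ 2"
    using \<open>x \<noteq> 0\<close> by (simp add: field_simps power2_eq_square)
  ultimately show ?thesis by (simp add: koebe_def power2_eq_square)
qed (auto simp: koebe_def)

lemma weier_shift:
  assumes "norm q < 1" "q \<noteq> 0" "x \<noteq> 0"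
  shows "weier (x * q) q = weier x q"
proof -
  have "koebe_sum (1 / x) q = koebe x + koebe_sum (q / x) q"
    using koebe_sum_rec[OF assms(1), of "1 / x"] by (simp add: koebe_inverse)
  thus ?thesis using koebe_sum_rec[OF assms(1), of x] assms by (simp add: weier_def)
qed

text \<open>On the unit circle the definition of \<open>weier\<close> contains the term \<open>k = 0\<close>, which is absent from Lambert series and
accounts for their constant terms.\<close>

lemma weier_unit: "norm q < 1 \<Longrightarrow> weier x q = koebe x + koebe_sum (x * q) q + koebe_sum (q / x) q"
  using koebe_sum_rec[of q x] by (simp add: weier_def)

text \<open>A real character given by the residues on which it is \<open>1\<close> and those on which it is \<open>- 1\<close>. The
names below carry the discriminant, with \<open>m\<close> for a minus sign.\<close>

definition table_char :: "nat \<Rightarrow> nat set \<Rightarrow> nat set \<Rightarrow> nat \<Rightarrow> complex" where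
  "table_char N ps ms n = (if n mod N \<in> ps then 1 else if n mod N \<in> ms then - 1 else 0)"

abbreviation "chi8 \<equiv> table_char 8 {1, 7} {3, 5}"
abbreviation "chi12 \<equiv> table_char 12 {1, 11} {5, 7}"
abbreviation "chi24 \<equiv> table_char 24 {1, 5, 19, 23} {7, 11, 13, 17}"
abbreviation "chim3 \<equiv> table_char 3 {1} {2}"
abbreviation "chim4 \<equiv> table_char 4 {1} {3}"
abbreviation "chim8 \<equiv> table_char 8 {1, 3} {5, 7}"
abbreviation "chi1 \<equiv> (\<lambda>_ :: nat. 1 :: complex)"

lemma table_char_norm: "norm (table_char N ps ms n) \<le> 1"
  by (simp add: table_char_def)

lemma table_char_periodic: "table_char N ps ms (n + N) = table_char N ps ms n"
  by (simp add: table_char_def)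

lemma root_sum_eqI:
  fixes f :: "nat \<Rightarrow> complex"
  assumes p: "p > 0" and per: "\<And>m. f (m + p) = f m" and u: "\<And>c u. (c, u) \<in> set cs \<Longrightarrow> u ^ p = 1"
    and base: "\<forall>m<p. f m = (\<Sum>(c, u)\<leftarrow>cs. c * u ^ m)"
  shows "f m = (\<Sum>(c, u)\<leftarrow>cs. c * u ^ m)"
proof (induction m rule: less_induct)
  case (less m)
  show ?case
  proof (cases "m < p")
    case False
    then obtain l where l: "m = l + p" by (metis add.commute le_Suc_ex not_less)
    have "f m = (\<Sum>(c, u)\<leftarrow>cs. c * u ^ l)" using less.IH[of l] p by (simp add: l per)
    also have "\<dots> = (\<Sum>(c, u)\<leftarrow>cs. c * u ^ m)"
      by (intro arg_cong[of _ _ sum_list] map_cong refl) (auto simp: l power_add dest: u)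
    finally show ?thesis .
  qed (use base in auto)
qed

section \<open>Characters as sums of powers of roots of unity\<close>

lemma cube_root_exists: obtains w :: complex where "w ^ 2 + w + 1 = 0"
proof
  show "(Complex (- 1 / 2) (sqrt 3 / 2)) ^ 2 + Complex (- 1 / 2) (sqrt 3 / 2) + 1 = 0"
    by (simp add: complex_eq_iff power2_eq_square)
qed

lemma eighth_root_exists: obtains z :: complex where "z ^ 4 = - 1"
proof
  have "csqrt \<i> ^ 4 = (csqrt \<i> ^ 2) ^ 2" by (simp only: power_mult[symmetric]) simp
  thus "csqrt \<i> ^ 4 = - 1" unfolding power2_csqrt by simp
qed

lemma cube_root_facts:
  fixes w :: complex
  assumes w: "w ^ 2 + w + 1 = 0"
  shows "norm w = 1" "w * w ^ 2 = 1" "w ^ 2 * w = 1" "w - w ^ 2 \<noteq> 0" "(w - w ^ 2) ^ 2 = - 3"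
proof -
  note c = cube_root_of_unity[OF w]
  have "norm w ^ 3 = 1" using c(1) by (simp flip: norm_power)
  thus "norm w = 1" using power_eq_iff_eq_base[of 3 "norm w" 1] by simp
  show "w * w ^ 2 = 1" "w ^ 2 * w = 1" using c(1) by (simp_all add: power2_eq_square power3_eq_cube mult_ac)
  show "w - w ^ 2 \<noteq> 0" using c(5) by simp
  have "(w - w ^ 2) ^ 2 = w ^ 2 - 2 * w ^ 3 + w ^ 3 * w" by (simp add: pow_expand algebra_simps)
  also have "\<dots> = (w ^ 2 + w + 1) - 3" unfolding c(1) by simp
  finally show "(w - w ^ 2) ^ 2 = - 3" using w by simp
qed

lemma eighth_root_norm:
  fixes z :: complex
  assumes z: "z ^ 4 = - 1"
  shows "norm z = 1" "z * z ^ 3 = - 1" "z ^ 3 * z = - 1" "z + z ^ 3 \<noteq> 0"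
proof -
  have "norm z ^ 4 = 1" by (simp add: z flip: norm_power)
  thus "norm z = 1" using power_eq_iff_eq_base[of 4 "norm z" 1] by simp
  show "z * z ^ 3 = - 1" "z ^ 3 * z = - 1" using z by (simp_all add: pow_expand mult_ac)
  have "(z + z ^ 3) ^ 2 = z ^ 2 + 2 * z ^ 4 + z ^ 4 * z ^ 2" by (simp add: pow_expand algebra_simps)
  also have "\<dots> = - 2" unfolding z by simp
  finally show "z + z ^ 3 \<noteq> 0" by auto
qed

text \<open>Keeping the Gauss sum \<open>D\<close> out of the coefficients leaves only signs to check on each residue.\<close>

lemma signed_root_sum_eqI:
  fixes f :: "nat \<Rightarrow> complex"
  assumes "p > 0" "\<And>m. f (m + p) = f m" "\<And>e u. (e, u) \<in> set es \<Longrightarrow> u ^ p = 1" "D \<noteq> 0"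
    and "\<And>m. m < p \<Longrightarrow> D * f m = (\<Sum>(e, u)\<leftarrow>es. e * u ^ m)"
  shows "f m = (\<Sum>(c, u)\<leftarrow>map (\<lambda>(e, u). (e / D, u)) es. c * u ^ m)"
proof (rule root_sum_eqI[of p])
  have *: "(\<Sum>(c, u)\<leftarrow>map (\<lambda>(e, u). (e / D, u)) es. c * u ^ m) = (\<Sum>(e, u)\<leftarrow>es. e * u ^ m) / D" for m
    by (induction es) (auto simp: add_divide_distrib)
  show "\<forall>m<p. f m = (\<Sum>(c, u)\<leftarrow>map (\<lambda>(e, u). (e / D, u)) es. c * u ^ m)"
    unfolding * using assms(4,5) by (auto simp: eq_divide_eq mult.commute)
qed (use assms in auto)

text \<open>This and the next lemmas are the finite Fourier expansions of the characters; the denominators are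
Gauss sums.\<close>

lemma chim3_roots:
  assumes w: "w ^ 2 + w + 1 = 0"
  shows "chim3 m = (\<Sum>(c, u)\<leftarrow>[(1 / (w - w ^ 2), w), (- 1 / (w - w ^ 2), w ^ 2)]. c * u ^ m)"
proof -
  note W = cube_root_facts[OF w] cube_root_of_unity[OF w]
  have w4: "(w ^ 2) ^ 2 = w" "(w ^ 2) ^ 3 = 1" "w ^ 4 = w"
  proof -
    have "w ^ 4 = w ^ 3 * w" "(w ^ 2) ^ 2 = w ^ 3 * w" "(w ^ 2) ^ 3 = w ^ 3 * w ^ 3" by (simp_all add: pow_expand)
    thus "(w ^ 2) ^ 2 = w" "(w ^ 2) ^ 3 = 1" "w ^ 4 = w" unfolding W(6) by simp_all
  qed
  have "chim3 m = (\<Sum>(c, u)\<leftarrow>map (\<lambda>(e, u). (e / (w - w ^ 2), u)) [(1, w), (- 1, w ^ 2)]. c * u ^ m)"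
  proof (rule signed_root_sum_eqI[of 3])
    fix m :: nat assume "m < 3"
    hence "m = 0 \<or> m = 1 \<or> m = 2" by auto
    thus "(w - w ^ 2) * chim3 m = (\<Sum>(e, u)\<leftarrow>[(1, w), (- 1, w ^ 2)]. e * u ^ m)"
      by (auto simp: table_char_def w4)
  qed (use W w4 in \<open>auto simp: table_char_periodic\<close>)
  thus ?thesis by simp
qed

lemma chim4_roots: "chim4 m = (\<Sum>(c, u)\<leftarrow>[(1 / (2 * \<i>), \<i>), (- 1 / (2 * \<i>), - \<i>)]. c * u ^ m)"
proof -
  have "chim4 m = (\<Sum>(c, u)\<leftarrow>map (\<lambda>(e, u). (e / (2 * \<i>), u)) [(1, \<i>), (- 1, - \<i>)]. c * u ^ m)"
  proof (rule signed_root_sum_eqI[of 4])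
    fix m :: nat assume "m < 4"
    hence "m = 0 \<or> m = 1 \<or> m = 2 \<or> m = 3" by auto
    thus "(2 * \<i>) * chim4 m = (\<Sum>(e, u)\<leftarrow>[(1, \<i>), (- 1, - \<i>)]. e * u ^ m)"
      by (auto simp: table_char_def power3_eq_cube)
  qed (auto simp: table_char_periodic)
  thus ?thesis by simp
qed

lemma
  fixes z :: complex
  assumes z: "z ^ 4 = - 1"
  shows chim8_roots: "chim8 m = (\<Sum>(c, u)\<leftarrow>[(1 / (2 * (z + z ^ 3)), z), (- 1 / (2 * (z + z ^ 3)), - (z ^ 3)),
            (1 / (2 * (z + z ^ 3)), z ^ 3), (- 1 / (2 * (z + z ^ 3)), - z)]. c * u ^ m)"
    and chi8_roots: "chi8 m = (\<Sum>(c, u)\<leftarrow>[(1 / (2 * (z + 1 / z)), z), (1 / (2 * (z + 1 / z)), - (z ^ 3)),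
            (- 1 / (2 * (z + 1 / z)), z ^ 3), (- 1 / (2 * (z + 1 / z)), - z)]. c * u ^ m)"
proof -
  have z8: "z ^ 8 = 1" using z power_add[of z 4 4] by simp
  have zr: "z ^ (8 * k + r) = z ^ r" for k r by (simp add: power_add power_mult z8)
  have zp: "z ^ 5 = - z" "z ^ 6 = - (z ^ 2)" "z ^ 7 = - (z ^ 3)" "z ^ 9 = z" "z ^ 12 = - 1" "z ^ 15 = - (z ^ 3)"
    "z ^ 18 = z ^ 2" "z ^ 21 = - z"
    using z power_add[of z 4 1] power_add[of z 4 2] power_add[of z 4 3] zr[of 1 1] zr[of 1 4] zr[of 1 7] zr[of 2 2] zr[of 2 5]
    by simp_all
  have z3: "(z ^ 3) ^ k = z ^ (3 * k)" for k by (simp flip: power_mult)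
  have z24: "z ^ 24 = 1" using z8 power_mult[of z 8 3] by simp
  have zi: "1 / z = - (z ^ 3)" using eighth_root_norm(3)[OF z] z by (auto simp: divide_eq_eq)
  have nu: "z + 1 / z \<noteq> 0" using eighth_root_facts(6)[OF z] by auto
  have m8: "m = 0 \<or> m = 1 \<or> m = 2 \<or> m = 3 \<or> m = 4 \<or> m = 5 \<or> m = 6 \<or> m = 7" if "m < 8" for m :: nat using that by auto
  have "chim8 m = (\<Sum>(c, u)\<leftarrow>map (\<lambda>(e, u). (e / (2 * (z + z ^ 3)), u)) [(1, z), (- 1, - (z ^ 3)), (1, z ^ 3), (- 1, - z)]. c * u ^ m)"
  proof (rule signed_root_sum_eqI[of 8])
    fix m :: nat assume "m < 8"
    from m8[OF this] show "2 * (z + z ^ 3) * chim8 m = (\<Sum>(e, u)\<leftarrow>[(1, z), (- 1, - (z ^ 3)), (1, z ^ 3), (- 1, - z)]. e * u ^ m)"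
      by (elim disjE) (simp_all add: table_char_def z3 zp z)
  next
    show "2 * (z + z ^ 3) \<noteq> 0" unfolding mult_eq_0_iff using eighth_root_norm(4)[OF z] by simp
  qed (use z8 z24 in \<open>auto simp: table_char_periodic z3\<close>)
  thus "chim8 m = (\<Sum>(c, u)\<leftarrow>[(1 / (2 * (z + z ^ 3)), z), (- 1 / (2 * (z + z ^ 3)), - (z ^ 3)),
            (1 / (2 * (z + z ^ 3)), z ^ 3), (- 1 / (2 * (z + z ^ 3)), - z)]. c * u ^ m)" by simp
  have "chi8 m = (\<Sum>(c, u)\<leftarrow>map (\<lambda>(e, u). (e / (2 * (z + 1 / z)), u)) [(1, z), (1, - (z ^ 3)), (- 1, z ^ 3), (- 1, - z)]. c * u ^ m)"
  proof (rule signed_root_sum_eqI[of 8])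
    fix m :: nat assume "m < 8"
    from m8[OF this] show "2 * (z + 1 / z) * chi8 m = (\<Sum>(e, u)\<leftarrow>[(1, z), (1, - (z ^ 3)), (- 1, z ^ 3), (- 1, - z)]. e * u ^ m)"
      unfolding zi by (elim disjE) (simp_all add: table_char_def z3 zp z)
  next
    show "2 * (z + 1 / z) \<noteq> 0" unfolding mult_eq_0_iff using nu by simp
  qed (use z8 z24 in \<open>auto simp: table_char_periodic z3\<close>)
  thus "chi8 m = (\<Sum>(c, u)\<leftarrow>[(1 / (2 * (z + 1 / z)), z), (1 / (2 * (z + 1 / z)), - (z ^ 3)),
            (- 1 / (2 * (z + 1 / z)), z ^ 3), (- 1 / (2 * (z + 1 / z)), - z)]. c * u ^ m)" by simp
qed

lemma table_char_mod_eqI: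
  fixes f g :: "nat \<Rightarrow> complex"
  assumes "p > 0" "\<And>m. f (m + p) = f m" "\<And>m. g (m + p) = g m" "\<forall>m<p. f m = g m"
  shows "f m = g m"
proof (induction m rule: less_induct)
  case (less m)
  show ?case
  proof (cases "m < p")
    case False
    then obtain l where "m = l + p" by (metis add.commute le_Suc_ex not_less)
    thus ?thesis using less.IH[of l] assms(1-3) by simp
  qed (use assms(4) in auto)
qed

lemma less_12_cases: "m < 12 \<Longrightarrow> m \<in> {0, 1, 2, 3, 4, 5, 6, 7, 8, 9, 10, 11 :: nat}" unfolding insert_iff empty_iff by presburger

lemma less_24_cases: "m < 24 \<Longrightarrow> m \<in> {0, 1, 2, 3, 4, 5, 6, 7, 8, 9, 10, 11, 12, 13, 14, 15, 16, 17, 18, 19, 20, 21, 22, 23 :: nat}" unfolding insert_iff empty_iff by presburger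

lemma table_char_add_multiple: "table_char N ps ms (n + N * k) = table_char N ps ms n"
  by (simp add: table_char_def)

lemma chi12_eq: "chi12 m = chim3 m * chim4 m"
proof (rule table_char_mod_eqI[of 12])
  show "chim3 (m + 12) * chim4 (m + 12) = chim3 m * chim4 m" for m
    using table_char_add_multiple[of 3 _ _ m 4] table_char_add_multiple[of 4 _ _ m 3] by simp
  show "\<forall>m<12. chi12 m = chim3 m * chim4 m"
  proof (intro allI impI)
    fix m :: nat assume "m < 12"
    from less_12_cases[OF this] show "chi12 m = chim3 m * chim4 m"
      unfolding insert_iff empty_iff by (elim disjE) (simp_all add: table_char_def)
  qed
qed (auto simp: table_char_periodic)

lemma chi24_eq: "chi24 m = chim3 m * chim8 m"
proof (rule table_char_mod_eqI[of 24])
  show "chim3 (m + 24) * chim8 (m + 24) = chim3 m * chim8 m" for m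
    using table_char_add_multiple[of 3 _ _ m 8] table_char_add_multiple[of 8 _ _ m 3] by simp
  show "\<forall>m<24. chi24 m = chim3 m * chim8 m"
  proof (intro allI impI)
    fix m :: nat assume "m < 24"
    from less_24_cases[OF this] show "chi24 m = chim3 m * chim8 m"
      unfolding insert_iff empty_iff by (elim disjE) (simp_all add: table_char_def)
  qed
qed (auto simp: table_char_periodic)

lemma chi12_roots:
  fixes w :: complex
  assumes w: "w ^ 2 + w + 1 = 0"
  shows "chi12 m = (\<Sum>(c, u)\<leftarrow>[(1 / (2 * \<i> * (w - w ^ 2)), w * \<i>), (1 / (2 * \<i> * (w - w ^ 2)), - (w ^ 2 * \<i>)),
       (- 1 / (2 * \<i> * (w - w ^ 2)), w ^ 2 * \<i>), (- 1 / (2 * \<i> * (w - w ^ 2)), - (w * \<i>))]. c * u ^ m)"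
proof -
  define \<delta> where "\<delta> = w - w ^ 2"
  have m: "- (w ^ 2 * \<i>) = w ^ 2 * (- \<i>)" "- (w * \<i>) = w * (- \<i>)" by simp_all
  have "chi12 m = (1 / \<delta> * w ^ m - 1 / \<delta> * (w ^ 2) ^ m) * (1 / (2 * \<i>) * \<i> ^ m - 1 / (2 * \<i>) * (- \<i>) ^ m)"
    unfolding chi12_eq chim3_roots[OF w] chim4_roots \<delta>_def by simp
  also have "\<dots> = (\<Sum>(c, u)\<leftarrow>[(1 / (2 * \<i> * \<delta>), w * \<i>), (1 / (2 * \<i> * \<delta>), w ^ 2 * (- \<i>)),
       (- 1 / (2 * \<i> * \<delta>), w ^ 2 * \<i>), (- 1 / (2 * \<i> * \<delta>), w * (- \<i>))]. c * u ^ m)"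
    unfolding list.map sum_list.Cons sum_list.Nil prod.case power_mult_distrib
    by (simp add: algebra_simps)
  finally show ?thesis unfolding m \<delta>_def .
qed

lemma chi24_roots:
  fixes w z :: complex
  assumes w: "w ^ 2 + w + 1 = 0" and z: "z ^ 4 = - 1"
  defines "D \<equiv> 2 * (z + z ^ 3) * (w - w ^ 2)"
  shows "chi24 m = (\<Sum>(c, u)\<leftarrow>[(1 / D, w * z), (1 / D, - (w ^ 2 * z ^ 3)), (- 1 / D, w ^ 2 * z), (- 1 / D, - (w * z ^ 3)),
      (1 / D, w * z ^ 3), (1 / D, - (w ^ 2 * z)), (- 1 / D, w ^ 2 * z ^ 3), (- 1 / D, - (w * z))]. c * u ^ m)"
proof -
  define \<delta> h where "\<delta> = w - w ^ 2" and "h = z + z ^ 3"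
  have D: "D = 2 * h * \<delta>" by (simp add: D_def \<delta>_def h_def)
  define a b where "a = - (z ^ 3)" and "b = - z"
  have m: "- (w ^ 2 * z ^ 3) = w ^ 2 * a" "- (w * z ^ 3) = w * a" "- (w ^ 2 * z) = w ^ 2 * b" "- (w * z) = w * b" by (simp_all add: a_def b_def)
  have "chi24 m = (1 / \<delta> * w ^ m - 1 / \<delta> * (w ^ 2) ^ m) * (1 / (2 * h) * z ^ m - 1 / (2 * h) * a ^ m + 1 / (2 * h) * (z ^ 3) ^ m - 1 / (2 * h) * b ^ m)"
    unfolding chi24_eq chim3_roots[OF w] chim8_roots[OF z] \<delta>_def h_def a_def b_def by simp
  also have "\<dots> = (\<Sum>(c, u)\<leftarrow>[(1 / D, w * z), (1 / D, w ^ 2 * a), (- 1 / D, w ^ 2 * z), (- 1 / D, w * a),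
      (1 / D, w * z ^ 3), (1 / D, w ^ 2 * b), (- 1 / D, w ^ 2 * z ^ 3), (- 1 / D, w * b)]. c * u ^ m)"
    unfolding list.map sum_list.Cons sum_list.Nil prod.case power_mult_distrib D
    by (simp add: algebra_simps)
  finally show ?thesis unfolding m .
qed

lemma koebe_eq: "x \<noteq> 0 \<Longrightarrow> koebe x = 1 / (x + 1 / x - 2)"
proof -
  assume x: "x \<noteq> 0"
  have "x + 1 / x - 2 = (1 - x) ^ 2 / x" using x by (simp add: field_simps power2_eq_square)
  thus ?thesis by (simp add: koebe_def)
qed

text \<open>The constant term of a Lambert series that is twisted by a character modulo 3 and a root of unity \<open>x\<close>.\<close>

lemma koebe_twist:
  assumes w: "w ^ 2 + w + 1 = 0" and x: "x \<noteq> 0" "x + 1 / x + 1 \<noteq> 0"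
  shows "koebe (w * x) - koebe (w ^ 2 * x) = - (w - w ^ 2) * (x - 1 / x) / (x + 1 / x + 1) ^ 2"
proof -
  note c = cube_root_of_unity[OF w]
  define y where "y = 1 / x"
  have xy: "x * y = 1" "y * x = 1" using x(1) by (simp_all add: y_def)
  have i: "1 / (w * x) = w ^ 2 * y" "1 / (w ^ 2 * x) = w * y"
    using c(6,7) by (simp_all add: y_def divide_inverse mult.commute)
  define A B where "A = w * x + w ^ 2 * y - 2" and "B = w ^ 2 * x + w * y - 2"
  have "A * B = w ^ 3 * (x ^ 2 + y ^ 2) + (w ^ 2 + w * w ^ 3) * (x * y) - 2 * (w ^ 2 + w) * (x + y) + 4"
    unfolding A_def B_def by (simp add: pow_expand algebra_simps)
  also have "w * w ^ 3 = w" unfolding c(1) by simp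
  also have "w ^ 2 + w = - 1" using w by (simp add: add_eq_0_iff2)
  finally have "A * B = (x + y + 1) ^ 2 + 3 * (1 - x * y)"
    unfolding c(1) by (simp add: power2_eq_square algebra_simps)
  hence AB: "A * B = (x + y + 1) ^ 2" unfolding xy by simp
  hence nz: "A \<noteq> 0" "B \<noteq> 0" using x(2) unfolding y_def[symmetric] by auto
  have "koebe (w * x) = 1 / A" "koebe (w ^ 2 * x) = 1 / B"
    using koebe_eq[of "w * x"] koebe_eq[of "w ^ 2 * x"] x(1) c(2) unfolding i A_def B_def by simp_all
  hence "koebe (w * x) - koebe (w ^ 2 * x) = (B - A) / (A * B)"
    using nz by (simp add: field_simps)
  also have "B - A = - (w - w ^ 2) * (x - y)" unfolding A_def B_def by (simp add: algebra_simps)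
  finally show ?thesis unfolding AB y_def .
qed

lemma koebe_eighth_root:
  assumes z: "z ^ 4 = - 1" shows "koebe z - koebe (z ^ 3) = - (z + 1 / z)"
proof -
  note f = eighth_root_facts[OF z]
  define \<nu> where "\<nu> = z + 1 / z"
  have "koebe z = 1 / (\<nu> - 2)" "koebe (z ^ 3) = 1 / (- \<nu> - 2)"
    using koebe_eq[of z] koebe_eq[of "z ^ 3"] f(1,7) by (simp_all add: \<nu>_def)
  moreover have \<nu>: "\<nu> * \<nu> = 2" using f(6) by (simp add: \<nu>_def power2_eq_square)
  hence "(\<nu> - 2) * (- \<nu> - 2) = 2" by (simp add: algebra_simps)
  moreover from this have "\<nu> - 2 \<noteq> 0" "- \<nu> - 2 \<noteq> 0" by auto
  ultimately have "koebe z - koebe (z ^ 3) = ((- \<nu> - 2) - (\<nu> - 2)) / 2"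
    by (metis diff_frac_eq mult_1)
  also have "\<dots> = - \<nu>" by simp
  finally show ?thesis by (simp add: \<nu>_def)
qed

lemma koebe_twist_eighth:
  assumes w: "w ^ 2 + w + 1 = 0" and z: "z ^ 4 = - 1"
  shows "(koebe (w * z) - koebe (w ^ 2 * z)) + (koebe (w * z ^ 3) - koebe (w ^ 2 * z ^ 3)) = - 6 * (z + z ^ 3) * (w - w ^ 2)"
proof -
  note f = eighth_root_facts[OF z]
  define \<nu> h \<delta> where "\<nu> = z + 1 / z" and "h = z + z ^ 3" and "\<delta> = w - w ^ 2"
  have \<nu>: "\<nu> * \<nu> = 2" using f(6) by (simp add: \<nu>_def power2_eq_square)
  have e: "(\<nu> + 1) * (1 - \<nu>) = - 1" using \<nu> by (simp add: algebra_simps)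
  hence nz: "\<nu> + 1 \<noteq> 0" "1 - \<nu> \<noteq> 0" by auto
  have i: "z - 1 / z = h" "z ^ 3 - 1 / z ^ 3 = h"
    using eighth_root_norm[OF z] f(1) by (simp_all add: h_def divide_eq_eq eq_diff_eq diff_eq_eq add_eq_0_iff2 field_simps)
  have "koebe (w * z) - koebe (w ^ 2 * z) = - \<delta> * h / (\<nu> + 1) ^ 2"
    using koebe_twist[OF w f(1)] nz(1) unfolding i(1) \<delta>_def \<nu>_def by blast
  moreover have "koebe (w * z ^ 3) - koebe (w ^ 2 * z ^ 3) = - \<delta> * h / (1 - \<nu>) ^ 2"
  proof -
    have "z ^ 3 + 1 / z ^ 3 + 1 = 1 - \<nu>" using f(7) by (simp add: \<nu>_def)
    thus ?thesis using koebe_twist[OF w, of "z ^ 3"] nz(2) f(1) unfolding i(2) \<delta>_def by simp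
  qed
  moreover have "1 / (\<nu> + 1) ^ 2 = (1 - \<nu>) ^ 2" "1 / (1 - \<nu>) ^ 2 = (\<nu> + 1) ^ 2"
  proof -
    have "(\<nu> + 1) ^ 2 * (1 - \<nu>) ^ 2 = 1" using e by (simp flip: power_mult_distrib)
    thus "1 / (\<nu> + 1) ^ 2 = (1 - \<nu>) ^ 2" "1 / (1 - \<nu>) ^ 2 = (\<nu> + 1) ^ 2" using nz by (simp_all add: divide_eq_eq mult.commute)
  qed
  ultimately have "(koebe (w * z) - koebe (w ^ 2 * z)) + (koebe (w * z ^ 3) - koebe (w ^ 2 * z ^ 3)) =
      - \<delta> * h * ((1 - \<nu>) ^ 2 + (\<nu> + 1) ^ 2)"
    by (metis (no_types, lifting) distrib_left mult_1_right times_divide_eq_right)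
  also have "(1 - \<nu>) ^ 2 + (\<nu> + 1) ^ 2 = 6" using \<nu> by (simp add: power2_eq_square algebra_simps)
  also have "- \<delta> * h * 6 = - 6 * h * \<delta>" by simp
  finally show ?thesis unfolding h_def \<delta>_def .
qed

section \<open>Evaluation of the Lambert series\<close>

lemma sum_residues:
  fixes F :: "nat \<Rightarrow> complex"
  shows "(\<Sum>r=1..3. F r) = F 1 + F 2 + F 3"
    "(\<Sum>r=1..4. F r) = F 1 + F 2 + F 3 + F 4"
    "(\<Sum>r=1..8. F r) = F 1 + F 2 + F 3 + F 4 + F 5 + F 6 + F 7 + F 8"
    "(\<Sum>r=1..12. F r) = F 1 + F 2 + F 3 + F 4 + F 5 + F 6 + F 7 + F 8 + F 9 + F 10 + F 11 + F 12"
    "(\<Sum>r=1..24. F r) = F 1 + F 2 + F 3 + F 4 + F 5 + F 6 + F 7 + F 8 + F 9 + F 10 + F 11 + F 12 + F 13 + F 14 + F 15 + F 16 + F 17 + F 18 + F 19 + F 20 + F 21 + F 22 + F 23 + F 24"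
  by (simp_all add: eval_nat_numeral)

text \<open>Averaging over \<open>x\<close> and \<open>- x\<close> keeps the even powers of \<open>\<Sum> m x\<^sup>m\<close>.\<close>

lemma koebe_minus: "x ^ 2 \<noteq> 1 \<Longrightarrow> koebe (- x) = 4 * koebe (x ^ 2) - koebe x"
proof -
  assume "x ^ 2 \<noteq> 1"
  hence nz: "1 - x \<noteq> 0" "1 + x \<noteq> 0" by (auto simp: add_eq_0_iff power2_eq_square)
  have "1 - x ^ 2 = (1 - x) * (1 + x)" by (simp add: power2_eq_square algebra_simps)
  hence "koebe (x ^ 2) = x ^ 2 / ((1 - x) ^ 2 * (1 + x) ^ 2)" by (simp only: koebe_def power_mult_distrib)
  hence "4 * koebe (x ^ 2) - koebe x = (4 * x ^ 2 - x * (1 + x) ^ 2) / ((1 - x) ^ 2 * (1 + x) ^ 2)"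
    using nz by (simp add: koebe_def diff_divide_distrib)
  also have "4 * x ^ 2 - x * (1 + x) ^ 2 = (- x) * (1 - x) ^ 2" by (simp add: power2_eq_square algebra_simps)
  finally show ?thesis using nz by (simp add: koebe_def)
qed

text \<open>Averaging over the cube roots of unity keeps the exponents divisible by 3.\<close>

lemma koebe_cube_roots:
  assumes w: "w ^ 2 + w + 1 = 0" and x: "x ^ 3 \<noteq> 1"
  shows "koebe x + koebe (w * x) + koebe (w ^ 2 * x) = 9 * koebe (x ^ 3)"
proof -
  note W = cube_root_facts[OF w] cube_root_of_unity[OF w]
  define v where "v = w ^ 2"
  have v: "w * v = 1" "w * w = v" "v * v = w" "1 + w + v = 0"
    using W(2,6) w by (simp_all add: v_def power2_eq_square power3_eq_cube add_ac)
  define A B C where "A = 1 - x" and "B = 1 - w * x" and "C = 1 - v * x"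
  have p: "B * C = 1 + x + x ^ 2" "A * C = 1 + w * x + v * x ^ 2" "A * B = 1 + v * x + w * x ^ 2"
  proof -
    have vw: "v = - 1 - w" using v(4) by (simp add: add_eq_0_iff eq_diff_eq add_ac)
    have "B * C = 1 - (w + v) * x + (w * v) * x ^ 2" by (simp add: B_def C_def power2_eq_square algebra_simps)
    thus "B * C = 1 + x + x ^ 2" unfolding v(1) unfolding vw by simp
    show "A * C = 1 + w * x + v * x ^ 2" "A * B = 1 + v * x + w * x ^ 2"
      unfolding A_def B_def C_def vw by (simp_all add: power2_eq_square algebra_simps)
  qed
  have ABC: "A * B * C = 1 - x ^ 3" unfolding mult.assoc p(1) by (simp add: A_def pow_expand algebra_simps)
  hence nz: "A \<noteq> 0" "B \<noteq> 0" "C \<noteq> 0" using x by auto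
  have N: "x * (B * C) ^ 2 + w * x * (A * C) ^ 2 + v * x * (A * B) ^ 2 = 9 * x ^ 3"
  proof -
    have "x * (B * C) ^ 2 + w * x * (A * C) ^ 2 + v * x * (A * B) ^ 2 =
        x * ((1 + w + v) + 2 * (1 + w * w + v * v) * x + (3 + w * (w * w) + 4 * (w * v) + v * (v * v)) * x ^ 2
          + 2 * (1 + w * (w * v) + v * (w * v)) * x ^ 3 + (1 + w * v * v + w * v * w) * x ^ 4)"
      unfolding p by (simp add: pow_expand algebra_simps)
    also have "\<dots> = x * ((1 + w + v) + 2 * (1 + w + v) * x + (3 + w * v + 4 * (w * v) + w * v) * x ^ 2
          + 2 * (1 + w + v) * x ^ 3 + (1 + w + v) * x ^ 4)"
      unfolding v(2,3) unfolding v(1) by (simp add: add_ac mult.commute[of v w] v(1))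
    finally show ?thesis unfolding v(1,4) by (simp add: pow_expand)
  qed
  have "koebe x + koebe (w * x) + koebe (w ^ 2 * x) = x / A ^ 2 + w * x / B ^ 2 + v * x / C ^ 2"
    by (simp add: koebe_def A_def B_def C_def v_def)
  also have "x / A ^ 2 = x * (B * C) ^ 2 / (A * B * C) ^ 2" using nz by (simp add: power_mult_distrib)
  also have "w * x / B ^ 2 = w * x * (A * C) ^ 2 / (A * B * C) ^ 2" using nz by (simp add: power_mult_distrib)
  also have "v * x / C ^ 2 = v * x * (A * B) ^ 2 / (A * B * C) ^ 2" using nz by (simp add: power_mult_distrib)
  finally show ?thesis unfolding add_divide_distrib[symmetric] N ABC koebe_def by simp
qed

lemma koebe_sum_dissect:
  assumes "norm Q < 1"
  shows "koebe_sum x Q = koebe_sum x (Q ^ 2) + koebe_sum (x * Q) (Q ^ 2)"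
proof -
  have Q2: "norm (Q ^ 2) < 1" using assms by (simp add: norm_power power_less_one_iff)
  have "(\<lambda>j. \<Sum>i = j * 2..<j * 2 + 2. koebe (x * Q ^ i)) sums koebe_sum x Q"
    by (rule sums_group[OF koebe_sums[OF assms]]) simp
  also have "(\<lambda>j. \<Sum>i = j * 2..<j * 2 + 2. koebe (x * Q ^ i)) = (\<lambda>j. koebe (x * (Q ^ 2) ^ j) + koebe (x * Q * (Q ^ 2) ^ j))"
  proof
    fix j
    have "Q ^ (j * 2) = (Q ^ 2) ^ j" by (simp flip: power_mult add: mult.commute)
    thus "(\<Sum>i = j * 2..<j * 2 + 2. koebe (x * Q ^ i)) = koebe (x * (Q ^ 2) ^ j) + koebe (x * Q * (Q ^ 2) ^ j)"
      by (simp add: mult_ac)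
  qed
  finally show ?thesis
    using sums_unique2 sums_add[OF koebe_sums[OF Q2, of x] koebe_sums[OF Q2, of "x * Q"]] by blast
qed

lemma koebe_sum_minus:
  assumes Q: "norm Q < 1" and x: "norm x < 1"
  shows "koebe_sum (- x) Q = 4 * koebe_sum (x ^ 2) (Q ^ 2) - koebe_sum x Q"
proof -
  have Q2: "norm (Q ^ 2) < 1" using Q by (simp add: norm_power power_less_one_iff)
  have "koebe (- x * Q ^ k) = 4 * koebe (x ^ 2 * (Q ^ 2) ^ k) - koebe (x * Q ^ k)" for k
  proof -
    have "norm (x * Q ^ k) < 1" using x Q mult_mono[of "norm x" "norm x" "norm Q ^ k" 1]
      by (simp add: norm_mult norm_power power_le_one)
    hence "norm ((x * Q ^ k) ^ 2) < 1" by (simp add: norm_power power_less_one_iff)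
    hence "(x * Q ^ k) ^ 2 \<noteq> 1" by auto
    moreover have "(Q ^ 2) ^ k = (Q ^ k) ^ 2" by (simp flip: power_mult add: mult.commute)
    ultimately show ?thesis using koebe_minus[of "x * Q ^ k"] by (simp add: power_mult_distrib)
  qed
  with koebe_sums[OF Q, of "- x"] sums_diff[OF sums_mult[OF koebe_sums[OF Q2, of "x ^ 2"], of 4] koebe_sums[OF Q, of x]]
  show ?thesis by (simp add: sums_unique2)
qed

lemma koebe_sum_cube_roots:
  assumes Q: "norm Q < 1" and x: "norm x < 1" and w: "w ^ 2 + w + 1 = 0"
  shows "koebe_sum (w * x) Q + koebe_sum (w ^ 2 * x) Q = 9 * koebe_sum (x ^ 3) (Q ^ 3) - koebe_sum x Q"
proof -
  have Q2: "norm (Q ^ 3) < 1" using Q by (simp add: norm_power power_less_one_iff)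
  have "koebe (w * x * Q ^ k) + koebe (w ^ 2 * x * Q ^ k) = 9 * koebe (x ^ 3 * (Q ^ 3) ^ k) - koebe (x * Q ^ k)" for k
  proof -
    have "norm (x * Q ^ k) < 1" using x Q mult_mono[of "norm x" "norm x" "norm Q ^ k" 1]
      by (simp add: norm_mult norm_power power_le_one)
    hence "norm ((x * Q ^ k) ^ 3) < 1" by (simp add: norm_power power_less_one_iff)
    hence "(x * Q ^ k) ^ 3 \<noteq> 1" by auto
    moreover have "(Q ^ 3) ^ k = (Q ^ k) ^ 3" by (simp flip: power_mult add: mult.commute)
    ultimately show ?thesis using koebe_cube_roots[OF w, of "x * Q ^ k"] by (simp add: power_mult_distrib mult.assoc eq_diff_eq add_ac)
  qed
  with sums_add[OF koebe_sums[OF Q, of "w * x"] koebe_sums[OF Q, of "w ^ 2 * x"]]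
    sums_diff[OF sums_mult[OF koebe_sums[OF Q2, of "x ^ 3"], of 9] koebe_sums[OF Q, of x]]
  show ?thesis by (simp add: sums_unique2)
qed

context nome
begin

lemma koebe_sum_reflect: "k \<le> N \<Longrightarrow> a * b = 1 \<Longrightarrow> koebe_sum (q ^ N / (a * q ^ k)) (q ^ N) = koebe_sum (b * q ^ (N - k)) (q ^ N)"
proof -
  assume "k \<le> N" "a * b = 1"
  moreover from this have "b = 1 / a" by (auto simp: eq_divide_eq mult.commute)
  ultimately show ?thesis using q_nz by (simp add: power_diff)
qed

lemma koebe_sum_reflect_1: "a * b = 1 \<Longrightarrow> koebe_sum (q / a) q = koebe_sum (b * q) q"
  using koebe_sum_reflect[of 0 1 a b] by simp

lemma table_sums:
  assumes "N > 0" "\<And>m. table_char M ps ms m = (\<Sum>(c, u)\<leftarrow>cs. c * u ^ m)" "\<And>c u. (c, u) \<in> set cs \<Longrightarrow> norm u \<le> 1"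
  shows "(\<lambda>n. divsum (table_char M ps ms) (table_char N ps' ms') n * q ^ n) sums
     (\<Sum>r=1..N. table_char N ps' ms' r * (\<Sum>(c, u)\<leftarrow>cs. c * koebe_sum (u * q ^ r) (q ^ N)))"
  by (rule divsum_sums) (rule norm_q assms table_char_periodic table_char_norm | assumption)+

lemma table_sums_trivial:
  assumes "\<And>m. table_char M ps ms m = (\<Sum>(c, u)\<leftarrow>cs. c * u ^ m)" "\<And>c u. (c, u) \<in> set cs \<Longrightarrow> norm u \<le> 1"
  shows "(\<lambda>n. divsum (table_char M ps ms) chi1 n * q ^ n) sums (\<Sum>(c, u)\<leftarrow>cs. c * koebe_sum (u * q) q)"
proof -
  have "(\<lambda>n. divsum (table_char M ps ms) chi1 n * q ^ n) sums
     (\<Sum>r=1..1. chi1 r * (\<Sum>(c, u)\<leftarrow>cs. c * koebe_sum (u * q ^ r) (q ^ 1)))"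
    by (rule divsum_sums[OF norm_q _ _ table_char_norm _ assms]) (assumption | simp)+
  thus ?thesis by simp
qed

text \<open>The Lambert series of \<open>\<sigma>\<close> at \<open>q\<^sup>k\<close>, a single Eisenstein series of weight two without its constant term. It is
not modular on its own, so only suitable combinations are eta quotients.\<close>

definition s :: "nat \<Rightarrow> complex" where "s k = koebe_sum (q ^ k) (q ^ k)"

lemma sigma_sums: "k > 0 \<Longrightarrow> (\<lambda>n. divsum chi1 chi1 n * (q ^ k) ^ n) sums s k"
  using divsum_sums[OF norm_qk, of k 1 chi1 chi1 "[(1, 1)]"] by (simp add: s_def)

text \<open>For an even character modulo \<open>N\<close> the residues \<open>r\<close> and \<open>N - r\<close> combine to a Weierstrass value. The
following evaluations all have this pattern; when both characters are odd, the two minus signs cancel.\<close>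

lemma S18_sums: "(\<lambda>n. divsum chi1 chi8 n * q ^ n) sums (q * E 2 ^ 3 * E 4 * E 8 ^ 2 / E (Suc 0) ^ 2)"
proof -
  have "(\<lambda>n. divsum chi1 chi8 n * q ^ n) sums (\<Sum>r=1..8. chi8 r * (\<Sum>(c, u)\<leftarrow>[(1, 1)]. c * koebe_sum (u * q ^ r) (q ^ 8)))"
    by (rule divsum_sums[OF norm_q]) (auto simp: table_char_norm table_char_periodic)
  also have "(\<Sum>r=1..8. chi8 r * (\<Sum>(c, u)\<leftarrow>[(1, 1)]. c * koebe_sum (u * q ^ r) (q ^ 8))) = weier q (q ^ 8) - weier (q ^ 3) (q ^ 8)"
    using koebe_sum_reflect[of 1 8 1 1] koebe_sum_reflect[of 3 8 1 1]
    unfolding sum_residues by (simp add: table_char_def weier_def)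
  finally show ?thesis unfolding weier_chi8_q .
qed

lemma S112_sums: "(\<lambda>n. divsum chi1 chi12 n * q ^ n) sums (q * E 2 ^ 2 * E 3 ^ 2 * E 4 * E 12 / E (Suc 0) ^ 2)"
proof -
  have "(\<lambda>n. divsum chi1 chi12 n * q ^ n) sums (\<Sum>r=1..12. chi12 r * (\<Sum>(c, u)\<leftarrow>[(1, 1)]. c * koebe_sum (u * q ^ r) (q ^ 12)))"
    by (rule divsum_sums[OF norm_q]) (auto simp: table_char_norm table_char_periodic)
  also have "(\<Sum>r=1..12. chi12 r * (\<Sum>(c, u)\<leftarrow>[(1, 1)]. c * koebe_sum (u * q ^ r) (q ^ 12))) = - (weier (q ^ 7) (q ^ 12) - weier (q ^ 11) (q ^ 12))"
    using koebe_sum_reflect[of 7 12 1 1] koebe_sum_reflect[of 11 12 1 1] unfolding sum_residues by (simp add: table_char_def weier_def)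
  finally show ?thesis unfolding weier_S112 by simp
qed

lemma S124_sums: "(\<lambda>n. divsum chi1 chi24 n * q ^ n) sums (eta_g' * (phi (Suc 0) * phi 3 + phi 2 * phi 6) / 2)"
proof -
  have "(\<lambda>n. divsum chi1 chi24 n * q ^ n) sums (\<Sum>r=1..24. chi24 r * (\<Sum>(c, u)\<leftarrow>[(1, 1)]. c * koebe_sum (u * q ^ r) (q ^ 24)))"
    by (rule divsum_sums[OF norm_q]) (auto simp: table_char_norm table_char_periodic)
  also have "(\<Sum>r=1..24. chi24 r * (\<Sum>(c, u)\<leftarrow>[(1, 1)]. c * koebe_sum (u * q ^ r) (q ^ 24))) =
     - ((weier (q ^ 11) (q ^ 24) - weier (q ^ 19) (q ^ 24)) + (weier (q ^ 17) (q ^ 24) - weier q (q ^ 24)))"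
    using koebe_sum_reflect[of 11 24 1 1] koebe_sum_reflect[of 19 24 1 1] koebe_sum_reflect[of 17 24 1 1] koebe_sum_reflect[of 1 24 1 1]
    unfolding sum_residues by (simp add: table_char_def weier_def)
  also have "weier q (q ^ 24) = weier (q ^ 25) (q ^ 24)"
    using weier_shift[OF norm_qk qk_nz q_nz, of 24] by (simp flip: power_Suc)
  finally show ?thesis unfolding weier_S124 by simp
qed

lemma S34_sums: "(\<lambda>n. divsum chim3 chim4 n * q ^ n) sums (q * E (Suc 0) ^ 2 * E 4 * E 6 ^ 2 * E 12 / E 3 ^ 2)"
proof -
  obtain w :: complex where w: "w ^ 2 + w + 1 = 0" by (rule cube_root_exists)
  note W = cube_root_facts[OF w]
  define \<delta> where "\<delta> = w - w ^ 2"
  let ?cs = "[(1 / \<delta>, w), (- 1 / \<delta>, w ^ 2)]"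
  have "(\<lambda>n. divsum chim3 chim4 n * q ^ n) sums (\<Sum>r=1..4. chim4 r * (\<Sum>(c, u)\<leftarrow>?cs. c * koebe_sum (u * q ^ r) (q ^ 4)))"
    by (rule table_sums[OF _ chim3_roots[OF w, folded \<delta>_def]])
       (use W(1) in \<open>auto simp: norm_power\<close>)
  also have "(\<Sum>r=1..4. chim4 r * (\<Sum>(c, u)\<leftarrow>?cs. c * koebe_sum (u * q ^ r) (q ^ 4))) =
     (weier (w * q) (q ^ 4) - weier (w ^ 2 * q) (q ^ 4)) / \<delta>"
    using koebe_sum_reflect[of 1 4 w "w ^ 2"] koebe_sum_reflect[of 1 4 "w ^ 2" w] W(2,3)
    unfolding sum_residues by (simp add: table_char_def weier_def add_divide_distrib diff_divide_distrib)
  also have "\<dots> = q * E (Suc 0) ^ 2 * E 4 * E 6 ^ 2 * E 12 / E 3 ^ 2"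
    unfolding weier_S34[OF w] \<delta>_def[symmetric] using W(4)[folded \<delta>_def] by simp
  finally show ?thesis .
qed

lemma S38_sums: "(\<lambda>n. divsum chim3 chim8 n * q ^ n) sums (eta_g * (phi (Suc 0) * phi 3 - phi 2 * phi 6) / 2)"
proof -
  obtain w :: complex where w: "w ^ 2 + w + 1 = 0" by (rule cube_root_exists)
  note W = cube_root_facts[OF w]
  define \<delta> where "\<delta> = w - w ^ 2"
  let ?cs = "[(1 / \<delta>, w), (- 1 / \<delta>, w ^ 2)]"
  have "(\<lambda>n. divsum chim3 chim8 n * q ^ n) sums (\<Sum>r=1..8. chim8 r * (\<Sum>(c, u)\<leftarrow>?cs. c * koebe_sum (u * q ^ r) (q ^ 8)))"
    by (rule table_sums[OF _ chim3_roots[OF w, folded \<delta>_def]])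
       (use W(1) in \<open>auto simp: norm_power\<close>)
  also have "(\<Sum>r=1..8. chim8 r * (\<Sum>(c, u)\<leftarrow>?cs. c * koebe_sum (u * q ^ r) (q ^ 8))) =
     ((weier (w * q) (q ^ 8) - weier (w ^ 2 * q) (q ^ 8)) + (weier (w * q ^ 3) (q ^ 8) - weier (w ^ 2 * q ^ 3) (q ^ 8))) / \<delta>"
    using koebe_sum_reflect[of 1 8 w "w ^ 2"] koebe_sum_reflect[of 1 8 "w ^ 2" w] koebe_sum_reflect[of 3 8 w "w ^ 2"] koebe_sum_reflect[of 3 8 "w ^ 2" w] W(2,3)
    unfolding sum_residues by (simp add: table_char_def weier_def add_divide_distrib diff_divide_distrib)
  also have "\<dots> = eta_g * (phi (Suc 0) * phi 3 - phi 2 * phi 6) / 2"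
    unfolding weier_S38[OF w] \<delta>_def[symmetric] using W(4)[folded \<delta>_def] by simp
  finally show ?thesis .
qed

lemma S43_sums: "(\<lambda>n. divsum chim4 chim3 n * q ^ n) sums (q * E (Suc 0) * E 2 ^ 2 * E 3 * E 12 ^ 2 / E 4 ^ 2)"
proof -
  define D where "D = 2 * \<i>"
  let ?cs = "[(1 / D, \<i>), (- 1 / D, - \<i>)]"
  have "(\<lambda>n. divsum chim4 chim3 n * q ^ n) sums (\<Sum>r=1..3. chim3 r * (\<Sum>(c, u)\<leftarrow>?cs. c * koebe_sum (u * q ^ r) (q ^ 3)))"
    by (rule table_sums[OF _ chim4_roots[folded D_def]]) auto
  also have "(\<Sum>r=1..3. chim3 r * (\<Sum>(c, u)\<leftarrow>?cs. c * koebe_sum (u * q ^ r) (q ^ 3))) =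
     (weier (\<i> * q) (q ^ 3) - weier (\<i> * q ^ 2) (q ^ 3)) / D"
    using koebe_sum_reflect[of 1 3 \<i> "- \<i>"] koebe_sum_reflect[of 2 3 \<i> "- \<i>"]
    unfolding sum_residues by (simp add: table_char_def weier_def add_divide_distrib diff_divide_distrib)
  also have "\<dots> = q * E (Suc 0) * E 2 ^ 2 * E 3 * E 12 ^ 2 / E 4 ^ 2"
    by (subst weier_S43) (simp_all add: D_def)
  finally show ?thesis .
qed

lemma S83_sums: "(\<lambda>n. divsum chim8 chim3 n * q ^ n) sums (eta_g' * (2 * phi 2 * phi 6 - phi (Suc 0) * phi 3))"
proof -
  obtain z :: complex where z: "z ^ 4 = - 1" by (rule eighth_root_exists)
  obtain w :: complex where w: "w ^ 2 + w + 1 = 0" by (rule cube_root_exists)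
  note Z = eighth_root_facts[OF z] eighth_root_norm[OF z]
  define h where "h = z + z ^ 3"
  let ?cs = "[(1 / (2 * h), z), (- 1 / (2 * h), - (z ^ 3)), (1 / (2 * h), z ^ 3), (- 1 / (2 * h), - z)]"
  have "(\<lambda>n. divsum chim8 chim3 n * q ^ n) sums (\<Sum>r=1..3. chim3 r * (\<Sum>(c, u)\<leftarrow>?cs. c * koebe_sum (u * q ^ r) (q ^ 3)))"
    by (rule table_sums[OF _ chim8_roots[OF z, folded h_def]])
       (use Z(11) in \<open>auto simp: norm_power\<close>)
  also have "(\<Sum>r=1..3. chim3 r * (\<Sum>(c, u)\<leftarrow>?cs. c * koebe_sum (u * q ^ r) (q ^ 3))) =
     ((weier (z * q) (q ^ 3) - weier (z * q ^ 2) (q ^ 3)) + (weier (z ^ 3 * q) (q ^ 3) - weier (z ^ 3 * q ^ 2) (q ^ 3))) / (2 * h)"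
    using koebe_sum_reflect[of 1 3 z "- (z ^ 3)"] koebe_sum_reflect[of 2 3 z "- (z ^ 3)"] koebe_sum_reflect[of 1 3 "z ^ 3" "- z"] koebe_sum_reflect[of 2 3 "z ^ 3" "- z"] Z(12,13)
    unfolding sum_residues by (simp add: table_char_def weier_def add_divide_distrib diff_divide_distrib)
  also have "\<dots> = eta_g' * (2 * phi 2 * phi 6 - phi (Suc 0) * phi 3)"
    unfolding weier_S83[OF z w] h_def[symmetric] using Z(14)[folded h_def] by simp
  finally show ?thesis .
qed

text \<open>When the outer character is trivial, the Weierstrass values are taken on the unit circle, and the terms that are
split off produce the constant \<open>1 / 2\<close>.\<close>

lemma S81_sums: "(\<lambda>n. divsum chi8 chi1 n * q ^ n) sums ((1 - E (Suc 0) ^ 2 * E 2 * E 4 ^ 3 / E 8 ^ 2) / 2)"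
proof -
  obtain z :: complex where z: "z ^ 4 = - 1" by (rule eighth_root_exists)
  note Z = eighth_root_facts[OF z] eighth_root_norm[OF z]
  define \<nu> where "\<nu> = z + 1 / z"
  have \<nu>: "\<nu> \<noteq> 0" using Z(6) by (auto simp: \<nu>_def)
  let ?cs = "[(1 / (2 * \<nu>), z), (1 / (2 * \<nu>), - (z ^ 3)), (- 1 / (2 * \<nu>), z ^ 3), (- 1 / (2 * \<nu>), - z)]"
  have "(\<lambda>n. divsum chi8 chi1 n * q ^ n) sums (\<Sum>(c, u)\<leftarrow>?cs. c * koebe_sum (u * q) q)"
    by (rule table_sums_trivial[OF chi8_roots[OF z, folded \<nu>_def]])
       (use Z(11) in \<open>auto simp: norm_power\<close>)
  also have "(\<Sum>(c, u)\<leftarrow>?cs. c * koebe_sum (u * q) q) =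
     ((weier z q - koebe z) - (weier (z ^ 3) q - koebe (z ^ 3))) / (2 * \<nu>)"
    using koebe_sum_reflect_1[of z "- (z ^ 3)"] koebe_sum_reflect_1[of "z ^ 3" "- z"] Z(12,13)
    by (simp add: weier_unit[OF norm_q] add_divide_distrib diff_divide_distrib)
  also have "\<dots> = ((weier z q - weier (z ^ 3) q) - (koebe z - koebe (z ^ 3))) / (2 * \<nu>)" by simp
  also have "koebe z - koebe (z ^ 3) = - \<nu>" unfolding \<nu>_def by (rule koebe_eighth_root[OF z])
  also have "(weier z q - weier (z ^ 3) q - - \<nu>) / (2 * \<nu>) = (1 - E (Suc 0) ^ 2 * E 2 * E 4 ^ 3 / E 8 ^ 2) / 2"
    unfolding weier_chi8_root[OF z] \<nu>_def[symmetric] using \<nu> by (simp add: field_simps)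
  finally show ?thesis .
qed

lemma S121_sums: "(\<lambda>n. divsum chi12 chi1 n * q ^ n) sums (1 - E (Suc 0) * E 3 * E 4 ^ 2 * E 6 ^ 2 / E 12 ^ 2)"
proof -
  obtain w :: complex where w: "w ^ 2 + w + 1 = 0" by (rule cube_root_exists)
  note W = cube_root_facts[OF w]
  define \<delta> D where "\<delta> = w - w ^ 2" and "D = 2 * \<i> * \<delta>"
  have D: "D \<noteq> 0" using W(4) by (simp add: D_def \<delta>_def)
  let ?cs = "[(1 / D, w * \<i>), (1 / D, - (w ^ 2 * \<i>)), (- 1 / D, w ^ 2 * \<i>), (- 1 / D, - (w * \<i>))]"
  have "(\<lambda>n. divsum chi12 chi1 n * q ^ n) sums (\<Sum>(c, u)\<leftarrow>?cs. c * koebe_sum (u * q) q)"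
    by (rule table_sums_trivial[OF chi12_roots[OF w, folded \<delta>_def, folded D_def]])
       (use W(1) in \<open>auto simp: norm_power norm_mult\<close>)
  also have "(\<Sum>(c, u)\<leftarrow>?cs. c * koebe_sum (u * q) q) =
     ((weier (w * \<i>) q - koebe (w * \<i>)) - (weier (w ^ 2 * \<i>) q - koebe (w ^ 2 * \<i>))) / D"
  proof -
    have "x * \<i> * (- (y * \<i>)) = - (x * y * (\<i> * \<i>))" for x y by (simp only: mult_minus_right mult_ac)
    hence i: "x * \<i> * (- (y * \<i>)) = x * y" for x y by simp
    have "w * \<i> * (- (w ^ 2 * \<i>)) = 1" "w ^ 2 * \<i> * (- (w * \<i>)) = 1" unfolding i W(2,3) by simp_all
    note R = this[THEN koebe_sum_reflect_1]
    show ?thesis unfolding weier_unit[OF norm_q] R by (simp add: add_divide_distrib diff_divide_distrib)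
  qed
  also have "\<dots> = ((weier (w * \<i>) q - weier (w ^ 2 * \<i>) q) - (koebe (w * \<i>) - koebe (w ^ 2 * \<i>))) / D" by simp
  also have "koebe (w * \<i>) - koebe (w ^ 2 * \<i>) = - D"
  proof -
    have "koebe (w * \<i>) - koebe (w ^ 2 * \<i>) = - \<delta> * (\<i> - 1 / \<i>) / (\<i> + 1 / \<i> + 1) ^ 2"
      unfolding \<delta>_def by (rule koebe_twist[OF w]) simp_all
    thus ?thesis by (simp add: D_def)
  qed
  also have "(weier (w * \<i>) q - weier (w ^ 2 * \<i>) q - - D) / D = 1 - E (Suc 0) * E 3 * E 4 ^ 2 * E 6 ^ 2 / E 12 ^ 2"
  proof -
    have "weier (w * \<i>) q - weier (w ^ 2 * \<i>) q = - D * (E (Suc 0) * E 3 * E 4 ^ 2 * E 6 ^ 2 / E 12 ^ 2)"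
      by (subst weier_S121[OF w]) (simp_all add: D_def \<delta>_def)
    thus ?thesis using D by (simp add: field_simps)
  qed
  finally show ?thesis .
qed

lemma S241_sums: "(\<lambda>n. divsum chi24 chi1 n * q ^ n) sums (3 - eta_g * (phi (Suc 0) * phi 3 + 2 * phi 2 * phi 6))"
proof -
  obtain w :: complex where w: "w ^ 2 + w + 1 = 0" by (rule cube_root_exists)
  note W = cube_root_facts[OF w]
  obtain z :: complex where z: "z ^ 4 = - 1" by (rule eighth_root_exists)
  note Z = eighth_root_facts[OF z] eighth_root_norm[OF z]
  define \<delta> h D where "\<delta> = w - w ^ 2" and "h = z + z ^ 3" and "D = 2 * h * \<delta>"
  have D: "D \<noteq> 0" unfolding D_def mult_eq_0_iff using W(4)[folded \<delta>_def] Z(14)[folded h_def] by simp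
  let ?cs = "[(1 / D, w * z), (1 / D, - (w ^ 2 * z ^ 3)), (- 1 / D, w ^ 2 * z), (- 1 / D, - (w * z ^ 3)),
      (1 / D, w * z ^ 3), (1 / D, - (w ^ 2 * z)), (- 1 / D, w ^ 2 * z ^ 3), (- 1 / D, - (w * z))]"
  have "(\<lambda>n. divsum chi24 chi1 n * q ^ n) sums (\<Sum>(c, u)\<leftarrow>?cs. c * koebe_sum (u * q) q)"
    by (rule table_sums_trivial[OF chi24_roots[OF w z, folded \<delta>_def h_def, folded D_def]])
       (use W(1) Z(11) in \<open>auto simp: norm_power norm_mult\<close>)
  also have "(\<Sum>(c, u)\<leftarrow>?cs. c * koebe_sum (u * q) q) =
     ((weier (w * z) q - koebe (w * z)) - (weier (w ^ 2 * z) q - koebe (w ^ 2 * z))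
      + (weier (w * z ^ 3) q - koebe (w * z ^ 3)) - (weier (w ^ 2 * z ^ 3) q - koebe (w ^ 2 * z ^ 3))) / D"
  proof -
    have "w * z * (- (w ^ 2 * z ^ 3)) = - ((w * w ^ 2) * (z * z ^ 3))" "w ^ 2 * z * (- (w * z ^ 3)) = - ((w * w ^ 2) * (z * z ^ 3))"
      "w * z ^ 3 * (- (w ^ 2 * z)) = - ((w * w ^ 2) * (z * z ^ 3))" "w ^ 2 * z ^ 3 * (- (w * z)) = - ((w * w ^ 2) * (z * z ^ 3))"
      by (simp_all only: mult_minus_right mult_minus_left minus_minus mult_ac)
    hence "w * z * (- (w ^ 2 * z ^ 3)) = 1" "w ^ 2 * z * (- (w * z ^ 3)) = 1" "w * z ^ 3 * (- (w ^ 2 * z)) = 1" "w ^ 2 * z ^ 3 * (- (w * z)) = 1"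
      unfolding W(2) Z(12) by simp_all
    note R = this[THEN koebe_sum_reflect_1]
    show ?thesis unfolding weier_unit[OF norm_q] R by (simp add: add_divide_distrib diff_divide_distrib)
  qed
  also have "\<dots> = (((weier (w * z) q - weier (w ^ 2 * z) q) + (weier (w * z ^ 3) q - weier (w ^ 2 * z ^ 3) q))
     - ((koebe (w * z) - koebe (w ^ 2 * z)) + (koebe (w * z ^ 3) - koebe (w ^ 2 * z ^ 3)))) / D" by (simp add: algebra_simps)
  also have "(koebe (w * z) - koebe (w ^ 2 * z)) + (koebe (w * z ^ 3) - koebe (w ^ 2 * z ^ 3)) = - 3 * D"
    unfolding koebe_twist_eighth[OF w z] D_def \<delta>_def[symmetric] h_def[symmetric] by simp
  also have "((weier (w * z) q - weier (w ^ 2 * z) q) + (weier (w * z ^ 3) q - weier (w ^ 2 * z ^ 3) q)) =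
     - D * (eta_g * (phi (Suc 0) * phi 3 + 2 * phi 2 * phi 6))"
    unfolding weier_S241[OF z w] D_def \<delta>_def[symmetric] h_def[symmetric] by simp
  also have "(- D * (eta_g * (phi (Suc 0) * phi 3 + 2 * phi 2 * phi 6)) - - 3 * D) / D = 3 - eta_g * (phi (Suc 0) * phi 3 + 2 * phi 2 * phi 6)"
    using D by (simp add: field_simps)
  finally show ?thesis .
qed

lemma koebe_sum_half: "k > 0 \<Longrightarrow> koebe_sum (q ^ k) (q ^ (2 * k)) = s k - s (2 * k)"
  using koebe_sum_dissect[OF norm_qk, of k "q ^ k"]
  by (simp add: s_def mult.commute[of 2] power_mult power2_eq_square)

lemma koebe_sum_minus_period: "k > 0 \<Longrightarrow> koebe_sum (- (q ^ k)) (q ^ k) = 4 * s (2 * k) - s k"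
  using koebe_sum_minus[OF norm_qk norm_qk, of k k]
  by (simp add: s_def mult.commute[of 2] power_mult)

lemma weier_half: "weier q (q ^ 2) = 2 * (s (Suc 0) - s 2)"
  using koebe_sum_half[of "Suc 0"] q_nz by (simp add: weier_def power2_eq_square)

lemma weier_minus_one: "k > 0 \<Longrightarrow> weier (- 1) (q ^ k) = 2 * (4 * s (2 * k) - s k) - 1 / 4"
  using koebe_sum_minus_period[of k] by (simp add: weier_unit[OF norm_qk] koebe_def)

text \<open>At points of order two and three the Weierstrass function is a combination of values of \<open>s\<close>, because
averaging over a subgroup of the curve only replaces \<open>q\<close> by a power.\<close>

lemma s_jacobi: "1 / 4 + 2 * s (Suc 0) - 8 * s 4 = E 2 ^ 20 / (4 * E (Suc 0) ^ 8 * E 4 ^ 8)"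
  unfolding weier_jacobi[symmetric] weier_half using weier_minus_one[of 2] by simp

lemma s_odd: "4 * s (Suc 0) - 12 * s 2 + 8 * s 4 = 4 * q * E 4 ^ 8 / E 2 ^ 4"
proof -
  have "koebe_sum (- q) (q ^ 2) = 4 * koebe_sum (q ^ 2) (q ^ 4) - koebe_sum q (q ^ 2)"
    using koebe_sum_minus[of "q ^ 2" q] norm_qk[of 2] norm_q by (simp flip: power_mult)
  hence "weier (- q) (q ^ 2) = 2 * (4 * koebe_sum (q ^ 2) (q ^ 4) - koebe_sum q (q ^ 2))"
    using q_nz by (simp add: weier_def power2_eq_square)
  moreover have "koebe_sum q (q ^ 2) = s (Suc 0) - s 2" "koebe_sum (q ^ 2) (q ^ 4) = s 2 - s 4"
    using koebe_sum_half[of "Suc 0"] koebe_sum_half[of 2] by simp_all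
  ultimately show ?thesis unfolding weier_odd[symmetric] weier_half by simp
qed

lemma s_hexagonal: "1 / 12 - s (Suc 0) + 8 * s 2 - 9 * s 3 = E (Suc 0) ^ 12 * E 6 ^ 2 / (12 * E 2 ^ 6 * E 3 ^ 4)"
proof -
  obtain w :: complex where w: "w ^ 2 + w + 1 = 0" by (rule cube_root_exists)
  note W = cube_root_facts[OF w]
  have "(1 - w) ^ 2 = (w ^ 2 + w + 1) - 3 * w" by (simp add: power2_eq_square algebra_simps)
  hence "koebe w = - 1 / 3" unfolding koebe_def using w cube_root_of_unity(2)[OF w] by simp
  moreover have "koebe_sum (w * q) q + koebe_sum (q / w) q = 9 * s 3 - s (Suc 0)"
    using koebe_sum_cube_roots[OF norm_q norm_q w] koebe_sum_reflect_1[OF W(2)] by (simp add: s_def)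
  ultimately have "weier w q = - 1 / 3 + (9 * s 3 - s (Suc 0))"
    by (simp add: weier_unit[OF norm_q] add.assoc)
  thus ?thesis unfolding weier_hexagonal[OF w, symmetric] using weier_minus_one[of "Suc 0"] by simp
qed

end

section \<open>Kronecker symbols and divisor sums\<close>

lemma table_char_mod: "table_char N ps ms (m mod N) = table_char N ps ms m"
  by (simp add: table_char_def)

lemma table_char_mult_mod: "table_char N ps ms (m * n) = table_char N ps ms ((m mod N) * (n mod N))"
  by (simp add: table_char_def mod_mult_eq)

lemma less_8_cases: "m < 8 \<Longrightarrow> m \<in> {0, 1, 2, 3, 4, 5, 6, 7 :: nat}"
  unfolding insert_iff empty_iff by presburger

lemma table_char_multI:
  assumes "N > 0" "\<And>a b. a < N \<Longrightarrow> b < N \<Longrightarrow> table_char N ps ms (a * b) = table_char N ps ms a * table_char N ps ms b"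
  shows "table_char N ps ms (m * n) = table_char N ps ms m * table_char N ps ms n"
  using assms(2)[of "m mod N" "n mod N"] assms(1)
  by (simp add: table_char_mod table_char_mult_mod[symmetric])

lemma chim3_mult: "chim3 (m * n) = chim3 m * chim3 n"
proof (rule table_char_multI)
  fix a b :: nat assume "a < 3" "b < 3"
  hence "a = 0 \<or> a = 1 \<or> a = 2" "b = 0 \<or> b = 1 \<or> b = 2" by auto
  thus "chim3 (a * b) = chim3 a * chim3 b" by (elim disjE) (simp_all add: table_char_def)
qed simp

lemma chim4_mult: "chim4 (m * n) = chim4 m * chim4 n"
proof (rule table_char_multI)
  fix a b :: nat assume "a < 4" "b < 4"
  hence "a = 0 \<or> a = 1 \<or> a = 2 \<or> a = 3" "b = 0 \<or> b = 1 \<or> b = 2 \<or> b = 3" by auto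
  thus "chim4 (a * b) = chim4 a * chim4 b" by (elim disjE) (simp_all add: table_char_def)
qed simp

lemma chi8_mult: "chi8 (m * n) = chi8 m * chi8 n"
proof (rule table_char_multI)
  fix a b :: nat assume "a < 8" "b < 8"
  from this[THEN less_8_cases] show "chi8 (a * b) = chi8 a * chi8 b"
    unfolding insert_iff empty_iff by (elim disjE) (simp_all add: table_char_def)
qed simp

lemma chim8_eq: "chim8 m = chim4 m * chi8 m"
proof (rule table_char_mod_eqI[of 8])
  show "chim4 (m + 8) * chi8 (m + 8) = chim4 m * chi8 m" for m
    using table_char_add_multiple[of 4 _ _ m 2] table_char_add_multiple[of 8 _ _ m 1] by simp
  show "\<forall>m<8. chim8 m = chim4 m * chi8 m"
  proof (intro allI impI)
    fix m :: nat assume "m < 8"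
    from less_8_cases[OF this] show "chim8 m = chim4 m * chi8 m"
      unfolding insert_iff empty_iff by (elim disjE) (simp_all add: table_char_def)
  qed
qed (auto simp: table_char_periodic)

lemma table_char_mults:
  "chim8 (m * n) = chim8 m * chim8 n" "chi12 (m * n) = chi12 m * chi12 n" "chi24 (m * n) = chi24 m * chi24 n"
  unfolding chi12_eq chi24_eq chim8_eq chim3_mult chim4_mult chi8_mult by (simp_all only: mult_ac)

lemma table_char_square: "table_char N ps ms m \<noteq> 0 \<Longrightarrow> table_char N ps ms m * table_char N ps ms m = 1"
  by (auto simp: table_char_def split: if_splits)

lemma Legendre_values: "Legendre a p \<in> {- 1, 0, 1}" by (simp add: Legendre_def)

lemma Legendre_eqI:
  assumes "2 < p" "x \<in> {- 1, 0, 1 :: int}" "y \<in> {- 1, 0, 1 :: int}" "[x = y] (mod int p)"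
  shows "x = y"
proof -
  have "int p dvd x - y" using assms(4) by (simp add: cong_iff_dvd_diff)
  moreover have "\<bar>x - y\<bar> < int p" using assms(1-3) by auto
  ultimately show ?thesis using dvd_imp_le_int[of "x - y" "int p"] by fastforce
qed

lemma Legendre_mult:
  assumes p: "prime p" "2 < p"
  shows "Legendre (a * b) (int p) = Legendre a (int p) * Legendre b (int p)"
proof (rule Legendre_eqI[OF p(2)])
  show "Legendre (a * b) (int p) \<in> {- 1, 0, 1}" "Legendre a (int p) * Legendre b (int p) \<in> {- 1, 0, 1}"
    using Legendre_values[of a "int p"] Legendre_values[of b "int p"] Legendre_values[of "a * b" "int p"] by auto
  have "[Legendre (a * b) (int p) = a ^ ((p - 1) div 2) * b ^ ((p - 1) div 2)] (mod int p)"
    using euler_criterion[OF p, of "a * b"] by (simp add: power_mult_distrib)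
  moreover have "[Legendre a (int p) * Legendre b (int p) = a ^ ((p - 1) div 2) * b ^ ((p - 1) div 2)] (mod int p)"
    by (intro cong_mult euler_criterion p)
  ultimately show "[Legendre (a * b) (int p) = Legendre a (int p) * Legendre b (int p)] (mod int p)"
    using cong_sym cong_trans by blast
qed

lemma odd_prime_mod_cases: "odd p \<Longrightarrow> p mod 8 \<in> {1, 3, 5, 7 :: nat}"
  unfolding insert_iff empty_iff by presburger

lemma Legendre_minus_one:
  assumes p: "prime p" "2 < p"
  shows "Legendre (- 1) (int p) = (- 1) ^ ((p - 1) div 2)"
proof (rule Legendre_eqI[OF p(2) Legendre_values])
  show "(- 1) ^ ((p - 1) div 2) \<in> {- 1, 0, 1 :: int}" by (cases "even ((p - 1) div 2)") auto
qed (rule euler_criterion[OF p])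

lemma minus_one_power_chim4: "odd p \<Longrightarrow> of_int ((- 1) ^ ((p - 1) div 2)) = chim4 p"
proof -
  assume "odd p"
  hence "p mod 4 = 1 \<and> even ((p - 1) div 2) \<or> p mod 4 = 3 \<and> odd ((p - 1) div 2)" by presburger
  thus ?thesis by (auto simp: table_char_def)
qed

text \<open>Gauss's lemma: the multiples \<open>2 j\<close> with \<open>j \<le> h = (p - 1) / 2\<close> are already reduced, and those beyond \<open>h\<close>
have \<open>j > h div 2\<close>.\<close>

lemma Legendre_two:
  assumes p: "prime p" "2 < p"
  shows "of_int (Legendre 2 (int p)) = chi8 p"
proof -
  define h where "h = (p - 1) div 2"
  have odd: "odd p" using p prime_odd_nat by blast
  hence ph: "p = 2 * h + 1" by (auto simp: h_def elim!: oddE)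
  interpret G: GAUSS p 2
    using p by unfold_locales (auto simp: cong_def)
  have h': "(int p - 1) div 2 = int h" by (simp add: ph)
  have "G.C = (\<lambda>j. 2 * int j) ` {1..h}"
  proof -
    have "G.C = (\<lambda>x. x * 2 mod int p) ` {0<..int h}" unfolding G.C_def G.B_def G.A_def h' image_image ..
    also have "\<dots> = (\<lambda>x. 2 * x) ` {0<..int h}" by (intro image_cong refl) (auto simp: ph)
    also have "{0<..int h} = int ` {1..h}" by (simp only: image_int_atLeastAtMost) auto
    finally show ?thesis by (simp add: image_image)
  qed
  hence "G.E = (\<lambda>j. 2 * int j) ` {j \<in> {1..h}. h < 2 * j}" unfolding G.E_def h' by auto
  also have "{j \<in> {1..h}. h < 2 * j} = {h div 2 + 1..h}" by auto
  finally have "G.E = (\<lambda>j. 2 * int j) ` {h div 2 + 1..h}" .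
  hence "card G.E = card {h div 2 + 1..h}" by (simp add: card_image inj_on_def)
  hence "card G.E = h - h div 2" by simp
  hence L: "Legendre 2 (int p) = (- 1) ^ (h - h div 2)" using G.gauss_lemma by simp
  define k where "k = h div 4"
  have "h = 4 * k \<or> h = 4 * k + 1 \<or> h = 4 * k + 2 \<or> h = 4 * k + 3" unfolding k_def by presburger
  then consider "h = 4 * k" | "h = 4 * k + 1" | "h = 4 * k + 2" | "h = 4 * k + 3" by blast
  thus ?thesis
  proof cases
    case 1
    hence "p = 1 + 8 * k" "h - h div 2 = 2 * k" by (simp_all add: ph)
    thus ?thesis unfolding L by (simp add: table_char_def)
  next
    case 2
    hence "p = 3 + 8 * k" "h - h div 2 = 2 * k + 1" by (simp_all add: ph)
    thus ?thesis unfolding L by (simp add: table_char_def)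
  next
    case 3
    hence "p = 5 + 8 * k" "h - h div 2 = 2 * k + 1" by (simp_all add: ph)
    thus ?thesis unfolding L by (simp add: table_char_def)
  next
    case 4
    hence "p = 7 + 8 * k" "h - h div 2 = 2 * (k + 1)" by (simp_all add: ph)
    thus ?thesis unfolding L by (simp add: table_char_def)
  qed
qed

lemma Legendre_mod_3: "of_int (Legendre (int p) 3) = chim3 p"
proof -
  have sq: "y ^ 2 mod 3 \<noteq> 2" for y :: int
  proof -
    have "y mod 3 = 0 \<or> y mod 3 = 1 \<or> y mod 3 = 2" by presburger
    moreover have "y ^ 2 mod 3 = (y mod 3) ^ 2 mod 3" by (simp add: power_mod)
    ultimately show ?thesis by auto
  qed
  have "p mod 3 = 0 \<or> p mod 3 = 1 \<or> p mod 3 = 2" by presburger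
  moreover have "int p mod 3 = int (p mod 3)" by (simp add: zmod_int)
  moreover have "\<exists>y :: int. y ^ 2 mod 3 = 1" by (rule exI[of _ 1]) simp
  ultimately show ?thesis using sq
    by (auto simp: Legendre_def table_char_def QuadRes_def cong_def)
qed

lemma Legendre_three:
  assumes p: "prime p" "2 < p" "p \<noteq> 3"
  shows "of_int (Legendre 3 (int p)) = chim3 p * chim4 p"
proof -
  have odd: "odd p" using p prime_odd_nat by blast
  have "Legendre (int p) (int 3) * Legendre (int 3) (int p) = (- 1) ^ ((p - 1) div 2 * ((3 - 1) div 2))"
    by (rule Quadratic_Reciprocity) (use p in auto)
  hence "of_int (Legendre (int p) 3 * Legendre 3 (int p)) = chim4 p"
    using minus_one_power_chim4[OF odd] by simp
  hence *: "chim3 p * of_int (Legendre 3 (int p)) = chim4 p" by (simp add: Legendre_mod_3)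
  have "chim4 p \<noteq> 0" using odd_prime_mod_cases[OF odd] minus_one_power_chim4[OF odd]
    by (metis of_int_eq_0_iff power_eq_0_iff zero_neq_neg_one)
  hence "chim3 p * chim3 p = 1" using * by (intro table_char_square) auto
  hence "chim3 p * (chim3 p * of_int (Legendre 3 (int p))) = of_int (Legendre 3 (int p))" by (simp flip: mult.assoc)
  thus ?thesis unfolding * ..
qed

text \<open>A completely multiplicative function is determined by its values at primes.\<close>

lemma kronecker_multiplicative:
  assumes "h 1 = (1 :: complex)" "\<And>m n. h (m * n) = h m * h n"
    and "\<And>p. prime p \<Longrightarrow> of_int (kronecker_prime t (int p)) = h p" and n: "n > 0"
  shows "chi t n = h n"
proof -
  have h1: "h (Suc 0) = 1" using assms(1) by simp
  have hp: "h (x ^ k) = h x ^ k" for x k by (induction k) (simp_all add: h1 assms(2))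
  have *: "S \<subseteq> prime_factors (int n) \<Longrightarrow>
      of_int (\<Prod>p\<in>S. kronecker_prime t p ^ e p) = h (nat (\<Prod>p\<in>S. p ^ e p))" if "finite S" for S :: "int set" and e
    using that
  proof (induction S rule: finite_induct)
    case (insert p S)
    have p: "prime p" using insert.prems by auto
    hence "p > 0" by (rule prime_gt_0_int)
    hence pn: "p = int (nat p)" by simp
    have "prime (nat p)" using p by simp
    from assms(3)[OF this] have kp: "of_int (kronecker_prime t p) = h (nat p)" unfolding pn[symmetric] .
    have "nat (p ^ e p * (\<Prod>p\<in>S. p ^ e p)) = nat p ^ e p * nat (\<Prod>p\<in>S. p ^ e p)"
      using \<open>p > 0\<close> by (simp add: nat_mult_distrib nat_power_eq)
    thus ?case using insert kp by (simp add: assms(2) hp)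
  qed (simp add: h1)
  have "(\<Prod>p\<in>prime_factors (int n). p ^ multiplicity p (int n)) = int n"
    using n by (simp add: prod_prime_factors)
  thus ?thesis using *[of "prime_factors (int n)" "\<lambda>p. multiplicity p (int n)"] n
    by (simp add: chi_def kronecker_def)
qed

lemma prime_cases: "prime p \<Longrightarrow> p = 2 \<or> p = 3 \<or> (prime p \<and> 2 < p \<and> p \<noteq> 3 \<and> odd (p :: nat))"
  using prime_ge_2_nat[of p] prime_odd_nat[of p] by auto

text \<open>Factoring the discriminants into \<open>- 1\<close>, 2 and 3 reduces everything to the supplementary laws and
quadratic reciprocity with 3.\<close>

lemma kronecker_prime_Legendre:
  assumes p: "prime p" "2 < p"
  shows "kronecker_prime 8 (int p) = Legendre 2 (int p) * Legendre 2 (int p) * Legendre 2 (int p)"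
    "kronecker_prime 12 (int p) = Legendre 2 (int p) * Legendre 2 (int p) * Legendre 3 (int p)"
    "kronecker_prime 24 (int p) = Legendre 2 (int p) * Legendre 2 (int p) * Legendre 2 (int p) * Legendre 3 (int p)"
    "kronecker_prime (- 3) (int p) = Legendre (- 1) (int p) * Legendre 3 (int p)"
    "kronecker_prime (- 4) (int p) = Legendre (- 1) (int p) * Legendre 2 (int p) * Legendre 2 (int p)"
    "kronecker_prime (- 8) (int p) = Legendre (- 1) (int p) * Legendre 2 (int p) * Legendre 2 (int p) * Legendre 2 (int p)"
  using p unfolding Legendre_mult[OF p, symmetric] by (simp_all add: kronecker_prime_def)

lemma kronecker_prime_table:
  assumes p: "prime p"
  shows "of_int (kronecker_prime 8 (int p)) = chi8 p" "of_int (kronecker_prime 12 (int p)) = chi12 p"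
    "of_int (kronecker_prime 24 (int p)) = chi24 p" "of_int (kronecker_prime (- 3) (int p)) = chim3 p"
    "of_int (kronecker_prime (- 4) (int p)) = chim4 p" "of_int (kronecker_prime (- 8) (int p)) = chim8 p"
proof -
  have L3: "Legendre 3 3 = 0" by (simp add: Legendre_def cong_def)
  have "of_int (kronecker_prime 8 (int p)) = chi8 p \<and> of_int (kronecker_prime 12 (int p)) = chi12 p \<and>
    of_int (kronecker_prime 24 (int p)) = chi24 p \<and> of_int (kronecker_prime (- 3) (int p)) = chim3 p \<and>
    of_int (kronecker_prime (- 4) (int p)) = chim4 p \<and> of_int (kronecker_prime (- 8) (int p)) = chim8 p"
    using prime_cases[OF p]
  proof (elim disjE conjE)
    assume "p = 2"
    thus ?thesis by (simp add: kronecker_prime_def table_char_def)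
  next
    assume 3: "p = 3"
    have "prime (3 :: nat)" "2 < (3 :: nat)" by simp_all
    note K = kronecker_prime_Legendre[OF this] Legendre_two[OF this] Legendre_minus_one[OF this]
    thus ?thesis unfolding 3 by (simp add: L3 table_char_def)
  next
    assume P: "prime p" "2 < p" "p \<noteq> 3" "odd p"
    note L = Legendre_two[OF P(1,2)] Legendre_three[OF P(1-3)] Legendre_minus_one[OF P(1,2)] minus_one_power_chim4[OF P(4)]
    have "chi8 p \<noteq> 0" "chim4 p \<noteq> 0"
      using odd_prime_mod_cases[OF P(4)] minus_one_power_chim4[OF P(4), symmetric] by (auto simp: table_char_def)
    hence sq: "chi8 p * chi8 p = 1" "chim4 p * chim4 p = 1" by (simp_all add: table_char_square)
    show ?thesis unfolding kronecker_prime_Legendre[OF P(1,2)] of_int_mult L chi12_eq chi24_eq chim8_eq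
      using sq by (simp add: mult_ac)
  qed
  thus "of_int (kronecker_prime 8 (int p)) = chi8 p" "of_int (kronecker_prime 12 (int p)) = chi12 p"
    "of_int (kronecker_prime 24 (int p)) = chi24 p" "of_int (kronecker_prime (- 3) (int p)) = chim3 p"
    "of_int (kronecker_prime (- 4) (int p)) = chim4 p" "of_int (kronecker_prime (- 8) (int p)) = chim8 p" by auto
qed

lemma chi_tables:
  assumes "n > 0"
  shows "chi 1 n = 1" "chi 8 n = chi8 n" "chi 12 n = chi12 n" "chi 24 n = chi24 n"
    "chi (- 3) n = chim3 n" "chi (- 4) n = chim4 n" "chi (- 8) n = chim8 n"
proof -
  have "of_int (kronecker_prime 1 (int p)) = (1 :: complex)" if p: "prime p" for p
  proof (cases "p = 2")
    case False
    hence "p > 2" using prime_ge_2_nat[OF p] by simp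
    hence "\<not> [1 = 0] (mod int p)" by (auto simp: cong_def)
    moreover have "QuadRes (int p) 1" by (auto simp: QuadRes_def intro!: exI[of _ 1])
    ultimately show ?thesis using False by (simp add: kronecker_prime_def Legendre_def)
  qed (simp add: kronecker_prime_def)
  thus "chi 1 n = 1" using assms by (intro kronecker_multiplicative[of "\<lambda>_. 1"]) auto
  show "chi 8 n = chi8 n"
    by (rule kronecker_multiplicative[OF _ chi8_mult kronecker_prime_table(1) assms]) (simp add: table_char_def)
  show "chi 12 n = chi12 n"
    by (rule kronecker_multiplicative[OF _ table_char_mults(2) kronecker_prime_table(2) assms]) (simp add: table_char_def)
  show "chi 24 n = chi24 n"
    by (rule kronecker_multiplicative[OF _ table_char_mults(3) kronecker_prime_table(3) assms]) (simp add: table_char_def)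
  show "chi (- 3) n = chim3 n"
    by (rule kronecker_multiplicative[OF _ chim3_mult kronecker_prime_table(4) assms]) (simp add: table_char_def)
  show "chi (- 4) n = chim4 n"
    by (rule kronecker_multiplicative[OF _ chim4_mult kronecker_prime_table(5) assms]) (simp add: table_char_def)
  show "chi (- 8) n = chim8 n"
    by (rule kronecker_multiplicative[OF _ table_char_mults(1) kronecker_prime_table(6) assms]) (simp add: table_char_def)
qed

text \<open>Agreement at positive arguments suffices, because zero is never a divisor here.\<close>

lemma sigma_char_divsum:
  assumes "k > 0" "n > 0" and f: "\<And>m. m > 0 \<Longrightarrow> f m = f' m" and g: "\<And>m. m > 0 \<Longrightarrow> g m = g' m"
  shows "sigma_char f g (real n / real k) = (if k dvd n then divsum f' g' (n div k) else 0)"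
proof (cases "k dvd n")
  case True
  then obtain l where l: "n = k * l" by blast
  hence "l > 0" using assms by auto
  have "real n / real k = real l" using assms by (simp add: l)
  moreover have "(\<Sum>m | m dvd l. f m * g (l div m) * of_nat m) = divsum f' g' l"
    unfolding divsum_def using \<open>l > 0\<close> by (intro sum.cong refl) (auto simp: f g elim!: dvdE)
  ultimately show ?thesis using assms \<open>l > 0\<close> by (simp add: sigma_char_def l)
next
  case False
  have "real n / real k \<notin> \<nat>"
  proof
    assume "real n / real k \<in> \<nat>"
    then obtain l where "real n / real k = real l" by (auto elim: Nats_cases)
    hence "real n = real (k * l)" using assms by (simp add: field_simps)
    hence "n = k * l" using of_nat_eq_iff by blast
    thus False using False by simp
  qed
  thus ?thesis using False by (simp add: sigma_char_def)
qed

lemma divisor_sigma_divsum: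
  assumes "k > 0" "n > 0"
  shows "divisor_sigma (real n / real k) = (if k dvd n then divsum chi1 chi1 (n div k) else 0)"
proof -
  have "divisor_sigma (real n / real k) = sigma_char chi1 chi1 (real n / real k)"
    by (simp add: divisor_sigma_def sigma_char_def)
  thus ?thesis using sigma_char_divsum[OF assms] by simp
qed

section \<open>Eta quotients as power series\<close>

text \<open>On a disc of radius \<open>r < 1\<close> the product converges uniformly by comparison with the geometric series.\<close>

lemma euler_holomorphic: "euler holomorphic_on ball 0 1"
proof (rule holomorphic_uniform_sequence)
  fix x :: complex assume x: "x \<in> ball 0 1"
  define r where "r = (1 + norm x) / 2"
  have r: "norm x < r" "r < 1" "0 \<le> r" using x by (auto simp: r_def)
  have sub: "cball x (r - norm x) \<subseteq> cball 0 r"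
  proof
    fix y assume "y \<in> cball x (r - norm x)"
    thus "y \<in> cball 0 r" using norm_triangle_sub[of y x] by (simp add: dist_norm norm_minus_commute)
  qed
  define P where "P = (\<lambda>N q. \<Prod>n<N. 1 + - (q * q ^ n :: complex))"
  have P: "(\<lambda>N q. \<Prod>n<N. 1 - (q * q ^ n :: complex)) = P" by (simp add: P_def)
  have "uniform_limit (cball 0 r) P euler sequentially"
  proof -
    have "uniformly_convergent_on (cball 0 r) P" unfolding P_def
    proof (rule Infinite_Products.uniformly_convergent_on_prod)
      show "uniformly_convergent_on (cball 0 r) (\<lambda>N q. \<Sum>n<N. norm (- (q * q ^ n :: complex)))"
      proof (rule Weierstrass_m_test')
        fix n and q :: complex assume "q \<in> cball 0 r"
        hence "norm q ^ Suc n \<le> r ^ Suc n" by (intro power_mono) auto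
        thus "norm (norm (- (q * q ^ n))) \<le> r ^ Suc n" by (simp add: norm_mult norm_power)
      next
        show "summable (\<lambda>n. r ^ Suc n)" using summable_mult[OF summable_geometric[of r], of r] r by simp
      qed
    qed (auto intro!: continuous_intros)
    then obtain l where l: "uniform_limit (cball 0 r) P l sequentially"
      unfolding uniformly_convergent_on_def by blast
    have "l q = euler q" if "q \<in> cball 0 r" for q
    proof (rule LIMSEQ_unique)
      show "(\<lambda>N. P N q) \<longlonglongrightarrow> l q" by (rule tendsto_uniform_limitI[OF l that])
      show "(\<lambda>N. P N q) \<longlonglongrightarrow> euler q"
        using qpoch_LIMSEQ[of q q] that r by (simp add: euler_def P_def)
    qed
    hence "uniform_limit (cball 0 r) P l sequentially = uniform_limit (cball 0 r) P euler sequentially"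
      by (intro uniform_limit_cong') auto
    with l show ?thesis by simp
  qed
  hence "uniform_limit (cball x (r - norm x)) P euler sequentially"
    by (rule uniform_limit_on_subset[OF _ sub])
  moreover have "cball x (r - norm x) \<subseteq> ball 0 1" using sub r by force
  ultimately show "\<exists>d>0. cball x d \<subseteq> ball 0 1 \<and> uniform_limit (cball x d) (\<lambda>N q. \<Prod>n<N. 1 - q * q ^ n) euler sequentially"
    unfolding P using r by (intro exI[of _ "r - norm x"]) auto
qed (auto intro!: holomorphic_intros)

lemma euler_power_holomorphic:
  assumes "k > 0"
  shows "(\<lambda>w. euler (w ^ k)) holomorphic_on ball 0 1" "\<And>w. w \<in> ball 0 1 \<Longrightarrow> euler (w ^ k) \<noteq> 0"
proof -
  have "norm (w ^ k) < 1" if "norm w < 1" for w :: complex using that assms by (simp add: norm_power power_less_one_iff)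
  hence *: "w ^ k \<in> ball 0 1" if "w \<in> ball 0 1" for w :: complex using that by simp
  show "(\<lambda>w. euler (w ^ k)) holomorphic_on ball 0 1"
    by (rule holomorphic_on_compose_gen[of "\<lambda>w. w ^ k" "ball 0 1" euler "ball 0 1", unfolded o_def])
       (use * in \<open>auto intro!: holomorphic_intros euler_holomorphic\<close>)
  show "\<And>w. w \<in> ball 0 1 \<Longrightarrow> euler (w ^ k) \<noteq> 0" using * by (intro euler_nonzero) auto
qed

text \<open>A function on the upper half-plane that factors through a holomorphic function on the unit disc has its Taylor
series as \<open>q\<close>-expansion.\<close>

lemma q_coeff_sums:
  assumes G: "G holomorphic_on ball 0 1"
    and F: "\<And>z. Im z > 0 \<Longrightarrow> F z = G (exp (2 * of_real pi * \<i> * z))" and w: "norm w < 1"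
  shows "(\<lambda>n. q_coeff F n * w ^ n) sums G w"
proof -
  define c where "c n = (deriv ^^ n) G 0 / fact n" for n
  have c: "(\<lambda>n. c n * w ^ n) sums G w" if "norm w < 1" for w
    using holomorphic_power_series[OF G, of w] that by (simp add: c_def)
  have "has_q_expansion F c"
    unfolding has_q_expansion_def
  proof (intro allI impI)
    fix z :: complex assume z: "Im z > 0"
    hence "norm (exp (2 * of_real pi * \<i> * z)) < 1" by (simp add: norm_exp_eq_Re)
    from c[OF this] show "(\<lambda>n. c n * exp (2 * of_real pi * \<i> * z) ^ n) sums F z" unfolding F[OF z] .
  qed
  from q_coeff_eq[OF this] c[OF w] show ?thesis by simp
qed

lemma dedekind_eta_euler:
  assumes "Im z > 0"
  shows "dedekind_eta (of_nat k * z) = exp (of_real pi * \<i> * z / 12) ^ k * euler (exp (2 * of_real pi * \<i> * z) ^ k)"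
proof -
  define x where "x = exp (2 * of_real pi * \<i> * z)"
  have 1: "exp (of_real pi * \<i> * (of_nat k * z) / 12) = exp (of_real pi * \<i> * z / 12) ^ k"
    by (simp flip: exp_of_nat_mult add: field_simps)
  have "exp (2 * of_real pi * \<i> * of_nat (Suc n) * (of_nat k * z)) = x ^ k * (x ^ k) ^ n" for n
  proof -
    have "x ^ k * (x ^ k) ^ n = x ^ (k * Suc n)" by (simp add: power_mult power_add)
    also have "\<dots> = exp (of_nat (k * Suc n) * (2 * of_real pi * \<i> * z))" unfolding x_def by (rule exp_of_nat_mult[symmetric])
    also have "of_nat (k * Suc n) * (2 * of_real pi * \<i> * z) = 2 * of_real pi * \<i> * of_nat (Suc n) * (of_nat k * z)"
      unfolding of_nat_mult by (simp only: mult_ac)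
    finally show ?thesis ..
  qed
  thus ?thesis unfolding dedekind_eta_def euler_def qpoch_def 1 by (simp add: x_def)
qed

lemma exp_24th: "exp (of_real pi * \<i> * z / 12) ^ 24 = exp (2 * of_real pi * \<i> * z)"
proof -
  have "of_nat 24 * (of_real pi * \<i> * z / 12) = 2 * of_real pi * \<i> * z" by simp
  thus ?thesis by (simp only: exp_of_nat_mult[symmetric])
qed

text \<open>The fractional powers of \<open>q\<close> in the eta functions are powers of \<open>e\<^sup>\<pi>\<^sup>i\<^sup>z\<^sup>/\<^sup>1\<^sup>2\<close>; the weight condition says
that together they form \<open>q\<^sup>m\<close>. What remains is holomorphic in \<open>q\<close>, since \<open>euler\<close> has no zeros in the disc.\<close>

lemma eta_quotient_sums:
  assumes F: "\<And>z. Im z > 0 \<Longrightarrow> F z = (\<Prod>(k, e)\<leftarrow>ps. dedekind_eta (of_nat k * z) ^ e) / (\<Prod>(k, e)\<leftarrow>qs. dedekind_eta (of_nat k * z) ^ e)"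
    and pos: "\<forall>(k, e)\<in>set ps \<union> set qs. k > 0"
    and weight: "(\<Sum>(k, e)\<leftarrow>ps. k * e) = (\<Sum>(k, e)\<leftarrow>qs. k * e) + 24 * m"
    and q: "norm q < 1"
  shows "(\<lambda>n. q_coeff F n * q ^ n) sums
    (q ^ m * ((\<Prod>(k, e)\<leftarrow>ps. euler (q ^ k) ^ e) / (\<Prod>(k, e)\<leftarrow>qs. euler (q ^ k) ^ e)))"
proof (rule q_coeff_sums[OF _ _ q])
  have hol: "(\<lambda>w. \<Prod>(k, e)\<leftarrow>rs. euler (w ^ k) ^ e) holomorphic_on ball 0 1"
    and nz: "\<And>w. w \<in> ball 0 1 \<Longrightarrow> (\<Prod>(k, e)\<leftarrow>rs. euler (w ^ k) ^ e) \<noteq> 0"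
    if "\<forall>(k, e)\<in>set rs. k > 0" for rs
    using that by (induction rs) (auto intro!: holomorphic_intros euler_power_holomorphic(1) simp: euler_power_holomorphic(2) simp del: mem_ball)
  show "(\<lambda>w. w ^ m * ((\<Prod>(k, e)\<leftarrow>ps. euler (w ^ k) ^ e) / (\<Prod>(k, e)\<leftarrow>qs. euler (w ^ k) ^ e))) holomorphic_on ball 0 1"
    by (intro holomorphic_intros hol nz) (use pos in auto)
  fix z assume z: "Im z > 0"
  define r x where "r = exp (of_real pi * \<i> * z / 12)" and "x = exp (2 * of_real pi * \<i> * z)"
  have eta: "(\<Prod>(k, e)\<leftarrow>rs. dedekind_eta (of_nat k * z) ^ e) = r ^ (\<Sum>(k, e)\<leftarrow>rs. k * e) * (\<Prod>(k, e)\<leftarrow>rs. euler (x ^ k) ^ e)" for rs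
    by (induction rs) (auto simp: dedekind_eta_euler[OF z] power_mult_distrib power_add power_mult r_def x_def)
  have "r ^ (24 * m) = x ^ m" using exp_24th[of z] by (simp add: power_mult r_def x_def)
  moreover have "r \<noteq> 0" by (simp add: r_def)
  ultimately show "F z = exp (2 * of_real pi * \<i> * z) ^ m * ((\<Prod>(k, e)\<leftarrow>ps. euler (exp (2 * of_real pi * \<i> * z) ^ k) ^ e) /
      (\<Prod>(k, e)\<leftarrow>qs. euler (exp (2 * of_real pi * \<i> * z) ^ k) ^ e))"
    unfolding F[OF z] eta weight power_add x_def[symmetric] by simp
qed

context nome
begin

lemma a_coeff_sums: "(\<lambda>n. a_coeff n * q ^ n) sums (q * (E 2 * E 4 * E 6 * E 12))"
  using eta_quotient_sums[of A_fun "[(2, 1), (4, 1), (6, 1), (12, 1)]" "[]" 1, OF _ _ _ norm_q]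
  by (simp add: A_fun_def a_coeff_def E_def mult.assoc)

lemma b1_coeff_sums: "(\<lambda>n. b1_coeff n * q ^ n) sums (q * (E (Suc 0) * E 6 ^ 4 * E 8 ^ 2 / (E 2 * E 3 * E 12)))"
  using eta_quotient_sums[of B1_fun "[(1, 1), (6, 4), (8, 2)]" "[(2, 1), (3, 1), (12, 1)]" 1, OF _ _ _ norm_q]
  by (simp add: B1_fun_def b1_coeff_def E_def mult.assoc)

lemma b2_coeff_sums: "(\<lambda>n. b2_coeff n * q ^ n) sums (q * (E (Suc 0) ^ 2 * E 8 * E 12 ^ 4 / (E 4 * E 6 * E 24)))"
  using eta_quotient_sums[of B2_fun "[(1, 2), (8, 1), (12, 4)]" "[(4, 1), (6, 1), (24, 1)]" 1, OF _ _ _ norm_q]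
  by (simp add: B2_fun_def b2_coeff_def E_def mult.assoc)

lemma c1_coeff_sums: "(\<lambda>n. c1_coeff n * q ^ n) sums (q ^ 2 * (E (Suc 0) * E 4 * E 6 ^ 4 * E 24 ^ 2 / (E 2 * E 3 * E 12 ^ 2)))"
  using eta_quotient_sums[of C1_fun "[(1, 1), (4, 1), (6, 4), (24, 2)]" "[(2, 1), (3, 1), (12, 2)]" 2, OF _ _ _ norm_q]
  by (simp add: C1_fun_def c1_coeff_def E_def mult.assoc)

lemma c2_coeff_sums: "(\<lambda>n. c2_coeff n * q ^ n) sums (q * (E (Suc 0) ^ 2 * E 4 ^ 4 * E 6 * E 24 / (E 2 ^ 2 * E 8 * E 12)))"
  using eta_quotient_sums[of C2_fun "[(1, 2), (4, 4), (6, 1), (24, 1)]" "[(2, 2), (8, 1), (12, 1)]" 1, OF _ _ _ norm_q]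
  by (simp add: C2_fun_def c2_coeff_def E_def mult.assoc)

end

section \<open>Theta series of the quaternary forms\<close>

text \<open>Finiteness makes \<open>card\<close> meaningful when the fourfold series is grouped by the value of the form.\<close>

lemma finite_quaternary_representations:
  assumes "a1 > 0" "a2 > 0" "a3 > 0" "a4 > 0"
  shows "finite {(x1 :: int, x2 :: int, x3 :: int, x4 :: int).
       int n = int a1 * x1\<^sup>2 + int a2 * x2\<^sup>2 + int a3 * x3\<^sup>2 + int a4 * x4\<^sup>2}"
proof -
  have bound: "x \<in> {- int n..int n}" if "int a * x\<^sup>2 \<le> int n" "a > 0" for x a
  proof -
    have "\<bar>x\<bar> \<le> x\<^sup>2" using self_le_power[of "\<bar>x\<bar>" 2] by (cases "x = 0") auto
    also have "1 * x\<^sup>2 \<le> int a * x\<^sup>2" using that by (intro mult_right_mono) auto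
    finally show ?thesis using that by auto
  qed
  have "{(x1 :: int, x2 :: int, x3 :: int, x4 :: int).
       int n = int a1 * x1\<^sup>2 + int a2 * x2\<^sup>2 + int a3 * x3\<^sup>2 + int a4 * x4\<^sup>2}
     \<subseteq> {- int n..int n} \<times> {- int n..int n} \<times> {- int n..int n} \<times> {- int n..int n}"
  proof (clarify, unfold mem_Times_iff fst_conv snd_conv)
    fix x1 x2 x3 x4 assume e: "int n = int a1 * x1\<^sup>2 + int a2 * x2\<^sup>2 + int a3 * x3\<^sup>2 + int a4 * x4\<^sup>2"
    have nn: "0 \<le> int a1 * x1\<^sup>2" "0 \<le> int a2 * x2\<^sup>2" "0 \<le> int a3 * x3\<^sup>2" "0 \<le> int a4 * x4\<^sup>2" by simp_all
    show "x1 \<in> {- int n..int n} \<and> x2 \<in> {- int n..int n} \<and> x3 \<in> {- int n..int n} \<and> x4 \<in> {- int n..int n}"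
      using e nn assms by (intro conjI bound[of a1 x1] bound[of a2 x2] bound[of a3 x3] bound[of a4 x4]) auto
  qed
  thus ?thesis by (rule finite_subset) auto
qed

context nome
begin

lemma phi_has_sum:
  assumes k: "k > 0"
  shows "((\<lambda>j :: int. q ^ (k * nat (j\<^sup>2))) has_sum phi k) UNIV"
proof -
  have "((\<lambda>j. theta_coeff (q ^ (2 * k)) j * (- (q ^ k)) powi j) has_sum phi k) UNIV"
    using theta_has_sum[OF norm_qk qk_nz, of "2 * k" "- (q ^ k)"] theta_minus_half[OF k] k q_nz by simp
  also have "(\<lambda>j. theta_coeff (q ^ (2 * k)) j * (- (q ^ k)) powi j) = (\<lambda>j. q ^ (k * nat (j\<^sup>2)))"
  proof
    fix j :: int
    have s: "(- 1 :: complex) powi j * (- 1) powi j = 1"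
      by (simp flip: power_int_mult_distrib)
    have "(- (q ^ k)) powi j = (- 1) powi j * (q ^ k) powi j"
      using power_int_mult_distrib[of "- 1" "q ^ k" j] by simp
    hence "theta_coeff (q ^ (2 * k)) j * (- (q ^ k)) powi j =
        ((- 1) powi j * (- 1) powi j) * ((q ^ (2 * k)) powi (j * (j - 1) div 2) * (q ^ k) powi j)"
      by (simp add: theta_coeff_def)
    also have "\<dots> = q powi (int (2 * k) * (j * (j - 1) div 2) + int k * j)"
      unfolding s using q_nz by (simp add: power_int_add power_int_mult del: of_nat_mult)
    also have "int (2 * k) * (j * (j - 1) div 2) + int k * j = int k * (2 * (j * (j - 1) div 2) + j)"
      by (simp add: algebra_simps)
    also have "2 * (j * (j - 1) div 2) = j * (j - 1)" by simp
    also have "int k * (j * (j - 1) + j) = int (k * nat (j\<^sup>2))" by (simp add: power2_eq_square algebra_simps)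
    finally show "theta_coeff (q ^ (2 * k)) j * (- (q ^ k)) powi j = q ^ (k * nat (j\<^sup>2))"
      by (simp only: power_int_of_nat)
  qed
  finally show ?thesis .
qed

theorem repr_count_sums:
  assumes a: "a1 > 0" "a2 > 0" "a3 > 0" "a4 > 0"
  shows "(\<lambda>n. of_nat (repr_count a1 a2 a3 a4 n) * q ^ n) sums (phi a1 * phi a2 * phi a3 * phi a4)"
proof -
  define e where "e = (\<lambda>(x1 :: int, x2 :: int, x3 :: int, x4 :: int).
     a1 * nat (x1\<^sup>2) + (a2 * nat (x2\<^sup>2) + (a3 * nat (x3\<^sup>2) + a4 * nat (x4\<^sup>2))))"
  have "((\<lambda>p. q ^ e p) has_sum (phi a1 * (phi a2 * (phi a3 * phi a4)))) (UNIV \<times> UNIV \<times> UNIV \<times> UNIV)"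
    using has_sum_times_complex[OF phi_has_sum[OF a(1)] has_sum_times_complex[OF phi_has_sum[OF a(2)]
        has_sum_times_complex[OF phi_has_sum[OF a(3)] phi_has_sum[OF a(4)]]]]
    by (simp add: e_def case_prod_unfold power_add)
  hence "((\<lambda>(n, p). q ^ n) has_sum (phi a1 * phi a2 * phi a3 * phi a4)) (SIGMA n:UNIV. {p. e p = n})"
    by (subst has_sum_reindex_bij_witness[of _ "\<lambda>p. (e p, p)" snd UNIV "\<lambda>p. q ^ e p"]) (auto simp: mult.assoc)
  hence "((\<lambda>n. of_nat (repr_count a1 a2 a3 a4 n) * q ^ n) has_sum (phi a1 * phi a2 * phi a3 * phi a4)) UNIV"
  proof (rule has_sum_SigmaD)
    fix n
    have "{p. e p = n} = {(x1 :: int, x2 :: int, x3 :: int, x4 :: int).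
       int n = int a1 * x1\<^sup>2 + int a2 * x2\<^sup>2 + int a3 * x3\<^sup>2 + int a4 * x4\<^sup>2}"
    proof -
      have "e (x1, x2, x3, x4) = n \<longleftrightarrow> int n = int a1 * x1\<^sup>2 + int a2 * x2\<^sup>2 + int a3 * x3\<^sup>2 + int a4 * x4\<^sup>2" for x1 x2 x3 x4
      proof -
        have "int (e (x1, x2, x3, x4)) = int a1 * x1\<^sup>2 + int a2 * x2\<^sup>2 + int a3 * x3\<^sup>2 + int a4 * x4\<^sup>2"
          by (simp add: e_def)
        thus ?thesis by linarith
      qed
      thus ?thesis by auto
    qed
    hence "finite {p. e p = n}" "card {p. e p = n} = repr_count a1 a2 a3 a4 n"
      using finite_quaternary_representations[OF a] by (simp_all add: repr_count_def)
    thus "((\<lambda>p. case (n, p) of (n, p) \<Rightarrow> q ^ n) has_sum of_nat (repr_count a1 a2 a3 a4 n) * q ^ n) {p. e p = n}"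
      by (intro has_sum_finiteI) auto
  qed
  thus ?thesis by (rule has_sum_imp_sums)
qed

end

section \<open>Relations between theta functions of level 24\<close>

text \<open>The algebraic part of the argument, isolated from the analysis: positive numbers \<open>q\<close> and \<open>e k\<close> that satisfy
the known relations for \<open>E k\<close>. The eta quotients that contain the square root of \<open>q\<close> are replaced by
their squares and products.\<close>

locale theta_algebra =
  fixes q :: real and e :: "nat \<Rightarrow> real"
  assumes q_pos: "q > 0" and e_pos: "k > 0 \<Longrightarrow> e k > 0"
    and theta_square: "k > 0 \<Longrightarrow> (e (2 * k) ^ 5 / (e k ^ 2 * e (4 * k) ^ 2)) ^ 2
        = (e (4 * k) ^ 5 / (e (2 * k) ^ 2 * e (8 * k) ^ 2)) ^ 2 + 4 * q ^ k * (e (8 * k) ^ 2 / e (4 * k)) ^ 2"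
    and theta_minus_square: "k > 0 \<Longrightarrow> (e k ^ 2 / e (2 * k)) ^ 2
        = (e (4 * k) ^ 5 / (e (2 * k) ^ 2 * e (8 * k) ^ 2)) ^ 2 - 4 * q ^ k * (e (8 * k) ^ 2 / e (4 * k)) ^ 2"
    and three_term_a: "1 + q * e 2 ^ 2 * e 12 ^ 4 / (e 4 ^ 4 * e 6 ^ 2) = e 2 ^ 2 * e 3 ^ 3 * e 12 / (e (Suc 0) * e 4 ^ 3 * e 6 ^ 2)"
    and three_term_b: "1 - q * e 2 ^ 2 * e 12 ^ 4 / (e 4 ^ 4 * e 6 ^ 2) = e (Suc 0) * e 6 ^ 7 / (e 2 * e 3 ^ 3 * e 4 ^ 2 * e 12 ^ 2)"
    and three_term_c: "3 * (e 12 * e 2 / (e 6 * e 4) * (e 3 / e (Suc 0)) ^ 2)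
      + e 12 * e 2 / (e 6 * e 4) * (e 6 * e (Suc 0) / (e 2 * e 3)) ^ 2
      = 4 * ((e 2 / e (Suc 0)) ^ 2 * (e 6 * e (Suc 0) / (e 2 * e 3)) * (e 4 / e 2) ^ 2)"
    and three_term_d: "2 * (e 12 * e 2 / (e 6 * e 4) * (e 2 / e (Suc 0)) ^ 4)
      + (e 4 / e 2) ^ 2 * (e 6 * e (Suc 0) / (e 2 * e 3)) ^ 2
      = 3 * ((e 3 / e (Suc 0)) ^ 2 * (e 4 / e 2) ^ 2)"
begin

lemma e_pos_simps [simp]: "e (Suc 0) > 0" "e (numeral n) > 0" by (simp_all add: e_pos)
lemma e_nz_simps [simp]: "e (Suc 0) \<noteq> 0" "e (numeral n) \<noteq> 0" using e_pos_simps by (metis less_irrefl)+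
lemma q_nz [simp]: "q \<noteq> 0" using q_pos by simp

text \<open>The letters stand for \<open>a = \<phi>(q)\<close>, \<open>b = \<phi>(q\<^sup>2)\<close>, \<open>c = \<phi>(q\<^sup>3)\<close>, \<open>d = \<phi>(q\<^sup>6)\<close>, \<open>a1 = \<phi>(- q)\<close>,
\<open>c1 = \<phi>(- q\<^sup>3)\<close>, and \<open>w2, W2, wW\<close> for the squares and the product of \<open>w = 2 q\<^sup>1\<^sup>/\<^sup>2 \<psi>(q\<^sup>4)\<close> and of the same
function \<open>W\<close> at \<open>q\<^sup>3\<close>. The capitals \<open>A, B1, B2, C1, C2\<close> are the cusp forms, \<open>\<tau>\<close> is the quantity in
the three-term relations, and \<open>g, g'\<close> are \<open>eta_g\<close> and \<open>eta_g'\<close>.\<close>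

definition a where "a = e 2 ^ 5 / (e (Suc 0) ^ 2 * e 4 ^ 2)"
definition b where "b = e 4 ^ 5 / (e 2 ^ 2 * e 8 ^ 2)"
definition c where "c = e 6 ^ 5 / (e 3 ^ 2 * e 12 ^ 2)"
definition d where "d = e 12 ^ 5 / (e 6 ^ 2 * e 24 ^ 2)"
definition a1 where "a1 = e (Suc 0) ^ 2 / e 2"
definition c1 where "c1 = e 3 ^ 2 / e 6"
definition w2 where "w2 = 4 * q * (e 8 ^ 2 / e 4) ^ 2"
definition W2 where "W2 = 4 * q ^ 3 * (e 24 ^ 2 / e 12) ^ 2"
definition wW where "wW = 4 * q ^ 2 * (e 8 ^ 2 * e 24 ^ 2 / (e 4 * e 12))"
definition A where "A = q * (e 2 * e 4 * e 6 * e 12)"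
definition \<tau> where "\<tau> = q * e 2 ^ 2 * e 12 ^ 4 / (e 4 ^ 4 * e 6 ^ 2)"
definition p where "p = 2 * \<tau> / (1 - \<tau>)"
definition v where "v = e (Suc 0) ^ 2 * e 3 ^ 2 * e 4 * e 12 / (e 2 ^ 3 * e 6 ^ 3)"
definition g where "g = e (Suc 0) * e 6 * e 8 * e 12 / (e 3 * e 24)"
definition g' where "g' = q * (e 2 * e 3 * e 4 * e 24 / (e (Suc 0) * e 8))"
definition B1 where "B1 = q * (e (Suc 0) * e 6 ^ 4 * e 8 ^ 2 / (e 2 * e 3 * e 12))"
definition B2 where "B2 = q * (e (Suc 0) ^ 2 * e 8 * e 12 ^ 4 / (e 4 * e 6 * e 24))"
definition C1 where "C1 = q ^ 2 * (e (Suc 0) * e 4 * e 6 ^ 4 * e 24 ^ 2 / (e 2 * e 3 * e 12 ^ 2))"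
definition C2 where "C2 = q * (e (Suc 0) ^ 2 * e 4 ^ 4 * e 6 * e 24 / (e 2 ^ 2 * e 8 * e 12))"

lemmas monomial_defs = a_def b_def c_def d_def a1_def c1_def w2_def W2_def wW_def A_def \<tau>_def v_def g_def g'_def
  B1_def B2_def C1_def C2_def

lemma pos: "a > 0" "b > 0" "c > 0" "d > 0" "a1 > 0" "c1 > 0" "w2 > 0" "W2 > 0" "wW > 0" "A > 0" "\<tau> > 0" "v > 0" "g > 0" "g' > 0"
    "B1 > 0" "B2 > 0"
  using q_pos by (simp_all add: monomial_defs)

lemma nz: "a \<noteq> 0" "b \<noteq> 0" "c \<noteq> 0" "d \<noteq> 0" "a1 \<noteq> 0" "c1 \<noteq> 0" "w2 \<noteq> 0" "W2 \<noteq> 0" "wW \<noteq> 0" "A \<noteq> 0" "\<tau> \<noteq> 0" "v \<noteq> 0"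
  using pos by auto

lemma square_relations: "a ^ 2 = b ^ 2 + w2" "a1 ^ 2 = b ^ 2 - w2" "c ^ 2 = d ^ 2 + W2" "c1 ^ 2 = d ^ 2 - W2"
  using theta_square[of "Suc 0"] theta_minus_square[of "Suc 0"] theta_square[of 3] theta_minus_square[of 3]
  by (simp_all add: monomial_defs)

lemma tau_plus: "1 + \<tau> = e 2 ^ 2 * e 3 ^ 3 * e 12 / (e (Suc 0) * e 4 ^ 3 * e 6 ^ 2)"
  using three_term_a by (simp add: \<tau>_def)

lemma tau_minus: "1 - \<tau> = e (Suc 0) * e 6 ^ 7 / (e 2 * e 3 ^ 3 * e 4 ^ 2 * e 12 ^ 2)"
  using three_term_b by (simp add: \<tau>_def)

lemma tau_pos: "1 - \<tau> > 0" unfolding tau_minus by simp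

lemma p_pos: "p > 0" using pos tau_pos by (simp add: p_def)

lemma one_plus_p: "1 + p = (1 + \<tau>) / (1 - \<tau>)" using tau_pos by (simp add: p_def field_simps)

text \<open>The eta quotient \<open>v\<close> is chosen to make this hold; it is \<open>\<phi>(- q\<^sup>2) \<phi>(- q\<^sup>6) / (a c)\<close>.\<close>

lemma c1_square: "c1 ^ 2 = v * (1 + p) * c ^ 2"
  unfolding one_plus_p tau_plus tau_minus unfolding monomial_defs by (simp add: field_simps pow_expand)

lemma tau_three_minus: "(1 - 3 * \<tau>) * c1 ^ 2 = (1 + \<tau>) * a1 ^ 2"
proof -
  define L where "L = e 4 ^ 2 * e 6 / (e (Suc 0) * e 2 * e 3)"
  have L: "L \<noteq> 0" by (simp add: L_def)
  have "L * (3 * (1 + \<tau>) * c1 ^ 2 + (1 + \<tau>) * a1 ^ 2) = (3 * (e 12 * e 2 / (e 6 * e 4) * (e 3 / e (Suc 0)) ^ 2)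
      + e 12 * e 2 / (e 6 * e 4) * (e 6 * e (Suc 0) / (e 2 * e 3)) ^ 2) * c1 ^ 2"
  proof -
    have "L * (1 + \<tau>) = e 12 * e 2 / (e 6 * e 4) * (e 3 / e (Suc 0)) ^ 2"
      "L * (1 + \<tau>) * a1 ^ 2 = e 12 * e 2 / (e 6 * e 4) * (e 6 * e (Suc 0) / (e 2 * e 3)) ^ 2 * c1 ^ 2"
      unfolding L_def tau_plus unfolding monomial_defs by (simp_all add: field_simps pow_expand)
    moreover have "L * (3 * (1 + \<tau>) * c1 ^ 2 + (1 + \<tau>) * a1 ^ 2) = 3 * (L * (1 + \<tau>)) * c1 ^ 2 + L * (1 + \<tau>) * a1 ^ 2"
      by (simp add: algebra_simps)
    ultimately show ?thesis by (simp add: distrib_right)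
  qed
  also have "\<dots> = L * (4 * c1 ^ 2)"
    unfolding three_term_c L_def by (simp add: field_simps pow_expand)
  finally have "3 * (1 + \<tau>) * c1 ^ 2 + (1 + \<tau>) * a1 ^ 2 = 4 * c1 ^ 2" using L by simp
  thus ?thesis by (simp add: algebra_simps)
qed

lemma tau_three_plus: "(1 + 3 * \<tau>) * c ^ 2 = (1 - \<tau>) * a ^ 2"
proof -
  define L where "L = (e 3 / e (Suc 0)) ^ 2 * (e 4 / e 2) ^ 2"
  define Z where "Z = e 12 * e 2 ^ 7 / (e 6 * e 4 ^ 3 * e (Suc 0) ^ 2 * e 3 ^ 2)"
  have L: "L \<noteq> 0" by (simp add: L_def)
  have "e 12 * e 2 / (e 6 * e 4) * (e 2 / e (Suc 0)) ^ 4 = L * Z"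
    "(e 4 / e 2) ^ 2 * (e 6 * e (Suc 0) / (e 2 * e 3)) ^ 2 = L * (a1 ^ 2 / c1 ^ 2)"
    unfolding L_def Z_def monomial_defs by (simp_all add: field_simps pow_expand)
  hence "L * (2 * Z + a1 ^ 2 / c1 ^ 2) = L * 3"
    using three_term_d unfolding L_def[symmetric] by (simp add: algebra_simps)
  hence "2 * Z + a1 ^ 2 / c1 ^ 2 = 3" using L by simp
  hence "(1 + \<tau>) * (2 * Z) + (1 + \<tau>) * a1 ^ 2 / c1 ^ 2 = (1 + \<tau>) * 3"
    by (simp only: distrib_left[symmetric] times_divide_eq_right[symmetric])
  moreover have "(1 + \<tau>) * a1 ^ 2 / c1 ^ 2 = 1 - 3 * \<tau>" unfolding tau_three_minus[symmetric] using nz by simp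
  ultimately have "(1 + \<tau>) * Z = 1 + 3 * \<tau>" by (simp add: algebra_simps)
  moreover have "(1 + \<tau>) * Z * c ^ 2 = (1 - \<tau>) * a ^ 2"
    unfolding tau_plus tau_minus Z_def unfolding monomial_defs by (simp add: field_simps pow_expand)
  ultimately show ?thesis by simp
qed

lemma a_square: "a ^ 2 = (1 + 2 * p) * c ^ 2"
proof -
  have "1 + 2 * p = (1 + 3 * \<tau>) / (1 - \<tau>)" using tau_pos by (simp add: p_def field_simps)
  hence "(1 + 2 * p) * c ^ 2 = (1 - \<tau>) * a ^ 2 / (1 - \<tau>)" unfolding tau_three_plus[symmetric] by simp
  thus ?thesis using tau_pos by simp
qed

lemma a1_square: "a1 ^ 2 = v * (1 - p) * c ^ 2"
proof -
  have *: "1 - p = (1 - 3 * \<tau>) / (1 - \<tau>)" using tau_pos by (simp add: p_def field_simps)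
  have "1 + \<tau> > 0" using pos by simp
  have "a1 ^ 2 * (1 + \<tau>) = (1 - 3 * \<tau>) * (v * ((1 + \<tau>) / (1 - \<tau>)) * c ^ 2)"
    using tau_three_minus unfolding c1_square one_plus_p by (simp add: mult_ac)
  also have "\<dots> = v * (1 - p) * c ^ 2 * (1 + \<tau>)" unfolding * by simp
  finally show ?thesis using \<open>1 + \<tau> > 0\<close> by simp
qed

lemma a1_c1: "a1 * c1 = a * v ^ 2 * c"
  unfolding monomial_defs by (simp add: field_simps pow_expand)

text \<open>Compare \<open>(a1 c1)\<^sup>2\<close>, computed from the squares of the factors, with its value as an eta quotient.\<close>

lemma v_square: "(1 + 2 * p) * v ^ 2 = 1 - p ^ 2"
proof -
  have "v ^ 2 * c ^ 4 * (1 - p ^ 2) = (a1 * c1) ^ 2"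
    unfolding power_mult_distrib a1_square c1_square by (simp add: power2_eq_square pow_expand algebra_simps)
  also have "\<dots> = v ^ 2 * c ^ 4 * ((1 + 2 * p) * v ^ 2)"
    unfolding a1_c1 power_mult_distrib a_square by (simp add: pow_expand algebra_simps)
  finally show ?thesis using nz by simp
qed

lemma p_less_1: "p < 1"
proof -
  have "0 < (1 + 2 * p) * v ^ 2" using p_pos pos by simp
  hence "p ^ 2 < 1" unfolding v_square by simp
  thus ?thesis using p_pos by (simp add: power2_less_1_iff)
qed

definition M where "M = (1 + p + p ^ 2 + (1 + 2 * p) * v) / 2"
definition N where "N = (1 + p + p ^ 2 - (1 + 2 * p) * v) / 2"

lemma b_square: "b ^ 2 = ((1 + 2 * p) + v * (1 - p)) / 2 * c ^ 2"
  and w2_eq: "w2 = ((1 + 2 * p) - v * (1 - p)) / 2 * c ^ 2"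
  and d_square: "d ^ 2 = (1 + v * (1 + p)) / 2 * c ^ 2"
  and W2_eq: "W2 = (1 - v * (1 + p)) / 2 * c ^ 2"
  using square_relations a_square a1_square c1_square by (simp_all add: algebra_simps)

text \<open>In terms of \<open>\<tau>\<close> the factor is \<open>\<tau> / (1 - \<tau>)\<^sup>2\<close>, and substituting the eta quotient for \<open>1 - \<tau>\<close> turns
the right side into a monomial.\<close>

lemma A_eq: "A = v * (2 * p + p ^ 2) / 4 * c ^ 4"
proof -
  have "v * (\<tau> / (1 - \<tau>) ^ 2) * c ^ 4 = A"
    unfolding tau_minus unfolding monomial_defs by (simp add: field_simps pow_expand)
  moreover have "\<tau> / (1 - \<tau>) ^ 2 = (2 * p + p ^ 2) / 4"
  proof -
    define r where "r = 1 - \<tau>"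
    have r: "r \<noteq> 0" "\<tau> = 1 - r" using tau_pos by (simp_all add: r_def)
    have "(2 * p + p ^ 2) / 4 = (2 * (2 * (1 - r) / r) + (2 * (1 - r) / r) ^ 2) / 4" by (simp add: p_def r(2))
    also have "\<dots> = (1 - r) / r ^ 2" using r(1) by (simp add: power2_eq_square field_simps)
    finally show ?thesis unfolding r_def by simp
  qed
  ultimately show ?thesis by simp
qed

lemma MN: "4 * (M * N) = (p * (2 + p)) ^ 2"
proof -
  have "2 * M = 1 + p + p ^ 2 + (1 + 2 * p) * v" "2 * N = 1 + p + p ^ 2 - (1 + 2 * p) * v"
    by (simp_all add: M_def N_def)
  hence "(2 * M) * (2 * N) = (1 + p + p ^ 2 + (1 + 2 * p) * v) * (1 + p + p ^ 2 - (1 + 2 * p) * v)" by (simp only:)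
  also have "\<dots> = (1 + p + p ^ 2) ^ 2 - (1 + 2 * p) * ((1 + 2 * p) * v ^ 2)"
    by (simp add: power2_eq_square algebra_simps)
  finally have "(2 * M) * (2 * N) = (1 + p + p ^ 2) ^ 2 - (1 + 2 * p) * ((1 + 2 * p) * v ^ 2)" .
  hence "4 * (M * N) = (1 + p + p ^ 2) ^ 2 - (1 + 2 * p) * ((1 + 2 * p) * v ^ 2)" by simp
  thus ?thesis unfolding v_square by (simp add: pow_expand algebra_simps)
qed

lemma M_pos: "M > 0" and N_pos: "N > 0"
proof -
  show "M > 0" using p_pos pos(12) by (simp add: M_def add_pos_pos)
  moreover have "4 * (M * N) > 0" unfolding MN using p_pos by simp
  ultimately show "N > 0" by (simp add: zero_less_mult_iff)
qed

text \<open>The square of the left side is known from the squares of the four theta values, and modulo the relation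
between \<open>p\<close> and \<open>v\<close> it is the square of \<open>M c\<^sup>4\<close>. Both sides are positive.\<close>

lemma abcd: "a * b * c * d = M * c ^ 4"
proof (rule power2_eq_imp_eq)
  \<comment> \<open>The cofactor on the right is the quotient on division by \<open>(1 + 2 p) v\<^sup>2 - (1 - p\<^sup>2)\<close> as polynomials in \<open>v\<close>; all later cofactors arise in this way.\<close>
  have "M ^ 2 - (1 + 2 * p) * (((1 + 2 * p) + v * (1 - p)) / 2) * ((1 + v * (1 + p)) / 2) = (p / 2 + p ^ 2 / 4) * ((1 + 2 * p) * v ^ 2 - (1 - p ^ 2))"
    by (simp add: M_def power2_eq_square field_simps)
  hence *: "M ^ 2 = (1 + 2 * p) * (((1 + 2 * p) + v * (1 - p)) / 2) * ((1 + v * (1 + p)) / 2)" unfolding v_square by simp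
  have "(a * b * c * d) ^ 2 = (1 + 2 * p) * (((1 + 2 * p) + v * (1 - p)) / 2) * ((1 + v * (1 + p)) / 2) * (c ^ 2) ^ 4"
    unfolding power_mult_distrib a_square b_square d_square by (simp add: pow_expand mult_ac)
  thus "(a * b * c * d) ^ 2 = (M * c ^ 4) ^ 2" unfolding *[symmetric] by (simp add: power_mult_distrib flip: power_mult)
qed (use pos M_pos in auto)

lemma acwW: "a * c * wW = N * c ^ 4"
proof (rule power2_eq_imp_eq)
  have "N ^ 2 - (1 + 2 * p) * (((1 + 2 * p) - v * (1 - p)) / 2) * ((1 - v * (1 + p)) / 2) = (p / 2 + p ^ 2 / 4) * ((1 + 2 * p) * v ^ 2 - (1 - p ^ 2))"
    by (simp add: N_def power2_eq_square field_simps)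
  hence *: "N ^ 2 = (1 + 2 * p) * (((1 + 2 * p) - v * (1 - p)) / 2) * ((1 - v * (1 + p)) / 2)" unfolding v_square by simp
  have "wW ^ 2 = w2 * W2" unfolding monomial_defs by (simp add: field_simps pow_expand)
  hence "(a * c * wW) ^ 2 = (1 + 2 * p) * (((1 + 2 * p) - v * (1 - p)) / 2) * ((1 - v * (1 + p)) / 2) * (c ^ 2) ^ 4"
    unfolding power_mult_distrib a_square w2_eq W2_eq by (simp only: pow_expand mult_ac)
  thus "(a * c * wW) ^ 2 = (N * c ^ 4) ^ 2" unfolding *[symmetric] by (simp add: power_mult_distrib flip: power_mult)
qed (use pos N_pos in auto)

lemma g_relations: "g ^ 2 * (a1 * c1 * wW) = a1 ^ 2 * w2 * A" "g' ^ 2 * (a1 * c1 * wW) = c1 ^ 2 * W2 * A" "g * g' = A"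
  unfolding monomial_defs by (simp_all add: field_simps pow_expand)

lemma a1c1wW: "a1 * c1 * wW = v ^ 2 * N * c ^ 4"
proof -
  have "a1 * c1 * wW = v ^ 2 * (a * c * wW)" unfolding a1_c1 by (simp only: mult_ac)
  thus ?thesis unfolding acwW by simp
qed

text \<open>Both \<open>g\<close> and \<open>g'\<close> are square roots of monomials with product \<open>A\<close>, and \<open>g / g' = (a1 w) / (c1 W)\<close>. Multiplication by
\<open>a1 c1 w W\<close> makes the square of the sum polynomial in known quantities.\<close>

lemma cd: "c * d = g + g'"
proof (rule power2_eq_imp_eq)
  define D where "D = a1 * c1 * wW"
  have D: "D > 0" using pos by (simp add: D_def)
  have "D * (g + g') ^ 2 = g ^ 2 * D + 2 * (g * g') * D + g' ^ 2 * D" by (simp add: power2_eq_square algebra_simps)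
  also have "\<dots> = A * (a1 ^ 2 * w2 + 2 * D + c1 ^ 2 * W2)"
    unfolding D_def g_relations by (simp add: algebra_simps)
  also have "\<dots> - D * (c * d) ^ 2 = c ^ 8 * ((1 / 4 * v ^ 2 - 1 / 4 * p * v ^ 2 - 1 / 4 * p ^ 2 * v ^ 2) * ((1 + 2 * p) * v ^ 2 - (1 - p ^ 2)))"
    unfolding D_def a1c1wW a1_square c1_square A_eq w2_eq W2_eq power_mult_distrib d_square N_def
    by (simp add: field_simps pow_expand)
  finally have "D * (g + g') ^ 2 = D * (c * d) ^ 2" unfolding v_square by simp
  hence "(g + g') ^ 2 = (c * d) ^ 2" using D by simp
  thus "(c * d) ^ 2 = (g + g') ^ 2" ..
qed (use pos in auto)

text \<open>Multiply by \<open>c d = g + g'\<close>, since \<open>a b c d\<close> is known.\<close>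

lemma ab: "a * b = g + 3 * g'"
proof -
  define D where "D = a1 * c1 * wW"
  have D: "D > 0" using pos by (simp add: D_def)
  have "D * ((g + 3 * g') * (g + g')) = g ^ 2 * D + 4 * (g * g') * D + 3 * (g' ^ 2 * D)" by (simp add: power2_eq_square algebra_simps)
  also have "\<dots> = A * (a1 ^ 2 * w2 + 4 * D + 3 * c1 ^ 2 * W2)"
    unfolding D_def g_relations by (simp add: algebra_simps)
  also have "\<dots> - D * (M * c ^ 4) = c ^ 8 * ((1 / 4 * v ^ 2 - 1 / 2 * p * v ^ 2 - 1 / 2 * p ^ 2 * v ^ 2) * ((1 + 2 * p) * v ^ 2 - (1 - p ^ 2)))"
    unfolding D_def a1c1wW a1_square c1_square A_eq w2_eq W2_eq M_def N_def
    by (simp add: field_simps pow_expand)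
  finally have "D * ((g + 3 * g') * (g + g')) = D * (M * c ^ 4)" unfolding v_square by simp
  hence "(g + 3 * g') * (g + g') = M * c ^ 4" using D by simp
  hence "(g + 3 * g') * (c * d) = a * b * (c * d)" unfolding abcd[symmetric] cd[symmetric] by (simp only: mult.assoc)
  thus ?thesis using nz mult_right_cancel[of "c * d" "a * b" "g + 3 * g'"] by simp
qed

text \<open>Dividing \<open>B1\<close> by \<open>c d\<close> gives an element of the function field generated by \<open>p\<close> and \<open>v\<close>; this and its analogue for
\<open>B2\<close> are verified on squares.\<close>

lemma B1_eq: "2 * p * B1 = v * N * c ^ 3 * d"
proof (rule power2_eq_imp_eq)
  have B: "B1 ^ 2 = w2 * v * A * c ^ 2 / 4"
    unfolding monomial_defs by (simp add: field_simps pow_expand)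
  have "4 * p ^ 2 * B1 ^ 2 - v ^ 2 * N ^ 2 * c ^ 6 * d ^ 2 = v ^ 2 / 4 * c ^ 8 * ((1 / 2 - 1 / 2 * v + p - 3 / 2 * p * v + 2 * p ^ 2 - p ^ 2 * v + p ^ 3) * ((1 + 2 * p) * v ^ 2 - (1 - p ^ 2)))"
    unfolding B w2_eq A_eq d_square N_def by (simp add: field_simps pow_expand)
  hence "4 * p ^ 2 * B1 ^ 2 = v ^ 2 * N ^ 2 * c ^ 6 * d ^ 2" unfolding v_square by simp
  thus "(2 * p * B1) ^ 2 = (v * N * c ^ 3 * d) ^ 2" by (simp add: power_mult_distrib flip: power_mult)
qed (use pos p_pos N_pos in auto)

text \<open>This fixes the sign of the square root in \<open>B2_eq\<close>.\<close>

lemma v_large: "1 - p < (1 + 2 * p) * v"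
proof (rule power2_less_imp_less)
  have "((1 + 2 * p) * v) ^ 2 - (1 - p) ^ 2 = (1 + 2 * p) * ((1 + 2 * p) * v ^ 2) - (1 - p) ^ 2"
    by (simp add: power2_eq_square mult_ac)
  also have "\<dots> = 2 * p * (1 - p) * (2 + p)" unfolding v_square by (simp add: power2_eq_square algebra_simps)
  also have "\<dots> > 0" using p_pos p_less_1 by simp
  finally show "(1 - p) ^ 2 < ((1 + 2 * p) * v) ^ 2" by simp
qed (use p_pos pos in auto)

lemma B2_eq: "4 * B2 = v * ((1 + 2 * p) * v - 1 + p) * c ^ 3 * d"
proof (rule power2_eq_imp_eq)
  have B: "B2 ^ 2 = a1 ^ 2 * d ^ 2 * v * (a * c * wW) / 4"
    unfolding monomial_defs by (simp add: field_simps pow_expand)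
  have "16 * B2 ^ 2 = 4 * (a1 ^ 2 * d ^ 2 * v * (a * c * wW))" unfolding B by simp
  also have "\<dots> = (4 * (1 - p) * N) * v ^ 2 * c ^ 6 * d ^ 2"
    unfolding acwW a1_square by (simp add: pow_expand mult_ac)
  finally have "16 * B2 ^ 2 = (4 * (1 - p) * N) * v ^ 2 * c ^ 6 * d ^ 2" .
  moreover have "4 * (1 - p) * N - ((1 + 2 * p) * v - 1 + p) ^ 2 = (- 1 - 2 * p) * ((1 + 2 * p) * v ^ 2 - (1 - p ^ 2))"
    unfolding N_def by (simp add: field_simps pow_expand)
  hence "4 * (1 - p) * N = ((1 + 2 * p) * v - 1 + p) ^ 2" unfolding v_square by simp
  ultimately show "(4 * B2) ^ 2 = (v * ((1 + 2 * p) * v - 1 + p) * c ^ 3 * d) ^ 2"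
    by (simp add: power_mult_distrib mult_ac flip: power_mult)
qed (use pos p_pos v_large in auto)

lemma C1_eq: "2 * p * C1 = d * W2 * a * v"
proof -
  have C: "C1 * w2 = B1 * wW" "wW ^ 2 = w2 * W2" unfolding monomial_defs by (simp_all add: field_simps pow_expand)
  have aw: "a * wW = N * c ^ 3"
  proof -
    have "c * (a * wW) = c * (N * c ^ 3)" using acwW by (simp add: pow_expand mult_ac)
    thus ?thesis using nz by simp
  qed
  have "2 * p * C1 * w2 = (2 * p * B1) * wW" using C(1) by (simp add: mult_ac)
  also have "\<dots> = d * v * wW * (N * c ^ 3)" unfolding B1_eq by (simp only: mult_ac)
  also have "\<dots> = d * v * a * wW ^ 2" unfolding aw[symmetric] by (simp add: power2_eq_square mult_ac)
  also have "\<dots> = d * W2 * a * v * w2" unfolding C(2) by (simp only: mult_ac)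
  finally show ?thesis using nz by simp
qed

lemma C2_eq: "4 * C2 = v * ((1 + 2 * p) * v - 1 + p) * c ^ 3 * b"
proof -
  have "C2 * d = B2 * b" unfolding monomial_defs by (simp add: field_simps pow_expand)
  hence "4 * C2 * d = 4 * B2 * b" by simp
  also have "\<dots> = v * ((1 + 2 * p) * v - 1 + p) * c ^ 3 * b * d" unfolding B2_eq by (simp only: mult_ac)
  finally show ?thesis using nz by simp
qed

lemma theta_1166_minus_2233: "a ^ 2 * d ^ 2 - b ^ 2 * c ^ 2 = 4 * A"
  unfolding a_square b_square d_square A_eq by (simp add: field_simps pow_expand)

text \<open>The right side is the combination of \<open>\<sigma>\<close>-series in the first two formulas, evaluated by
\<open>s_jacobi\<close>, \<open>s_odd\<close> and \<open>s_hexagonal\<close>; the first quotient is the eta quotient of \<open>s_hexagonal\<close>.\<close>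

lemma theta_1166_plus_2233:
  "a ^ 2 * d ^ 2 + b ^ 2 * c ^ 2 = a1 ^ 6 / c1 ^ 2 / 9 + 7 / 18 * a ^ 4 - b ^ 4 - c ^ 4 / 2 + 3 * d ^ 4 + 5 / 9 * (b ^ 2 * w2) + d ^ 2 * W2"
proof -
  define H where "H = a1 ^ 6 / c1 ^ 2"
  have p1: "1 + p > 0" using p_pos by simp
  have "a1 ^ 6 = (a1 ^ 2) ^ 3" by (simp flip: power_mult)
  hence "H = v ^ 3 * (1 - p) ^ 3 * (c ^ 2) ^ 3 / (v * (1 + p) * c ^ 2)" unfolding H_def a1_square c1_square by (simp add: power_mult_distrib)
  also have "\<dots> = v ^ 2 * (1 - p) ^ 3 / (1 + p) * c ^ 4"   proof -
    have "v ^ 3 * t * (c ^ 2) ^ 3 / (v * r * c ^ 2) = v ^ 2 * t / r * c ^ 4" if "r > 0" for t r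
      using that nz by (simp add: field_simps pow_expand)
    from this[OF p1] show ?thesis .
  qed
  finally have "(1 + 2 * p) * H = ((1 + 2 * p) * v ^ 2) * (1 - p) ^ 3 / (1 + p) * c ^ 4" by simp
  also have "\<dots> = (1 - p) ^ 4 * c ^ 4"
  proof -
    have "1 - p ^ 2 = (1 - p) * (1 + p)" by (simp add: power2_eq_square algebra_simps)
    thus ?thesis unfolding v_square using p1 by (simp add: pow_expand)
  qed
  finally have H: "(1 + 2 * p) * H = (1 - p) ^ 4 * c ^ 4" .
  have q4: "a ^ 4 = (a ^ 2) ^ 2" "b ^ 4 = (b ^ 2) ^ 2" "d ^ 4 = (d ^ 2) ^ 2" by (simp_all flip: power_mult)
  have "(1 + 2 * p) * (a ^ 2 * d ^ 2 + b ^ 2 * c ^ 2) - (1 + 2 * p) * (7 / 18 * a ^ 4 - b ^ 4 - c ^ 4 / 2 + 3 * d ^ 4 + 5 / 9 * (b ^ 2 * w2) + d ^ 2 * W2)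
     - (1 - p) ^ 4 * c ^ 4 / 9 = c ^ 4 * ((- 1 / 9 - 16 / 9 * p - 1 / 9 * p ^ 2) * ((1 + 2 * p) * v ^ 2 - (1 - p ^ 2)))"
    unfolding q4 a_square b_square d_square w2_eq W2_eq by (simp add: field_simps pow_expand)
  hence "(1 + 2 * p) * (a ^ 2 * d ^ 2 + b ^ 2 * c ^ 2) = (1 + 2 * p) * (H / 9 + 7 / 18 * a ^ 4 - b ^ 4 - c ^ 4 / 2 + 3 * d ^ 4 + 5 / 9 * (b ^ 2 * w2) + d ^ 2 * W2)"
    unfolding v_square H[symmetric] by (simp add: algebra_simps)
  thus ?thesis using p_pos by (simp add: H_def)
qed

text \<open>Multiplying by \<open>c d\<close> leaves only \<open>a b c d\<close>, \<open>B1 c d\<close>, \<open>B2 c d\<close> and squares, all known in terms of \<open>p\<close>, \<open>v\<close> and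
\<open>c\<^sup>2\<close>; the factor \<open>p\<close> clears the denominator of \<open>B1\<close>.\<close>

lemma theta_1266: "5 * (a * b * d ^ 2) = a * b * (2 * a ^ 2 - 3 * b ^ 2) + 6 * c * d ^ 3 + 8 * B1 - 4 * B2"
proof -
  define X where "X = a * b * c * d"
  define B where "B = 4 * B2"
  have "p * (c * d) * (5 * (a * b * d ^ 2) - (a * b * (2 * a ^ 2 - 3 * b ^ 2) + 6 * c * d ^ 3 + 8 * B1 - B)) =
      p * (5 * X * d ^ 2 - X * (2 * a ^ 2 - 3 * b ^ 2) - 6 * c ^ 2 * (d ^ 2) ^ 2 + B * (c * d)) - 4 * (2 * p * B1) * (c * d)"
    by (simp add: X_def pow_expand algebra_simps)
  also have "\<dots> = p * (5 * X * d ^ 2 - X * (2 * a ^ 2 - 3 * b ^ 2) - 6 * c ^ 2 * (d ^ 2) ^ 2 + v * ((1 + 2 * p) * v - 1 + p) * c ^ 4 * d ^ 2) - 4 * v * N * c ^ 4 * d ^ 2"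
    unfolding B_def B1_eq B2_eq by (simp add: pow_expand algebra_simps)
  also have "\<dots> = c ^ 6 * ((v + 1 / 2 * p + 3 / 2 * p * v - 1 / 2 * p ^ 2 + 1 / 2 * p ^ 2 * v) * ((1 + 2 * p) * v ^ 2 - (1 - p ^ 2)))"
    unfolding X_def abcd a_square b_square d_square M_def N_def by (simp add: field_simps pow_expand)
  finally have "p * (c * d) * (5 * (a * b * d ^ 2) - (a * b * (2 * a ^ 2 - 3 * b ^ 2) + 6 * c * d ^ 3 + 8 * B1 - B)) = 0" unfolding v_square by simp
  thus ?thesis using nz p_pos by (simp add: B_def)
qed

lemma theta_2236: "5 * (b ^ 2 * c * d) = 2 * a * b ^ 3 + 3 * c * d * (3 * d ^ 2 - 2 * c ^ 2) - 4 * B2"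
proof -
  define X where "X = a * b * c * d"
  define B where "B = 4 * B2"
  have "(c * d) * (5 * (b ^ 2 * c * d) - (2 * a * b ^ 3 + 3 * c * d * (3 * d ^ 2 - 2 * c ^ 2) - B)) =
      5 * b ^ 2 * c ^ 2 * d ^ 2 - 2 * X * b ^ 2 - 3 * c ^ 2 * d ^ 2 * (3 * d ^ 2 - 2 * c ^ 2) + B * (c * d)"
    by (simp add: X_def pow_expand algebra_simps)
  also have "\<dots> = 5 * b ^ 2 * c ^ 2 * d ^ 2 - 2 * X * b ^ 2 - 3 * c ^ 2 * d ^ 2 * (3 * d ^ 2 - 2 * c ^ 2) + v * ((1 + 2 * p) * v - 1 + p) * c ^ 4 * d ^ 2"
    unfolding B_def B2_eq by (simp add: pow_expand algebra_simps)
  also have "\<dots> = c ^ 6 * ((- 3 / 2 + 1 / 2 * v - p + 1 / 2 * p * v) * ((1 + 2 * p) * v ^ 2 - (1 - p ^ 2)))"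
    unfolding X_def abcd a_square b_square d_square M_def N_def by (simp add: field_simps pow_expand)
  finally have "(c * d) * (5 * (b ^ 2 * c * d) - (2 * a * b ^ 3 + 3 * c * d * (3 * d ^ 2 - 2 * c ^ 2) - B)) = 0" unfolding v_square by simp
  thus ?thesis using nz by (simp add: B_def)
qed

text \<open>The Lambert series for discriminants 12, \<open>-3\<close>, \<open>-4\<close>: \<open>1 - K\<close>, \<open>H\<close>, \<open>S\<close>, \<open>S'\<close> belong to the pairs \<open>(12, 1)\<close>,
\<open>(-4, -3)\<close>, \<open>(1, 12)\<close>, \<open>(-3, -4)\<close>, and \<open>1 - K2\<close>, \<open>H2\<close> are the first two at \<open>q\<^sup>2\<close>.\<close>

definition K where "K = e (Suc 0) * e 3 * e 4 ^ 2 * e 6 ^ 2 / e 12 ^ 2"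
definition H where "H = q * (e (Suc 0) * e 2 ^ 2 * e 3 * e 12 ^ 2 / e 4 ^ 2)"
definition K2 where "K2 = e 2 * e 6 * e 8 ^ 2 * e 12 ^ 2 / e 24 ^ 2"
definition H2 where "H2 = q ^ 2 * (e 2 * e 4 ^ 2 * e 6 * e 24 ^ 2 / e 8 ^ 2)"
definition S where "S = q * (e 2 ^ 2 * e 3 ^ 2 * e 4 * e 12 / e (Suc 0) ^ 2)"
definition S' where "S' = q * (e (Suc 0) ^ 2 * e 4 * e 6 ^ 2 * e 12 / e 3 ^ 2)"

lemma KH: "K - H = a * v ^ 2 * c ^ 3"
proof -
  have "K * (1 - \<tau>) = a * v ^ 2 * c ^ 3" unfolding tau_minus unfolding K_def monomial_defs by (simp add: field_simps pow_expand)
  moreover have "H = K * \<tau>" unfolding K_def H_def monomial_defs by (simp add: field_simps pow_expand)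
  ultimately show ?thesis by (simp add: algebra_simps)
qed

lemma S_eq: "4 * (a * S) = (1 + p) * (2 * p + p ^ 2) * c ^ 5" and S'_eq: "4 * (a * S') = (1 - p) * (2 * p + p ^ 2) * c ^ 5"
proof -
  have 1: "S * (a1 * c1) = c1 ^ 2 * A" "S' * (a1 * c1) = a1 ^ 2 * A"
    unfolding S_def S'_def monomial_defs by (simp_all add: field_simps pow_expand)
  have "v ^ 2 * c * (4 * (a * S)) = v ^ 2 * c * ((1 + p) * (2 * p + p ^ 2) * c ^ 5)"
    using 1(1) unfolding a1_c1 c1_square A_eq by (simp add: pow_expand mult_ac)
  thus "4 * (a * S) = (1 + p) * (2 * p + p ^ 2) * c ^ 5" using nz by simp
  have "v ^ 2 * c * (4 * (a * S')) = v ^ 2 * c * ((1 - p) * (2 * p + p ^ 2) * c ^ 5)"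
    using 1(2) unfolding a1_c1 a1_square A_eq by (simp add: pow_expand mult_ac)
  thus "4 * (a * S') = (1 - p) * (2 * p + p ^ 2) * c ^ 5" using nz by simp
qed

lemma theta_1333: "a * c ^ 3 = K - H + 2 * S + 2 * S'"
proof -
  have "a * (K - H + 2 * S + 2 * S') = a * (K - H) + (4 * (a * S) + 4 * (a * S')) / 2" by (simp add: algebra_simps)
  also have "\<dots> = a ^ 2 * v ^ 2 * c ^ 3 + (2 * p + p ^ 2) * c ^ 5"
    unfolding KH S_eq S'_eq by (simp add: power2_eq_square field_simps)
  also have "\<dots> = ((1 + 2 * p) * v ^ 2 + 2 * p + p ^ 2) * c ^ 5" unfolding a_square by (simp add: pow_expand algebra_simps)
  also have "\<dots> = a ^ 2 * c ^ 3" unfolding v_square a_square by (simp add: pow_expand algebra_simps)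
  finally show ?thesis using nz by (simp add: power2_eq_square)
qed

lemma K2_H2: "a * c * wW * K2 = a * c * w2 * A" "a * c * wW * H2 = a * c * W2 * A"
  unfolding K2_def H2_def monomial_defs by (simp_all add: field_simps pow_expand)

text \<open>Here the multiplier is \<open>a\<close> times \<open>a c w W\<close>, which is known by \<open>acwW\<close>.\<close>

lemma theta_1366: "a * c * d ^ 2 = S + K2 + S' + H2"
proof -
  define Y where "Y = a * c * wW"
  have Y: "Y > 0" using pos by (simp add: Y_def)
  have "a * Y * (a * c * d ^ 2 - (S + K2 + S' + H2)) = a ^ 2 * c * Y * d ^ 2 - Y * (4 * (a * S) + 4 * (a * S')) / 4 - a * (Y * K2 + Y * H2)"
    by (simp add: power2_eq_square algebra_simps)
  also have "a * (Y * K2 + Y * H2) = a ^ 2 * c * A * (w2 + W2)"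
    unfolding Y_def K2_H2 by (simp add: power2_eq_square algebra_simps)
  also have "a ^ 2 * c * Y * d ^ 2 - Y * (4 * (a * S) + 4 * (a * S')) / 4 - a ^ 2 * c * A * (w2 + W2) = c ^ 9 * ((- 1 / 4 - 1 / 4 * p - 1 / 4 * p ^ 2) * ((1 + 2 * p) * v ^ 2 - (1 - p ^ 2)))"
    unfolding Y_def acwW S_eq S'_eq a_square d_square A_eq w2_eq W2_eq N_def by (simp add: field_simps pow_expand)
  finally have "a * Y * (a * c * d ^ 2 - (S + K2 + S' + H2)) = 0" unfolding v_square by simp
  thus ?thesis using Y nz by simp
qed

lemma theta_2336: "b * c ^ 2 * d = S + K2 - S' - H2"
proof -
  define X Y where "X = a * b * c * d" and "Y = a * c * wW"
  have Y: "Y > 0" using pos by (simp add: Y_def)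
  have "a * Y * (b * c ^ 2 * d - (S + K2 - S' - H2)) = X * c * Y - Y * (4 * (a * S)) / 4 + Y * (4 * (a * S')) / 4 - a * (Y * K2 - Y * H2)"
    by (simp add: X_def power2_eq_square algebra_simps)
  also have "a * (Y * K2 - Y * H2) = a ^ 2 * c * A * (w2 - W2)"
    unfolding Y_def K2_H2 by (simp add: power2_eq_square algebra_simps)
  also have "X * c * Y - Y * (4 * (a * S)) / 4 + Y * (4 * (a * S')) / 4 - a ^ 2 * c * A * (w2 - W2) = c ^ 9 * ((- 1 / 4 - 1 / 2 * p - 1 / 2 * p ^ 2 - 1 / 4 * p ^ 3) * ((1 + 2 * p) * v ^ 2 - (1 - p ^ 2)))"
    unfolding X_def Y_def abcd acwW S_eq S'_eq a_square d_square A_eq w2_eq W2_eq M_def N_def by (simp add: field_simps pow_expand)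
  finally have "a * Y * (b * c ^ 2 * d - (S + K2 - S' - H2)) = 0" unfolding v_square by simp
  thus ?thesis using Y nz by simp
qed

lemma g_eq: "2 * g = 3 * (c * d) - a * b" "2 * g' = a * b - c * d" using ab cd by simp_all

text \<open>For this form and for \<open>(2, 3, 6, 6)\<close> the relation \<open>c d = g + g'\<close> is all that is needed.\<close>

lemma theta_1336: "a * c ^ 2 * d = g * (a * c) + g' * (a * c)"
proof -
  have "a * c ^ 2 * d = (c * d) * (a * c)" by (simp add: power2_eq_square)
  thus ?thesis unfolding cd by (simp add: algebra_simps)
qed

lemma theta_2366: "b * c * d ^ 2 = g * (b * d) + g' * (b * d)"
proof -
  have "b * c * d ^ 2 = (c * d) * (b * d)" by (simp add: power2_eq_square)
  thus ?thesis unfolding cd by (simp add: algebra_simps)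
qed

text \<open>The multiplier \<open>a c\<^sup>2 d\<close> is chosen so that \<open>g\<close> and \<open>g'\<close> appear multiplied by \<open>c d\<close>, where they are
expressible by \<open>a b c d\<close> and \<open>c\<^sup>2 d\<^sup>2\<close>.\<close>

lemma theta_1666: "3 * (a * d ^ 3) = g' * (2 * a * c - b * d) + g * (2 * a * c + b * d) + 8 * C1 + 4 * C2"
proof -
  define X C where "X = a * b * c * d" and "C = 4 * C2"
  have "p * (a * c ^ 2 * d) * (3 * (a * d ^ 3) - (g' * (2 * a * c - b * d) + g * (2 * a * c + b * d) + 8 * C1 + C)) =
      p * (3 * a ^ 2 * c ^ 2 * (d ^ 2) ^ 2 - ((2 * g') * (c * d) * (2 * a ^ 2 * c ^ 2 - X) + (2 * g) * (c * d) * (2 * a ^ 2 * c ^ 2 + X)) / 2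
        - C * (a * c ^ 2 * d)) - 4 * (2 * p * C1) * (a * c ^ 2 * d)"
    by (simp add: X_def pow_expand algebra_simps add_divide_distrib diff_divide_distrib)
  also have "\<dots> = p * (3 * a ^ 2 * c ^ 2 * (d ^ 2) ^ 2 - ((X - c ^ 2 * d ^ 2) * (2 * a ^ 2 * c ^ 2 - X) + (3 * c ^ 2 * d ^ 2 - X) * (2 * a ^ 2 * c ^ 2 + X)) / 2
        - v * ((1 + 2 * p) * v - 1 + p) * c ^ 4 * X) - 4 * (v * a ^ 2 * c ^ 2 * W2 * d ^ 2)"
    unfolding C_def C1_eq C2_eq g_eq by (simp add: X_def pow_expand algebra_simps add_divide_distrib diff_divide_distrib)
  also have "\<dots> = c ^ 8 * ((v + 1 / 2 * p + 3 / 2 * p * v + 1 / 2 * p ^ 2 + 1 / 4 * p ^ 3) * ((1 + 2 * p) * v ^ 2 - (1 - p ^ 2)))"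
    unfolding X_def abcd a_square b_square d_square W2_eq M_def by (simp add: field_simps pow_expand)
  finally have "p * (a * c ^ 2 * d) * (3 * (a * d ^ 3) - (g' * (2 * a * c - b * d) + g * (2 * a * c + b * d) + 8 * C1 + C)) = 0"
    unfolding v_square by simp
  thus ?thesis using nz p_pos by (simp add: C_def)
qed

lemma theta_2223: "3 * (b ^ 3 * c) = g * (2 * a * c + b * d) + 3 * g' * (2 * a * c - b * d) - 4 * C2"
proof -
  define X C where "X = a * b * c * d" and "C = 4 * C2"
  have "(a * c ^ 2 * d) * (3 * (b ^ 3 * c) - (g * (2 * a * c + b * d) + 3 * g' * (2 * a * c - b * d) - C)) =
      3 * X * b ^ 2 * c ^ 2 - ((2 * g) * (c * d) * (2 * a ^ 2 * c ^ 2 + X) + 3 * (2 * g') * (c * d) * (2 * a ^ 2 * c ^ 2 - X)) / 2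
        + C * (a * c ^ 2 * d)"
    by (simp add: X_def pow_expand algebra_simps add_divide_distrib diff_divide_distrib)
  also have "\<dots> = 3 * X * b ^ 2 * c ^ 2 - ((3 * c ^ 2 * d ^ 2 - X) * (2 * a ^ 2 * c ^ 2 + X) + 3 * (X - c ^ 2 * d ^ 2) * (2 * a ^ 2 * c ^ 2 - X)) / 2
        + v * ((1 + 2 * p) * v - 1 + p) * c ^ 4 * X"
    unfolding C_def C2_eq g_eq by (simp add: X_def pow_expand algebra_simps add_divide_distrib diff_divide_distrib)
  also have "\<dots> = c ^ 8 * (3 * (1 / 6 + 1 / 6 * v + 1 / 6 * p + 1 / 3 * p * v + 1 / 6 * p ^ 2) * ((1 + 2 * p) * v ^ 2 - (1 - p ^ 2)))"
    unfolding X_def abcd a_square b_square d_square M_def by (simp add: field_simps pow_expand)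
  finally have "(a * c ^ 2 * d) * (3 * (b ^ 3 * c) - (g * (2 * a * c + b * d) + 3 * g' * (2 * a * c - b * d) - C)) = 0"
    unfolding v_square by simp
  thus ?thesis using nz by (simp add: C_def)
qed

lemma theta_2333: "3 * (b * c ^ 3) = g * (4 * b * d - a * c) + g' * (a * c + 4 * b * d) - 8 * C1"
proof -
  define X where "X = a * b * c * d"
  have "p * (a * c ^ 2 * d) * (3 * (b * c ^ 3) - (g * (4 * b * d - a * c) + g' * (a * c + 4 * b * d) - 8 * C1)) =
      p * (3 * X * c ^ 4 - ((2 * g) * (c * d) * (4 * X - a ^ 2 * c ^ 2) + (2 * g') * (c * d) * (a ^ 2 * c ^ 2 + 4 * X)) / 2)
        + 4 * (2 * p * C1) * (a * c ^ 2 * d)"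
    by (simp add: X_def pow_expand algebra_simps add_divide_distrib diff_divide_distrib)
  also have "\<dots> = p * (3 * X * c ^ 4 - ((3 * c ^ 2 * d ^ 2 - X) * (4 * X - a ^ 2 * c ^ 2) + (X - c ^ 2 * d ^ 2) * (a ^ 2 * c ^ 2 + 4 * X)) / 2)
        + 4 * (v * a ^ 2 * c ^ 2 * W2 * d ^ 2)"
    unfolding C1_eq g_eq by (simp add: X_def pow_expand algebra_simps add_divide_distrib diff_divide_distrib)
  also have "\<dots> = c ^ 8 * (3 * (- 1 / 3 * v - 1 / 3 * p - 2 / 3 * p * v - 1 / 3 * p ^ 2 - 1 / 3 * p ^ 2 * v) * ((1 + 2 * p) * v ^ 2 - (1 - p ^ 2)))"
    unfolding X_def abcd a_square b_square d_square W2_eq M_def by (simp add: field_simps pow_expand)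
  finally have "p * (a * c ^ 2 * d) * (3 * (b * c ^ 3) - (g * (4 * b * d - a * c) + g' * (a * c + 4 * b * d) - 8 * C1)) = 0"
    unfolding v_square by simp
  thus ?thesis using nz p_pos by simp
qed

end

section \<open>Comparison of coefficients\<close>

definition power_sums :: "complex \<Rightarrow> (nat \<Rightarrow> complex) \<Rightarrow> complex \<Rightarrow> bool" where
  "power_sums q u U \<longleftrightarrow> (\<lambda>n. u n * q ^ n) sums U"

lemma power_sums_add: "power_sums q u U \<Longrightarrow> power_sums q v V \<Longrightarrow> power_sums q (\<lambda>n. u n + v n) (U + V)"
  unfolding power_sums_def distrib_right by (rule sums_add)

lemma power_sums_diff: "power_sums q u U \<Longrightarrow> power_sums q v V \<Longrightarrow> power_sums q (\<lambda>n. u n - v n) (U - V)"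
  unfolding power_sums_def left_diff_distrib by (rule sums_diff)

lemma power_sums_cmult: "power_sums q u U \<Longrightarrow> power_sums q (\<lambda>n. c * u n) (c * U)"
  unfolding power_sums_def mult.assoc by (rule sums_mult)

text \<open>The coefficients of the power series at \<open>q\<^sup>k\<close>; they realise the convention that a divisor sum at a fraction is zero.\<close>

definition dilate :: "nat \<Rightarrow> (nat \<Rightarrow> complex) \<Rightarrow> nat \<Rightarrow> complex" where
  "dilate k u n = (if k dvd n then u (n div k) else 0)"

lemma power_sums_dilate:
  assumes "power_sums (q ^ k) u U" "k > 0"
  shows "power_sums q (dilate k u) U"
proof -
  have "(\<lambda>n. dilate k u (k * n) * q ^ (k * n)) sums U"
    using assms by (simp add: power_sums_def dilate_def power_mult)
  thus ?thesis unfolding power_sums_def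
    using assms(2) by (subst (asm) sums_mono_reindex) (auto simp: strict_mono_def dilate_def elim!: dvdE)
qed

text \<open>The two series are allowed to differ by a constant, because the formulas hold for \<open>n \<ge> 1\<close> only. A power
series that vanishes on an interval to the right of 0 vanishes identically.\<close>

lemma power_sums_eq:
  assumes u: "\<And>x. 0 < x \<Longrightarrow> x < 1 \<Longrightarrow> \<exists>U. power_sums (complex_of_real x) u (U + C) \<and> power_sums (complex_of_real x) v U"
    and n: "n \<ge> 1"
  shows "u n = v n"
proof (rule ccontr)
  assume ne: "u n \<noteq> v n"
  define h where "h m = u m - v m - (if m = 0 then C else 0)" for m
  have h: "(\<lambda>m. h m * of_real x ^ m) sums 0" if x: "0 < x" "x < 1" for x
  proof -
    from u[OF x] obtain U where U: "power_sums (complex_of_real x) u (U + C)" "power_sums (complex_of_real x) v U" by blast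
    have "(\<lambda>m. (if m = 0 then C else 0) * of_real x ^ m) sums C"
      using sums_single[of 0 "\<lambda>m. C * of_real x ^ m"] by (simp add: if_distrib[of "\<lambda>z. z * _"] cong: if_cong)
    from sums_diff[OF sums_diff[OF U[unfolded power_sums_def]] this] show ?thesis
      by (simp add: h_def left_diff_distrib)
  qed
  have s: "summable (\<lambda>m. h m * z ^ m)" if "norm z < 1 / 2" for z
    using powser_inside[OF sums_summable[OF h[of "1 / 2"]], of z] that by simp
  \<comment> \<open>The extra factor \<open>z\<close> makes the function vanish at 0, as the principle of isolated zeros in the form used requires, whatever \<open>h 0\<close> is.\<close>
  define f where "f z = z * (\<Sum>m. h m * z ^ m)" for z
  define a where "a m = (case m of 0 \<Rightarrow> 0 | Suc k \<Rightarrow> h k)" for m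
  have f: "(\<lambda>m. a m * (z - 0) ^ m) sums f z" if "norm (z - 0) < 1 / 2" for z
  proof -
    have "(\<lambda>m. a (Suc m) * z ^ Suc m) sums f z"
      using sums_mult[OF summable_sums[OF s], of z z] that by (simp add: a_def f_def mult_ac)
    thus ?thesis by (subst (asm) sums_Suc_iff) (simp add: a_def)
  qed
  have "a (Suc n) \<noteq> 0" using ne n by (simp add: a_def h_def)
  obtain r where r: "0 < r" "\<And>z. z \<in> cball 0 r - {0} \<Longrightarrow> f z \<noteq> 0"
    by (rule powser_0_nonzero[of "1 / 2" 0 a f "Suc n"]) (use f \<open>a (Suc n) \<noteq> 0\<close> in \<open>simp_all add: f_def\<close>)
  define x where "x = min r (1 / 2)"
  have x: "0 < x" "x < 1" "x \<le> r" using r(1) by (auto simp: x_def)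
  hence "f (of_real x) \<noteq> 0" by (intro r) auto
  moreover have "f (of_real x) = 0" using sums_unique[OF h[OF x(1,2)]] by (simp add: f_def)
  ultimately show False by simp
qed

context nome
begin

lemma nome_power: "k > 0 \<Longrightarrow> nome (q ^ k)"
  using norm_qk qk_nz by unfold_locales

lemma E_power: "k > 0 \<Longrightarrow> nome.E (q ^ k) m = E (k * m)"
  by (simp add: nome.E_def[OF nome_power] E_def power_mult)

lemma s_power: "k > 0 \<Longrightarrow> nome.s (q ^ k) m = s (k * m)"
  by (simp add: nome.s_def[OF nome_power] s_def power_mult)

lemma s_relations:
  assumes "k > 0"
  shows "1 / 4 + 2 * s k - 8 * s (k * 4) = phi k ^ 4 / 4"
    and "4 * s k - 12 * s (k * 2) + 8 * s (k * 4) = 4 * q ^ k * E (k * 4) ^ 8 / E (k * 2) ^ 4"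
  using nome.s_jacobi[OF nome_power[OF assms]] nome.s_odd[OF nome_power[OF assms]] assms
  by (simp_all add: E_power s_power phi_def power_divide power_mult_distrib mult.commute[of k] flip: power_mult)

end

text \<open>The partial products are positive, so the limit is real and nonnegative, and it is not zero.\<close>

lemma euler_of_real:
  assumes "0 \<le> x" "x < 1"
  shows "euler (of_real x) = of_real (Re (euler (of_real x)))" "Re (euler (of_real x)) > 0"
proof -
  define P where "P N = (\<Prod>n<N. 1 - x * x ^ n)" for N
  have n: "norm (complex_of_real x) < 1" using assms by simp
  have "(\<lambda>N. complex_of_real (P N)) \<longlonglongrightarrow> euler (of_real x)"
    using qpoch_LIMSEQ[OF n, of "of_real x"] by (simp add: P_def euler_def)
  hence L: "P \<longlonglongrightarrow> Re (euler (of_real x))" "(\<lambda>N. 0) \<longlonglongrightarrow> Im (euler (of_real x))"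
    using tendsto_Re tendsto_Im by fastforce+
  have "Im (euler (of_real x)) = 0" using L(2) LIMSEQ_unique tendsto_const by blast
  thus e: "euler (of_real x) = of_real (Re (euler (of_real x)))" by (simp add: complex_eq_iff)
  have "P N \<ge> 0" for N unfolding P_def using assms power_le_one[of x] by (intro prod_nonneg) (auto simp: mult_le_one)
  hence "Re (euler (of_real x)) \<ge> 0" using L(1) by (intro LIMSEQ_le_const) auto
  moreover have "Re (euler (of_real x)) \<noteq> 0" using euler_nonzero[OF n] e by auto
  ultimately show "Re (euler (of_real x)) > 0" by simp
qed

text \<open>Real \<open>q\<close> between 0 and 1, where the eta quotients are positive numbers and the relations of \<open>theta_algebra\<close> apply.\<close>

locale real_nome =
  fixes x :: real
  assumes x_pos: "0 < x" and x_less: "x < 1"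
begin

sublocale nome "complex_of_real x"
  using x_pos x_less by unfold_locales auto

lemma of_real_E: "k > 0 \<Longrightarrow> of_real (Re (E k)) = E k" and Re_E_pos: "k > 0 \<Longrightarrow> Re (E k) > 0"
  using euler_of_real[of "x ^ k"] x_pos x_less by (simp_all add: E_def power_less_one_iff less_imp_le)

sublocale R: theta_algebra x "\<lambda>k. Re (E k)"
proof
  fix k :: nat assume k: "k > 0"
  show "(Re (E (2 * k)) ^ 5 / (Re (E k) ^ 2 * Re (E (4 * k)) ^ 2)) ^ 2
        = (Re (E (4 * k)) ^ 5 / (Re (E (2 * k)) ^ 2 * Re (E (8 * k)) ^ 2)) ^ 2 + 4 * x ^ k * (Re (E (8 * k)) ^ 2 / Re (E (4 * k))) ^ 2"
    by (rule of_real_eq_iff[where 'a = complex, THEN iffD1])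
       (use phi_square[OF k] k in \<open>simp add: of_real_E phi_def\<close>)
  show "(Re (E k) ^ 2 / Re (E (2 * k))) ^ 2
        = (Re (E (4 * k)) ^ 5 / (Re (E (2 * k)) ^ 2 * Re (E (8 * k)) ^ 2)) ^ 2 - 4 * x ^ k * (Re (E (8 * k)) ^ 2 / Re (E (4 * k))) ^ 2"
    by (rule of_real_eq_iff[where 'a = complex, THEN iffD1])
       (use phi_minus_square[OF k] k in \<open>simp add: of_real_E phi_def phi_minus_def\<close>)
next
  show "1 + x * Re (E 2) ^ 2 * Re (E 12) ^ 4 / (Re (E 4) ^ 4 * Re (E 6) ^ 2) =
      Re (E 2) ^ 2 * Re (E 3) ^ 3 * Re (E 12) / (Re (E (Suc 0)) * Re (E 4) ^ 3 * Re (E 6) ^ 2)"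
    by (rule of_real_eq_iff[where 'a = complex, THEN iffD1]) (use eta_three_term_a in \<open>simp add: of_real_E\<close>)
  show "1 - x * Re (E 2) ^ 2 * Re (E 12) ^ 4 / (Re (E 4) ^ 4 * Re (E 6) ^ 2) =
      Re (E (Suc 0)) * Re (E 6) ^ 7 / (Re (E 2) * Re (E 3) ^ 3 * Re (E 4) ^ 2 * Re (E 12) ^ 2)"
    by (rule of_real_eq_iff[where 'a = complex, THEN iffD1]) (use eta_three_term_b in \<open>simp add: of_real_E\<close>)
  show "3 * (Re (E 12) * Re (E 2) / (Re (E 6) * Re (E 4)) * (Re (E 3) / Re (E (Suc 0))) ^ 2)
      + Re (E 12) * Re (E 2) / (Re (E 6) * Re (E 4)) * (Re (E 6) * Re (E (Suc 0)) / (Re (E 2) * Re (E 3))) ^ 2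
      = 4 * ((Re (E 2) / Re (E (Suc 0))) ^ 2 * (Re (E 6) * Re (E (Suc 0)) / (Re (E 2) * Re (E 3))) * (Re (E 4) / Re (E 2)) ^ 2)"
    by (rule of_real_eq_iff[where 'a = complex, THEN iffD1]) (use eta_three_term_c in \<open>simp add: of_real_E\<close>)
  show "2 * (Re (E 12) * Re (E 2) / (Re (E 6) * Re (E 4)) * (Re (E 2) / Re (E (Suc 0))) ^ 4)
      + (Re (E 4) / Re (E 2)) ^ 2 * (Re (E 6) * Re (E (Suc 0)) / (Re (E 2) * Re (E 3))) ^ 2
      = 3 * ((Re (E 3) / Re (E (Suc 0))) ^ 2 * (Re (E 4) / Re (E 2)) ^ 2)"
    by (rule of_real_eq_iff[where 'a = complex, THEN iffD1]) (use eta_three_term_d in \<open>simp add: of_real_E\<close>)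
qed (use x_pos Re_E_pos in auto)

lemma phi_real: "phi (Suc 0) = of_real R.a" "phi 2 = of_real R.b" "phi 3 = of_real R.c" "phi 6 = of_real R.d"
  by (simp_all add: phi_def R.monomial_defs of_real_E)

lemma eta_g_real: "eta_g = of_real R.g" "eta_g' = of_real R.g'"
  by (simp_all add: eta_g_def eta_g'_def R.monomial_defs of_real_E)

lemma cusp_power_sums:
  "power_sums (of_real x) a_coeff (of_real R.A)" "power_sums (of_real x) b1_coeff (of_real R.B1)"
  "power_sums (of_real x) b2_coeff (of_real R.B2)" "power_sums (of_real x) c1_coeff (of_real R.C1)"
  "power_sums (of_real x) c2_coeff (of_real R.C2)"
  using a_coeff_sums b1_coeff_sums b2_coeff_sums c1_coeff_sums c2_coeff_sums
  by (simp_all add: power_sums_def R.monomial_defs of_real_E)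

lemma power_sums_1: "power_sums (of_real x) u U \<Longrightarrow> power_sums (of_real x) (dilate 1 u) U"
  using power_sums_dilate[of "of_real x" 1] by simp

lemma sigma_power_sums: "k > 0 \<Longrightarrow> power_sums (of_real x) (dilate k (divsum chi1 chi1)) (s k)"
  using sigma_sums by (intro power_sums_dilate) (simp_all add: power_sums_def)

lemma chi8_power_sums:
  "power_sums (of_real x) (dilate 1 (divsum chi1 chi8)) (of_real (R.a * R.b * (R.a ^ 2 - R.b ^ 2) / 4))"
  "power_sums (of_real x) (dilate 3 (divsum chi1 chi8)) (of_real (R.c * R.d * (R.c ^ 2 - R.d ^ 2) / 4))"
  "power_sums (of_real x) (dilate 1 (divsum chi8 chi1)) (of_real ((1 - R.a * R.b * (2 * R.b ^ 2 - R.a ^ 2)) / 2))"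
  "power_sums (of_real x) (dilate 3 (divsum chi8 chi1)) (of_real ((1 - R.c * R.d * (2 * R.d ^ 2 - R.c ^ 2)) / 2))"
proof -
  have sq: "R.a ^ 2 - R.b ^ 2 = R.w2" "2 * R.b ^ 2 - R.a ^ 2 = R.a1 ^ 2" "R.c ^ 2 - R.d ^ 2 = R.W2" "2 * R.d ^ 2 - R.c ^ 2 = R.c1 ^ 2"
    using R.square_relations by simp_all
  have 1: "of_real (R.a * R.b * R.w2 / 4) = of_real x * E 2 ^ 3 * E 4 * E 8 ^ 2 / E (Suc 0) ^ 2"
    by (simp add: R.monomial_defs of_real_E field_simps pow_expand)
  show "power_sums (of_real x) (dilate 1 (divsum chi1 chi8)) (of_real (R.a * R.b * (R.a ^ 2 - R.b ^ 2) / 4))"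
    unfolding sq 1 using S18_sums by (intro power_sums_1) (simp add: power_sums_def)
  have 2: "of_real (R.c * R.d * R.W2 / 4) = of_real x ^ 3 * E 6 ^ 3 * E 12 * E 24 ^ 2 / E 3 ^ 2"
    by (simp add: R.monomial_defs of_real_E field_simps pow_expand)
  show "power_sums (of_real x) (dilate 3 (divsum chi1 chi8)) (of_real (R.c * R.d * (R.c ^ 2 - R.d ^ 2) / 4))"
    unfolding sq 2 using nome.S18_sums[OF nome_power[of 3]] by (intro power_sums_dilate) (simp_all add: power_sums_def E_power)
  have 3: "of_real ((1 - R.a * R.b * R.a1 ^ 2) / 2) = (1 - E (Suc 0) ^ 2 * E 2 * E 4 ^ 3 / E 8 ^ 2) / 2"
    by (simp add: R.monomial_defs of_real_E field_simps pow_expand)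
  show "power_sums (of_real x) (dilate 1 (divsum chi8 chi1)) (of_real ((1 - R.a * R.b * (2 * R.b ^ 2 - R.a ^ 2)) / 2))"
    unfolding sq 3 using S81_sums by (intro power_sums_1) (simp add: power_sums_def)
  have 4: "of_real ((1 - R.c * R.d * R.c1 ^ 2) / 2) = (1 - E 3 ^ 2 * E 6 * E 12 ^ 3 / E 24 ^ 2) / 2"
    by (simp add: R.monomial_defs of_real_E field_simps pow_expand)
  show "power_sums (of_real x) (dilate 3 (divsum chi8 chi1)) (of_real ((1 - R.c * R.d * (2 * R.d ^ 2 - R.c ^ 2)) / 2))"
    unfolding sq 4 using nome.S81_sums[OF nome_power[of 3]] by (intro power_sums_dilate) (simp_all add: power_sums_def E_power)
qed

lemma chi12_power_sums:
  "power_sums (of_real x) (dilate 1 (divsum chi1 chi12)) (of_real R.S)"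
  "power_sums (of_real x) (dilate 1 (divsum chi12 chi1)) (of_real (1 - R.K))"
  "power_sums (of_real x) (dilate 2 (divsum chi12 chi1)) (of_real (1 - R.K2))"
  "power_sums (of_real x) (dilate 1 (divsum chim3 chim4)) (of_real R.S')"
  "power_sums (of_real x) (dilate 1 (divsum chim4 chim3)) (of_real R.H)"
  "power_sums (of_real x) (dilate 2 (divsum chim4 chim3)) (of_real R.H2)"
  using power_sums_1[unfolded power_sums_def, OF S112_sums] power_sums_1[unfolded power_sums_def, OF S121_sums]
    power_sums_1[unfolded power_sums_def, OF S34_sums] power_sums_1[unfolded power_sums_def, OF S43_sums]
    power_sums_dilate[unfolded power_sums_def, OF nome.S121_sums[OF nome_power[of 2]]]
    power_sums_dilate[unfolded power_sums_def, OF nome.S43_sums[OF nome_power[of 2]]]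
  by (simp_all add: power_sums_def R.S_def R.S'_def R.K_def R.H_def R.K2_def R.H2_def of_real_E E_power mult.assoc)

lemma chi24_power_sums:
  "power_sums (of_real x) (dilate 1 (divsum chi1 chi24)) (of_real (R.g' * (R.a * R.c + R.b * R.d) / 2))"
  "power_sums (of_real x) (dilate 1 (divsum chi24 chi1)) (of_real (3 - R.g * (R.a * R.c + 2 * R.b * R.d)))"
  "power_sums (of_real x) (dilate 1 (divsum chim3 chim8)) (of_real (R.g * (R.a * R.c - R.b * R.d) / 2))"
  "power_sums (of_real x) (dilate 1 (divsum chim8 chim3)) (of_real (R.g' * (2 * R.b * R.d - R.a * R.c)))"
  using power_sums_1[unfolded power_sums_def, OF S124_sums] power_sums_1[unfolded power_sums_def, OF S241_sums]
    power_sums_1[unfolded power_sums_def, OF S38_sums] power_sums_1[unfolded power_sums_def, OF S83_sums]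
  by (simp_all add: power_sums_def phi_real eta_g_real mult.assoc)

text \<open>The combination of Eisenstein series in the first two formulas; it is half of \<open>theta_1166_plus_2233\<close>, without the constant term.\<close>

lemma sigma_combination:
  "2 * s 1 - 2 * s 2 - 6 * s 3 - 4 * s 4 + 6 * s 6 + 16 * s 8 + 12 * s 12 - 48 * s 24
     = of_real ((R.a ^ 2 * R.d ^ 2 + R.b ^ 2 * R.c ^ 2) / 2 - 1)"
proof -
  define X O1 O3 where "X = R.a1 ^ 6 / R.c1 ^ 2" and "O1 = R.b ^ 2 * R.w2" and "O3 = R.d ^ 2 * R.W2"
  have X: "complex_of_real X = E (Suc 0) ^ 12 * E 6 ^ 2 / (E 2 ^ 6 * E 3 ^ 4)"
    by (simp add: X_def R.monomial_defs of_real_E field_simps pow_expand)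
  have O: "complex_of_real O1 = 4 * of_real x ^ 1 * E 4 ^ 8 / E 2 ^ 4" "complex_of_real O3 = 4 * of_real x ^ 3 * E 12 ^ 8 / E 6 ^ 4"
    by (simp_all add: O1_def O3_def R.monomial_defs of_real_E field_simps pow_expand)
  have h: "1 - 12 * s 1 + 96 * s 2 - 108 * s 3 = of_real X"
  proof -
    have "12 * (1 / 12 - s (Suc 0) + 8 * s 2 - 9 * s 3) = of_real X" unfolding s_hexagonal X by simp
    thus ?thesis by simp
  qed
  have j: "1 + 8 * s k - 32 * s (k * 4) = phi k ^ 4" if "k > 0" for k
  proof -
    have "4 * (1 / 4 + 2 * s k - 8 * s (k * 4)) = phi k ^ 4" unfolding s_relations(1)[OF that] by simp
    thus ?thesis by simp
  qed
  have o: "4 * s 1 - 12 * s 2 + 8 * s 4 = of_real O1" "4 * s 3 - 12 * s 6 + 8 * s 12 = of_real O3"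
    unfolding O using s_relations(2)[of 1] s_relations(2)[of 3] by simp_all
  \<comment> \<open>The coefficients solve the linear system that expresses the left side through Jacobi's relation at \<open>q, q\<^sup>2, q\<^sup>3, q\<^sup>6\<close>, the odd one at \<open>q, q\<^sup>3\<close> and the hexagonal one at \<open>q\<close>.\<close>
  have "2 * (2 * s 1 - 2 * s 2 - 6 * s 3 - 4 * s 4 + 6 * s 6 + 16 * s 8 + 12 * s 12 - 48 * s 24) + 2
     = (1 - 12 * s 1 + 96 * s 2 - 108 * s 3) / 9 + 7 / 18 * (1 + 8 * s 1 - 32 * s 4) - (1 + 8 * s 2 - 32 * s 8)
       - (1 + 8 * s 3 - 32 * s 12) / 2 + 3 * (1 + 8 * s 6 - 32 * s 24) + 5 / 9 * (4 * s 1 - 12 * s 2 + 8 * s 4)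
       + (4 * s 3 - 12 * s 6 + 8 * s 12)"
    by (simp add: field_simps)
  also have "\<dots> = of_real X / 9 + 7 / 18 * of_real R.a ^ 4 - of_real R.b ^ 4 - of_real R.c ^ 4 / 2 + 3 * of_real R.d ^ 4
       + 5 / 9 * of_real O1 + of_real O3"
    using j[of 1] j[of 2] j[of 3] j[of 6] unfolding h o by (simp add: phi_real)
  also have "\<dots> = of_real (R.a ^ 2 * R.d ^ 2 + R.b ^ 2 * R.c ^ 2)"
    unfolding R.theta_1166_plus_2233 X_def O1_def O3_def by simp
  finally show ?thesis by (simp add: field_simps)
qed

end

text \<open>The constant 1 that is subtracted counts the representation of zero.\<close>

lemma repr_count_eqI:
  assumes "a1 > 0" "a2 > 0" "a3 > 0" "a4 > 0"
    and "\<And>x. real_nome x \<Longrightarrow> power_sums (of_real x) v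
        (nome.phi (of_real x) a1 * nome.phi (of_real x) a2 * nome.phi (of_real x) a3 * nome.phi (of_real x) a4 - 1)"
    and "n \<ge> 1"
  shows "of_nat (repr_count a1 a2 a3 a4 n) = v n"
proof (rule power_sums_eq[where C = 1])
  fix x :: real assume "0 < x" "x < 1"
  then interpret real_nome x by unfold_locales
  show "\<exists>U. power_sums (of_real x) (\<lambda>n. of_nat (repr_count a1 a2 a3 a4 n)) (U + 1) \<and> power_sums (of_real x) v U"
    using assms(5)[OF real_nome_axioms] repr_count_sums[OF assms(1-4)]
    by (intro exI[of _ "phi a1 * phi a2 * phi a3 * phi a4 - 1"]) (simp add: power_sums_def)
qed (rule assms(6))

lemma sigma_char_dilate:
  assumes "n > 0" "k > 0" "\<And>m. m > 0 \<Longrightarrow> f m = f' m" "\<And>m. m > 0 \<Longrightarrow> g m = g' m"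
  shows "sigma_char f g (real n / real k) = dilate k (divsum f' g') n"
  using sigma_char_divsum[of k n f f' g g'] assms by (simp add: dilate_def)

lemma sigma_char_values:
  assumes "n \<ge> 1"
  shows "sigma_char (chi 1) (chi 8) (real n) = dilate 1 (divsum chi1 chi8) n"
    "sigma_char (chi 1) (chi 8) (real n / 3) = dilate 3 (divsum chi1 chi8) n"
    "sigma_char (chi 8) (chi 1) (real n) = dilate 1 (divsum chi8 chi1) n"
    "sigma_char (chi 8) (chi 1) (real n / 3) = dilate 3 (divsum chi8 chi1) n"
    "sigma_char (chi 1) (chi 12) (real n) = dilate 1 (divsum chi1 chi12) n"
    "sigma_char (chi 12) (chi 1) (real n) = dilate 1 (divsum chi12 chi1) n"
    "sigma_char (chi 12) (chi 1) (real n / 2) = dilate 2 (divsum chi12 chi1) n"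
    "sigma_char (chi (- 3)) (chi (- 4)) (real n) = dilate 1 (divsum chim3 chim4) n"
    "sigma_char (chi (- 4)) (chi (- 3)) (real n) = dilate 1 (divsum chim4 chim3) n"
    "sigma_char (chi (- 4)) (chi (- 3)) (real n / 2) = dilate 2 (divsum chim4 chim3) n"
    "sigma_char (chi 1) (chi 24) (real n) = dilate 1 (divsum chi1 chi24) n"
    "sigma_char (chi 24) (chi 1) (real n) = dilate 1 (divsum chi24 chi1) n"
    "sigma_char (chi (- 3)) (chi (- 8)) (real n) = dilate 1 (divsum chim3 chim8) n"
    "sigma_char (chi (- 8)) (chi (- 3)) (real n) = dilate 1 (divsum chim8 chim3) n"
  using assms sigma_char_dilate[of n 1 "chi _" _ "chi _"] sigma_char_dilate[of n 2 "chi _" _ "chi _"] sigma_char_dilate[of n 3 "chi _" _ "chi _"]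
  by (simp_all add: chi_tables)

lemma divisor_sigma_values:
  assumes "n \<ge> 1"
  shows "divisor_sigma (real n) = dilate 1 (divsum chi1 chi1) n"
    "divisor_sigma (real n / numeral k) = dilate (numeral k) (divsum chi1 chi1) n"
  using assms divisor_sigma_divsum[of 1 n] divisor_sigma_divsum[of "numeral k" n] by (simp_all add: dilate_def)

lemmas power_sums_intros = power_sums_add power_sums_diff power_sums_cmult

lemma power_sums_cong: "power_sums q u U \<Longrightarrow> U = V \<Longrightarrow> power_sums q u V"
  by simp

lemma repr_count_1166:
  assumes "n \<ge> 1"
  shows "of_nat (repr_count 1 1 6 6 n) =
      2 * dilate 1 (divsum chi1 chi1) n - 2 * dilate 2 (divsum chi1 chi1) n - 6 * dilate 3 (divsum chi1 chi1) n
      - 4 * dilate 4 (divsum chi1 chi1) n + 6 * dilate 6 (divsum chi1 chi1) n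
      + 16 * dilate 8 (divsum chi1 chi1) n + 12 * dilate 12 (divsum chi1 chi1) n
      - 48 * dilate 24 (divsum chi1 chi1) n + 2 * a_coeff n" (is "_ = ?v n")
proof (rule repr_count_eqI[OF _ _ _ _ _ assms])
  fix x assume "real_nome x"
  then interpret real_nome x .
  show "power_sums (of_real x) ?v (phi 1 * phi 1 * phi 6 * phi 6 - 1)"
    by (rule power_sums_cong, (rule power_sums_intros sigma_power_sums cusp_power_sums | simp; fail)+, unfold sigma_combination)
       (use arg_cong[OF R.theta_1166_minus_2233, of complex_of_real] in \<open>simp add: phi_real power2_eq_square field_simps\<close>)
qed simp_all

lemma repr_count_2233:
  assumes "n \<ge> 1"
  shows "of_nat (repr_count 2 2 3 3 n) =
      2 * dilate 1 (divsum chi1 chi1) n - 2 * dilate 2 (divsum chi1 chi1) n - 6 * dilate 3 (divsum chi1 chi1) n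
      - 4 * dilate 4 (divsum chi1 chi1) n + 6 * dilate 6 (divsum chi1 chi1) n
      + 16 * dilate 8 (divsum chi1 chi1) n + 12 * dilate 12 (divsum chi1 chi1) n
      - 48 * dilate 24 (divsum chi1 chi1) n - 2 * a_coeff n" (is "_ = ?v n")
proof (rule repr_count_eqI[OF _ _ _ _ _ assms])
  fix x assume "real_nome x"
  then interpret real_nome x .
  show "power_sums (of_real x) ?v (phi 2 * phi 2 * phi 3 * phi 3 - 1)"
    by (rule power_sums_cong, (rule power_sums_intros sigma_power_sums cusp_power_sums | simp; fail)+, unfold sigma_combination)
       (use arg_cong[OF R.theta_1166_minus_2233, of complex_of_real] in \<open>simp add: phi_real power2_eq_square field_simps\<close>)
qed simp_all

lemma repr_count_1266:
  assumes "n \<ge> 1"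
  shows "of_nat (repr_count 1 2 6 6 n) =
      4 / 5 * dilate 1 (divsum chi1 chi8) n + 24 / 5 * dilate 3 (divsum chi1 chi8) n
      + 2 / 5 * dilate 1 (divsum chi8 chi1) n - 12 / 5 * dilate 3 (divsum chi8 chi1) n
      + 8 / 5 * b1_coeff n - 4 / 5 * b2_coeff n" (is "_ = ?v n")
proof (rule repr_count_eqI[OF _ _ _ _ _ assms])
  fix x assume "real_nome x"
  then interpret real_nome x .
  show "power_sums (of_real x) ?v (phi 1 * phi 2 * phi 6 * phi 6 - 1)"
    by (rule power_sums_cong, (rule power_sums_intros chi8_power_sums cusp_power_sums)+)
       (use arg_cong[OF R.theta_1266, of "\<lambda>y. complex_of_real (y / 5)"] in
         \<open>simp add: phi_real power2_eq_square power3_eq_cube algebra_simps add_divide_distrib diff_divide_distrib\<close>)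
qed simp_all

lemma repr_count_2236:
  assumes "n \<ge> 1"
  shows "of_nat (repr_count 2 2 3 6 n) =
      8 / 5 * dilate 1 (divsum chi1 chi8) n - 12 / 5 * dilate 3 (divsum chi1 chi8) n
      - 4 / 5 * dilate 1 (divsum chi8 chi1) n - 6 / 5 * dilate 3 (divsum chi8 chi1) n - 4 / 5 * b2_coeff n" (is "_ = ?v n")
proof (rule repr_count_eqI[OF _ _ _ _ _ assms])
  fix x assume "real_nome x"
  then interpret real_nome x .
  show "power_sums (of_real x) ?v (phi 2 * phi 2 * phi 3 * phi 6 - 1)"
    by (rule power_sums_cong, (rule power_sums_intros chi8_power_sums cusp_power_sums)+)
       (use arg_cong[OF R.theta_2236, of "\<lambda>y. complex_of_real (y / 5)"] in
         \<open>simp add: phi_real power2_eq_square power3_eq_cube algebra_simps add_divide_distrib diff_divide_distrib\<close>)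
qed simp_all

lemma repr_count_1333:
  assumes "n \<ge> 1"
  shows "of_nat (repr_count 1 3 3 3 n) =
      2 * dilate 1 (divsum chi1 chi12) n - dilate 1 (divsum chi12 chi1) n + 2 * dilate 1 (divsum chim3 chim4) n
      - dilate 1 (divsum chim4 chim3) n" (is "_ = ?v n")
proof (rule repr_count_eqI[OF _ _ _ _ _ assms])
  fix x assume "real_nome x"
  then interpret real_nome x .
  show "power_sums (of_real x) ?v (phi 1 * phi 3 * phi 3 * phi 3 - 1)"
    by (rule power_sums_cong, (rule power_sums_intros chi12_power_sums cusp_power_sums)+)
       (use arg_cong[OF R.theta_1333, of complex_of_real] in \<open>simp add: phi_real power2_eq_square power3_eq_cube field_simps\<close>)
qed simp_all

lemma repr_count_1366:
  assumes "n \<ge> 1"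
  shows "of_nat (repr_count 1 3 6 6 n) =
      dilate 1 (divsum chi1 chi12) n - dilate 2 (divsum chi12 chi1) n + dilate 1 (divsum chim3 chim4) n
      + dilate 2 (divsum chim4 chim3) n" (is "_ = ?v n")
proof (rule repr_count_eqI[OF _ _ _ _ _ assms])
  fix x assume "real_nome x"
  then interpret real_nome x .
  show "power_sums (of_real x) ?v (phi 1 * phi 3 * phi 6 * phi 6 - 1)"
    by (rule power_sums_cong, (rule power_sums_intros chi12_power_sums cusp_power_sums)+)
       (use arg_cong[OF R.theta_1366, of complex_of_real] in \<open>simp add: phi_real power2_eq_square power3_eq_cube field_simps\<close>)
qed simp_all

lemma repr_count_2336:
  assumes "n \<ge> 1"
  shows "of_nat (repr_count 2 3 3 6 n) =
      dilate 1 (divsum chi1 chi12) n - dilate 2 (divsum chi12 chi1) n - dilate 1 (divsum chim3 chim4) n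
      - dilate 2 (divsum chim4 chim3) n" (is "_ = ?v n")
proof (rule repr_count_eqI[OF _ _ _ _ _ assms])
  fix x assume "real_nome x"
  then interpret real_nome x .
  show "power_sums (of_real x) ?v (phi 2 * phi 3 * phi 3 * phi 6 - 1)"
    by (rule power_sums_cong, (rule power_sums_intros chi12_power_sums cusp_power_sums)+)
       (use arg_cong[OF R.theta_2336, of complex_of_real] in \<open>simp add: phi_real power2_eq_square power3_eq_cube field_simps\<close>)
qed simp_all

lemma repr_count_1336:
  assumes "n \<ge> 1"
  shows "of_nat (repr_count 1 3 3 6 n) =
      4 / 3 * dilate 1 (divsum chi1 chi24) n - 1 / 3 * dilate 1 (divsum chi24 chi1) n
      + 4 / 3 * dilate 1 (divsum chim3 chim8) n - 1 / 3 * dilate 1 (divsum chim8 chim3) n" (is "_ = ?v n")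
proof (rule repr_count_eqI[OF _ _ _ _ _ assms])
  fix x assume "real_nome x"
  then interpret real_nome x .
  show "power_sums (of_real x) ?v (phi 1 * phi 3 * phi 3 * phi 6 - 1)"
    by (rule power_sums_cong, (rule power_sums_intros chi24_power_sums cusp_power_sums)+)
       (use arg_cong[OF R.theta_1336, of complex_of_real] in \<open>simp add: phi_real power2_eq_square power3_eq_cube field_simps\<close>)
qed simp_all

lemma repr_count_1666:
  assumes "n \<ge> 1"
  shows "of_nat (repr_count 1 6 6 6 n) =
      2 / 3 * dilate 1 (divsum chi1 chi24) n - 1 / 3 * dilate 1 (divsum chi24 chi1) n
      + 2 / 3 * dilate 1 (divsum chim3 chim8) n - 1 / 3 * dilate 1 (divsum chim8 chim3) n
      + 8 / 3 * c1_coeff n + 4 / 3 * c2_coeff n" (is "_ = ?v n")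
proof (rule repr_count_eqI[OF _ _ _ _ _ assms])
  fix x assume "real_nome x"
  then interpret real_nome x .
  show "power_sums (of_real x) ?v (phi 1 * phi 6 * phi 6 * phi 6 - 1)"
    by (rule power_sums_cong, (rule power_sums_intros chi24_power_sums cusp_power_sums)+)
       (use arg_cong[OF R.theta_1666, of "\<lambda>y. complex_of_real (y / 3)"] in
         \<open>simp add: phi_real power2_eq_square power3_eq_cube algebra_simps add_divide_distrib diff_divide_distrib\<close>)
qed simp_all

lemma repr_count_2223:
  assumes "n \<ge> 1"
  shows "of_nat (repr_count 2 2 2 3 n) =
      2 * dilate 1 (divsum chi1 chi24) n - 1 / 3 * dilate 1 (divsum chi24 chi1) n
      + 2 / 3 * dilate 1 (divsum chim3 chim8) n - dilate 1 (divsum chim8 chim3) n - 4 / 3 * c2_coeff n" (is "_ = ?v n")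
proof (rule repr_count_eqI[OF _ _ _ _ _ assms])
  fix x assume "real_nome x"
  then interpret real_nome x .
  show "power_sums (of_real x) ?v (phi 2 * phi 2 * phi 2 * phi 3 - 1)"
    by (rule power_sums_cong, (rule power_sums_intros chi24_power_sums cusp_power_sums)+)
       (use arg_cong[OF R.theta_2223, of "\<lambda>y. complex_of_real (y / 3)"] in
         \<open>simp add: phi_real power2_eq_square power3_eq_cube algebra_simps add_divide_distrib diff_divide_distrib\<close>)
qed simp_all

lemma repr_count_2333:
  assumes "n \<ge> 1"
  shows "of_nat (repr_count 2 3 3 3 n) =
      4 / 3 * dilate 1 (divsum chi1 chi24) n - 1 / 3 * dilate 1 (divsum chi24 chi1) n
      - 4 / 3 * dilate 1 (divsum chim3 chim8) n + 1 / 3 * dilate 1 (divsum chim8 chim3) n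
      - 8 / 3 * c1_coeff n" (is "_ = ?v n")
proof (rule repr_count_eqI[OF _ _ _ _ _ assms])
  fix x assume "real_nome x"
  then interpret real_nome x .
  show "power_sums (of_real x) ?v (phi 2 * phi 3 * phi 3 * phi 3 - 1)"
    by (rule power_sums_cong, (rule power_sums_intros chi24_power_sums cusp_power_sums)+)
       (use arg_cong[OF R.theta_2333, of "\<lambda>y. complex_of_real (y / 3)"] in
         \<open>simp add: phi_real power2_eq_square power3_eq_cube algebra_simps add_divide_distrib diff_divide_distrib\<close>)
qed simp_all

lemma repr_count_2366:
  assumes "n \<ge> 1"
  shows "of_nat (repr_count 2 3 6 6 n) =
      1 / 3 * (2 * dilate 1 (divsum chi1 chi24) n - dilate 1 (divsum chi24 chi1) n
      - 2 * dilate 1 (divsum chim3 chim8) n + dilate 1 (divsum chim8 chim3) n)" (is "_ = ?v n")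
proof (rule repr_count_eqI[OF _ _ _ _ _ assms])
  fix x assume "real_nome x"
  then interpret real_nome x .
  show "power_sums (of_real x) ?v (phi 2 * phi 3 * phi 6 * phi 6 - 1)"
    by (rule power_sums_cong, (rule power_sums_intros chi24_power_sums cusp_power_sums)+)
       (use arg_cong[OF R.theta_2366, of complex_of_real] in \<open>simp add: phi_real power2_eq_square power3_eq_cube field_simps\<close>)
qed simp_all

theorem theorem4p2:
  fixes n :: nat
  assumes "n \<ge> 1"
  shows
    "of_nat (repr_count 1 1 6 6 n) =
          2 * divisor_sigma (real n) - 2 * divisor_sigma (real n / 2) - 6 * divisor_sigma (real n / 3) - 4 * divisor_sigma (real n / 4)
          + 6 * divisor_sigma (real n / 6) + 16 * divisor_sigma (real n / 8) + 12 * divisor_sigma (real n / 12)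
          - 48 * divisor_sigma (real n / 24) + 2 * a_coeff n \<and>
     of_nat (repr_count 2 2 3 3 n) =
          2 * divisor_sigma (real n) - 2 * divisor_sigma (real n / 2) - 6 * divisor_sigma (real n / 3) - 4 * divisor_sigma (real n / 4)
          + 6 * divisor_sigma (real n / 6) + 16 * divisor_sigma (real n / 8) + 12 * divisor_sigma (real n / 12)
          - 48 * divisor_sigma (real n / 24) - 2 * a_coeff n \<and>
     of_nat (repr_count 1 2 6 6 n) =
          4 / 5 * sigma_char (chi 1) (chi 8) (real n)
          + 24 / 5 * sigma_char (chi 1) (chi 8) (real n / 3)
          + 2 / 5 * sigma_char (chi 8) (chi 1) (real n)
          - 12 / 5 * sigma_char (chi 8) (chi 1) (real n / 3)
          + 8 / 5 * b1_coeff n - 4 / 5 * b2_coeff n \<and>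
     of_nat (repr_count 2 2 3 6 n) =
          8 / 5 * sigma_char (chi 1) (chi 8) (real n)
          - 12 / 5 * sigma_char (chi 1) (chi 8) (real n / 3)
          - 4 / 5 * sigma_char (chi 8) (chi 1) (real n)
          - 6 / 5 * sigma_char (chi 8) (chi 1) (real n / 3)
          - 4 / 5 * b2_coeff n \<and>
     of_nat (repr_count 1 3 3 3 n) =
          2 * sigma_char (chi 1) (chi 12) (real n)
          - sigma_char (chi 12) (chi 1) (real n)
          + 2 * sigma_char (chi (- 3)) (chi (- 4)) (real n)
          - sigma_char (chi (- 4)) (chi (- 3)) (real n) \<and>
     of_nat (repr_count 1 3 6 6 n) =
          sigma_char (chi 1) (chi 12) (real n)
          - sigma_char (chi 12) (chi 1) (real n / 2)
          + sigma_char (chi (- 3)) (chi (- 4)) (real n)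
          + sigma_char (chi (- 4)) (chi (- 3)) (real n / 2) \<and>
     of_nat (repr_count 2 3 3 6 n) =
          sigma_char (chi 1) (chi 12) (real n)
          - sigma_char (chi 12) (chi 1) (real n / 2)
          - sigma_char (chi (- 3)) (chi (- 4)) (real n)
          - sigma_char (chi (- 4)) (chi (- 3)) (real n / 2) \<and>
     of_nat (repr_count 1 3 3 6 n) =
          4 / 3 * sigma_char (chi 1) (chi 24) (real n)
          - 1 / 3 * sigma_char (chi 24) (chi 1) (real n)
          + 4 / 3 * sigma_char (chi (- 3)) (chi (- 8)) (real n)
          - 1 / 3 * sigma_char (chi (- 8)) (chi (- 3)) (real n) \<and>
     of_nat (repr_count 1 6 6 6 n) =
          2 / 3 * sigma_char (chi 1) (chi 24) (real n)
          - 1 / 3 * sigma_char (chi 24) (chi 1) (real n)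
          + 2 / 3 * sigma_char (chi (- 3)) (chi (- 8)) (real n)
          - 1 / 3 * sigma_char (chi (- 8)) (chi (- 3)) (real n)
          + 8 / 3 * c1_coeff n + 4 / 3 * c2_coeff n \<and>
     of_nat (repr_count 2 2 2 3 n) =
          2 * sigma_char (chi 1) (chi 24) (real n)
          - 1 / 3 * sigma_char (chi 24) (chi 1) (real n)
          + 2 / 3 * sigma_char (chi (- 3)) (chi (- 8)) (real n)
          - sigma_char (chi (- 8)) (chi (- 3)) (real n)
          - 4 / 3 * c2_coeff n \<and>
     of_nat (repr_count 2 3 3 3 n) =
          4 / 3 * sigma_char (chi 1) (chi 24) (real n)
          - 1 / 3 * sigma_char (chi 24) (chi 1) (real n)
          - 4 / 3 * sigma_char (chi (- 3)) (chi (- 8)) (real n)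
          + 1 / 3 * sigma_char (chi (- 8)) (chi (- 3)) (real n)
          - 8 / 3 * c1_coeff n \<and>
     of_nat (repr_count 2 3 6 6 n) =
          1 / 3 * (2 * sigma_char (chi 1) (chi 24) (real n) - sigma_char (chi 24) (chi 1) (real n)
          - 2 * sigma_char (chi (- 3)) (chi (- 8)) (real n) + sigma_char (chi (- 8)) (chi (- 3)) (real n))"
  unfolding sigma_char_values[OF assms] divisor_sigma_values[OF assms]
  by (intro conjI repr_count_1166 repr_count_2233 repr_count_1266 repr_count_2236 repr_count_1333 repr_count_1366
      repr_count_2336 repr_count_1336 repr_count_1666 repr_count_2223 repr_count_2333 repr_count_2366 assms)

end
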